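(* Let $d\ge 1$. Let $f\in W^{1,\infty}(\mathbb{R},\mathbb{R}^d)$ with $f(0)=0$; let $A\in W^{1,\infty}(\mathbb{R})$ be nondecreasing with $A(0)=0$; let $u_0\in L^\infty(\mathbb{R}^d)\cap L^1(\mathbb{R}^d)\cap BV(\mathbb{R}^d)$; and let $\mu$ be a nonnegative Radon measure on $\mathbb{R}^d\setminus\{0\}$ with $\int_{\mathbb{R}^d\setminus\{0\}}|z|^2\wedge1\,\mathrm{d}\mu(z)<+\infty$. Let $u$ and $u^\epsilon$ be respectively the entropy solutions of $$\partial_tu+\mathrm{div}f(u)=0,\ u(0)=u_0,\qquad\text{and}\qquad\partial_tu^\epsilon+\mathrm{div}f(u^\epsilon)=\epsilon\,\mathcal{L}^\mu[A(u^\epsilon)],\ u^\epsilon(0)=u_0.$$ Then for every $T,\epsilon>0$, $$\begin{aligned} \|u-u^\epsilon\|_{C([0,T];L^1)}\le C\inf_{\hat r>r>0}\Big\{&d^{\frac12}T^{\frac12}\epsilon^{\frac12}\sqrt{\int_{0<|z|\le r}|z|^2\,\mathrm{d}\mu(z)}\\ &+T\epsilon\Big[\int_{r<|z|\le\hat r}|z|\,\mathrm{d}\mu(z)+\Big|\int_{r\wedge1<|z|\le r\vee1}z\,\mathrm{d}\mu(z)\Big|+\int_{|z|>\hat r}\mathrm{d}\mu(z)\Big]\Big\}, \end{aligned}$$ where $C$ only depends on $\|u_0\|_{L^1(\mathbb{R}^d)\cap BV(\mathbb{R}^d)}$ and $\|A'\|_{L^\infty(\mathbb{R})}$.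
   Context: Notation: $Q_T=\mathbb{R}^d\times(0,T)$; $a\wedge b=\min\{a,b\}$, $a\vee b=\max\{a,b\}$; $|\cdot|$ is the Euclidean norm; $\|u_0\|_{L^1\cap BV}=\|u_0\|_{L^1(\mathbb{R}^d)}+|u_0|_{BV(\mathbb{R}^d)}$ with $|\cdot|_{BV}$ the total variation semi-norm; $C([0,T];L^1)$ means $C([0,T];L^1(\mathbb{R}^d))$ with the sup norm; $D$ is the gradient in $x$; $\mathrm{sgn}(u)=\pm1$ if $\pm u>0$ and $\mathrm{sgn}(0)=0$. Operators. For a Lévy measure $\mu$ (nonnegative Radon measure on $\mathbb{R}^d\setminus\{0\}$ with $\int|z|^2\wedge1\,\mathrm{d}\mu<\infty$) and $r>0$: $\mathcal{L}^\mu[\phi](x)=\int_{\mathbb{R}^d\setminus\{0\}}\phi(x+z)-\phi(x)-z\cdot D\phi(x)\mathbf{1}_{|z|\le1}\,\mathrm{d}\mu(z)$, $\mathcal{L}^\mu_r[\phi](x)=\int_{0<|z|\le r}\phi(x+z)-\phi(x)-z\cdot D\phi(x)\mathbf{1}_{|z|\le1}\,\mathrm{d}\mu(z)$, $b^\mu_r=-\int_{|z|>r}z\,\mathbf{1}_{|z|\le1}\,\mathrm{d}\mu(z)$, $\mathcal{L}^{\mu,r}[\phi](x)=\int_{|z|>r}\phi(x+z)-\phi(x)\,\mathrm{d}\mu(z)$. The dual measure $\mu^\ast$ is defined by $\int\phi(z)\,\mathrm{d}\mu^\ast(z)=\int\phi(-z)\,\mathrm{d}\mu(z)$. The entropy flux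 is $q_f(u,k)=\mathrm{sgn}(u-k)(f(u)-f(k))$. Entropy solution on $Q_T$ of $\partial_tu+\mathrm{div}f(u)=\mathcal{L}^\mu[A(u)]$, $u(\cdot,0)=u_0$: a function $u\in L^\infty(Q_T)\cap C([0,T];L^1(\mathbb{R}^d))$ such that for all $k\in\mathbb{R}$, all $r>0$ and all nonnegative $\phi\in C_c^\infty(\mathbb{R}^{d+1})$, $$\begin{aligned}&\int_{Q_T}|u-k|\,\partial_t\phi+\big(q_f(u,k)+b_r^{\mu^\ast}|A(u)-A(k)|\big)\cdot D\phi\,\mathrm{d}x\,\mathrm{d}t\\&+\int_{Q_T}|A(u)-A(k)|\,\mathcal{L}^{\mu^\ast}_r[\phi]+\mathrm{sgn}(u-k)\,\mathcal{L}^{\mu,r}[A(u)]\,\phi\,\mathrm{d}x\,\mathrm{d}t\\&-\int_{\mathbb{R}^d}|u(x,T)-k|\,\phi(x,T)\,\mathrm{d}x+\int_{\mathbb{R}^d}|u_0(x)-k|\,\phi(x,0)\,\mathrm{d}x\ge0.\end{aligned}$$ For $u^\epsilon$ this definition is used with $\epsilon A$ in place of $A$; for the pure conservation law it is used with $A=0$. Under the stated assumptions on the data it is known that there is exactly one entropy solution for every $T>0$. *)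

theory Defs
  imports "HOL-Probability.Probability"
begin

(* The constant of the theorem must not depend on the dimension d, so d has to be a number that can
   be quantified below the existential quantifier for that constant, and not a type. Hence R^d is
   the set of extensional functions on {..<d}, the space of the product measure library. Its
   Euclidean norm is L2_set z {..<d}, and its topology is the one inherited from the product
   topology on nat => real. Vector-valued objects are used through their components below d. *)

definition Rd :: "nat \<Rightarrow> (nat \<Rightarrow> real) set" where
  "Rd d = {..<d} \<rightarrow>\<^sub>E UNIV"

definition lebesgue_Rd :: "nat \<Rightarrow> (nat \<Rightarrow> real) measure" where
  "lebesgue_Rd d = PiM {..<d} (\<lambda>_. lborel)"

abbreviation vnorm :: "nat \<Rightarrow> (nat \<Rightarrow> real) \<Rightarrow> real" where
  "vnorm d z \<equiv> L2_set z {..<d}"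

definition vzero :: "nat \<Rightarrow> nat \<Rightarrow> real" where
  "vzero d = (\<lambda>i\<in>{..<d}. 0)"

definition vadd :: "nat \<Rightarrow> (nat \<Rightarrow> real) \<Rightarrow> (nat \<Rightarrow> real) \<Rightarrow> nat \<Rightarrow> real" where
  "vadd d x z = (\<lambda>i\<in>{..<d}. x i + z i)"

definition vneg :: "nat \<Rightarrow> (nat \<Rightarrow> real) \<Rightarrow> nat \<Rightarrow> real" where
  "vneg d z = (\<lambda>i\<in>{..<d}. - z i)"

definition space_time :: "nat \<Rightarrow> real \<Rightarrow> ((nat \<Rightarrow> real) \<times> real) measure" where
  "space_time d T = lebesgue_Rd d \<Otimes>\<^sub>M restrict_space lborel {0<..<T}"

definition partial :: "nat \<Rightarrow> ((nat \<Rightarrow> real) \<Rightarrow> real) \<Rightarrow> (nat \<Rightarrow> real) \<Rightarrow> real" where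
  "partial i \<phi> x = deriv (\<lambda>s. \<phi> (x(i := s))) (x i)"

definition smooth :: "nat \<Rightarrow> ((nat \<Rightarrow> real) \<Rightarrow> real) \<Rightarrow> bool" where
  "smooth n \<phi> \<longleftrightarrow> (\<forall>is. set is \<subseteq> {..<n} \<longrightarrow>
     continuous_on (Rd n) (foldr partial is \<phi>) \<and>
     (\<forall>i<n. \<forall>x\<in>Rd n. (\<lambda>s. foldr partial is \<phi> (x(i := s))) differentiable (at (x i))))"

definition test_fun :: "nat \<Rightarrow> ((nat \<Rightarrow> real) \<Rightarrow> real) \<Rightarrow> bool" where
  "test_fun n \<phi> \<longleftrightarrow> smooth n \<phi> \<and> compact (closure {x \<in> Rd n. \<phi> x \<noteq> 0})"

definition test_fun_real :: "(real \<Rightarrow> real) \<Rightarrow> bool" where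
  "test_fun_real \<phi> \<longleftrightarrow>
     (\<forall>n x. (deriv ^^ n) \<phi> differentiable (at x)) \<and> compact (closure {x. \<phi> x \<noteq> 0})"

(* Elements of L^1 and L^infinity are given by Borel representatives. *)

definition L_inf :: "'a measure \<Rightarrow> ('a \<Rightarrow> real) \<Rightarrow> bool" where
  "L_inf M g \<longleftrightarrow> g \<in> borel_measurable M \<and> (\<exists>c. AE x in M. \<bar>g x\<bar> \<le> c)"

definition L_inf_norm :: "'a measure \<Rightarrow> ('a \<Rightarrow> real) \<Rightarrow> real" where
  "L_inf_norm M g = real_of_ereal (esssup M (\<lambda>x. ereal \<bar>g x\<bar>))"

(* h is (the continuous representative of) an element of W^{1,infinity}(R), and h' is its weak
   derivative. *)

definition W1_inf :: "(real \<Rightarrow> real) \<Rightarrow> (real \<Rightarrow> real) \<Rightarrow> bool" where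
  "W1_inf h h' \<longleftrightarrow> continuous_on UNIV h \<and> L_inf lborel h \<and> L_inf lborel h' \<and>
     (\<forall>\<phi>. test_fun_real \<phi> \<longrightarrow>
       (\<integral>s. h s * deriv \<phi> s \<partial>lborel) = - (\<integral>s. h' s * \<phi> s \<partial>lborel))"

definition total_variation :: "nat \<Rightarrow> ((nat \<Rightarrow> real) \<Rightarrow> real) \<Rightarrow> ereal" where
  "total_variation d v =
     (SUP \<psi>\<in>{\<psi>. (\<forall>i<d. test_fun d (\<lambda>x. \<psi> x i)) \<and> (\<forall>x\<in>Rd d. vnorm d (\<psi> x) \<le> 1)}.
        ereal (\<integral>x. v x * (\<Sum>i<d. partial i (\<lambda>y. \<psi> y i) x) \<partial>lebesgue_Rd d))"

definition BV :: "nat \<Rightarrow> ((nat \<Rightarrow> real) \<Rightarrow> real) \<Rightarrow> bool" where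
  "BV d v \<longleftrightarrow> integrable (lebesgue_Rd d) v \<and> total_variation d v < \<infinity>"

definition L1_norm :: "nat \<Rightarrow> ((nat \<Rightarrow> real) \<Rightarrow> real) \<Rightarrow> real" where
  "L1_norm d v = (\<integral>x. \<bar>v x\<bar> \<partial>lebesgue_Rd d)"

definition L1_BV_norm :: "nat \<Rightarrow> ((nat \<Rightarrow> real) \<Rightarrow> real) \<Rightarrow> real" where
  "L1_BV_norm d v = L1_norm d v + real_of_ereal (total_variation d v)"

definition C_L1 :: "nat \<Rightarrow> real \<Rightarrow> ((nat \<Rightarrow> real) \<Rightarrow> real \<Rightarrow> real) \<Rightarrow> bool" where
  "C_L1 d T u \<longleftrightarrow> (\<forall>t\<in>{0..T}. integrable (lebesgue_Rd d) (\<lambda>x. u x t) \<and>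
     ((\<lambda>s. L1_norm d (\<lambda>x. u x s - u x t)) \<longlongrightarrow> 0) (at t within {0..T}))"

definition C_L1_norm :: "nat \<Rightarrow> real \<Rightarrow> ((nat \<Rightarrow> real) \<Rightarrow> real \<Rightarrow> real) \<Rightarrow> real" where
  "C_L1_norm d T u = (SUP t\<in>{0..T}. L1_norm d (\<lambda>x. u x t))"

(* On the sigma-compact metric space R^d - {0}, a Radon measure is a Borel measure that is finite
   on compact sets. *)

definition levy_measure :: "nat \<Rightarrow> (nat \<Rightarrow> real) measure \<Rightarrow> bool" where
  "levy_measure d \<mu> \<longleftrightarrow>
     space \<mu> = Rd d - {vzero d} \<and>
     sets \<mu> = sets (restrict_space (lebesgue_Rd d) (Rd d - {vzero d})) \<and>
     (\<forall>K. compact K \<and> K \<subseteq> Rd d - {vzero d} \<longrightarrow> emeasure \<mu> K < \<infinity>) \<and>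
     (\<integral>\<^sup>+z. ennreal (min ((vnorm d z)\<^sup>2) 1) \<partial>\<mu>) < \<infinity>"

definition dual_measure :: "nat \<Rightarrow> (nat \<Rightarrow> real) measure \<Rightarrow> (nat \<Rightarrow> real) measure" where
  "dual_measure d \<mu> = distr \<mu> \<mu> (vneg d)"

definition levy_near :: "nat \<Rightarrow> (nat \<Rightarrow> real) measure \<Rightarrow> real \<Rightarrow>
    ((nat \<Rightarrow> real) \<Rightarrow> real) \<Rightarrow> (nat \<Rightarrow> real) \<Rightarrow> real" where
  "levy_near d \<mu> r \<phi> x = (LINT z:{z. 0 < vnorm d z \<and> vnorm d z \<le> r}|\<mu>.
     \<phi> (vadd d x z) - \<phi> x
       - (\<Sum>i<d. z i * partial i \<phi> x) * indicator {z. vnorm d z \<le> 1} z)"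

definition levy_drift :: "nat \<Rightarrow> (nat \<Rightarrow> real) measure \<Rightarrow> real \<Rightarrow> nat \<Rightarrow> real" where
  "levy_drift d \<mu> r i =
     - (LINT z:{z. r < vnorm d z}|\<mu>. z i * indicator {z. vnorm d z \<le> 1} z)"

definition levy_far :: "nat \<Rightarrow> (nat \<Rightarrow> real) measure \<Rightarrow> real \<Rightarrow>
    ((nat \<Rightarrow> real) \<Rightarrow> real) \<Rightarrow> (nat \<Rightarrow> real) \<Rightarrow> real" where
  "levy_far d \<mu> r \<phi> x = (LINT z:{z. r < vnorm d z}|\<mu>. \<phi> (vadd d x z) - \<phi> x)"

definition entropy_flux :: "(real \<Rightarrow> nat \<Rightarrow> real) \<Rightarrow> real \<Rightarrow> real \<Rightarrow> nat \<Rightarrow> real" where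
  "entropy_flux f u k i = sgn (u - k) * (f u i - f k i)"

(* Test functions live on R^(d+1) with time as the coordinate of index d: the point (x,t) is
   x(d := t), and partial d is the time derivative. *)

definition entropy_solution :: "nat \<Rightarrow> (real \<Rightarrow> nat \<Rightarrow> real) \<Rightarrow> (real \<Rightarrow> real) \<Rightarrow>
    (nat \<Rightarrow> real) measure \<Rightarrow> ((nat \<Rightarrow> real) \<Rightarrow> real) \<Rightarrow> real \<Rightarrow>
    ((nat \<Rightarrow> real) \<Rightarrow> real \<Rightarrow> real) \<Rightarrow> bool" where
  "entropy_solution d f A \<mu> u\<^sub>0 T u \<longleftrightarrow>
     L_inf (space_time d T) (\<lambda>(x, t). u x t) \<and> C_L1 d T u \<and>
     (\<forall>k. \<forall>r>0. \<forall>\<phi>. test_fun (Suc d) \<phi> \<and> (\<forall>y\<in>Rd (Suc d). 0 \<le> \<phi> y) \<longrightarrow>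
        (\<integral>(x, t). \<bar>u x t - k\<bar> * partial d \<phi> (x(d := t))
            + (\<Sum>i<d. (entropy_flux f (u x t) k i
                       + levy_drift d (dual_measure d \<mu>) r i * \<bar>A (u x t) - A k\<bar>)
                     * partial i \<phi> (x(d := t))) \<partial>space_time d T)
      + (\<integral>(x, t). \<bar>A (u x t) - A k\<bar>
              * levy_near d (dual_measure d \<mu>) r (\<lambda>y. \<phi> (y(d := t))) x
            + sgn (u x t - k) * levy_far d \<mu> r (\<lambda>y. A (u y t)) x * \<phi> (x(d := t))
          \<partial>space_time d T)
      - (\<integral>x. \<bar>u x T - k\<bar> * \<phi> (x(d := T)) \<partial>lebesgue_Rd d)
      + (\<integral>x. \<bar>u\<^sub>0 x - k\<bar> * \<phi> (x(d := 0)) \<partial>lebesgue_Rd d) \<ge> 0)"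

end

theory Submission
  imports Defs
begin

(* Kuznetsov's argument with mollification in space only. Let \<omega> be an even mollifier of width \<delta> and let
   P(t) be the double integral of |v(x,t) - u(y,t)| \<omega>(x - y), where v = u^\<epsilon>. The entropy inequality of
   each solution, with the other one frozen at a fixed time, bounds the growth of P on short intervals;
   the flux terms of the two solutions cancel, and only the nonlocal term of v survives. In that term all
   jumps are moved onto the kernel and, from there, onto translates of u, where
   |u(. + h,t) - u(.,t)|_1 \<le> |h| |u0|_BV and |u(.,t)|_1 \<le> |u0|_1; both follow from the same argument
   with the translated solution or 0 in place of v. Replacing P(t) by |v(t) - u(t)|_1 costs a multiple of
   sqrt d \<delta> |u0|_BV, and near jumps contribute sqrt d T \<epsilon> M / \<delta>, where M is the second moment of the jumps
   up to r. The choice \<delta> = sqrt (T \<epsilon> M) balances the two. *)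

section \<open>Smooth functions of one variable\<close>

text \<open>Everything is moved onto u because nothing is known about translates of
  \<open>v\<close>. Even u(.,t) is not treated as a BV function: what is propagated in time is the
  translation estimate, and that is all the kernel estimates consume. Time needs no mollifier
  because both solutions are continuous in time with values in L1: freezing one of them on a short
  interval costs an error that is small compared with the length of the interval. The resulting
  bounds are one-sided and P need not be differentiable, so the growth bound is integrated by a
  supremum argument. The constant must not depend on d. Hence the mollifier is a product of
  one-dimensional bumps: each of its first derivatives has L1 norm
  \<open>bump_variation / \<delta>\<close> in every dimension. The factors sqrt d come from the
  diagonal of the supporting cube and from Cauchy-Schwarz for the sum of the |z i|. In the constant
  (2 + L \<open>bump_variation\<close> + 2 L) N + 1, the 2 counts the mollification errors at times
  0 and t, the next term belongs to the jumps up to r, 2 L to drift and larger jumps, and the 1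
  keeps the constant positive.\<close>

definition smooth1 :: "(real \<Rightarrow> real) \<Rightarrow> bool" where
  "smooth1 g \<longleftrightarrow> (\<forall>n x. (deriv ^^ n) g differentiable (at x))"

text \<open>The iterates of \<open>deriv\<close> never leave a class closed under differentiation.
  Smoothness is thus reduced to naming such a class, and no formula for higher derivatives is
  needed.\<close>

lemma smooth1_coinduct:
  assumes "g \<in> S"
    and step: "\<And>g. g \<in> S \<Longrightarrow> \<exists>g'\<in>S. \<forall>x. (g has_real_derivative g' x) (at x)"
  shows "smooth1 g"
proof -
  have D: "deriv g \<in> S \<and> (\<forall>x. g differentiable (at x))" if gS: "g \<in> S" for g
  proof -
    obtain g' where g': "g' \<in> S" "\<And>x. (g has_real_derivative g' x) (at x)"
      using step[OF gS] by blast
    then have "deriv g = g'" by (auto intro: DERIV_imp_deriv)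
    then show ?thesis using g' by (auto simp: real_differentiable_def)
  qed
  have "(deriv ^^ n) g \<in> S" for n
    by (induction n) (use assms(1) D in auto)
  then show ?thesis using D unfolding smooth1_def by blast
qed

lemma smooth1_deriv: "smooth1 g \<Longrightarrow> smooth1 (deriv g)"
  unfolding smooth1_def by (metis funpow_Suc_right o_apply)

lemma smooth1_DERIV: "smooth1 g \<Longrightarrow> (g has_real_derivative deriv g x) (at x)"
  unfolding smooth1_def DERIV_deriv_iff_real_differentiable by (drule spec[of _ 0]) simp

lemma smooth1_continuous: "smooth1 g \<Longrightarrow> continuous_on A g"
  by (meson smooth1_DERIV DERIV_isCont continuous_at_imp_continuous_on)

lemma smooth1_measurable: "smooth1 g \<Longrightarrow> g \<in> borel_measurable borel"
  by (intro borel_measurable_continuous_onI smooth1_continuous)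

lemma smooth1_affine:
  assumes "smooth1 g" shows "smooth1 (\<lambda>s. c * g (a * s + b))"
proof (rule smooth1_coinduct[where S = "{h. \<exists>c g. smooth1 g \<and> h = (\<lambda>s. c * g (a * s + b))}"])
  fix h assume "h \<in> {h. \<exists>c g. smooth1 g \<and> h = (\<lambda>s. c * g (a * s + b))}"
  then obtain c g where h: "smooth1 g" "h = (\<lambda>s. c * g (a * s + b))" by auto
  have "(h has_real_derivative (c * a) * deriv g (a * s + b)) (at s)" for s
  proof -
    have "((\<lambda>s. a * s + b) has_real_derivative a) (at s)" by (auto intro!: derivative_eq_intros)
    from DERIV_cmult[OF DERIV_chain2[OF smooth1_DERIV[OF h(1)] this], of c]
    show ?thesis unfolding h(2) by (simp add: mult_ac)
  qed
  then show "\<exists>g'\<in>{h. \<exists>c g. smooth1 g \<and> h = (\<lambda>s. c * g (a * s + b))}.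
      \<forall>x. (h has_real_derivative g' x) (at x)"
    using smooth1_deriv[OF h(1)]
    by (intro bexI[of _ "\<lambda>s. (c * a) * deriv g (a * s + b)"] CollectI allI
        exI[of _ "c * a"] exI[of _ "deriv g"] conjI refl)
qed (use assms in \<open>blast\<close>)

lemma smooth1_shift: "smooth1 g \<Longrightarrow> smooth1 (\<lambda>s. g (s - b))"
  using smooth1_affine[of g 1 1 "-b"] by simp

lemma smooth1_antideriv:
  assumes "\<And>x. (G has_real_derivative g x) (at x)" "smooth1 g"
  shows "smooth1 G"
proof (rule smooth1_coinduct[where S = "insert G {g. smooth1 g}"])
  fix h assume "h \<in> insert G {g. smooth1 g}"
  then show "\<exists>g'\<in>insert G {g. smooth1 g}. \<forall>x. (h has_real_derivative g' x) (at x)"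
  proof
    assume "h = G"
    then show ?thesis using assms by (intro bexI[of _ g]) auto
  next
    assume "h \<in> {g. smooth1 g}"
    then show ?thesis using smooth1_deriv smooth1_DERIV by (intro bexI[of _ "deriv h"]) auto
  qed
qed simp

text \<open>The product rule turns a product into a sum of products, so a class that is to be closed
  under differentiation has to be closed under both operations at once.\<close>

inductive_set smooth_alg :: "(real \<Rightarrow> real) set" where
  base: "smooth1 g \<Longrightarrow> g \<in> smooth_alg"
| add: "g \<in> smooth_alg \<Longrightarrow> h \<in> smooth_alg \<Longrightarrow> (\<lambda>x. g x + h x) \<in> smooth_alg"
| mult: "g \<in> smooth_alg \<Longrightarrow> h \<in> smooth_alg \<Longrightarrow> (\<lambda>x. g x * h x) \<in> smooth_alg"

lemma smooth_alg_smooth1: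
  assumes "g \<in> smooth_alg" shows "smooth1 g"
proof (rule smooth1_coinduct[OF assms])
  fix g assume "g \<in> smooth_alg"
  then show "\<exists>g'\<in>smooth_alg. \<forall>x. (g has_real_derivative g' x) (at x)"
  proof induction
    case (base g)
    then show ?case using smooth1_deriv smooth1_DERIV smooth_alg.base by blast
  next
    case (add g h)
    then obtain g' h' where *: "g' \<in> smooth_alg" "h' \<in> smooth_alg"
      "\<And>x. (g has_real_derivative g' x) (at x)" "\<And>x. (h has_real_derivative h' x) (at x)" by blast
    then show ?case
      using DERIV_add[OF *(3,4)] smooth_alg.add[OF *(1,2)]
      by (intro bexI[of _ "\<lambda>x. g' x + h' x"]) auto
  next
    case (mult g h)
    then obtain g' h' where *: "g' \<in> smooth_alg" "h' \<in> smooth_alg"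
      "\<And>x. (g has_real_derivative g' x) (at x)" "\<And>x. (h has_real_derivative h' x) (at x)" by blast
    have "(\<lambda>x. g' x * h x + h' x * g x) \<in> smooth_alg"
      using mult * by (intro smooth_alg.add smooth_alg.mult)
    then show ?case
      using DERIV_mult[OF *(3,4)] by (intro bexI[of _ "\<lambda>x. g' x * h x + h' x * g x"]) auto
  qed
qed

lemma smooth1_add: "smooth1 g \<Longrightarrow> smooth1 h \<Longrightarrow> smooth1 (\<lambda>x. g x + h x)"
  using smooth_alg_smooth1[OF smooth_alg.add[OF smooth_alg.base smooth_alg.base]] .

lemma smooth1_mult: "smooth1 g \<Longrightarrow> smooth1 h \<Longrightarrow> smooth1 (\<lambda>x. g x * h x)"
  using smooth_alg_smooth1[OF smooth_alg.mult[OF smooth_alg.base smooth_alg.base]] .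

lemma smooth1_diff: "smooth1 g \<Longrightarrow> smooth1 h \<Longrightarrow> smooth1 (\<lambda>x. g x - h x)"
  using smooth1_add[of g "\<lambda>x. - h x"] smooth1_affine[of h "-1" 1 0] by simp

(* The functions p (1/x) exp (-1/x), extended by 0, are closed under differentiation, which gives
   smoothness by coinduction. *)

definition flat_exp :: "real poly \<Rightarrow> real \<Rightarrow> real" where
  "flat_exp p x = (if 0 < x then poly p (1 / x) * exp (- (1 / x)) else 0)"

lemma poly_mult_exp_tendsto_0: "((\<lambda>y. poly p y * exp (- y)) \<longlongrightarrow> (0::real)) at_top"
proof (induction p)
  case (pCons a p)
  have "((\<lambda>y. y ^ k / exp y) \<longlongrightarrow> (0::real)) at_top" for k
    by (rule tendsto_power_div_exp_0)
  then have *: "((\<lambda>y. y ^ k * exp (- y)) \<longlongrightarrow> (0::real)) at_top" for k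
    by (simp add: exp_minus field_simps)
  have "((\<lambda>y. \<Sum>i\<le>degree (pCons a p). coeff (pCons a p) i * (y ^ i * exp (- y)))
      \<longlongrightarrow> (\<Sum>i\<le>degree (pCons a p). coeff (pCons a p) i * 0)) at_top"
    by (intro tendsto_intros *)
  then show ?case
    by (simp only: poly_altdef sum_distrib_right mult.assoc) simp
qed simp

text \<open>With y = 1/x one has d/dx = - y^2 d/dy, so p(y) exp(-y) becomes y^2 (p - p')(y) exp(-y);
  \<open>[:0, 0, 1:]\<close> is the polynomial y^2. At 0 the exponential beats every polynomial in
  1/x.\<close>

lemma flat_exp_DERIV:
  "(flat_exp p has_real_derivative flat_exp ([:0, 0, 1:] * (p - pderiv p)) x) (at x)"
proof -
  consider "x < 0" | "x = 0" | "x > 0" by linarith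
  then show ?thesis
  proof cases
    case 1
    have "((\<lambda>_. 0) has_real_derivative 0) (at x)" by simp
    then have "(flat_exp p has_real_derivative 0) (at x)"
      by (rule has_field_derivative_transform_within_open[where S = "{..<0}"])
        (use 1 in \<open>auto simp: flat_exp_def\<close>)
    then show ?thesis using 1 by (simp add: flat_exp_def)
  next
    case 3
    have "((\<lambda>x. poly p (1 / x) * exp (- (1 / x))) has_real_derivative
        flat_exp ([:0, 0, 1:] * (p - pderiv p)) x) (at x)"
    proof -
      have i: "((\<lambda>x. 1 / x) has_real_derivative - (1 / x) * (1 / x)) (at x)"
        using 3 by (auto intro!: derivative_eq_intros simp: power2_eq_square)
      have e: "((\<lambda>x. exp (- (1 / x))) has_real_derivative exp (- (1 / x)) * (1 / x * (1 / x))) (at x)"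
        by (rule DERIV_cong[OF DERIV_fun_exp[OF DERIV_minus[OF i]]]) simp
      show ?thesis
        by (rule DERIV_cong[OF DERIV_mult[OF DERIV_chain2[OF poly_DERIV i] e]])
          (use 3 in \<open>simp add: flat_exp_def algebra_simps\<close>)
    qed
    then show ?thesis
      by (rule has_field_derivative_transform_within_open[where S = "{0<..}"])
        (use 3 in \<open>auto simp: flat_exp_def\<close>)
  next
    case 2
    have "((\<lambda>h. flat_exp p h / h) \<longlongrightarrow> 0) (at 0)"
    proof (rule filterlim_split_at)
      have "eventually (\<lambda>h::real. flat_exp p h / h = 0) (at_left 0)"
        by (auto simp: eventually_at_filter flat_exp_def)
      then show "((\<lambda>h. flat_exp p h / h) \<longlongrightarrow> 0) (at_left 0)"
        by (rule tendsto_eventually)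
      \<comment> \<open>Dividing by h multiplies the polynomial in 1/h by one more factor 1/h, which
        is \<open>pCons 0 p\<close>.\<close>
      have "((\<lambda>h. poly (pCons 0 p) (inverse h) * exp (- inverse h)) \<longlongrightarrow> 0) (at_right 0)"
        by (rule filterlim_compose[OF poly_mult_exp_tendsto_0 filterlim_inverse_at_top_right])
      moreover have "eventually (\<lambda>h::real. poly (pCons 0 p) (inverse h) * exp (- inverse h)
          = flat_exp p h / h) (at_right 0)"
        by (auto simp: eventually_at_filter flat_exp_def field_simps)
      ultimately show "((\<lambda>h. flat_exp p h / h) \<longlongrightarrow> 0) (at_right 0)"
        using tendsto_cong by force
    qed
    then show ?thesis using 2 by (simp add: DERIV_def flat_exp_def)
  qed
qed

lemma flat_exp_smooth1: "smooth1 (flat_exp p)"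
  by (rule smooth1_coinduct[where S = "range flat_exp"]) (use flat_exp_DERIV in blast)+

section \<open>Smooth functions with compact support on the line\<close>

definition Cc :: "(real \<Rightarrow> real) \<Rightarrow> bool" where
  "Cc g \<longleftrightarrow> smooth1 g \<and> (\<exists>R. \<forall>s. R < \<bar>s\<bar> \<longrightarrow> g s = 0)"

lemma CcD: "Cc g \<Longrightarrow> smooth1 g" by (simp add: Cc_def)

lemma Cc_support: assumes "Cc g" obtains R where "0 < R" "\<And>s. R < \<bar>s\<bar> \<Longrightarrow> g s = 0"
proof -
  obtain R where R: "\<And>s. R < \<bar>s\<bar> \<Longrightarrow> g s = 0" using assms by (auto simp: Cc_def)
  show thesis by (rule that[of "max R 1"]) (use R in auto)
qed

lemma Cc_deriv: assumes "Cc g" shows "Cc (deriv g)"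
proof -
  obtain R where R: "0 < R" "\<And>s. R < \<bar>s\<bar> \<Longrightarrow> g s = 0" using Cc_support assms by blast
  have "deriv g s = 0" if "R < \<bar>s\<bar>" for s
  proof -
    have "((\<lambda>_. 0) has_real_derivative 0) (at s)" by simp
    then have "(g has_real_derivative 0) (at s)"
      by (rule has_field_derivative_transform_within_open[where S = "{..<-R} \<union> {R<..}"])
        (use that R in auto)
    then show ?thesis by (rule DERIV_imp_deriv)
  qed
  then show ?thesis using assms smooth1_deriv by (auto simp: Cc_def)
qed

lemma Cc_bounded: assumes "Cc g" obtains C where "0 \<le> C" "\<And>s. \<bar>g s\<bar> \<le> C"
proof -
  obtain R where R: "0 < R" "\<And>s. R < \<bar>s\<bar> \<Longrightarrow> g s = 0" using Cc_support assms by blast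
  have "compact (g ` {-R..R})"
    using assms by (intro compact_continuous_image smooth1_continuous) (auto simp: Cc_def)
  then obtain C where "\<forall>y\<in>g ` {-R..R}. norm y \<le> C"
    using compact_imp_bounded bounded_iff by metis
  then have C: "\<And>s. s \<in> {-R..R} \<Longrightarrow> \<bar>g s\<bar> \<le> C" by auto
  show thesis
  proof (rule that[of "max C 0"])
    fix s show "\<bar>g s\<bar> \<le> max C 0"
    proof (cases "R < \<bar>s\<bar>")
      case False
      then have "s \<in> {-R..R}" by auto
      from C[OF this] show ?thesis by simp
    qed (use R in simp)
  qed auto
qed

lemma Cc_shift: assumes "Cc g" shows "Cc (\<lambda>s. g (s - b))"
proof -
  obtain R where R: "0 < R" "\<And>s. R < \<bar>s\<bar> \<Longrightarrow> g s = 0" using Cc_support assms by blast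
  have "g (s - b) = 0" if "R + \<bar>b\<bar> < \<bar>s\<bar>" for s
    using that by (intro R(2)) auto
  then show ?thesis using assms smooth1_shift unfolding Cc_def by blast
qed

lemma Cc_scale: assumes "Cc g" "a \<noteq> 0" shows "Cc (\<lambda>s. c * g (a * s))"
proof -
  obtain R where R: "0 < R" "\<And>s. R < \<bar>s\<bar> \<Longrightarrow> g s = 0" using Cc_support assms by blast
  have "c * g (a * s) = 0" if "R / \<bar>a\<bar> < \<bar>s\<bar>" for s
    using that assms R(2)[of "a * s"] by (auto simp: abs_mult field_simps)
  moreover have "smooth1 (\<lambda>s. c * g (a * s))"
    using smooth1_affine[of g c a 0] assms by (simp add: Cc_def)
  ultimately show ?thesis unfolding Cc_def by blast
qed

lemma Cc_integrable: assumes "Cc g" shows "integrable lborel g"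
proof -
  obtain R where R: "0 < R" "\<And>s. R < \<bar>s\<bar> \<Longrightarrow> g s = 0" using Cc_support assms by blast
  have "set_integrable lborel {-R..R} g"
    using assms by (intro borel_integrable_atLeastAtMost' smooth1_continuous) (auto simp: Cc_def)
  moreover have "indicator {-R..R} s * g s = g s" for s
    using R(2)[of s] by (cases "R < \<bar>s\<bar>") (auto simp: indicator_def)
  ultimately show ?thesis by (simp add: set_integrable_def)
qed

lemma Cc_integral_deriv: assumes "Cc g" shows "(\<integral>s. deriv g s \<partial>lborel) = 0"
proof -
  obtain R where R: "0 < R" "\<And>s. R < \<bar>s\<bar> \<Longrightarrow> g s = 0" using Cc_support assms by blast
  have z: "deriv g s = 0" if "s \<notin> {-R..R}" for s
  proof -
    have "((\<lambda>_. 0) has_real_derivative 0) (at s)" by simp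
    then have "(g has_real_derivative 0) (at s)"
      by (rule has_field_derivative_transform_within_open[where S = "{..<-R} \<union> {R<..}"])
        (use that R in auto)
    then show ?thesis by (rule DERIV_imp_deriv)
  qed
  have "(\<integral>s. indicator {-(R+1)..R+1} s *\<^sub>R deriv g s \<partial>lborel) = g (R + 1) - g (-(R+1))"
    using R(1) smooth1_DERIV[OF CcD[OF assms]] smooth1_continuous[OF smooth1_deriv[OF CcD[OF assms]]]
    by (intro integral_FTC_atLeastAtMost)
       (auto simp: has_real_derivative_iff_has_vector_derivative has_vector_derivative_at_within)
  moreover have "(\<lambda>s. indicator {-(R+1)..R+1} s *\<^sub>R deriv g s) = deriv g"
  proof
    fix s show "indicator {-(R+1)..R+1} s *\<^sub>R deriv g s = deriv g s"
    using z[of s] R(1) by (cases "s \<in> {-R..R}") (auto simp: indicator_def)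
  qed
  ultimately show ?thesis using R by simp
qed

section \<open>A bump function, its primitive and smooth cutoffs\<close>

lemma bump_exists:
  "\<exists>\<eta>. Cc \<eta> \<and> (\<forall>s. 0 \<le> \<eta> s) \<and> (\<forall>s. 1 < \<bar>s\<bar> \<longrightarrow> \<eta> s = 0) \<and> (\<forall>s. \<eta> (- s) = \<eta> s)
    \<and> (\<integral>s. \<eta> s \<partial>lborel) = 1"
proof -
  \<comment> \<open>\<open>flat_exp 1\<close> is exp(-1/x) for x > 0 and 0 otherwise, so the product
    of its values at 1 + s and 1 - s is even and positive exactly on (-1,1).\<close>
  define h where "h s = flat_exp 1 (1 * s + 1) * flat_exp 1 ((-1) * s + 1)" for s
  have sm: "smooth1 h"
    unfolding h_def using smooth1_affine[OF flat_exp_smooth1, of 1 1 1 1]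
      smooth1_affine[OF flat_exp_smooth1, of 1 1 "-1" 1] by (intro smooth1_mult) simp_all
  have h0: "h s = 0" if "1 < \<bar>s\<bar>" for s using that by (auto simp: h_def flat_exp_def)
  have hn: "0 \<le> h s" for s by (auto simp: h_def flat_exp_def)
  have he: "h (- s) = h s" for s unfolding h_def by (simp add: mult.commute)
  have Cch: "Cc h" using sm h0 by (auto simp: Cc_def)
  have "(\<integral>s. h s \<partial>lborel) \<noteq> 0"
  proof
    assume "(\<integral>s. h s \<partial>lborel) = 0"
    then have "AE s in lborel. h s = 0"
      using Cc_integrable[OF Cch] hn by (subst (asm) integral_nonneg_eq_0_iff_AE) auto
    moreover have "h s \<noteq> 0" if "s \<in> {-1<..<1}" for s
      using that by (auto simp: h_def flat_exp_def)
    ultimately have "AE s in lborel. s \<notin> {-1<..<1::real}" by (auto elim: eventually_mono)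
    then have "emeasure lborel {-1<..<1::real} = 0"
      by (subst (asm) AE_iff_measurable[where N = "{-1<..<1}"]) auto
    then show False by simp
  qed
  moreover have "0 \<le> (\<integral>s. h s \<partial>lborel)" using hn by simp
  ultimately have pos: "0 < (\<integral>s. h s \<partial>lborel)" by simp
  define c where "c = 1 / (\<integral>s. h s \<partial>lborel)"
  have "Cc (\<lambda>s. c * h s)" using Cc_scale[OF Cch, of 1 c] by simp
  then show ?thesis
    using pos h0 hn he by (intro exI[of _ "\<lambda>s. c * h s"]) (auto simp: c_def)
qed

definition bump :: "real \<Rightarrow> real" where
  "bump = (SOME \<eta>. Cc \<eta> \<and> (\<forall>s. 0 \<le> \<eta> s) \<and> (\<forall>s. 1 < \<bar>s\<bar> \<longrightarrow> \<eta> s = 0) \<and> (\<forall>s. \<eta> (- s) = \<eta> s)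
    \<and> (\<integral>s. \<eta> s \<partial>lborel) = 1)"

lemma bump_props:
  "Cc bump" "0 \<le> bump s" "1 < \<bar>s\<bar> \<Longrightarrow> bump s = 0" "bump (- s) = bump s" "(\<integral>s. bump s \<partial>lborel) = 1"
  using someI_ex[OF bump_exists, folded bump_def] by auto

lemma bump_measurable [measurable]: "bump \<in> borel_measurable borel"
  using bump_props(1) CcD smooth1_measurable by blast

text \<open>A smoothed Heaviside function. The lower limit -2 lies to the left of the support of
  \<open>bump\<close>, so the values are 0 up to -1 and 1 from 1 on.\<close>

definition step :: "real \<Rightarrow> real" where
  "step x = (LBINT s=-2..x. bump s)"

lemma step_DERIV: "(step has_real_derivative bump x) (at x)"
proof -
  define a where "a = - \<bar>x\<bar> - 3"
  define b where "b = \<bar>x\<bar> + 3"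
  have bc: "continuous_on A bump" for A using bump_props(1) CcD smooth1_continuous by blast
  have "((\<lambda>u. LBINT y=ereal (-2)..ereal u. bump y) has_vector_derivative bump x) (at x within {a..b})"
    by (rule interval_integral_FTC2) (auto simp: a_def b_def intro!: bc)
  then have "(step has_vector_derivative bump x) (at x within {a..b})"
    unfolding step_def[abs_def] by simp
  moreover have "at x within {a..b} = at x"
    by (rule at_within_interior) (auto simp: a_def b_def)
  ultimately show ?thesis by (simp add: has_real_derivative_iff_has_vector_derivative)
qed

lemma step_left: assumes "x \<le> -1" shows "step x = 0"
proof -
  have "step x = step (- 2)"
  proof (cases "x = - 2")
    case False
    have *: "step p = step q" if pq: "p < q" "q \<le> -1" for p q
    proof -
      obtain z where "p < z" "z < q" "step q - step p = (q - p) * bump z"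
        using MVT2[OF pq(1), of step bump] step_DERIV by blast
      then show ?thesis using pq bump_props(3)[of z] by auto
    qed
    show ?thesis using *[of x "-2"] *[of "-2" x] assms False by (cases "x < -2") auto
  qed simp
  then show ?thesis by (simp add: step_def)
qed

lemma step_right: assumes "1 \<le> x" shows "step x = 1"
proof -
  have bc: "continuous_on A bump" for A using bump_props(1) CcD smooth1_continuous by blast
  have "(\<integral>s. indicator {-2..x+1} s *\<^sub>R bump s \<partial>lborel) = step (x + 1) - step (- 2)"
    using assms step_DERIV
    by (intro integral_FTC_atLeastAtMost bc)
       (auto simp: has_real_derivative_iff_has_vector_derivative has_vector_derivative_at_within)
  moreover have "(\<lambda>s. indicator {-2..x+1} s *\<^sub>R bump s) = bump"
  proof
    fix s show "indicator {-2..x+1} s *\<^sub>R bump s = bump s"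
    using bump_props(3)[of s] assms by (cases "1 < \<bar>s\<bar>") (auto simp: indicator_def)
  qed
  ultimately have "step (x + 1) = 1" using step_left[of "-2"] bump_props(5) by simp
  moreover obtain z where "x < z" "z < x + 1" "step (x+1) - step x = (x + 1 - x) * bump z"
    using MVT2[of x "x + 1" step bump] step_DERIV by auto
  ultimately show ?thesis using assms bump_props(3)[of z] by auto
qed

lemma step_mono: "x \<le> y \<Longrightarrow> step x \<le> step y"
  using step_DERIV bump_props(2) by (rule deriv_nonneg_imp_mono[of x y step bump]) auto

lemma step_bounds: "0 \<le> step x" "step x \<le> 1"
  using step_mono[of "min x (-1)" x] step_left[of "min x (-1)"]
    step_mono[of x "max x 1"] step_right[of "max x 1"] by auto

lemma step_smooth1: "smooth1 step"
  using smooth1_antideriv step_DERIV bump_props(1) CcD by blast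

text \<open>A smooth approximation of the indicator of (a,b) with transition layers of half-width
  1/n. Its derivative is a rescaled bump at a minus a rescaled bump at b, so integrating P against
  the derivative yields P a - P b in the limit.\<close>

definition cutoff :: "real \<Rightarrow> real \<Rightarrow> nat \<Rightarrow> real \<Rightarrow> real" where
  "cutoff a b n s = step (real n * (s - a)) - step (real n * (s - b))"

lemma cutoff_smooth1: "smooth1 (cutoff a b n)"
proof -
  have "smooth1 (\<lambda>s. step (real n * (s - c)))" for c
    using smooth1_affine[OF step_smooth1, of 1 "real n" "- real n * c"] by (simp add: algebra_simps)
  from smooth1_diff[OF this this] show ?thesis unfolding cutoff_def[abs_def] .
qed

lemma cutoff_DERIV:
  "(cutoff a b n has_real_derivative n * bump (n * (s - a)) - n * bump (n * (s - b))) (at s)"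
proof -
  have "((\<lambda>s. real n * (s - c)) has_real_derivative real n) (at s)" for c
    by (auto intro!: derivative_eq_intros)
  from DERIV_chain2[OF step_DERIV this]
  have "((\<lambda>s. step (real n * (s - c))) has_real_derivative real n * bump (real n * (s - c))) (at s)" for c
    by (simp add: mult.commute)
  from DERIV_diff[OF this this] show ?thesis unfolding cutoff_def[abs_def] .
qed

lemma cutoff_outside:
  assumes "1 \<le> n" "a \<le> b" "s \<le> a - 1 / n \<or> b + 1 / n \<le> s" shows "cutoff a b n s = 0"
proof -
  from assms(3) show ?thesis
  proof
    assume "s \<le> a - 1 / n"
    then have "n * (s - a) \<le> - 1" using assms by (simp add: field_simps)
    moreover have "n * (s - b) \<le> n * (s - a)" using assms by (intro mult_left_mono) auto
    ultimately show ?thesis by (simp add: cutoff_def step_left)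
  next
    assume "b + 1 / n \<le> s"
    then have "1 \<le> n * (s - b)" using assms by (simp add: field_simps)
    moreover have "n * (s - b) \<le> n * (s - a)" using assms by (intro mult_left_mono) auto
    ultimately show ?thesis by (simp add: cutoff_def step_right)
  qed
qed

lemma cutoff_inside:
  assumes "1 \<le> n" "a + 1 / n \<le> s" "s \<le> b - 1 / n" shows "cutoff a b n s = 1"
proof -
  have "1 \<le> n * (s - a)" "n * (s - b) \<le> -1" using assms by (simp_all add: field_simps)
  then show ?thesis by (simp add: cutoff_def step_left step_right)
qed

lemma cutoff_bounds: assumes "a \<le> b" shows "0 \<le> cutoff a b n s" "cutoff a b n s \<le> 1"
proof -
  have "n * (s - b) \<le> n * (s - a)" using assms by (intro mult_left_mono) auto
  then show "0 \<le> cutoff a b n s" by (simp add: cutoff_def step_mono)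
  show "cutoff a b n s \<le> 1"
    using step_bounds(2)[of "n * (s - a)"] step_bounds(1)[of "n * (s - b)"] by (simp add: cutoff_def)
qed

lemma cutoff_Cc: assumes "1 \<le> n" "a \<le> b" shows "Cc (cutoff a b n)"
  unfolding Cc_def
proof (intro conjI cutoff_smooth1 exI[of _ "\<bar>a\<bar> + \<bar>b\<bar> + 1"] allI impI)
  fix s :: real assume s: "\<bar>a\<bar> + \<bar>b\<bar> + 1 < \<bar>s\<bar>"
  have "1 / real n \<le> 1" using assms by simp
  then show "cutoff a b n s = 0" using s assms by (intro cutoff_outside) linarith+
qed

text \<open>Substitute s = n (t - a) and use dominated convergence with majorant C
  \<open>bump\<close>. Continuity is asked for at the single point a, because P will be a function
  truncated by an indicator.\<close>

lemma bump_mollify: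
  assumes [measurable]: "P \<in> borel_measurable borel" and bd: "\<And>t. \<bar>P t\<bar> \<le> C" and "isCont P a"
  shows "(\<lambda>n. \<integral>t. P t * (real n * bump (real n * (t - a))) \<partial>lborel) \<longlonglongrightarrow> P a"
proof -
  have bi: "integrable lborel bump" using bump_props(1) Cc_integrable by blast
  have eq: "(\<integral>t. P t * (real n * bump (real n * (t - a))) \<partial>lborel)
      = (\<integral>s. P (a + s / real n) * bump s \<partial>lborel)" if "1 \<le> n" for n
  proof -
    have "(\<integral>t. P t * (real n * bump (real n * (t - a))) \<partial>lborel)
      = \<bar>1 / real n\<bar> *\<^sub>R (\<integral>s. P (a + (1 / real n) * s) * (real n * bump (real n * (a + (1 / real n) * s - a))) \<partial>lborel)"
      using that by (intro lborel_integral_real_affine) auto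
    also have "\<dots> = (\<integral>s. (1 / real n) * (P (a + (1 / real n) * s) * (real n * bump (real n * (a + (1 / real n) * s - a)))) \<partial>lborel)"
      by (simp only: Bochner_Integration.integral_mult_right_zero) simp
    also have "\<dots> = (\<integral>s. P (a + s / real n) * bump s \<partial>lborel)"
    proof (intro Bochner_Integration.integral_cong refl)
      fix s
      have "real n * (a + (1 / real n) * s - a) = s" "real n > 0" using that by simp_all
      then show "(1 / real n) * (P (a + (1 / real n) * s) * (real n * bump (real n * (a + (1 / real n) * s - a))))
        = P (a + s / real n) * bump s" by simp
    qed
    finally show ?thesis .
  qed
  have "(\<lambda>n. \<integral>s. P (a + s / real n) * bump s \<partial>lborel) \<longlonglongrightarrow> (\<integral>s. P a * bump s \<partial>lborel)"
  proof (rule integral_dominated_convergence[where w = "\<lambda>s. C * bump s"])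
    show "integrable lborel (\<lambda>s. C * bump s)" using bi by simp
    have "(\<lambda>n. P (a + s / real n) * bump s) \<longlonglongrightarrow> P a * bump s" for s
    proof -
      have "(\<lambda>n. a + s / real n) \<longlonglongrightarrow> a + 0"
        by (intro tendsto_add tendsto_const tendsto_divide_0[OF tendsto_const]
            filterlim_at_top_imp_at_infinity filterlim_real_sequentially)
      then have "(\<lambda>n. P (a + s / real n)) \<longlonglongrightarrow> P a"
        using assms(3) by (auto intro: isCont_tendsto_compose)
      then show ?thesis by (intro tendsto_intros)
    qed
    then show "AE s in lborel. (\<lambda>n. P (a + s / real n) * bump s) \<longlonglongrightarrow> P a * bump s" by simp
    show "AE s in lborel. norm (P (a + s / real n) * bump s) \<le> C * bump s" for n
      using bd bump_props(2) by (auto simp: abs_mult intro!: mult_right_mono)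
  qed auto
  also have "(\<integral>s. P a * bump s \<partial>lborel) = P a" using bump_props(5) by simp
  finally show ?thesis
    by (rule Lim_transform_eventually) (use eq in \<open>auto simp: eventually_sequentially intro!: exI[of _ 1]\<close>)
qed

section \<open>Lipschitz representatives and product test functions\<close>

lemma compact_closure_subset:
  fixes X :: "'a::t2_space set"
  assumes "compact K" "X \<subseteq> K" shows "compact (closure X)"
proof -
  have "closure X \<subseteq> K" using assms by (intro closure_minimal compact_imp_closed)
  then have "K \<inter> closure X = closure X" by blast
  then show ?thesis using compact_Int_closed[OF assms(1) closed_closure[of X]] by simp
qed

text \<open>\<open>real_of_ereal\<close> sends infinite values to 0, so the essential supremum has
  to be shown finite: it is bounded above by c, and a negative value would make the whole line a
  null set.\<close>

lemma L_inf_norm_AE: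
  fixes g :: "real \<Rightarrow> real"
  assumes "L_inf lborel g"
  shows "0 \<le> L_inf_norm lborel g" "AE s in lborel. \<bar>g s\<bar> \<le> L_inf_norm lborel g"
proof -
  define E where "E = esssup lborel (\<lambda>s. ereal \<bar>g s\<bar>)"
  obtain c where [measurable]: "g \<in> borel_measurable lborel" and c: "AE s in lborel. \<bar>g s\<bar> \<le> c"
    using assms by (auto simp: L_inf_def)
  have "E \<le> ereal c" unfolding E_def by (rule esssup_I) (use c in auto)
  moreover have AE: "AE s in lborel. ereal \<bar>g s\<bar> \<le> E" unfolding E_def by (rule esssup_AE)
  have "0 \<le> E"
  proof (rule ccontr)
    assume "\<not> 0 \<le> E"
    have "AE s::real in lborel. False"
      using AE
    proof (rule eventually_mono)
      fix s assume elim: "ereal \<bar>g s\<bar> \<le> E"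
      have "0 \<le> ereal \<bar>g s\<bar>" by simp
      then show False using elim \<open>\<not> 0 \<le> E\<close> order_trans by blast
    qed
    then have "emeasure lborel (UNIV::real set) = 0" by (simp add: AE_iff_null null_sets_def)
    then show False by simp
  qed
  ultimately obtain e where e: "E = ereal e" "0 \<le> e" by (cases E) auto
  then show "0 \<le> L_inf_norm lborel g" "AE s in lborel. \<bar>g s\<bar> \<le> L_inf_norm lborel g"
    using AE by (auto simp: L_inf_norm_def E_def[symmetric])
qed

text \<open>Test the weak derivative with \<open>cutoff a b n\<close>. The left side tends to h a -
  h b; the right side is at most L times the length of the support, which is b - a plus 2/n for the
  two transition layers.\<close>

lemma W1_inf_lipschitz:
  assumes "W1_inf h h'"
  shows "\<bar>h a - h b\<bar> \<le> L_inf_norm lborel h' * \<bar>a - b\<bar>"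
proof -
  define L where "L = L_inf_norm lborel h'"
  have hc: "continuous_on UNIV h" and h'L: "L_inf lborel h'"
    and weak: "\<And>\<phi>. test_fun_real \<phi> \<Longrightarrow>
       (\<integral>s. h s * deriv \<phi> s \<partial>lborel) = - (\<integral>s. h' s * \<phi> s \<partial>lborel)"
    using assms by (auto simp: W1_inf_def)
  have hm [measurable]: "h \<in> borel_measurable borel"
    using hc by (rule borel_measurable_continuous_onI)
  have h'm [measurable]: "h' \<in> borel_measurable borel" using h'L by (simp add: L_inf_def)
  have L: "0 \<le> L" "AE s in lborel. \<bar>h' s\<bar> \<le> L" using L_inf_norm_AE[OF h'L] by (auto simp: L_def)
  have main: "\<bar>h a - h b\<bar> \<le> L * (b - a)" if ab: "a < b" for a b
  proof -
    obtain K where K: "0 \<le> K" "\<And>s. s \<in> {a - 2..b + 2} \<Longrightarrow> \<bar>h s\<bar> \<le> K"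
    proof -
      have "compact (h ` {a - 2..b + 2})"
        by (intro compact_continuous_image continuous_on_subset[OF hc]) auto
      then obtain C where "\<forall>y\<in>h ` {a - 2..b + 2}. norm y \<le> C"
        using compact_imp_bounded bounded_iff by metis
      then show thesis by (intro that[of "max C 0"]) (auto simp: le_max_iff_disj)
    qed
    \<comment> \<open>The truncation supplies the global bound of \<open>bump_mollify\<close>
      without changing h where the derivative of a cutoff lives: for n at least 1 that is within
      distance 1 of a or b.\<close>
    define P where "P s = h s * indicator {a - 2..b + 2} s" for s
    have Pm [measurable]: "P \<in> borel_measurable borel" unfolding P_def by measurable
    have Pb: "\<bar>P s\<bar> \<le> K" for s using K by (auto simp: P_def indicator_def)
    have Pc: "isCont P c" if "c \<in> {a..b}" for c
    proof -
      have "isCont h c" using hc by (simp add: continuous_on_eq_continuous_at)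
      moreover have "eventually (\<lambda>s. h s = P s) (nhds c)"
      proof -
        have "eventually (\<lambda>s. s \<in> {a-2<..<b+2}) (nhds c)"
          using that by (intro eventually_nhds_in_open) auto
        then show ?thesis by eventually_elim (auto simp: P_def indicator_def)
      qed
      ultimately show ?thesis using isCont_cong by blast
    qed
    have PX: "P c = h c" if "c \<in> {a..b}" for c using that by (auto simp: P_def)
    have conv: "(\<lambda>n. (\<integral>t. P t * (real n * bump (real n * (t - a))) \<partial>lborel)
        - (\<integral>t. P t * (real n * bump (real n * (t - b))) \<partial>lborel)) \<longlonglongrightarrow> h a - h b"
      using bump_mollify[OF Pm Pb Pc, of a] bump_mollify[OF Pm Pb Pc, of b] ab
      by (intro tendsto_diff) (auto simp: PX)
    have bd: "\<bar>(\<integral>t. P t * (real n * bump (real n * (t - a))) \<partial>lborel)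
        - (\<integral>t. P t * (real n * bump (real n * (t - b))) \<partial>lborel)\<bar> \<le> L * (b - a + 2 / real n)"
      if n: "1 \<le> n" for n
    proof -
      let ?\<phi> = "cutoff a b n"
      have Cc: "Cc ?\<phi>" using ab n by (intro cutoff_Cc) auto
      have d: "deriv ?\<phi> s = n * bump (n * (s - a)) - n * bump (n * (s - b))" for s
        by (rule DERIV_imp_deriv[OF cutoff_DERIV])
      have tf: "test_fun_real ?\<phi>"
        unfolding test_fun_real_def
      proof (intro conjI)
        show "\<forall>k x. (deriv ^^ k) ?\<phi> differentiable at x"
          using CcD[OF Cc] by (simp add: smooth1_def)
        obtain R where R: "0 < R" "\<And>s. R < \<bar>s\<bar> \<Longrightarrow> ?\<phi> s = 0" using Cc_support Cc by blast
        have "{x. ?\<phi> x \<noteq> 0} \<subseteq> {-R..R}"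
        proof
          fix x assume "x \<in> {x. ?\<phi> x \<noteq> 0}"
          then have "\<not> R < \<bar>x\<bar>" using R(2) by auto
          then show "x \<in> {-R..R}" by auto
        qed
        then show "compact (closure {x. ?\<phi> x \<noteq> 0})"
          by (rule compact_closure_subset[rotated]) simp
      qed
      have int: "integrable lborel (\<lambda>t. P t * (real n * bump (real n * (t - c))))" for c
      proof (rule Bochner_Integration.integrable_bound)
        show "integrable lborel (\<lambda>t. K * (n * bump (n * (t - c))))"
          using Cc_integrable[OF Cc_shift[OF Cc_scale[OF bump_props(1), of n n]], of c] n
          by simp
        show "AE t in lborel. norm (P t * (n * bump (n * (t - c)))) \<le> norm (K * (n * bump (n * (t - c))))"
          using Pb K(1) bump_props(2) by (auto simp: abs_mult intro!: mult_right_mono)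
      qed simp
      have "(\<integral>t. P t * (real n * bump (real n * (t - a))) \<partial>lborel)
        - (\<integral>t. P t * (real n * bump (real n * (t - b))) \<partial>lborel)
        = (\<integral>t. P t * deriv ?\<phi> t \<partial>lborel)"
        unfolding d right_diff_distrib[of "P _"]
        by (rule Bochner_Integration.integral_diff[symmetric]) (rule int)+
      also have "\<dots> = (\<integral>t. h t * deriv ?\<phi> t \<partial>lborel)"
      proof (intro Bochner_Integration.integral_cong refl)
        fix t
        show "P t * deriv ?\<phi> t = h t * deriv ?\<phi> t"
        proof (cases "t \<in> {a - 2..b + 2}")
          case False
          have "1 < \<bar>n * (t - c)\<bar>" if "c \<in> {a, b}" for c
          proof -
            have "2 < \<bar>t - c\<bar>" using False that ab by auto
            also have "\<dots> \<le> n * \<bar>t - c\<bar>" using n by (simp add: mult_le_cancel_right1)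
            finally show ?thesis by (simp add: abs_mult)
          qed
          then have "deriv ?\<phi> t = 0" unfolding d by (simp add: bump_props(3))
          then show ?thesis by simp
        qed (simp add: P_def)
      qed
      also have "\<dots> = - (\<integral>s. h' s * ?\<phi> s \<partial>lborel)" by (rule weak[OF tf])
      finally have "\<bar>(\<integral>t. P t * (real n * bump (real n * (t - a))) \<partial>lborel)
        - (\<integral>t. P t * (real n * bump (real n * (t - b))) \<partial>lborel)\<bar> = \<bar>\<integral>s. h' s * ?\<phi> s \<partial>lborel\<bar>"
        by simp
      also have "\<dots> \<le> (\<integral>s. \<bar>h' s * ?\<phi> s\<bar> \<partial>lborel)" by (rule integral_abs_bound)
      also have "\<dots> \<le> (\<integral>s. L * indicator {a - 1 / n..b + 1 / n} s \<partial>lborel)"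
      proof (rule integral_mono_AE')
        show "integrable lborel (\<lambda>s. L * indicator {a - 1 / n..b + 1 / n} s)"
          by (intro integrable_mult_right integrable_real_indicator) (simp_all add: emeasure_lborel_Icc_eq)
        show "AE s in lborel. \<bar>h' s * ?\<phi> s\<bar> \<le> L * indicator {a - 1 / n..b + 1 / n} s"
          using L(2)
        proof eventually_elim
          case (elim s)
          have "\<bar>?\<phi> s\<bar> \<le> indicator {a - 1 / n..b + 1 / n} s"
            using cutoff_outside[of n a b s] cutoff_bounds[of a b n s] ab n
            by (cases "s \<in> {a - 1 / n..b + 1 / n}") (auto simp: indicator_def)
          then show ?case using elim L(1) by (auto simp: abs_mult intro!: mult_mono)
        qed
        show "AE s in lborel. 0 \<le> L * indicator {a - 1 / n..b + 1 / n} s" using L(1) by simp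
      qed
      also have "\<dots> = L * (b - a + 2 / n)"
      proof -
        have "0 \<le> 1 / real n" by simp
        then have "a - 1 / n \<le> b + 1 / n" using ab by linarith
        then show ?thesis by (simp add: algebra_simps)
      qed
      finally show ?thesis .
    qed
    have "(\<lambda>n. L * (b - a + 2 / real n)) \<longlonglongrightarrow> L * (b - a + 0)"
      by (intro tendsto_intros tendsto_divide_0[OF tendsto_const]
            filterlim_at_top_imp_at_infinity filterlim_real_sequentially)
    then have "\<bar>h a - h b\<bar> \<le> L * (b - a + 0)"
      by (rule LIMSEQ_le[OF tendsto_rabs[OF conv]]) (use bd in blast)
    then show ?thesis by simp
  qed
  show ?thesis
    using main[of a b] main[of b a] by (cases a b rule: linorder_cases) (auto simp: L_def abs_minus_commute)
qed

text \<open>The essential bound holds almost everywhere, and by continuity the set where it holds is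
  closed, hence it is the whole line.\<close>

lemma W1_inf_bounded: assumes "W1_inf h h'" obtains C where "0 \<le> C" "\<And>s. \<bar>h s\<bar> \<le> C"
proof -
  have hc: "continuous_on UNIV h" and "L_inf lborel h" using assms by (auto simp: W1_inf_def)
  then obtain c where c: "AE s in lborel. \<bar>h s\<bar> \<le> c" by (auto simp: L_inf_def)
  have "s \<in> {s. \<bar>h s\<bar> \<le> c}" for s
  proof (rule mem_closed_if_AE_lebesgue)
    show "closed {s. \<bar>h s\<bar> \<le> c}"
      by (intro closed_Collect_le continuous_intros hc)
    show "AE s in lebesgue. s \<in> {s. \<bar>h s\<bar> \<le> c}" using c by (simp add: AE_completion)
  qed
  then show thesis using that[of "max c 0"] by (auto simp: le_max_iff_disj)
qed

(* All test functions and mollifiers in the proof are products of functions of one variable, so that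
   iterated partial derivatives stay in the same class. *)

definition prodf :: "nat \<Rightarrow> (nat \<Rightarrow> real \<Rightarrow> real) \<Rightarrow> (nat \<Rightarrow> real) \<Rightarrow> real" where
  "prodf n g x = (\<Prod>i<n. g i (x i))"

definition dprodf :: "nat \<Rightarrow> (nat \<Rightarrow> real \<Rightarrow> real) \<Rightarrow> nat \<Rightarrow> (nat \<Rightarrow> real) \<Rightarrow> real" where
  "dprodf n g i = prodf n (g(i := deriv (g i)))"

lemma prodf_cong: "(\<And>i. i < n \<Longrightarrow> x i = y i) \<Longrightarrow> prodf n g x = prodf n g y"
  unfolding prodf_def by (intro prod.cong) auto

lemma prodf_split: "i < n \<Longrightarrow> prodf n g x = g i (x i) * (\<Prod>j\<in>{..<n} - {i}. g j (x j))"
  unfolding prodf_def by (subst prod.remove[of _ i]) auto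

lemma partial_prodf:
  assumes "i < n" "smooth1 (g i)" shows "partial i (prodf n g) = dprodf n g i"
proof
  fix x
  have "((\<lambda>s. g i s * (\<Prod>j\<in>{..<n} - {i}. g j (x j))) has_real_derivative
      deriv (g i) (x i) * (\<Prod>j\<in>{..<n} - {i}. g j (x j))) (at (x i))"
    by (intro DERIV_cmult_right smooth1_DERIV assms)
  moreover have "prodf n g (x(i := s)) = g i s * (\<Prod>j\<in>{..<n} - {i}. g j (x j))" for s
    unfolding prodf_split[OF assms(1)] by (auto intro!: prod.cong)
  moreover have "dprodf n g i x = deriv (g i) (x i) * (\<Prod>j\<in>{..<n} - {i}. g j (x j))"
    unfolding dprodf_def prodf_split[OF assms(1)] by (auto intro!: prod.cong)
  ultimately show "partial i (prodf n g) x = dprodf n g i x"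
    unfolding partial_def by (simp add: DERIV_imp_deriv)
qed

lemma prodf_update_differentiable:
  assumes "i < n" "smooth1 (g i)" shows "(\<lambda>s. prodf n g (x(i := s))) differentiable (at t)"
proof -
  have "((\<lambda>s. g i s * (\<Prod>j\<in>{..<n} - {i}. g j (x j))) has_real_derivative
      deriv (g i) t * (\<Prod>j\<in>{..<n} - {i}. g j (x j))) (at t)"
    by (intro DERIV_cmult_right smooth1_DERIV assms)
  moreover have "prodf n g (x(i := s)) = g i s * (\<Prod>j\<in>{..<n} - {i}. g j (x j))" for s
    unfolding prodf_split[OF assms(1)] by (auto intro!: prod.cong)
  ultimately show ?thesis by (auto simp: real_differentiable_def)
qed

text \<open>Derivative along the line a + s z. With the mean value theorem it takes the place of
  Taylor expansions in several variables.\<close>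

lemma prodf_line_DERIV:
  assumes "\<And>i. i < n \<Longrightarrow> smooth1 (g i)"
  shows "((\<lambda>s. prodf n g (\<lambda>i. a i + s * z i)) has_real_derivative
     (\<Sum>i<n. z i * dprodf n g i (\<lambda>i. a i + s * z i))) (at s)"
proof -
  have "((\<lambda>s. g i (a i + s * z i)) has_real_derivative z i * deriv (g i) (a i + s * z i)) (at s)"
    if "i < n" for i
  proof -
    have "((\<lambda>s. a i + s * z i) has_real_derivative z i) (at s)" by (auto intro!: derivative_eq_intros)
    from DERIV_chain2[OF smooth1_DERIV[OF assms[OF that]] this]
    show ?thesis by (simp add: mult.commute)
  qed
  then have "((\<lambda>s. \<Prod>i<n. g i (a i + s * z i)) has_real_derivative
    (\<Sum>i<n. z i * deriv (g i) (a i + s * z i) * (\<Prod>j\<in>{..<n} - {i}. g j (a j + s * z j)))) (at s)"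
    by (intro has_field_derivative_prod) auto
  moreover have "z i * deriv (g i) (a i + s * z i) * (\<Prod>j\<in>{..<n} - {i}. g j (a j + s * z j))
    = z i * dprodf n g i (\<lambda>i. a i + s * z i)" if "i < n" for i
    unfolding dprodf_def prodf_split[OF that] by (auto intro!: prod.cong)
  ultimately show ?thesis unfolding prodf_def by simp
qed

definition Ccs :: "nat \<Rightarrow> (nat \<Rightarrow> real \<Rightarrow> real) \<Rightarrow> bool" where
  "Ccs n g \<longleftrightarrow> (\<forall>i<n. Cc (g i))"

lemma Ccs_deriv: "Ccs n g \<Longrightarrow> Ccs n (g(i := deriv (g i)))"
  by (auto simp: Ccs_def Cc_deriv)

lemma Ccs_shift: "Ccs n g \<Longrightarrow> Ccs n (\<lambda>i s. g i (s - y i))"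
  by (auto simp: Ccs_def Cc_shift)

lemma prodf_bounded:
  assumes "Ccs n g" obtains C where "0 \<le> C" "\<And>x. \<bar>prodf n g x\<bar> \<le> C"
proof -
  have "\<exists>C. 0 \<le> C \<and> (\<forall>s. \<bar>g i s\<bar> \<le> C)" if "i < n" for i
    proof -
    have "Cc (g i)" using assms that by (simp add: Ccs_def)
    then obtain C where "0 \<le> C" "\<And>s. \<bar>g i s\<bar> \<le> C" by (rule Cc_bounded) blast
    then show ?thesis by blast
  qed
  then have "\<forall>i. \<exists>C. i < n \<longrightarrow> 0 \<le> C \<and> (\<forall>s. \<bar>g i s\<bar> \<le> C)" by blast
  from choice[OF this] obtain C where C: "\<And>i. i < n \<Longrightarrow> 0 \<le> C i" "\<And>i s. i < n \<Longrightarrow> \<bar>g i s\<bar> \<le> C i" by blast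
  show thesis
  proof (rule that[of "\<Prod>i<n. C i"])
    show "0 \<le> (\<Prod>i<n. C i)" by (rule prod_nonneg) (simp add: C)
    show "\<bar>prodf n g x\<bar> \<le> (\<Prod>i<n. C i)" for x
      unfolding prodf_def abs_prod by (rule prod_mono) (simp add: C)
  qed
qed

lemma prodf_support:
  assumes "Ccs n g" obtains R where "0 < R" "\<And>x i. i < n \<Longrightarrow> R < \<bar>x i\<bar> \<Longrightarrow> prodf n g x = 0"
proof -
  have "\<exists>R>0. \<forall>s. R < \<bar>s\<bar> \<longrightarrow> g i s = 0" if "i < n" for i
    proof -
    have "Cc (g i)" using assms that by (simp add: Ccs_def)
    then obtain R where "0 < R" "\<And>s. R < \<bar>s\<bar> \<Longrightarrow> g i s = 0" by (rule Cc_support) blast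
    then show ?thesis by blast
  qed
  then have "\<forall>i. \<exists>R. i < n \<longrightarrow> 0 < R \<and> (\<forall>s. R < \<bar>s\<bar> \<longrightarrow> g i s = 0)" by blast
  from choice[OF this] obtain R where R: "\<And>i. i < n \<Longrightarrow> 0 < R i" "\<And>i s. i < n \<Longrightarrow> R i < \<bar>s\<bar> \<Longrightarrow> g i s = 0" by blast
  show thesis
  proof (rule that[of "1 + (\<Sum>i<n. R i)"])
    have R0: "\<And>i. i < n \<Longrightarrow> 0 \<le> R i" using R(1) less_imp_le by blast
    then show "0 < 1 + (\<Sum>i<n. R i)" by (intro add_pos_nonneg sum_nonneg) simp_all
    fix x :: "nat \<Rightarrow> real" and i assume i: "i < n" and *: "1 + (\<Sum>i<n. R i) < \<bar>x i\<bar>"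
    have "R i \<le> (\<Sum>i<n. R i)" using R0 i by (intro member_le_sum) simp_all
    then have "g i (x i) = 0" using * i by (intro R(2)) auto
    then show "prodf n g x = 0" unfolding prodf_def using i by auto
  qed
qed

lemma prodf_lipschitz:
  assumes "Ccs n g"
  obtains C where "0 \<le> C" "\<And>x y. \<bar>prodf n g x - prodf n g y\<bar> \<le> C * (\<Sum>i<n. \<bar>x i - y i\<bar>)"
proof -
  have "\<exists>C. 0 \<le> C \<and> (\<forall>x. \<bar>dprodf n g i x\<bar> \<le> C)" for i
    proof -
    obtain C where "0 \<le> C" "\<And>x. \<bar>prodf n (g(i := deriv (g i))) x\<bar> \<le> C"
      using Ccs_deriv[OF assms] by (rule prodf_bounded) blast
    then show ?thesis unfolding dprodf_def by blast
  qed
  then have "\<forall>i. \<exists>C. 0 \<le> C \<and> (\<forall>x. \<bar>dprodf n g i x\<bar> \<le> C)" by blast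
  from choice[OF this] obtain C where C: "\<And>i. 0 \<le> C i" "\<And>i x. \<bar>dprodf n g i x\<bar> \<le> C i" by blast
  define K where "K = (\<Sum>i<n. C i)"
  have K: "C i \<le> K" if "i < n" for i unfolding K_def using that C(1) by (intro member_le_sum) auto
  have K0: "0 \<le> K" unfolding K_def using C(1) by (intro sum_nonneg) auto
  show thesis
  proof (rule that[OF K0])
    fix x y :: "nat \<Rightarrow> real"
    define z where "z i = x i - y i" for i
    have sm: "\<And>i. i < n \<Longrightarrow> smooth1 (g i)" using assms CcD by (auto simp: Ccs_def)
    obtain c where c: "prodf n g (\<lambda>i. y i + 1 * z i) - prodf n g (\<lambda>i. y i + 0 * z i)
       = (1 - 0) * (\<Sum>i<n. z i * dprodf n g i (\<lambda>i. y i + c * z i))"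
      using MVT2[of 0 1 "\<lambda>s. prodf n g (\<lambda>i. y i + s * z i)"
          "\<lambda>s. \<Sum>i<n. z i * dprodf n g i (\<lambda>i. y i + s * z i)"] prodf_line_DERIV[OF sm] by auto
    have "\<bar>prodf n g x - prodf n g y\<bar> = \<bar>\<Sum>i<n. z i * dprodf n g i (\<lambda>i. y i + c * z i)\<bar>"
      using c by (simp add: z_def)
    also have "\<dots> \<le> (\<Sum>i<n. \<bar>z i\<bar> * K)"
    proof (intro order_trans[OF sum_abs] sum_mono)
      fix i assume "i \<in> {..<n}"
      then have "\<bar>dprodf n g i (\<lambda>i. y i + c * z i)\<bar> \<le> K" using C(2)[of i] K[of i] by (auto intro: order_trans)
      then show "\<bar>z i * dprodf n g i (\<lambda>i. y i + c * z i)\<bar> \<le> \<bar>z i\<bar> * K"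
        by (auto simp: abs_mult intro!: mult_left_mono)
    qed
    finally show "\<bar>prodf n g x - prodf n g y\<bar> \<le> K * (\<Sum>i<n. \<bar>x i - y i\<bar>)"
      by (simp add: z_def sum_distrib_left mult.commute)
  qed
qed

text \<open>The topology is the product topology on \<open>nat \<Rightarrow> real\<close>. Its
  coordinate maps are continuous, so a bound by finitely many coordinate differences tends to
  0.\<close>

lemma continuous_on_component_lipschitz:
  fixes F :: "(nat \<Rightarrow> real) \<Rightarrow> real"
  assumes "\<And>x y. \<bar>F x - F y\<bar> \<le> C * (\<Sum>i<n. \<bar>x i - y i\<bar>)"
  shows "continuous_on S F"
proof -
  have "((\<lambda>x. C * (\<Sum>i<n. \<bar>x i - a i\<bar>)) \<longlongrightarrow> 0) (at a within S)" for a
  proof -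
    have "continuous_on UNIV (\<lambda>x::nat \<Rightarrow> real. C * (\<Sum>i<n. \<bar>x i - a i\<bar>))"
      by (intro continuous_intros continuous_on_product_coordinates)
    then have "((\<lambda>x. C * (\<Sum>i<n. \<bar>x i - a i\<bar>)) \<longlongrightarrow> C * (\<Sum>i<n. \<bar>a i - a i\<bar>)) (at a within UNIV)"
      unfolding continuous_on_def by blast
    then show ?thesis by (auto intro: tendsto_within_subset)
  qed
  then have "((\<lambda>x. F x - F a) \<longlongrightarrow> 0) (at a within S)" for a
    by (rule Lim_null_comparison[rotated]) (use assms in auto)
  then show ?thesis unfolding continuous_on_def using LIM_zero_iff by blast
qed

lemma compact_Rd_box: "compact {x \<in> Rd n. \<forall>i<n. x i \<in> {-R..R}}"
proof -
  \<comment> \<open>Outside of the index range extensional functions take the single value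
    \<open>undefined\<close>. With that point as factor the box is a full product of compact sets,
    and Tychonoff's theorem applies.\<close>
  define S where "S i = (if i < n then {-R..R} else {undefined::real})" for i
  have "compactin (product_topology (\<lambda>_. euclidean) UNIV) (PiE UNIV S)"
    by (subst compactin_PiE) (auto simp: S_def)
  then have "compact (PiE UNIV S)" by (simp add: euclidean_product_topology)
  moreover have "PiE UNIV S = {x \<in> Rd n. \<forall>i<n. x i \<in> {-R..R}}"
    by (auto simp: S_def Rd_def PiE_def Pi_def extensional_def split: if_splits)
  ultimately show ?thesis by simp
qed

lemma compact_support_Rd:
  assumes "\<And>x i. x \<in> Rd n \<Longrightarrow> i < n \<Longrightarrow> R < \<bar>x i\<bar> \<Longrightarrow> \<phi> x = (0::real)"
  shows "compact (closure {x \<in> Rd n. \<phi> x \<noteq> 0})"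
proof -
  have "{x \<in> Rd n. \<phi> x \<noteq> 0} \<subseteq> {x \<in> Rd n. \<forall>i<n. x i \<in> {-R..R}}"
    using assms by (auto simp: abs_le_iff[symmetric] not_less[symmetric])
  then show ?thesis by (rule compact_closure_subset[OF compact_Rd_box])
qed

lemma foldr_partial_prodf:
  assumes "Ccs n g" "set is \<subseteq> {..<n}"
  shows "\<exists>g'. Ccs n g' \<and> foldr partial is (prodf n g) = prodf n g'"
  using assms(2)
proof (induction "is")
  case (Cons i "is")
  then obtain g' where g': "Ccs n g'" "foldr partial is (prodf n g) = prodf n g'" by auto
  have "partial i (prodf n g') = dprodf n g' i"
    using Cons.prems g'(1) CcD by (intro partial_prodf) (auto simp: Ccs_def)
  then show ?case using Ccs_deriv[OF g'(1), of i] g'(2) by (auto simp: dprodf_def)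
qed (use assms in auto)

lemma test_fun_prodf: assumes "Ccs n g" shows "test_fun n (prodf n g)"
  unfolding test_fun_def smooth_def
proof (intro conjI allI impI ballI)
  fix "is" assume "set is \<subseteq> {..<n}"
  then obtain g' where g': "Ccs n g'" "foldr partial is (prodf n g) = prodf n g'"
    using foldr_partial_prodf[OF assms] by blast
  obtain C where "0 \<le> C" "\<And>x y. \<bar>prodf n g' x - prodf n g' y\<bar> \<le> C * (\<Sum>i<n. \<bar>x i - y i\<bar>)"
    using g'(1) by (rule prodf_lipschitz) blast
  then show "continuous_on (Rd n) (foldr partial is (prodf n g))"
    unfolding g'(2) by (intro continuous_on_component_lipschitz)
  fix i x assume "i < n"
  then show "(\<lambda>s. foldr partial is (prodf n g) (x(i := s))) differentiable at (x i)"
    unfolding g'(2) using g'(1) CcD by (intro prodf_update_differentiable) (auto simp: Ccs_def)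
next
  obtain R where "0 < R" "\<And>x i. i < n \<Longrightarrow> R < \<bar>x i\<bar> \<Longrightarrow> prodf n g x = 0"
    using assms by (rule prodf_support) blast
  then show "compact (closure {x \<in> Rd n. prodf n g x \<noteq> 0})" by (intro compact_support_Rd[of n R]) auto
qed

definition vsub :: "nat \<Rightarrow> (nat \<Rightarrow> real) \<Rightarrow> (nat \<Rightarrow> real) \<Rightarrow> nat \<Rightarrow> real" where
  "vsub d x y = (\<lambda>i\<in>{..<d}. x i - y i)"

section \<open>Lebesgue measure on \<open>Rd d\<close>: translations, reflections and difference
  kernels\<close>

interpretation lb: product_sigma_finite "\<lambda>_::nat. lborel :: real measure" ..

lemma space_lebesgue_Rd: "space (lebesgue_Rd d) = Rd d"
  by (simp add: lebesgue_Rd_def space_PiM Rd_def)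

lemma sigma_finite_lebesgue_Rd: "sigma_finite_measure (lebesgue_Rd d)"
  unfolding lebesgue_Rd_def by (rule lb.sigma_finite) simp

interpretation lR: sigma_finite_measure "lebesgue_Rd d" for d by (rule sigma_finite_lebesgue_Rd)

lemma component_measurable [measurable (raw)]:
  assumes "f \<in> N \<rightarrow>\<^sub>M lebesgue_Rd d" "i < d" shows "(\<lambda>x. f x i) \<in> borel_measurable N"
proof -
  have "(\<lambda>x. x i) \<in> lebesgue_Rd d \<rightarrow>\<^sub>M lborel"
    unfolding lebesgue_Rd_def using assms by (intro measurable_component_singleton) auto
  from measurable_compose[OF assms(1) this] show ?thesis by simp
qed

lemma restrict_measurable_Rd:
  assumes "\<And>i. i < d \<Longrightarrow> (\<lambda>x. F x i) \<in> borel_measurable N"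
  shows "(\<lambda>x. \<lambda>i\<in>{..<d}. F x i) \<in> N \<rightarrow>\<^sub>M lebesgue_Rd d"
  unfolding lebesgue_Rd_def using assms by (intro measurable_restrict) auto

lemma vadd_measurable [measurable (raw)]:
  assumes [measurable]: "f \<in> N \<rightarrow>\<^sub>M lebesgue_Rd d" "g \<in> N \<rightarrow>\<^sub>M lebesgue_Rd d"
  shows "(\<lambda>x. vadd d (f x) (g x)) \<in> N \<rightarrow>\<^sub>M lebesgue_Rd d"
  unfolding vadd_def by (rule restrict_measurable_Rd) measurable

lemma vsub_measurable [measurable (raw)]:
  assumes [measurable]: "f \<in> N \<rightarrow>\<^sub>M lebesgue_Rd d" "g \<in> N \<rightarrow>\<^sub>M lebesgue_Rd d"
  shows "(\<lambda>x. vsub d (f x) (g x)) \<in> N \<rightarrow>\<^sub>M lebesgue_Rd d"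
  unfolding vsub_def by (rule restrict_measurable_Rd) measurable

lemma vneg_measurable [measurable (raw)]:
  assumes [measurable]: "f \<in> N \<rightarrow>\<^sub>M lebesgue_Rd d"
  shows "(\<lambda>x. vneg d (f x)) \<in> N \<rightarrow>\<^sub>M lebesgue_Rd d"
  unfolding vneg_def by (rule restrict_measurable_Rd) measurable

lemma vnorm_measurable [measurable (raw)]:
  assumes [measurable]: "f \<in> N \<rightarrow>\<^sub>M lebesgue_Rd d"
  shows "(\<lambda>x. vnorm d (f x)) \<in> borel_measurable N"
  unfolding L2_set_def by measurable

lemma prodf_measurable [measurable (raw)]:
  assumes "Ccs d g" and [measurable]: "f \<in> N \<rightarrow>\<^sub>M lebesgue_Rd d"
  shows "(\<lambda>x. prodf d g (f x)) \<in> borel_measurable N"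
proof -
  have "(\<lambda>x. g i (f x i)) \<in> borel_measurable N" if "i < d" for i
    by (rule measurable_compose[OF component_measurable[OF assms(2) that]])
      (use assms(1) that CcD smooth1_measurable in \<open>auto simp: Ccs_def\<close>)
  then show ?thesis unfolding prodf_def by (intro borel_measurable_prod) auto
qed

lemma dprodf_measurable [measurable (raw)]:
  assumes "Ccs d g" and "f \<in> N \<rightarrow>\<^sub>M lebesgue_Rd d"
  shows "(\<lambda>x. dprodf d g i (f x)) \<in> borel_measurable N"
  unfolding dprodf_def using prodf_measurable[OF Ccs_deriv[OF assms(1)] assms(2)] .

lemma prodf_integrable: "Ccs d g \<Longrightarrow> integrable (lebesgue_Rd d) (prodf d g)"
  unfolding prodf_def[abs_def] lebesgue_Rd_def
  by (intro lb.product_integrable_prod) (auto simp: Ccs_def Cc_integrable)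

lemma prodf_integral: "Ccs d g \<Longrightarrow> (\<integral>x. prodf d g x \<partial>lebesgue_Rd d) = (\<Prod>i<d. \<integral>s. g i s \<partial>lborel)"
  unfolding prodf_def[abs_def] lebesgue_Rd_def
  by (intro lb.product_integral_prod) (auto simp: Ccs_def Cc_integrable)

lemma prodf_abs_integral:
  "Ccs d g \<Longrightarrow> (\<integral>x. \<bar>prodf d g x\<bar> \<partial>lebesgue_Rd d) = (\<Prod>i<d. \<integral>s. \<bar>g i s\<bar> \<partial>lborel)"
  unfolding prodf_def[abs_def] lebesgue_Rd_def abs_prod
  by (intro lb.product_integral_prod[where f = "\<lambda>i s. \<bar>g i s\<bar>"]) (auto simp: Ccs_def Cc_integrable)

lemma emeasure_lborel_affine:
  assumes "s = 1 \<or> s = (-1::real)" and [measurable]: "A \<in> sets borel"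
  shows "emeasure lborel ((\<lambda>t. c + s * t) -` A) = emeasure lborel A"
proof -
  have "lborel = density (distr lborel borel (\<lambda>x. c + s * x)) (\<lambda>_. \<bar>s\<bar>)"
    using assms by (intro lborel_real_affine) auto
  also have "\<dots> = distr lborel borel (\<lambda>x. c + s * x)" using assms by (auto simp: density_1)
  finally have "emeasure lborel A = emeasure (distr lborel borel (\<lambda>x. c + s * x)) A" by simp
  also have "\<dots> = emeasure lborel ((\<lambda>t. c + s * t) -` A)" by (subst emeasure_distr) auto
  finally show ?thesis by simp
qed

text \<open>Translations and point reflections are treated together. The preimage of a box is a box
  with sides of the same measure, and a product measure is determined by its values on
  boxes.\<close>

lemma distr_lebesgue_Rd_affine:
  assumes s: "s = 1 \<or> s = (-1::real)"
  shows "distr (lebesgue_Rd d) (lebesgue_Rd d) (\<lambda>y. \<lambda>i\<in>{..<d}. c i + s * y i) = lebesgue_Rd d"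
proof -
  have T: "(\<lambda>y. \<lambda>i\<in>{..<d}. c i + s * y i) \<in> lebesgue_Rd d \<rightarrow>\<^sub>M lebesgue_Rd d"
    by (rule restrict_measurable_Rd) measurable
  show ?thesis
    unfolding lebesgue_Rd_def
  proof (rule lb.PiM_eqI)
    fix A assume A: "\<And>i. i \<in> {..<d} \<Longrightarrow> A i \<in> sets (lborel::real measure)"
    have *: "(\<lambda>y. \<lambda>i\<in>{..<d}. c i + s * y i) -` Pi\<^sub>E {..<d} A \<inter> Rd d
      = Pi\<^sub>E {..<d} (\<lambda>i. (\<lambda>t. c i + s * t) -` A i)"
      by (auto simp: Rd_def PiE_def Pi_def restrict_def extensional_def)
    have "emeasure (distr (lebesgue_Rd d) (lebesgue_Rd d) (\<lambda>y. \<lambda>i\<in>{..<d}. c i + s * y i)) (Pi\<^sub>E {..<d} A)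
      = emeasure (lebesgue_Rd d) (Pi\<^sub>E {..<d} (\<lambda>i. (\<lambda>t. c i + s * t) -` A i))"
      using A by (subst emeasure_distr[OF T]) (simp_all add: *[symmetric] space_lebesgue_Rd[unfolded lebesgue_Rd_def] lebesgue_Rd_def sets_PiM_I_finite)
    also have "\<dots> = (\<Prod>i<d. emeasure lborel ((\<lambda>t. c i + s * t) -` A i))"
      unfolding lebesgue_Rd_def
    proof (rule lb.emeasure_PiM)
      fix i assume "i \<in> {..<d}"
      then have "A i \<in> sets borel" using A by auto
      then have "(\<lambda>t. c i + s * t) -` A i \<inter> space borel \<in> sets borel" by (rule measurable_sets[rotated]) auto
      then show "(\<lambda>t. c i + s * t) -` A i \<in> sets lborel" by simp
    qed simp
    also have "\<dots> = (\<Prod>i<d. emeasure lborel (A i))"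
      using A s by (intro prod.cong refl emeasure_lborel_affine) auto
    finally show "emeasure (distr (Pi\<^sub>M {..<d} (\<lambda>_. lborel)) (Pi\<^sub>M {..<d} (\<lambda>_. lborel)) (\<lambda>y. \<lambda>i\<in>{..<d}. c i + s * y i)) (Pi\<^sub>E {..<d} A)
      = (\<Prod>i<d. emeasure lborel (A i))"
      by (simp add: lebesgue_Rd_def)
  qed simp_all
qed

lemma affine_measurable: "(\<lambda>y. \<lambda>i\<in>{..<d}. c i + s * y i) \<in> lebesgue_Rd d \<rightarrow>\<^sub>M lebesgue_Rd d"
  by (rule restrict_measurable_Rd) measurable

lemma affine_forms:
  "vadd d y h = (\<lambda>i\<in>{..<d}. h i + 1 * y i)" "vsub d y h = (\<lambda>i\<in>{..<d}. - h i + 1 * y i)"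
  "vsub d h y = (\<lambda>i\<in>{..<d}. h i + (-1) * y i)" "vneg d y = (\<lambda>i\<in>{..<d}. 0 + (-1) * y i)"
  by (auto simp: vadd_def vsub_def vneg_def)

lemma
  fixes \<kappa> :: "(nat \<Rightarrow> real) \<Rightarrow> real"
  assumes [measurable]: "\<kappa> \<in> borel_measurable (lebesgue_Rd d)"
  shows integral_vadd: "(\<integral>y. \<kappa> (vadd d y h) \<partial>lebesgue_Rd d) = (\<integral>y. \<kappa> y \<partial>lebesgue_Rd d)"
    and integral_vsub_right: "(\<integral>y. \<kappa> (vsub d y h) \<partial>lebesgue_Rd d) = (\<integral>y. \<kappa> y \<partial>lebesgue_Rd d)"
    and integral_vsub_left: "(\<integral>y. \<kappa> (vsub d h y) \<partial>lebesgue_Rd d) = (\<integral>y. \<kappa> y \<partial>lebesgue_Rd d)"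
proof -
  have *: "(\<integral>y. \<kappa> (\<lambda>i\<in>{..<d}. c i + s * y i) \<partial>lebesgue_Rd d) = (\<integral>y. \<kappa> y \<partial>lebesgue_Rd d)"
    if "s = 1 \<or> s = -1" for c s
    by (subst (2) distr_lebesgue_Rd_affine[OF that, symmetric, of d c])
      (rule integral_distr[OF affine_measurable assms, symmetric])
  show "(\<integral>y. \<kappa> (vadd d y h) \<partial>lebesgue_Rd d) = (\<integral>y. \<kappa> y \<partial>lebesgue_Rd d)"
    "(\<integral>y. \<kappa> (vsub d y h) \<partial>lebesgue_Rd d) = (\<integral>y. \<kappa> y \<partial>lebesgue_Rd d)"
    "(\<integral>y. \<kappa> (vsub d h y) \<partial>lebesgue_Rd d) = (\<integral>y. \<kappa> y \<partial>lebesgue_Rd d)"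
    by (simp_all only: affine_forms(1) affine_forms(2)[of d _ h] affine_forms(3)[of d h] * simp_thms)
qed

lemma
  fixes \<kappa> :: "(nat \<Rightarrow> real) \<Rightarrow> real"
  assumes "integrable (lebesgue_Rd d) \<kappa>"
  shows integrable_vadd: "integrable (lebesgue_Rd d) (\<lambda>y. \<kappa> (vadd d y h))"
    and integrable_vsub_right: "integrable (lebesgue_Rd d) (\<lambda>y. \<kappa> (vsub d y h))"
    and integrable_vsub_left: "integrable (lebesgue_Rd d) (\<lambda>y. \<kappa> (vsub d h y))"
proof -
  have *: "integrable (lebesgue_Rd d) (\<lambda>y. \<kappa> (\<lambda>i\<in>{..<d}. c i + s * y i))"
    if "s = 1 \<or> s = -1" for c s
    by (rule integrable_distr[OF affine_measurable]) (simp add: distr_lebesgue_Rd_affine[OF that] assms)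
  show "integrable (lebesgue_Rd d) (\<lambda>y. \<kappa> (vadd d y h))"
    "integrable (lebesgue_Rd d) (\<lambda>y. \<kappa> (vsub d y h))"
    "integrable (lebesgue_Rd d) (\<lambda>y. \<kappa> (vsub d h y))"
    by (simp_all only: affine_forms(1) affine_forms(2)[of d _ h] affine_forms(3)[of d h] * simp_thms)
qed

interpretation lRR: pair_sigma_finite "lebesgue_Rd d" "lebesgue_Rd d" for d ..

text \<open>For fixed x the map from y to x - y preserves the measure, so the inner integral of the
  kernel does not depend on x and the double integral factorises.\<close>

lemma kernel_integrable:
  fixes \<alpha> \<kappa> :: "(nat \<Rightarrow> real) \<Rightarrow> real"
  assumes "integrable (lebesgue_Rd d) \<alpha>" "integrable (lebesgue_Rd d) \<kappa>"
  shows "integrable (lebesgue_Rd d \<Otimes>\<^sub>M lebesgue_Rd d) (\<lambda>(x, y). \<alpha> x * \<kappa> (vsub d x y))" (is ?A)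
    and "(\<integral>(x, y). \<alpha> x * \<kappa> (vsub d x y) \<partial>(lebesgue_Rd d \<Otimes>\<^sub>M lebesgue_Rd d))
      = (\<integral>x. \<alpha> x \<partial>lebesgue_Rd d) * (\<integral>x. \<kappa> x \<partial>lebesgue_Rd d)" (is ?B)
proof -
  note [measurable] = borel_measurable_integrable[OF assms(1)] borel_measurable_integrable[OF assms(2)]
  have m: "(\<lambda>x. \<bar>\<kappa> x\<bar>) \<in> borel_measurable (lebesgue_Rd d)" by measurable
  show ?A
  proof (rule lRR.Fubini_integrable)
    show "(\<lambda>(x, y). \<alpha> x * \<kappa> (vsub d x y)) \<in> borel_measurable (lebesgue_Rd d \<Otimes>\<^sub>M lebesgue_Rd d)"
      by measurable
    show "integrable (lebesgue_Rd d) (\<lambda>x. \<integral>y. norm (case (x, y) of (x, y) \<Rightarrow> \<alpha> x * \<kappa> (vsub d x y)) \<partial>lebesgue_Rd d)"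
      using assms integral_vsub_left[OF m] by (simp add: abs_mult)
    show "AE x in lebesgue_Rd d. integrable (lebesgue_Rd d) (\<lambda>y. case (x, y) of (x, y) \<Rightarrow> \<alpha> x * \<kappa> (vsub d x y))"
      using integrable_vsub_left[OF assms(2)] by simp
  qed
  then have "(\<integral>(x, y). \<alpha> x * \<kappa> (vsub d x y) \<partial>(lebesgue_Rd d \<Otimes>\<^sub>M lebesgue_Rd d))
      = (\<integral>x. (\<integral>y. \<alpha> x * \<kappa> (vsub d x y) \<partial>lebesgue_Rd d) \<partial>lebesgue_Rd d)"
    by (subst lRR.integral_fst'[symmetric]) simp_all
  then show ?B using integral_vsub_left[of \<kappa> d] by simp
qed

text \<open>Exchanging x and y reduces this to \<open>kernel_integrable\<close> for the reflected
  kernel.\<close>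

lemma kernel_integrable':
  fixes \<beta> \<kappa> :: "(nat \<Rightarrow> real) \<Rightarrow> real"
  assumes "integrable (lebesgue_Rd d) \<beta>" "integrable (lebesgue_Rd d) \<kappa>"
  shows "integrable (lebesgue_Rd d \<Otimes>\<^sub>M lebesgue_Rd d) (\<lambda>(x, y). \<beta> y * \<kappa> (vsub d x y))" (is ?A)
    and "(\<integral>(x, y). \<beta> y * \<kappa> (vsub d x y) \<partial>(lebesgue_Rd d \<Otimes>\<^sub>M lebesgue_Rd d))
      = (\<integral>x. \<beta> x \<partial>lebesgue_Rd d) * (\<integral>x. \<kappa> x \<partial>lebesgue_Rd d)" (is ?B)
proof -
  define \<kappa>' where "\<kappa>' x = \<kappa> (vneg d x)" for x
  have vn: "vneg d x = vsub d (\<lambda>_. 0) x" for x by (simp add: vneg_def vsub_def)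
  note [measurable] = borel_measurable_integrable[OF assms(2)]
  have i: "integrable (lebesgue_Rd d) \<kappa>'"
    unfolding \<kappa>'_def[abs_def] vn by (rule integrable_vsub_left[OF assms(2)])
  have e: "(\<integral>x. \<kappa>' x \<partial>lebesgue_Rd d) = (\<integral>x. \<kappa> x \<partial>lebesgue_Rd d)"
    unfolding \<kappa>'_def[abs_def] vn by (rule integral_vsub_left) measurable
  have "vneg d (vsub d x y) = vsub d y x" for x y by (auto simp: vneg_def vsub_def)
  then have *: "\<kappa>' (vsub d x y) = \<kappa> (vsub d y x)" for x y by (simp add: \<kappa>'_def)
  show ?A using lRR.integrable_product_swap[OF kernel_integrable(1)[OF assms(1) i]]
    by (simp add: * split_def)
  have "(\<integral>(x, y). \<beta> y * \<kappa> (vsub d x y) \<partial>(lebesgue_Rd d \<Otimes>\<^sub>M lebesgue_Rd d))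
     = (\<integral>(x, y). \<beta> x * \<kappa>' (vsub d x y) \<partial>(lebesgue_Rd d \<Otimes>\<^sub>M lebesgue_Rd d))"
    using lRR.integral_product_swap[OF borel_measurable_integrable[OF kernel_integrable(1)[OF assms(1) i]]]
    by (simp add: * split_def)
  then show ?B using kernel_integrable(2)[OF assms(1) i] e by simp
qed

section \<open>Doubled integrals against a kernel\<close>

(* W x y stands for an expression in u x and v y, and the kernel for a mollifier or its image under the
   operators of the equation. The bound by \<alpha> x + \<beta> y, with both functions integrable, makes every
   double integral below absolutely convergent, since the kernel is integrable in each variable. *)

definition pairing :: "nat \<Rightarrow> ((nat \<Rightarrow> real) \<Rightarrow> (nat \<Rightarrow> real) \<Rightarrow> real) \<Rightarrow> ((nat \<Rightarrow> real) \<Rightarrow> real) \<Rightarrow> real" where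
  "pairing d W \<kappa> = (\<integral>(x, y). W x y * \<kappa> (vsub d x y) \<partial>(lebesgue_Rd d \<Otimes>\<^sub>M lebesgue_Rd d))"

definition dominated :: "nat \<Rightarrow> ((nat \<Rightarrow> real) \<Rightarrow> (nat \<Rightarrow> real) \<Rightarrow> real) \<Rightarrow>
    ((nat \<Rightarrow> real) \<Rightarrow> real) \<Rightarrow> ((nat \<Rightarrow> real) \<Rightarrow> real) \<Rightarrow> bool" where
  "dominated d W \<alpha> \<beta> \<longleftrightarrow> (\<lambda>(x, y). W x y) \<in> borel_measurable (lebesgue_Rd d \<Otimes>\<^sub>M lebesgue_Rd d) \<and>
     integrable (lebesgue_Rd d) \<alpha> \<and> integrable (lebesgue_Rd d) \<beta> \<and>
     (\<forall>x\<in>Rd d. \<forall>y\<in>Rd d. \<bar>W x y\<bar> \<le> \<alpha> x + \<beta> y)"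

lemma dominated_kernel_bound_integrable:
  assumes "dominated d W \<alpha> \<beta>" "integrable (lebesgue_Rd d) \<kappa>"
  shows "integrable (lebesgue_Rd d \<Otimes>\<^sub>M lebesgue_Rd d) (\<lambda>(x, y). (\<alpha> x + \<beta> y) * \<bar>\<kappa> (vsub d x y)\<bar>)"
    and "(\<integral>(x, y). (\<alpha> x + \<beta> y) * \<bar>\<kappa> (vsub d x y)\<bar> \<partial>(lebesgue_Rd d \<Otimes>\<^sub>M lebesgue_Rd d))
     = ((\<integral>x. \<alpha> x \<partial>lebesgue_Rd d) + (\<integral>x. \<beta> x \<partial>lebesgue_Rd d)) * (\<integral>x. \<bar>\<kappa> x\<bar> \<partial>lebesgue_Rd d)"
proof -
  have i: "integrable (lebesgue_Rd d) \<alpha>" "integrable (lebesgue_Rd d) \<beta>"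
     "integrable (lebesgue_Rd d) (\<lambda>x. \<bar>\<kappa> x\<bar>)"
    using assms by (auto simp: dominated_def)
  note k = kernel_integrable[OF i(1,3)] kernel_integrable'[OF i(2,3)]
  show "integrable (lebesgue_Rd d \<Otimes>\<^sub>M lebesgue_Rd d) (\<lambda>(x, y). (\<alpha> x + \<beta> y) * \<bar>\<kappa> (vsub d x y)\<bar>)"
    using Bochner_Integration.integrable_add[OF k(1,3)] by (simp add: split_def algebra_simps)
  show "(\<integral>(x, y). (\<alpha> x + \<beta> y) * \<bar>\<kappa> (vsub d x y)\<bar> \<partial>(lebesgue_Rd d \<Otimes>\<^sub>M lebesgue_Rd d))
     = ((\<integral>x. \<alpha> x \<partial>lebesgue_Rd d) + (\<integral>x. \<beta> x \<partial>lebesgue_Rd d)) * (\<integral>x. \<bar>\<kappa> x\<bar> \<partial>lebesgue_Rd d)"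
    using Bochner_Integration.integral_add[OF k(1,3)] k(2,4) by (simp add: split_def algebra_simps)
qed

lemma space_pair_Rd: "space (lebesgue_Rd d \<Otimes>\<^sub>M lebesgue_Rd d) = Rd d \<times> Rd d"
  by (simp add: space_pair_measure space_lebesgue_Rd)

lemma pairing_integrable:
  assumes "dominated d W \<alpha> \<beta>" "integrable (lebesgue_Rd d) \<kappa>"
  shows "integrable (lebesgue_Rd d \<Otimes>\<^sub>M lebesgue_Rd d) (\<lambda>(x, y). W x y * \<kappa> (vsub d x y))"
proof (rule Bochner_Integration.integrable_bound[OF dominated_kernel_bound_integrable(1)[OF assms]])
  note [measurable] = borel_measurable_integrable[OF assms(2)]
  have [measurable]: "(\<lambda>(x, y). W x y) \<in> borel_measurable (lebesgue_Rd d \<Otimes>\<^sub>M lebesgue_Rd d)"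
    using assms(1) by (simp add: dominated_def)
  show "(\<lambda>(x, y). W x y * \<kappa> (vsub d x y)) \<in> borel_measurable (lebesgue_Rd d \<Otimes>\<^sub>M lebesgue_Rd d)"
    by measurable
  show "AE p in lebesgue_Rd d \<Otimes>\<^sub>M lebesgue_Rd d. norm (case p of (x, y) \<Rightarrow> W x y * \<kappa> (vsub d x y))
      \<le> norm (case p of (x, y) \<Rightarrow> (\<alpha> x + \<beta> y) * \<bar>\<kappa> (vsub d x y)\<bar>)"
  proof (intro AE_I2)
    fix p assume "p \<in> space (lebesgue_Rd d \<Otimes>\<^sub>M lebesgue_Rd d)"
    then have "\<bar>W (fst p) (snd p)\<bar> \<le> \<alpha> (fst p) + \<beta> (snd p)"
      using assms(1) by (auto simp: dominated_def space_pair_Rd)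
    then show "norm (case p of (x, y) \<Rightarrow> W x y * \<kappa> (vsub d x y))
      \<le> norm (case p of (x, y) \<Rightarrow> (\<alpha> x + \<beta> y) * \<bar>\<kappa> (vsub d x y)\<bar>)"
      by (auto simp: split_def abs_mult intro!: mult_right_mono)
  qed
qed

lemma pairing_bound:
  assumes "dominated d W \<alpha> \<beta>" "integrable (lebesgue_Rd d) \<kappa>"
  shows "\<bar>pairing d W \<kappa>\<bar> \<le>
     ((\<integral>x. \<alpha> x \<partial>lebesgue_Rd d) + (\<integral>x. \<beta> x \<partial>lebesgue_Rd d)) * (\<integral>x. \<bar>\<kappa> x\<bar> \<partial>lebesgue_Rd d)"
proof -
  have "\<bar>pairing d W \<kappa>\<bar> \<le> (\<integral>p. \<bar>case p of (x, y) \<Rightarrow> W x y * \<kappa> (vsub d x y)\<bar> \<partial>(lebesgue_Rd d \<Otimes>\<^sub>M lebesgue_Rd d))"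
    unfolding pairing_def by (rule integral_abs_bound)
  also have "\<dots> \<le> (\<integral>(x, y). (\<alpha> x + \<beta> y) * \<bar>\<kappa> (vsub d x y)\<bar> \<partial>(lebesgue_Rd d \<Otimes>\<^sub>M lebesgue_Rd d))"
  proof (rule integral_mono)
    show "integrable (lebesgue_Rd d \<Otimes>\<^sub>M lebesgue_Rd d) (\<lambda>p. \<bar>case p of (x, y) \<Rightarrow> W x y * \<kappa> (vsub d x y)\<bar>)"
      using pairing_integrable[OF assms] by (rule integrable_abs)
    show "integrable (lebesgue_Rd d \<Otimes>\<^sub>M lebesgue_Rd d) (\<lambda>(x, y). (\<alpha> x + \<beta> y) * \<bar>\<kappa> (vsub d x y)\<bar>)"
      by (rule dominated_kernel_bound_integrable[OF assms])
    fix p assume "p \<in> space (lebesgue_Rd d \<Otimes>\<^sub>M lebesgue_Rd d)"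
    then have "\<bar>W (fst p) (snd p)\<bar> \<le> \<alpha> (fst p) + \<beta> (snd p)"
      using assms(1) by (auto simp: dominated_def space_pair_Rd)
    then show "\<bar>case p of (x, y) \<Rightarrow> W x y * \<kappa> (vsub d x y)\<bar> \<le> (case p of (x, y) \<Rightarrow> (\<alpha> x + \<beta> y) * \<bar>\<kappa> (vsub d x y)\<bar>)"
      by (auto simp: split_def abs_mult intro!: mult_right_mono)
  qed
  finally show ?thesis using dominated_kernel_bound_integrable(2)[OF assms] by simp
qed

lemma pairing_diff_left:
  assumes "dominated d W \<alpha> \<beta>" "dominated d W' \<alpha>' \<beta>'" "integrable (lebesgue_Rd d) \<kappa>"
  shows "pairing d W \<kappa> - pairing d W' \<kappa> = pairing d (\<lambda>x y. W x y - W' x y) \<kappa>"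
  unfolding pairing_def
  using Bochner_Integration.integral_diff[OF pairing_integrable[OF assms(1,3)] pairing_integrable[OF assms(2,3)]]
  by (simp add: split_def left_diff_distrib)

lemma pairing_diff_bound:
  assumes W: "dominated d W \<alpha> \<beta>" "dominated d W' \<alpha>' \<beta>'" and \<kappa>: "integrable (lebesgue_Rd d) \<kappa>"
    and "integrable (lebesgue_Rd d) a" "integrable (lebesgue_Rd d) b"
    and "\<And>x y. x \<in> Rd d \<Longrightarrow> y \<in> Rd d \<Longrightarrow> \<bar>W x y - W' x y\<bar> \<le> a x + b y"
  shows "\<bar>pairing d W \<kappa> - pairing d W' \<kappa>\<bar> \<le>
     ((\<integral>x. a x \<partial>lebesgue_Rd d) + (\<integral>x. b x \<partial>lebesgue_Rd d)) * (\<integral>x. \<bar>\<kappa> x\<bar> \<partial>lebesgue_Rd d)"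
  unfolding pairing_diff_left[OF assms(1-3)]
proof (rule pairing_bound[OF _ \<kappa>])
  have [measurable]: "(\<lambda>(x, y). W x y) \<in> borel_measurable (lebesgue_Rd d \<Otimes>\<^sub>M lebesgue_Rd d)"
    "(\<lambda>(x, y). W' x y) \<in> borel_measurable (lebesgue_Rd d \<Otimes>\<^sub>M lebesgue_Rd d)"
    using W by (simp_all add: dominated_def)
  show "dominated d (\<lambda>x y. W x y - W' x y) a b"
    unfolding dominated_def using assms(4-6) by auto
qed

lemma pairing_fst:
  assumes "dominated d W \<alpha> \<beta>" "integrable (lebesgue_Rd d) \<kappa>"
  shows "pairing d W \<kappa> = (\<integral>x. (\<integral>y. W x y * \<kappa> (vsub d x y) \<partial>lebesgue_Rd d) \<partial>lebesgue_Rd d)"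
  unfolding pairing_def using lRR.integral_fst'[OF pairing_integrable[OF assms]] by simp

lemma pairing_snd:
  assumes "dominated d W \<alpha> \<beta>" "integrable (lebesgue_Rd d) \<kappa>"
  shows "pairing d W \<kappa> = (\<integral>y. (\<integral>x. W x y * \<kappa> (vsub d x y) \<partial>lebesgue_Rd d) \<partial>lebesgue_Rd d)"
  unfolding pairing_def using lRR.integral_snd[OF pairing_integrable[OF assms]] by simp

lemma dominated_shift:
  assumes "dominated d W \<alpha> \<beta>"
  shows "dominated d (\<lambda>x y. W x (vsub d y h)) \<alpha> (\<lambda>y. \<beta> (vsub d y h))"
proof -
  have [measurable]: "(\<lambda>(x, y). W x y) \<in> borel_measurable (lebesgue_Rd d \<Otimes>\<^sub>M lebesgue_Rd d)"
    using assms by (simp add: dominated_def)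
  have [measurable]: "(\<lambda>y. vsub d y h) \<in> lebesgue_Rd d \<rightarrow>\<^sub>M lebesgue_Rd d"
    unfolding affine_forms(2) by (rule affine_measurable)
  have "(\<lambda>(x, y). W x (vsub d y h)) \<in> borel_measurable (lebesgue_Rd d \<Otimes>\<^sub>M lebesgue_Rd d)"
    by measurable
  moreover have "vsub d y h \<in> Rd d" for y by (auto simp: vsub_def Rd_def)
  ultimately show ?thesis using assms integrable_vsub_right by (auto simp: dominated_def)
qed

text \<open>For fixed x replace y by y - h. This is the mechanism that carries a jump from the
  kernel to the second function.\<close>

lemma pairing_shift:
  assumes "dominated d W \<alpha> \<beta>" "integrable (lebesgue_Rd d) \<kappa>"
  shows "pairing d W (\<lambda>\<xi>. \<kappa> (vsub d \<xi> h)) = pairing d (\<lambda>x y. W x (vsub d y h)) \<kappa>"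
proof -
  have *: "vsub d (vsub d x (vsub d y h)) h = vsub d x y" for x y by (auto simp: vsub_def)
  note [measurable] = borel_measurable_integrable[OF assms(2)]
  have [measurable]: "(\<lambda>(x, y). W x y) \<in> borel_measurable (lebesgue_Rd d \<Otimes>\<^sub>M lebesgue_Rd d)"
    using assms(1) by (simp add: dominated_def)
  have [measurable]: "(\<lambda>y. vsub d y h) \<in> lebesgue_Rd d \<rightarrow>\<^sub>M lebesgue_Rd d"
    unfolding affine_forms(2) by (rule affine_measurable)
  have "pairing d W (\<lambda>\<xi>. \<kappa> (vsub d \<xi> h))
    = (\<integral>x. (\<integral>y. W x y * \<kappa> (vsub d (vsub d x y) h) \<partial>lebesgue_Rd d) \<partial>lebesgue_Rd d)"
    by (rule pairing_fst[OF assms(1) integrable_vsub_right[OF assms(2)]])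
  also have "\<dots> = (\<integral>x. (\<integral>y. W x (vsub d y h) * \<kappa> (vsub d x y) \<partial>lebesgue_Rd d) \<partial>lebesgue_Rd d)"
  proof (rule Bochner_Integration.integral_cong[OF refl])
    fix x assume x: "x \<in> space (lebesgue_Rd d)"
    have "(\<lambda>y. W x y * \<kappa> (vsub d (vsub d x y) h)) \<in> borel_measurable (lebesgue_Rd d)"
      using x by measurable
    from integral_vsub_right[OF this, of h]
    show "(\<integral>y. W x y * \<kappa> (vsub d (vsub d x y) h) \<partial>lebesgue_Rd d)
       = (\<integral>y. W x (vsub d y h) * \<kappa> (vsub d x y) \<partial>lebesgue_Rd d)"
      by (simp add: *)
  qed
  also have "\<dots> = pairing d (\<lambda>x y. W x (vsub d y h)) \<kappa>"
    by (rule pairing_fst[OF dominated_shift[OF assms(1)] assms(2), symmetric])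
  finally show ?thesis .
qed

text \<open>The majorant is given for parameters within distance 1 of s0, so the increments are
  restricted to (-1,1). The mean value theorem bounds the difference quotients by b, and dominated
  convergence along sequences gives the limit.\<close>

lemma leibniz_rule_lebesgue:
  fixes F F' :: "real \<Rightarrow> 'a \<Rightarrow> real"
  assumes int: "\<And>s. integrable N (F s)" and [measurable]: "F' s0 \<in> borel_measurable N"
    and D: "\<And>s x. x \<in> space N \<Longrightarrow> ((\<lambda>s. F s x) has_real_derivative F' s x) (at s)"
    and b: "integrable N b" "\<And>s x. x \<in> space N \<Longrightarrow> \<bar>s - s0\<bar> < 1 \<Longrightarrow> \<bar>F' s x\<bar> \<le> b x"
  shows "((\<lambda>s. \<integral>x. F s x \<partial>N) has_real_derivative (\<integral>x. F' s0 x \<partial>N)) (at s0)"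
proof -
  have "((\<lambda>h. ((\<integral>x. F (s0 + h) x \<partial>N) - (\<integral>x. F s0 x \<partial>N)) / h) \<longlongrightarrow> (\<integral>x. F' s0 x \<partial>N))
     (at 0 within {-1<..<1})"
    unfolding tendsto_at_iff_sequentially comp_def
  proof (intro allI impI)
    fix X :: "nat \<Rightarrow> real" assume X: "\<forall>i. X i \<in> {-1<..<1} - {0}" "X \<longlonglongrightarrow> 0"
    have "(\<lambda>i. \<integral>x. (F (s0 + X i) x - F s0 x) / X i \<partial>N) \<longlonglongrightarrow> (\<integral>x. F' s0 x \<partial>N)"
    proof (rule integral_dominated_convergence[where w = b])
      show "(\<lambda>x. (F (s0 + X i) x - F s0 x) / X i) \<in> borel_measurable N" for i
        using int by measurable
      show "AE x in N. (\<lambda>i. (F (s0 + X i) x - F s0 x) / X i) \<longlonglongrightarrow> F' s0 x"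
      proof (intro AE_I2)
        fix x assume "x \<in> space N"
        from D[OF this, of s0] have "((\<lambda>h. (F (s0 + h) x - F s0 x) / h) \<longlongrightarrow> F' s0 x) (at 0)"
          by (simp add: DERIV_def)
        then show "(\<lambda>i. (F (s0 + X i) x - F s0 x) / X i) \<longlonglongrightarrow> F' s0 x"
          unfolding tendsto_at_iff_sequentially comp_def using X by auto
      qed
      show "AE x in N. norm ((F (s0 + X i) x - F s0 x) / X i) \<le> b x" for i
      proof (intro AE_I2)
        fix x assume x: "x \<in> space N"
        have "\<exists>c. \<bar>c - s0\<bar> < 1 \<and> F (s0 + X i) x - F s0 x = X i * F' c x"
        proof (cases "0 < X i")
          case True
          obtain c where "s0 < c" "c < s0 + X i" "F (s0 + X i) x - F s0 x = (s0 + X i - s0) * F' c x"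
            using MVT2[of s0 "s0 + X i" "\<lambda>s. F s x" "\<lambda>s. F' s x"] D[OF x] True by auto
          then show ?thesis using X(1)[rule_format, of i] by (intro exI[of _ c]) auto
        next
          case False
          then have "X i < 0" using X(1)[rule_format, of i] by auto
          then obtain c where "c < s0" "s0 + X i < c" "F s0 x - F (s0 + X i) x = (s0 - (s0 + X i)) * F' c x"
            using MVT2[of "s0 + X i" s0 "\<lambda>s. F s x" "\<lambda>s. F' s x"] D[OF x] by auto
          then show ?thesis using X(1)[rule_format, of i] by (intro exI[of _ c]) auto
        qed
        then obtain c where "\<bar>c - s0\<bar> < 1" "F (s0 + X i) x - F s0 x = X i * F' c x" by blast
        then show "norm ((F (s0 + X i) x - F s0 x) / X i) \<le> b x"
          using b(2)[OF x, of c] X(1)[rule_format, of i] by auto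
      qed
    qed (use b in auto)
    moreover have "(\<integral>x. (F (s0 + X i) x - F s0 x) / X i \<partial>N)
        = ((\<integral>x. F (s0 + X i) x \<partial>N) - (\<integral>x. F s0 x \<partial>N)) / X i" for i
      using Bochner_Integration.integral_diff[OF int int, of "s0 + X i" s0] by simp
    ultimately show "(\<lambda>i. ((\<integral>x. F (s0 + X i) x \<partial>N) - (\<integral>x. F s0 x \<partial>N)) / X i) \<longlonglongrightarrow> (\<integral>x. F' s0 x \<partial>N)"
      by (simp only:)
  qed
  moreover have "at 0 within {-1<..<1} = at (0::real)" by (rule at_within_open) auto
  ultimately show ?thesis by (simp add: DERIV_def)
qed

definition cube :: "nat \<Rightarrow> real \<Rightarrow> (nat \<Rightarrow> real) set" where
  "cube d R = Pi\<^sub>E {..<d} (\<lambda>_. {-R..R})"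

lemma cube_sets [measurable]: "cube d R \<in> sets (lebesgue_Rd d)"
  unfolding cube_def lebesgue_Rd_def by (intro sets_PiM_I_finite) auto

lemma emeasure_box:
  "emeasure (lebesgue_Rd d) (Pi\<^sub>E {..<d} (\<lambda>i. {a i..b i})) = ennreal (\<Prod>i<d. max 0 (b i - a i))"
proof -
  have "emeasure (lebesgue_Rd d) (Pi\<^sub>E {..<d} (\<lambda>i. {a i..b i})) = (\<Prod>i<d. emeasure lborel {a i..b i})"
    unfolding lebesgue_Rd_def by (rule lb.emeasure_PiM) auto
  also have "\<dots> = (\<Prod>i<d. ennreal (max 0 (b i - a i)))"
    by (intro prod.cong refl) (auto simp: emeasure_lborel_Icc_eq max_def ennreal_neg)
  also have "\<dots> = ennreal (\<Prod>i<d. max 0 (b i - a i))" by (rule prod_ennreal) auto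
  finally show ?thesis .
qed

lemma indicator_integrable:
  "A \<in> sets (lebesgue_Rd d) \<Longrightarrow> emeasure (lebesgue_Rd d) A < \<infinity> \<Longrightarrow>
   integrable (lebesgue_Rd d) (indicator A :: _ \<Rightarrow> real)"
  by (rule integrable_real_indicator) auto

lemma cube_integrable: "integrable (lebesgue_Rd d) (indicator (cube d R) :: _ \<Rightarrow> real)"
  by (rule indicator_integrable) (auto simp: cube_def[of d R] emeasure_box cube_sets[unfolded cube_def])

lemma prodf_cube_bound:
  assumes "Ccs d g"
  obtains C R where "0 \<le> C" "0 < R" "\<And>x. x \<in> Rd d \<Longrightarrow> \<bar>prodf d g x\<bar> \<le> C * indicator (cube d R) x"
proof -
  obtain C where C: "0 \<le> C" "\<And>x. \<bar>prodf d g x\<bar> \<le> C" using assms by (rule prodf_bounded) blast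
  obtain R where R: "0 < R" "\<And>x i. i < d \<Longrightarrow> R < \<bar>x i\<bar> \<Longrightarrow> prodf d g x = 0"
    using assms by (rule prodf_support) blast
  have "\<bar>prodf d g x\<bar> \<le> C * indicator (cube d R) x" if xR: "x \<in> Rd d" for x
  proof (cases "x \<in> cube d R")
    case False
    then obtain i where "i < d" "x i \<notin> {-R..R}"
      using xR unfolding cube_def Rd_def PiE_iff by blast
    then have "prodf d g x = 0" by (intro R(2)) auto
    then show ?thesis using C(1) by simp
  qed (use C in auto)
  then show thesis using that C R by blast
qed

lemma prodf_shift_integrable:
  assumes "Ccs d g" shows "integrable (lebesgue_Rd d) (\<lambda>\<xi>. prodf d g (\<lambda>i. \<xi> i + z i))"
proof -
  have "integrable (lebesgue_Rd d) (\<lambda>\<xi>. prodf d g (vadd d \<xi> z))"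
    by (rule integrable_vadd[OF prodf_integrable[OF assms]])
  then show ?thesis
    by (rule back_subst[of "integrable (lebesgue_Rd d)"]) (auto intro!: prodf_cong simp: vadd_def)
qed

lemma pairing_prodf_DERIV:
  assumes W: "dominated d W \<alpha> \<beta>" and g: "Ccs d g"
  shows "((\<lambda>s. pairing d W (\<lambda>\<xi>. prodf d g (\<lambda>i. \<xi> i + s * z i))) has_real_derivative
     (\<Sum>i<d. z i * pairing d W (\<lambda>\<xi>. dprodf d g i (\<lambda>i. \<xi> i + s0 * z i)))) (at s0)"
proof -
  have sm: "\<And>i. i < d \<Longrightarrow> smooth1 (g i)" using g CcD by (auto simp: Ccs_def)
  have pint: "integrable (lebesgue_Rd d) (\<lambda>\<xi>. dprodf d g i (\<lambda>i. \<xi> i + s0 * z i))" for i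
    unfolding dprodf_def by (rule prodf_shift_integrable[OF Ccs_deriv[OF g]])
  have "\<forall>i. \<exists>p. 0 \<le> fst p \<and> 0 < snd p \<and> (\<forall>x\<in>Rd d. \<bar>dprodf d g i x\<bar> \<le> fst p * indicator (cube d (snd p)) x)"
  proof
    fix i
    obtain C R where "0 \<le> C" "0 < R" "\<And>x. x \<in> Rd d \<Longrightarrow> \<bar>dprodf d g i x\<bar> \<le> C * indicator (cube d R) x"
      unfolding dprodf_def using Ccs_deriv[OF g] by (rule prodf_cube_bound) blast
    then show "\<exists>p. 0 \<le> fst p \<and> 0 < snd p \<and> (\<forall>x\<in>Rd d. \<bar>dprodf d g i x\<bar> \<le> fst p * indicator (cube d (snd p)) x)"
      by (intro exI[of _ "(C, R)"]) auto
  qed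
  from choice[OF this] obtain p where
    p: "\<And>i. 0 \<le> fst (p i)" "\<And>i x. x \<in> Rd d \<Longrightarrow> \<bar>dprodf d g i x\<bar> \<le> fst (p i) * indicator (cube d (snd (p i))) x"
    by blast
  define Z where "Z = (\<Sum>i<d. \<bar>z i\<bar>)"
  have Z: "\<bar>z i\<bar> \<le> Z" if "i < d" for i unfolding Z_def using that by (intro member_le_sum) auto
  \<comment> \<open>For |s - s0| < 1 the shift s z moves each coordinate by at most (|s0| + 1) Z.
    Enlarging the supporting cubes by this amount makes one integrable majorant serve all these
    s.\<close>
  define \<kappa> where "\<kappa> \<xi> = (\<Sum>i<d. \<bar>z i\<bar> * (fst (p i) * indicator (cube d (snd (p i) + (\<bar>s0\<bar> + 1) * Z)) \<xi>))" for \<xi>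
  have \<kappa>i: "integrable (lebesgue_Rd d) \<kappa>"
    unfolding \<kappa>_def by (intro Bochner_Integration.integrable_sum integrable_mult_right cube_integrable)
  have \<kappa>0: "0 \<le> \<kappa> \<xi>" for \<xi>
    unfolding \<kappa>_def by (intro sum_nonneg mult_nonneg_nonneg) (auto simp: p indicator_def)
  have \<kappa>b: "\<bar>\<Sum>i<d. z i * dprodf d g i (\<lambda>i. \<xi> i + s * z i)\<bar> \<le> \<kappa> \<xi>" if \<xi>: "\<xi> \<in> Rd d" and s: "\<bar>s - s0\<bar> < 1" for \<xi> s
    unfolding \<kappa>_def
  proof (rule order_trans[OF sum_abs], rule sum_mono)
    fix i assume "i \<in> {..<d}"
    define \<xi>' where "\<xi>' = (\<lambda>i\<in>{..<d}. \<xi> i + s * z i)"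
    have \<xi>': "\<xi>' \<in> Rd d" by (auto simp: \<xi>'_def Rd_def)
    have "dprodf d g i (\<lambda>i. \<xi> i + s * z i) = dprodf d g i \<xi>'"
      unfolding dprodf_def by (rule prodf_cong) (auto simp: \<xi>'_def)
    then have "\<bar>dprodf d g i (\<lambda>i. \<xi> i + s * z i)\<bar> \<le> fst (p i) * indicator (cube d (snd (p i))) \<xi>'"
      using p(2)[OF \<xi>', of i] by simp
    also have "\<dots> \<le> fst (p i) * indicator (cube d (snd (p i) + (\<bar>s0\<bar> + 1) * Z)) \<xi>"
    proof -
      have "\<xi> \<in> cube d (snd (p i) + (\<bar>s0\<bar> + 1) * Z)" if c: "\<xi>' \<in> cube d (snd (p i))"
      proof -
        have "\<bar>\<xi> j\<bar> \<le> snd (p i) + (\<bar>s0\<bar> + 1) * Z" if j: "j < d" for j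
        proof -
          have "\<bar>\<xi>' j\<bar> \<le> snd (p i)" using c j by (auto simp: cube_def PiE_def Pi_def abs_le_iff)
          moreover have "\<xi> j = \<xi>' j - s * z j" using j by (simp add: \<xi>'_def)
          moreover have "\<bar>s * z j\<bar> \<le> (\<bar>s0\<bar> + 1) * Z"
            unfolding abs_mult using s Z[OF j] by (intro mult_mono) auto
          ultimately show ?thesis by linarith
        qed
        then have "\<xi> j \<in> {- (snd (p i) + (\<bar>s0\<bar> + 1) * Z)..snd (p i) + (\<bar>s0\<bar> + 1) * Z}" if "j < d" for j
          using that[THEN \<open>\<And>j. j < d \<Longrightarrow> \<bar>\<xi> j\<bar> \<le> snd (p i) + (\<bar>s0\<bar> + 1) * Z\<close>]
          by (simp only: atLeastAtMost_iff) linarith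
        then show ?thesis using \<xi> unfolding cube_def Rd_def PiE_def Pi_def by blast
      qed
      then show ?thesis using p(1) by (auto simp: indicator_def)
    qed
    finally show "\<bar>z i * dprodf d g i (\<lambda>i. \<xi> i + s * z i)\<bar>
      \<le> \<bar>z i\<bar> * (fst (p i) * indicator (cube d (snd (p i) + (\<bar>s0\<bar> + 1) * Z)) \<xi>)"
      unfolding abs_mult by (intro mult_left_mono) auto
  qed
  define F where "F s = (\<lambda>(x, y). W x y * prodf d g (\<lambda>i. vsub d x y i + s * z i))" for s
  define F' where "F' s = (\<lambda>(x, y). W x y * (\<Sum>i<d. z i * dprodf d g i (\<lambda>i. vsub d x y i + s * z i)))" for s
  have F'int: "integrable (lebesgue_Rd d \<Otimes>\<^sub>M lebesgue_Rd d) (F' s0)"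
    unfolding F'_def by (rule pairing_integrable[OF W])
      (intro Bochner_Integration.integrable_sum integrable_mult_right pint)
  have "((\<lambda>s. \<integral>p. F s p \<partial>(lebesgue_Rd d \<Otimes>\<^sub>M lebesgue_Rd d)) has_real_derivative
     (\<integral>p. F' s0 p \<partial>(lebesgue_Rd d \<Otimes>\<^sub>M lebesgue_Rd d))) (at s0)"
  proof (rule leibniz_rule_lebesgue)
    show "integrable (lebesgue_Rd d \<Otimes>\<^sub>M lebesgue_Rd d) (F s)" for s
      unfolding F_def by (rule pairing_integrable[OF W prodf_shift_integrable[OF g]])
    show "F' s0 \<in> borel_measurable (lebesgue_Rd d \<Otimes>\<^sub>M lebesgue_Rd d)" using F'int by auto
    show "((\<lambda>s. F s p) has_real_derivative F' s p) (at s)" for s p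
      unfolding F_def F'_def split_def by (intro DERIV_cmult prodf_line_DERIV sm)
    show "integrable (lebesgue_Rd d \<Otimes>\<^sub>M lebesgue_Rd d) (\<lambda>(x, y). (\<alpha> x + \<beta> y) * \<bar>\<kappa> (vsub d x y)\<bar>)"
      by (rule dominated_kernel_bound_integrable[OF W \<kappa>i])
    fix s p assume pS: "p \<in> space (lebesgue_Rd d \<Otimes>\<^sub>M lebesgue_Rd d)" and s: "\<bar>s - s0\<bar> < 1"
    have "\<bar>W (fst p) (snd p)\<bar> \<le> \<alpha> (fst p) + \<beta> (snd p)"
      using pS W by (auto simp: dominated_def space_pair_Rd)
    moreover have "vsub d (fst p) (snd p) \<in> Rd d" by (auto simp: vsub_def Rd_def)
    ultimately show "\<bar>F' s p\<bar> \<le> (case p of (x, y) \<Rightarrow> (\<alpha> x + \<beta> y) * \<bar>\<kappa> (vsub d x y)\<bar>)"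
      using \<kappa>b[OF _ s] \<kappa>0 unfolding F'_def split_def abs_mult by (intro mult_mono) auto
  qed
  moreover have "(\<integral>p. F s p \<partial>(lebesgue_Rd d \<Otimes>\<^sub>M lebesgue_Rd d)) = pairing d W (\<lambda>\<xi>. prodf d g (\<lambda>i. \<xi> i + s * z i))" for s
    by (simp add: F_def pairing_def)
  moreover have "(\<integral>p. F' s0 p \<partial>(lebesgue_Rd d \<Otimes>\<^sub>M lebesgue_Rd d))
     = (\<Sum>i<d. z i * pairing d W (\<lambda>\<xi>. dprodf d g i (\<lambda>i. \<xi> i + s0 * z i)))"
  proof -
    have "(\<integral>p. F' s0 p \<partial>(lebesgue_Rd d \<Otimes>\<^sub>M lebesgue_Rd d))
      = (\<integral>p. (\<Sum>i<d. z i * (case p of (x, y) \<Rightarrow> W x y * dprodf d g i (\<lambda>i. vsub d x y i + s0 * z i))) \<partial>(lebesgue_Rd d \<Otimes>\<^sub>M lebesgue_Rd d))"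
      unfolding F'_def split_def by (simp add: sum_distrib_left mult.left_commute)
    also have "\<dots> = (\<Sum>i<d. z i * pairing d W (\<lambda>\<xi>. dprodf d g i (\<lambda>i. \<xi> i + s0 * z i)))"
      unfolding pairing_def
      by (subst Bochner_Integration.integral_sum)
        (auto intro!: integrable_mult_right pairing_integrable[OF W pint, unfolded split_def] simp: split_def)
    finally show ?thesis .
  qed
  ultimately show ?thesis by simp
qed

section \<open>Mollification and translates in L1\<close>

text \<open>Continuity of translations in L1 at h = 0. The shift is measured coordinatewise because
  the mollifiers are supported in cubes.\<close>

definition translation_continuous :: "nat \<Rightarrow> ((nat \<Rightarrow> real) \<Rightarrow> real) \<Rightarrow> bool" where
  "translation_continuous d g \<longleftrightarrow> (\<forall>e>0. \<exists>\<rho>>0. \<forall>h. (\<forall>i<d. \<bar>h i\<bar> \<le> \<rho>) \<longrightarrow>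
     (\<integral>x. \<bar>g (vadd d x h) - g x\<bar> \<partial>lebesgue_Rd d) \<le> e)"

lemma vadd_Rd [simp]: "vadd d x h \<in> Rd d" by (auto simp: vadd_def Rd_def)
lemma vsub_Rd [simp]: "vsub d x h \<in> Rd d" by (auto simp: vsub_def Rd_def)
lemma vneg_Rd [simp]: "vneg d h \<in> Rd d" by (auto simp: vneg_def Rd_def)

lemma translation_continuous_add:
  assumes f: "integrable (lebesgue_Rd d) f" "translation_continuous d f"
    and g: "integrable (lebesgue_Rd d) g" "translation_continuous d g"
  shows "translation_continuous d (\<lambda>x. f x + g x)"
  unfolding translation_continuous_def
proof (intro allI impI)
  fix e :: real assume "0 < e"
  then have e2: "0 < e / 2" by simp
  obtain r1 where r1: "r1 > 0" "\<And>h. (\<forall>i<d. \<bar>h i\<bar> \<le> r1) \<Longrightarrow> (\<integral>x. \<bar>f (vadd d x h) - f x\<bar> \<partial>lebesgue_Rd d) \<le> e / 2"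
    using f(2) e2 unfolding translation_continuous_def by blast
  obtain r2 where r2: "r2 > 0" "\<And>h. (\<forall>i<d. \<bar>h i\<bar> \<le> r2) \<Longrightarrow> (\<integral>x. \<bar>g (vadd d x h) - g x\<bar> \<partial>lebesgue_Rd d) \<le> e / 2"
    using g(2) e2 unfolding translation_continuous_def by blast
  show "\<exists>\<rho>>0. \<forall>h. (\<forall>i<d. \<bar>h i\<bar> \<le> \<rho>) \<longrightarrow>
     (\<integral>x. \<bar>(f (vadd d x h) + g (vadd d x h)) - (f x + g x)\<bar> \<partial>lebesgue_Rd d) \<le> e"
  proof (intro exI[of _ "min r1 r2"] conjI allI impI)
    fix h assume h: "\<forall>i<d. \<bar>h i\<bar> \<le> min r1 r2"
    have i: "integrable (lebesgue_Rd d) (\<lambda>x. \<bar>f (vadd d x h) - f x\<bar>)"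
      "integrable (lebesgue_Rd d) (\<lambda>x. \<bar>g (vadd d x h) - g x\<bar>)"
      using integrable_vadd f(1) g(1) by (auto intro!: integrable_abs Bochner_Integration.integrable_diff)
    have "(\<integral>x. \<bar>(f (vadd d x h) + g (vadd d x h)) - (f x + g x)\<bar> \<partial>lebesgue_Rd d)
      \<le> (\<integral>x. \<bar>f (vadd d x h) - f x\<bar> + \<bar>g (vadd d x h) - g x\<bar> \<partial>lebesgue_Rd d)"
      using integrable_vadd f(1) g(1) i
      by (intro integral_mono) (auto intro!: integrable_abs Bochner_Integration.integrable_diff Bochner_Integration.integrable_add)
    also have "\<dots> \<le> e / 2 + e / 2"
      using r1(2)[of h] r2(2)[of h] h i by (subst Bochner_Integration.integral_add) auto
    finally show "(\<integral>x. \<bar>(f (vadd d x h) + g (vadd d x h)) - (f x + g x)\<bar> \<partial>lebesgue_Rd d) \<le> e" by simp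
  qed (use r1 r2 in auto)
qed

lemma translation_continuous_cmult:
  assumes "translation_continuous d f"
  shows "translation_continuous d (\<lambda>x. c * f x)"
  unfolding translation_continuous_def
proof (intro allI impI)
  fix e :: real assume "0 < e"
  then have "0 < e / (\<bar>c\<bar> + 1)" by (simp add: add_nonneg_pos)
  then obtain r where r: "r > 0"
    "\<And>h. (\<forall>i<d. \<bar>h i\<bar> \<le> r) \<Longrightarrow> (\<integral>x. \<bar>f (vadd d x h) - f x\<bar> \<partial>lebesgue_Rd d) \<le> e / (\<bar>c\<bar> + 1)"
    using assms unfolding translation_continuous_def by blast
  show "\<exists>\<rho>>0. \<forall>h. (\<forall>i<d. \<bar>h i\<bar> \<le> \<rho>) \<longrightarrow>
     (\<integral>x. \<bar>c * f (vadd d x h) - c * f x\<bar> \<partial>lebesgue_Rd d) \<le> e"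
  proof (intro exI[of _ r] conjI allI impI r(1))
    fix h assume h: "\<forall>i<d. \<bar>h i\<bar> \<le> r"
    have "(\<integral>x. \<bar>c * f (vadd d x h) - c * f x\<bar> \<partial>lebesgue_Rd d) = \<bar>c\<bar> * (\<integral>x. \<bar>f (vadd d x h) - f x\<bar> \<partial>lebesgue_Rd d)"
      by (simp add: abs_mult flip: right_diff_distrib)
    also have "\<dots> \<le> (\<bar>c\<bar> + 1) * (e / (\<bar>c\<bar> + 1))"
      using r(2)[OF h] \<open>0 < e\<close> by (intro mult_mono) auto
    also have "\<dots> = e" by (simp add: add_nonneg_eq_0_iff)
    finally show "(\<integral>x. \<bar>c * f (vadd d x h) - c * f x\<bar> \<partial>lebesgue_Rd d) \<le> e" .
  qed
qed

text \<open>The class is closed in L1. By translation invariance the approximation error D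
  contributes the same integral before and after the shift, and the translates of g' supply the
  remaining third of e.\<close>

lemma translation_continuous_approx:
  assumes g: "integrable (lebesgue_Rd d) g"
    and "\<And>e. e > 0 \<Longrightarrow> \<exists>g'. integrable (lebesgue_Rd d) g' \<and> translation_continuous d g' \<and>
       (\<integral>x. \<bar>g' x - g x\<bar> \<partial>lebesgue_Rd d) \<le> e"
  shows "translation_continuous d g"
  unfolding translation_continuous_def
proof (intro allI impI)
  fix e :: real assume "0 < e"
  then have e3: "0 < e / 3" by simp
  obtain g' where g': "integrable (lebesgue_Rd d) g'" "translation_continuous d g'"
    "(\<integral>x. \<bar>g' x - g x\<bar> \<partial>lebesgue_Rd d) \<le> e / 3"
    using assms(2)[OF e3] by blast
  obtain r where r: "r > 0" "\<And>h. (\<forall>i<d. \<bar>h i\<bar> \<le> r) \<Longrightarrow> (\<integral>x. \<bar>g' (vadd d x h) - g' x\<bar> \<partial>lebesgue_Rd d) \<le> e / 3"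
    using g'(2) e3 unfolding translation_continuous_def by blast
  show "\<exists>\<rho>>0. \<forall>h. (\<forall>i<d. \<bar>h i\<bar> \<le> \<rho>) \<longrightarrow> (\<integral>x. \<bar>g (vadd d x h) - g x\<bar> \<partial>lebesgue_Rd d) \<le> e"
  proof (intro exI[of _ r] conjI allI impI r(1))
    fix h assume h: "\<forall>i<d. \<bar>h i\<bar> \<le> r"
    define D where "D x = \<bar>g' x - g x\<bar>" for x
    have D: "integrable (lebesgue_Rd d) D"
      unfolding D_def using g g'(1) by (intro integrable_abs Bochner_Integration.integrable_diff)
    have iv: "integrable (lebesgue_Rd d) (\<lambda>x. D (vadd d x h))" by (rule integrable_vadd[OF D])
    have im: "integrable (lebesgue_Rd d) (\<lambda>x. \<bar>g' (vadd d x h) - g' x\<bar>)"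
      using integrable_vadd[OF g'(1)] g'(1) by (intro integrable_abs Bochner_Integration.integrable_diff)
    have "(\<integral>x. \<bar>g (vadd d x h) - g x\<bar> \<partial>lebesgue_Rd d)
      \<le> (\<integral>x. D (vadd d x h) + \<bar>g' (vadd d x h) - g' x\<bar> + D x \<partial>lebesgue_Rd d)"
      by (intro integral_mono integrable_abs Bochner_Integration.integrable_diff
          Bochner_Integration.integrable_add integrable_vadd[OF g] g iv im D)
        (auto simp: D_def)
    also have "\<dots> = (\<integral>x. D x \<partial>lebesgue_Rd d) + (\<integral>x. \<bar>g' (vadd d x h) - g' x\<bar> \<partial>lebesgue_Rd d) + (\<integral>x. D x \<partial>lebesgue_Rd d)"
      using iv im D integral_vadd[of D d h] by simp
    also have "\<dots> \<le> e / 3 + e / 3 + e / 3"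
      using g'(3) r(2)[OF h] unfolding D_def by (intro add_mono)
    finally show "(\<integral>x. \<bar>g (vadd d x h) - g x\<bar> \<partial>lebesgue_Rd d) \<le> e" by simp
  qed
qed

lemma translation_continuous_limit:
  assumes g: "integrable (lebesgue_Rd d) g" and w: "integrable (lebesgue_Rd d) w"
    and s: "\<And>n::nat. integrable (lebesgue_Rd d) (s n)" "\<And>n. translation_continuous d (s n)"
    and lim: "\<And>x. x \<in> Rd d \<Longrightarrow> (\<lambda>n. s n x) \<longlonglongrightarrow> g x"
    and bound: "\<And>n x. x \<in> Rd d \<Longrightarrow> \<bar>s n x\<bar> \<le> w x"
  shows "translation_continuous d g"
proof (rule translation_continuous_approx[OF g])
  fix e :: real assume e: "0 < e"
  have "(\<lambda>n. \<integral>x. \<bar>s n x - g x\<bar> \<partial>lebesgue_Rd d) \<longlonglongrightarrow> (\<integral>x. 0 \<partial>lebesgue_Rd d)"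
  proof (rule integral_dominated_convergence[where w = "\<lambda>x. w x + \<bar>g x\<bar>"])
    show "(\<lambda>x. \<bar>s n x - g x\<bar>) \<in> borel_measurable (lebesgue_Rd d)" for n
      using s(1)[of n] g by (intro borel_measurable_abs borel_measurable_diff) auto
    show "AE x in lebesgue_Rd d. (\<lambda>n. \<bar>s n x - g x\<bar>) \<longlonglongrightarrow> 0"
    proof (intro AE_I2)
      fix x assume "x \<in> space (lebesgue_Rd d)"
      then have "(\<lambda>n. s n x) \<longlonglongrightarrow> g x" using lim by (simp add: space_lebesgue_Rd)
      then show "(\<lambda>n. \<bar>s n x - g x\<bar>) \<longlonglongrightarrow> 0" by (simp add: LIM_zero tendsto_rabs_zero)
    qed
    show "AE x in lebesgue_Rd d. norm \<bar>s n x - g x\<bar> \<le> w x + \<bar>g x\<bar>" for n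
    proof (intro AE_I2)
      fix x assume "x \<in> space (lebesgue_Rd d)"
      then have "\<bar>s n x\<bar> \<le> w x" using bound by (simp add: space_lebesgue_Rd)
      then show "norm \<bar>s n x - g x\<bar> \<le> w x + \<bar>g x\<bar>" by simp
    qed
    show "integrable (lebesgue_Rd d) (\<lambda>x. w x + \<bar>g x\<bar>)" using w g by auto
  qed simp
  then have "(\<lambda>n. \<integral>x. \<bar>s n x - g x\<bar> \<partial>lebesgue_Rd d) \<longlonglongrightarrow> 0" by simp
  from order_tendstoD(2)[OF this e]
  obtain n where "(\<integral>x. \<bar>s n x - g x\<bar> \<partial>lebesgue_Rd d) < e" by (auto simp: eventually_sequentially)
  then show "\<exists>g'. integrable (lebesgue_Rd d) g' \<and> translation_continuous d g' \<and>
       (\<integral>x. \<bar>g' x - g x\<bar> \<partial>lebesgue_Rd d) \<le> e"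
    using s by (intro exI[of _ "s n"]) auto
qed

definition rbox :: "nat \<Rightarrow> (nat \<Rightarrow> real) \<Rightarrow> (nat \<Rightarrow> real) \<Rightarrow> (nat \<Rightarrow> real) set" where
  "rbox d a b = Pi\<^sub>E {..<d} (\<lambda>i. {a i..b i})"

lemma rbox_sets [measurable]: "rbox d a b \<in> sets (lebesgue_Rd d)"
  unfolding rbox_def lebesgue_Rd_def by (intro sets_PiM_I_finite) auto

lemma rbox_integrable: "integrable (lebesgue_Rd d) (indicator (rbox d a b) :: _ \<Rightarrow> real)"
  by (rule indicator_integrable) (auto simp: rbox_def[of d] emeasure_box rbox_sets[unfolded rbox_def])

lemma rbox_integral: "(\<integral>x. indicator (rbox d a b) x \<partial>lebesgue_Rd d) = (\<Prod>i<d. max 0 (b i - a i))"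
proof -
  have "rbox d a b \<inter> space (lebesgue_Rd d) = rbox d a b"
    using sets.sets_into_space[OF rbox_sets] by blast
  then show ?thesis by (simp add: measure_def rbox_def emeasure_box prod_nonneg)
qed

text \<open>If every |h i| is at most \<rho>, the box and its translate differ only inside the box
  enlarged by \<rho> on all sides minus the box shrunk by \<rho>.\<close>

lemma translation_continuous_rbox: "translation_continuous d (indicator (rbox d a b))"
  unfolding translation_continuous_def
proof (intro allI impI)
  fix e :: real assume e: "0 < e"
  \<comment> \<open>Volume of the enlarged box minus volume of the shrunken one;
    \<open>max 0\<close> covers boxes that have become empty. It is continuous in \<rho> and
    vanishes at 0.\<close>
  define m where "m \<rho> = (\<Prod>i<d. max 0 (b i - a i + 2 * \<rho>)) - (\<Prod>i<d. max 0 (b i - a i - 2 * \<rho>))" for \<rho>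
  have "isCont m 0" unfolding m_def by (intro continuous_intros)
  moreover have "m 0 = 0" by (simp add: m_def)
  ultimately have "m \<midarrow>0\<rightarrow> 0" by (simp add: isCont_def)
  from LIM_D[OF this e] obtain r where r: "r > 0" "\<And>\<rho>. \<rho> \<noteq> 0 \<Longrightarrow> \<bar>\<rho>\<bar> < r \<Longrightarrow> \<bar>m \<rho>\<bar> < e" by auto
  define \<rho> where "\<rho> = r / 2"
  have \<rho>: "\<rho> > 0" "m \<rho> \<le> e" using r(1) r(2)[of \<rho>] by (auto simp: \<rho>_def)
  define P where "P = rbox d (\<lambda>i. a i - \<rho>) (\<lambda>i. b i + \<rho>)"
  define N where "N = rbox d (\<lambda>i. a i + \<rho>) (\<lambda>i. b i - \<rho>)"
  show "\<exists>\<rho>>0. \<forall>h. (\<forall>i<d. \<bar>h i\<bar> \<le> \<rho>) \<longrightarrow>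
     (\<integral>x. \<bar>indicator (rbox d a b) (vadd d x h) - indicator (rbox d a b) x\<bar> \<partial>lebesgue_Rd d) \<le> e"
  proof (intro exI[of _ \<rho>] conjI allI impI \<rho>(1))
    fix h assume h: "\<forall>i<d. \<bar>h i\<bar> \<le> \<rho>"
    have pt: "\<bar>indicator (rbox d a b) (vadd d x h) - indicator (rbox d a b) x\<bar>
      \<le> (indicator P x - indicator N x :: real)" if x: "x \<in> Rd d" for x
    proof -
      have hi: "- \<rho> \<le> h i \<and> h i \<le> \<rho>" if "i < d" for i using h that by (auto simp: abs_le_iff)
      have mem: "y \<in> rbox d p q \<longleftrightarrow> (\<forall>i<d. p i \<le> y i \<and> y i \<le> q i)" if "y \<in> Rd d" for y p q
        using that by (auto simp: rbox_def Rd_def PiE_iff)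
      have v: "vadd d x h i = x i + h i" if "i < d" for i using that by (simp add: vadd_def)
      have A: "x \<in> N \<Longrightarrow> vadd d x h \<in> rbox d a b" "x \<in> N \<Longrightarrow> x \<in> rbox d a b"
         "vadd d x h \<in> rbox d a b \<Longrightarrow> x \<in> P" "x \<in> rbox d a b \<Longrightarrow> x \<in> P"
      proof -
        have *: "a i + \<rho> \<le> x i \<and> x i \<le> b i - \<rho> \<Longrightarrow> a i \<le> x i + h i \<and> x i + h i \<le> b i"
          "a i + \<rho> \<le> x i \<and> x i \<le> b i - \<rho> \<Longrightarrow> a i \<le> x i \<and> x i \<le> b i"
          "a i \<le> x i + h i \<and> x i + h i \<le> b i \<Longrightarrow> a i - \<rho> \<le> x i \<and> x i \<le> b i + \<rho>"
          "a i \<le> x i \<and> x i \<le> b i \<Longrightarrow> a i - \<rho> \<le> x i \<and> x i \<le> b i + \<rho>" if "i < d" for i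
          using hi[OF that] \<rho>(1) by linarith+
        show "x \<in> N \<Longrightarrow> vadd d x h \<in> rbox d a b" "x \<in> N \<Longrightarrow> x \<in> rbox d a b"
         "vadd d x h \<in> rbox d a b \<Longrightarrow> x \<in> P" "x \<in> rbox d a b \<Longrightarrow> x \<in> P"
          unfolding N_def P_def mem[OF x] mem[OF vadd_Rd] using * by (simp_all add: v)
      qed
      then show ?thesis by (auto simp: indicator_def)
    qed
    have i: "integrable (lebesgue_Rd d) (\<lambda>x. indicator P x - indicator N x :: real)"
      unfolding P_def N_def by (intro Bochner_Integration.integrable_diff rbox_integrable)
    have "(\<integral>x. \<bar>indicator (rbox d a b) (vadd d x h) - indicator (rbox d a b) x :: real\<bar> \<partial>lebesgue_Rd d)
      \<le> (\<integral>x. indicator P x - indicator N x \<partial>lebesgue_Rd d)"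
      by (intro integral_mono i integrable_abs Bochner_Integration.integrable_diff rbox_integrable
          integrable_vadd[OF rbox_integrable]) (auto simp: space_lebesgue_Rd pt)
    also have "\<dots> = m \<rho>"
      unfolding P_def N_def m_def
      by (subst Bochner_Integration.integral_diff)
        (auto simp only: rbox_integrable rbox_integral intro!: arg_cong2[where f = minus] prod.cong)
    finally show "(\<integral>x. \<bar>indicator (rbox d a b) (vadd d x h) - indicator (rbox d a b) x\<bar> \<partial>lebesgue_Rd d) \<le> e"
      using \<rho>(2) by simp
  qed
qed

text \<open>A generator of the product sigma-algebra that is stable under intersection, as Dynkin's
  theorem requires. Empty boxes belong to it through intervals with reversed end points.\<close>

lemma sets_lebesgue_Rd_boxes:
  "sets (lebesgue_Rd d) = sigma_sets (Rd d) {Pi\<^sub>E {..<d} F | F. \<forall>i\<in>{..<d}. F i \<in> range (\<lambda>(a, b). {a..b::real})}"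
proof -
  let ?E = "range (\<lambda>(a, b). {a..b::real})"
  have cover: "\<exists>S\<subseteq>?E. countable S \<and> UNIV = \<Union>S"
  proof (intro exI[of _ "range (\<lambda>n. {- real n..real n})"] conjI)
    show "UNIV = \<Union> (range (\<lambda>n. {- real n..real n}))"
    proof -
      have "\<exists>n. x \<in> {- real n..real n}" for x :: real
      proof -
        obtain n where "\<bar>x\<bar> \<le> real n" using real_arch_simple by blast
        then show ?thesis by (auto simp: abs_le_iff intro!: exI[of _ n])
      qed
      then show ?thesis by blast
    qed
  qed auto
  have "sets (lebesgue_Rd d) = sets (Pi\<^sub>M {..<d} (\<lambda>_. sigma UNIV ?E))"
    unfolding lebesgue_Rd_def by (intro sets_PiM_cong refl) (simp add: borel_eq_atLeastAtMost)
  also have "\<dots> = sets (sigma (Pi\<^sub>E {..<d} (\<lambda>_. UNIV))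
      {{f\<in>(\<Pi>\<^sub>E i\<in>{..<d}. UNIV). \<forall>i\<in>j. f i \<in> A i} | A j. j \<in> {{..<d}} \<and> A \<in> Pi j (\<lambda>_. ?E)})"
    using cover by (intro sets_PiM_sigma) auto
  also have "{{f\<in>(\<Pi>\<^sub>E i\<in>{..<d}. UNIV). \<forall>i\<in>j. f i \<in> A i} | A j. j \<in> {{..<d}} \<and> A \<in> Pi j (\<lambda>_. ?E)}
     = {Pi\<^sub>E {..<d} F | F. \<forall>i\<in>{..<d}. F i \<in> ?E}"
  proof -
    have "{f\<in>(\<Pi>\<^sub>E i\<in>{..<d}. UNIV). \<forall>i\<in>{..<d}. f i \<in> A i} = Pi\<^sub>E {..<d} A" for A :: "nat \<Rightarrow> real set"
      unfolding PiE_iff Collect_conj_eq[symmetric] by (rule set_eqI) (simp add: PiE_iff conj_commute)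
    then have *: "{f\<in>(\<Pi>\<^sub>E i\<in>{..<d}. UNIV). \<forall>i\<in>j. f i \<in> A i} = Pi\<^sub>E {..<d} A" if "j = {..<d}"
      for A :: "nat \<Rightarrow> real set" and j
      using that by simp
    show ?thesis
    proof (intro set_eqI iffI)
      fix X assume "X \<in> {{f\<in>(\<Pi>\<^sub>E i\<in>{..<d}. UNIV). \<forall>i\<in>j. f i \<in> A i} | A j. j \<in> {{..<d}} \<and> A \<in> Pi j (\<lambda>_. ?E)}"
      then obtain A j where X': "X = {f\<in>(\<Pi>\<^sub>E i\<in>{..<d}. UNIV). \<forall>i\<in>j. f i \<in> A i}"
         "j \<in> {{..<d}}" "A \<in> Pi j (\<lambda>_. ?E)" by (elim CollectE exE conjE)
      then have X: "j = {..<d}" "X = {f\<in>(\<Pi>\<^sub>E i\<in>{..<d}. UNIV). \<forall>i\<in>j. f i \<in> A i}"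
        "A \<in> Pi j (\<lambda>_. ?E)" by simp_all
      show "X \<in> {Pi\<^sub>E {..<d} F | F. \<forall>i\<in>{..<d}. F i \<in> ?E}"
        unfolding X(2) *[OF X(1)] using X(1,3) by (auto simp: Pi_iff)
    next
      fix X assume "X \<in> {Pi\<^sub>E {..<d} F | F. \<forall>i\<in>{..<d}. F i \<in> ?E}"
      then obtain F where X: "X = Pi\<^sub>E {..<d} F" "\<forall>i\<in>{..<d}. F i \<in> ?E" by blast
      show "X \<in> {{f\<in>(\<Pi>\<^sub>E i\<in>{..<d}. UNIV). \<forall>i\<in>j. f i \<in> A i} | A j. j \<in> {{..<d}} \<and> A \<in> Pi j (\<lambda>_. ?E)}"
      proof (intro CollectI exI[of _ F] exI[of _ "{..<d}"] conjI)
        show "X = {f\<in>(\<Pi>\<^sub>E i\<in>{..<d}. UNIV). \<forall>i\<in>{..<d}. f i \<in> F i}"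
          using X(1) *[OF refl, of F] by simp
        show "F \<in> Pi {..<d} (\<lambda>_. ?E)" using X(2) by (intro Pi_I) blast
      qed simp
    qed
  qed
  also have "sets (sigma (Pi\<^sub>E {..<d} (\<lambda>_. UNIV)) {Pi\<^sub>E {..<d} F | F. \<forall>i\<in>{..<d}. F i \<in> ?E})
     = sigma_sets (Rd d) {Pi\<^sub>E {..<d} F | F. \<forall>i\<in>{..<d}. F i \<in> ?E}"
    unfolding Rd_def by (rule sets_measure_of) (auto simp: PiE_iff)
  finally show ?thesis .
qed

text \<open>Dynkin induction starting from boxes. The intersection with a cube keeps the indicators
  integrable when passing to complements; measurability is carried along in the induction because
  the complement and union cases need it.\<close>

lemma translation_continuous_indicator_cube:
  assumes "A \<in> sets (lebesgue_Rd d)"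
  shows "translation_continuous d (indicator (A \<inter> cube d R))"
proof -
  let ?G = "{Pi\<^sub>E {..<d} F | F. \<forall>i\<in>{..<d}. F i \<in> range (\<lambda>(a, b). {a..b::real})}"
  have ind: "integrable (lebesgue_Rd d) (indicator (A \<inter> cube d R) :: _ \<Rightarrow> real)" if "A \<in> sets (lebesgue_Rd d)" for A
    by (rule Bochner_Integration.integrable_bound[OF cube_integrable[of d R]])
      (use that in \<open>auto simp: indicator_def\<close>)
  have IS: "Int_stable ?G"
  proof (rule Int_stableI)
    fix A B assume "A \<in> ?G" "B \<in> ?G"
    then obtain F G where F: "A = Pi\<^sub>E {..<d} F" "\<And>i. i < d \<Longrightarrow> F i \<in> range (\<lambda>(a, b). {a..b::real})"
      and G: "B = Pi\<^sub>E {..<d} G" "\<And>i. i < d \<Longrightarrow> G i \<in> range (\<lambda>(a, b). {a..b::real})" by auto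
    have "F i \<inter> G i \<in> range (\<lambda>(a, b). {a..b::real})" if "i < d" for i
    proof -
      obtain a b where "F i = {a..b}" using F(2)[OF \<open>i < d\<close>] by auto
      moreover obtain a' b' where "G i = {a'..b'}" using G(2)[OF \<open>i < d\<close>] by auto
      ultimately have "F i \<inter> G i = {max a a'..min b b'}" by auto
      then show ?thesis by (intro image_eqI[of _ _ "(max a a', min b b')"]) auto
    qed
    moreover have "A \<inter> B = Pi\<^sub>E {..<d} (\<lambda>i. F i \<inter> G i)" unfolding F G by (rule PiE_Int)
    ultimately show "A \<inter> B \<in> ?G" by auto
  qed
  have sub: "?G \<subseteq> Pow (Rd d)" by (auto simp: Rd_def PiE_iff)
  have "A \<in> sigma_sets (Rd d) ?G" using assms sets_lebesgue_Rd_boxes by simp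
  then have "A \<in> sets (lebesgue_Rd d) \<and> translation_continuous d (indicator (A \<inter> cube d R))"
  proof (induction rule: sigma_sets_induct_disjoint[OF IS sub, consumes 1, case_names basic empty compl union])
    case (basic A)
    then obtain F where F: "A = Pi\<^sub>E {..<d} F" "\<And>i. i < d \<Longrightarrow> F i \<in> range (\<lambda>(a, b). {a..b::real})" by auto
    have "\<exists>a b. F i = {a..b}" if "i < d" for i using F(2)[OF that] by auto
    then obtain a b where ab: "\<And>i. i < d \<Longrightarrow> F i = {a i..b i}" by metis
    have "A = rbox d a b" unfolding F rbox_def by (intro PiE_cong) (auto simp: ab)
    moreover have "rbox d a b \<inter> cube d R = rbox d (\<lambda>i. max (a i) (- R)) (\<lambda>i. min (b i) R)"
      unfolding rbox_def cube_def PiE_Int by (intro PiE_cong) auto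
    ultimately show ?case using translation_continuous_rbox by simp
  next
    case empty
    then show ?case by (simp add: translation_continuous_def)
  next
    case (compl A)
    have m: "Rd d - A \<in> sets (lebesgue_Rd d)"
      using compl sets.compl_sets[of A "lebesgue_Rd d"] by (simp add: space_lebesgue_Rd)
    have "translation_continuous d (indicator (cube d R))"
      using translation_continuous_rbox[of d "\<lambda>_. - R" "\<lambda>_. R"] by (simp add: rbox_def cube_def)
    then have "translation_continuous d (\<lambda>x. indicator (cube d R) x + (-1) * indicator (A \<inter> cube d R) x)"
      using compl ind cube_integrable
      by (intro translation_continuous_add translation_continuous_cmult integrable_mult_right) auto
    moreover have "(\<lambda>x. indicator (cube d R) x + (-1) * indicator (A \<inter> cube d R) x)
      = (indicator ((Rd d - A) \<inter> cube d R) :: _ \<Rightarrow> real)"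
      by (auto simp: indicator_def cube_def Rd_def PiE_iff fun_eq_iff)
    ultimately show ?case using m by simp
  next
    case (union A)
    have m: "\<And>i. A i \<in> sets (lebesgue_Rd d)" using union by blast
    have tc: "translation_continuous d (indicator ((\<Union>i<n. A i) \<inter> cube d R))" for n
    proof (induction n)
      case 0
      then show ?case by (simp add: translation_continuous_def)
    next
      case (Suc n)
      have "translation_continuous d (\<lambda>x. indicator ((\<Union>i<n. A i) \<inter> cube d R) x + indicator (A n \<inter> cube d R) x)"
        using Suc union ind m by (intro translation_continuous_add) auto
      moreover have "A i \<inter> A n = {}" if "i < n" for i
        using union(1) that by (auto simp: disjoint_family_on_def)
      then have "(\<lambda>x. indicator ((\<Union>i<n. A i) \<inter> cube d R) x + indicator (A n \<inter> cube d R) x)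
        = (indicator ((\<Union>i<Suc n. A i) \<inter> cube d R) :: _ \<Rightarrow> real)"
        by (auto simp: indicator_def fun_eq_iff less_Suc_eq)
      ultimately show ?case by simp
    qed
    have "translation_continuous d (indicator ((\<Union>i. A i) \<inter> cube d R))"
    proof (rule translation_continuous_limit[where w = "indicator (cube d R)"
        and s = "\<lambda>n. indicator ((\<Union>i<n. A i) \<inter> cube d R)"])
      show "integrable (lebesgue_Rd d) (indicator ((\<Union>i. A i) \<inter> cube d R) :: _ \<Rightarrow> real)"
        using m by (intro ind) auto
      show "integrable (lebesgue_Rd d) (indicator ((\<Union>i<n. A i) \<inter> cube d R) :: _ \<Rightarrow> real)" for n
        using m by (intro ind) auto
      show "integrable (lebesgue_Rd d) (indicator (cube d R) :: _ \<Rightarrow> real)" by (rule cube_integrable)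
      show "(\<lambda>n. indicator ((\<Union>i<n. A i) \<inter> cube d R) x) \<longlonglongrightarrow> (indicator ((\<Union>i. A i) \<inter> cube d R) x :: real)" for x
        unfolding indicator_inter_arith by (intro tendsto_mult tendsto_const LIMSEQ_indicator_UN)
      show "\<bar>indicator ((\<Union>i<n. A i) \<inter> cube d R) x\<bar> \<le> (indicator (cube d R) x :: real)" for n x
        by (auto simp: indicator_def)
    qed (rule tc)
    then show ?case using m by auto
  qed
  then show ?thesis by simp
qed

lemma Rd_exhaust_cube:
  assumes "x \<in> Rd d" shows "eventually (\<lambda>n. x \<in> cube d (real n)) sequentially"
proof -
  obtain N where N: "(\<Sum>i<d. \<bar>x i\<bar>) \<le> real N" using real_arch_simple by blast
  have "x \<in> cube d (real n)" if "n \<ge> N" for n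
  proof -
    have "x i \<in> {- real n..real n}" if "i < d" for i
    proof -
      have "\<bar>x i\<bar> \<le> (\<Sum>i<d. \<bar>x i\<bar>)" using that by (intro member_le_sum) auto
      then have "\<bar>x i\<bar> \<le> real n" using N \<open>n \<ge> N\<close> by linarith
      then show ?thesis by auto
    qed
    then show ?thesis using assms by (auto simp: cube_def Rd_def PiE_iff)
  qed
  then show ?thesis unfolding eventually_sequentially by blast
qed

text \<open>Measure-theoretic induction: sets of finite measure are exhausted by cubes, then linear
  combinations and dominated limits follow.\<close>

lemma integrable_translation_continuous:
  assumes "integrable (lebesgue_Rd d) g"
  shows "translation_continuous d g"
  using assms
proof (induction rule: integrable_induct)
  case (base A c)
  have "translation_continuous d (indicator A)"
  proof (rule translation_continuous_limit[where s = "\<lambda>n. indicator (A \<inter> cube d (real n))" and w = "indicator A"])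
    show i: "integrable (lebesgue_Rd d) (indicator A :: _ \<Rightarrow> real)"
      using base by (intro indicator_integrable)
    then show "integrable (lebesgue_Rd d) (indicator A :: _ \<Rightarrow> real)" .
    show "integrable (lebesgue_Rd d) (indicator (A \<inter> cube d (real n)) :: _ \<Rightarrow> real)" for n
      by (rule Bochner_Integration.integrable_bound[OF i]) (use base in \<open>auto simp: indicator_def\<close>)
    show "translation_continuous d (indicator (A \<inter> cube d (real n)))" for n
      using base by (intro translation_continuous_indicator_cube)
    show "(\<lambda>n. indicator (A \<inter> cube d (real n)) x) \<longlonglongrightarrow> (indicator A x :: real)" if "x \<in> Rd d" for x
      by (rule tendsto_eventually) (use Rd_exhaust_cube[OF that] in eventually_elim, auto simp: indicator_def)
    show "\<bar>indicator (A \<inter> cube d (real n)) x\<bar> \<le> (indicator A x :: real)" for n x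
      by (auto simp: indicator_def)
  qed
  from translation_continuous_cmult[OF this, of c] show ?case by (simp add: mult.commute)
next
  case (add f g)
  then show ?case by (intro translation_continuous_add)
next
  case (lim f s)
  show ?case
  \<comment> \<open>\<open>integrable_induct\<close> supplies approximants bounded by twice the
    absolute value of their limit.\<close>
  proof (rule translation_continuous_limit[where s = s and w = "\<lambda>x. 2 * \<bar>f x\<bar>"])
    show "integrable (lebesgue_Rd d) (\<lambda>x. 2 * \<bar>f x\<bar>)" using \<open>integrable (lebesgue_Rd d) f\<close> by simp
  qed (use lim in \<open>simp_all add: space_lebesgue_Rd\<close>)
qed

section \<open>Product mollifiers and their derivatives\<close>

definition scaled_bump :: "real \<Rightarrow> real \<Rightarrow> real" where
  "scaled_bump \<delta> s = 1 / \<delta> * bump (1 / \<delta> * s)"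

text \<open>The absolute constant that enters the final bound. It belongs to the fixed
  one-dimensional bump and is therefore independent of the dimension.\<close>

definition bump_variation :: real where
  "bump_variation = (\<integral>s. \<bar>deriv bump s\<bar> \<partial>lborel)"

abbreviation mollifier :: "nat \<Rightarrow> real \<Rightarrow> (nat \<Rightarrow> real) \<Rightarrow> real" where
  "mollifier d \<delta> \<equiv> prodf d (\<lambda>_. scaled_bump \<delta>)"

abbreviation dmollifier :: "nat \<Rightarrow> real \<Rightarrow> nat \<Rightarrow> (nat \<Rightarrow> real) \<Rightarrow> real" where
  "dmollifier d \<delta> \<equiv> dprodf d (\<lambda>_. scaled_bump \<delta>)"

context
  fixes \<delta> :: real
  assumes \<delta>: "0 < \<delta>"
begin

lemma scaled_bump_Cc: "Cc (scaled_bump \<delta>)"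
proof -
  have "1 / \<delta> \<noteq> 0" using \<delta> by simp
  from Cc_scale[OF bump_props(1) this] show ?thesis unfolding scaled_bump_def .
qed

lemma mollifier_Ccs: "Ccs d (\<lambda>_. scaled_bump \<delta>)"
  by (simp add: Ccs_def scaled_bump_Cc)

lemma scaled_bump_nonneg: "0 \<le> scaled_bump \<delta> s"
  using \<delta> bump_props(2) by (simp add: scaled_bump_def)

lemma scaled_bump_integral: "(\<integral>s. scaled_bump \<delta> s \<partial>lborel) = 1"
proof -
  have "(\<integral>s. scaled_bump \<delta> s \<partial>lborel) = \<bar>\<delta>\<bar> *\<^sub>R (\<integral>s. scaled_bump \<delta> (0 + \<delta> * s) \<partial>lborel)"
    using \<delta> by (intro lborel_integral_real_affine) simp
  also have "(\<lambda>s. scaled_bump \<delta> (0 + \<delta> * s)) = (\<lambda>s. 1 / \<delta> * bump s)"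
    using \<delta> by (simp add: scaled_bump_def)
  finally show ?thesis using \<delta> bump_props(5) by simp
qed

lemma scaled_bump_deriv: "deriv (scaled_bump \<delta>) s = 1 / \<delta> * (1 / \<delta> * deriv bump (1 / \<delta> * s))"
proof (rule DERIV_imp_deriv)
  have "((\<lambda>s. 1 / \<delta> * s) has_real_derivative 1 / \<delta>) (at s)" by (rule DERIV_cmult_Id)
  from DERIV_cmult[OF DERIV_chain2[OF smooth1_DERIV[OF CcD[OF bump_props(1)]] this], of "1 / \<delta>"]
  show "(scaled_bump \<delta> has_real_derivative 1 / \<delta> * (1 / \<delta> * deriv bump (1 / \<delta> * s))) (at s)"
    unfolding scaled_bump_def[abs_def] by (simp add: mult_ac)
qed

lemma scaled_bump_deriv_integral: "(\<integral>s. \<bar>deriv (scaled_bump \<delta>) s\<bar> \<partial>lborel) = bump_variation / \<delta>"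
proof -
  have "(\<integral>s. \<bar>deriv (scaled_bump \<delta>) s\<bar> \<partial>lborel)
      = \<bar>\<delta>\<bar> *\<^sub>R (\<integral>s. \<bar>deriv (scaled_bump \<delta>) (0 + \<delta> * s)\<bar> \<partial>lborel)"
    using \<delta> by (intro lborel_integral_real_affine) simp
  also have "(\<lambda>s. \<bar>deriv (scaled_bump \<delta>) (0 + \<delta> * s)\<bar>) = (\<lambda>s. 1 / \<delta> * (1 / \<delta>) * \<bar>deriv bump s\<bar>)"
    using \<delta> by (simp add: scaled_bump_deriv abs_mult fun_eq_iff)
  finally show ?thesis using \<delta> by (simp add: bump_variation_def)
qed

lemma mollifier_nonneg: "0 \<le> mollifier d \<delta> x"
  unfolding prodf_def by (intro prod_nonneg) (auto simp: scaled_bump_nonneg)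

lemma mollifier_integral: "(\<integral>x. mollifier d \<delta> x \<partial>lebesgue_Rd d) = 1"
  using prodf_integral[OF mollifier_Ccs] scaled_bump_integral by simp

lemma mollifier_integrable: "integrable (lebesgue_Rd d) (mollifier d \<delta>)"
  by (rule prodf_integrable[OF mollifier_Ccs])

lemma dmollifier_integrable: "integrable (lebesgue_Rd d) (dmollifier d \<delta> i)"
  unfolding dprodf_def by (rule prodf_integrable[OF Ccs_deriv[OF mollifier_Ccs]])

lemma mollifier_support: "i < d \<Longrightarrow> \<delta> < \<bar>x i\<bar> \<Longrightarrow> mollifier d \<delta> x = 0"
proof -
  assume i: "i < d" and "\<delta> < \<bar>x i\<bar>"
  then have "1 < \<bar>1 / \<delta> * x i\<bar>" using \<delta> by (simp add: abs_mult field_simps)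
  then have "scaled_bump \<delta> (x i) = 0" unfolding scaled_bump_def using bump_props(3) by simp
  then show ?thesis unfolding prodf_def using i by (intro prod_zero) auto
qed

text \<open>All factors except the i-th are nonnegative with integral 1, so only the derivative of
  one scaled bump is seen and the value does not depend on d.\<close>

lemma dmollifier_abs_integral:
  assumes "i < d" shows "(\<integral>x. \<bar>dmollifier d \<delta> i x\<bar> \<partial>lebesgue_Rd d) = bump_variation / \<delta>"
proof -
  have "(\<integral>x. \<bar>dmollifier d \<delta> i x\<bar> \<partial>lebesgue_Rd d)
     = (\<Prod>j<d. \<integral>s. \<bar>((\<lambda>_. scaled_bump \<delta>)(i := deriv (scaled_bump \<delta>))) j s\<bar> \<partial>lborel)"
    unfolding dprodf_def by (rule prodf_abs_integral[OF Ccs_deriv[OF mollifier_Ccs]])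
  also have "\<dots> = (\<integral>s. \<bar>deriv (scaled_bump \<delta>) s\<bar> \<partial>lborel) * (\<Prod>j\<in>{..<d} - {i}. 1)"
    using assms by (subst prod.remove[of _ i])
      (auto intro!: prod.cong simp: scaled_bump_nonneg scaled_bump_integral)
  finally show ?thesis by (simp add: scaled_bump_deriv_integral)
qed

lemma dmollifier_integral:
  assumes "i < d" shows "(\<integral>x. dmollifier d \<delta> i x \<partial>lebesgue_Rd d) = 0"
proof -
  have "(\<integral>x. dmollifier d \<delta> i x \<partial>lebesgue_Rd d)
     = (\<Prod>j<d. \<integral>s. ((\<lambda>_. scaled_bump \<delta>)(i := deriv (scaled_bump \<delta>))) j s \<partial>lborel)"
    unfolding dprodf_def by (rule prodf_integral[OF Ccs_deriv[OF mollifier_Ccs]])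
  also have "\<dots> = 0"
    using assms Cc_integral_deriv[OF scaled_bump_Cc] by (intro prod_zero bexI[of _ i]) auto
  finally show ?thesis .
qed

lemma scaled_bump_even: "scaled_bump \<delta> (- s) = scaled_bump \<delta> s"
  by (simp add: scaled_bump_def bump_props(4))

lemma scaled_bump_deriv_odd: "deriv (scaled_bump \<delta>) (- s) = - deriv (scaled_bump \<delta>) s"
proof -
  have "((\<lambda>s. - s) has_real_derivative - 1) (at s)" by (auto intro!: derivative_eq_intros)
  from DERIV_chain2[OF smooth1_DERIV[OF CcD[OF scaled_bump_Cc]] this]
  have "(scaled_bump \<delta> has_real_derivative - deriv (scaled_bump \<delta>) (- s)) (at s)"
    by (simp add: scaled_bump_even)
  then show ?thesis using DERIV_imp_deriv by force
qed

lemma mollifier_swap: "mollifier d \<delta> (vsub d y x) = mollifier d \<delta> (vsub d x y)"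
  unfolding prodf_def
proof (intro prod.cong refl)
  fix i assume "i \<in> {..<d}"
  then show "scaled_bump \<delta> (vsub d y x i) = scaled_bump \<delta> (vsub d x y i)"
    using scaled_bump_even[of "x i - y i"] by (simp add: vsub_def)
qed

text \<open>The i-th derivative of an even function is odd; this is what makes \<open>qflux\<close>
  antisymmetric.\<close>

lemma dmollifier_swap:
  assumes "i < d" shows "dmollifier d \<delta> i (vsub d y x) = - dmollifier d \<delta> i (vsub d x y)"
proof -
  let ?g = "(\<lambda>_. scaled_bump \<delta>)(i := deriv (scaled_bump \<delta>))"
  have "(\<Prod>j\<in>{..<d} - {i}. ?g j (vsub d y x j)) = (\<Prod>j\<in>{..<d} - {i}. ?g j (vsub d x y j))"
  proof (intro prod.cong refl)
    fix j assume "j \<in> {..<d} - {i}"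
    then show "?g j (vsub d y x j) = ?g j (vsub d x y j)"
      using scaled_bump_even[of "x j - y j"] by (simp add: vsub_def)
  qed
  moreover have "deriv (scaled_bump \<delta>) (y i - x i) = - deriv (scaled_bump \<delta>) (x i - y i)"
    using scaled_bump_deriv_odd[of "x i - y i"] by simp
  ultimately show ?thesis
    unfolding dprodf_def prodf_split[OF assms] using assms by (simp add: vsub_def)
qed

end

section \<open>Algebra of pairings and Lipschitz integrands\<close>

lemma dominatedD:
  assumes "dominated d W \<alpha> \<beta>"
  shows "(\<lambda>(x, y). W x y) \<in> borel_measurable (lebesgue_Rd d \<Otimes>\<^sub>M lebesgue_Rd d)"
    "integrable (lebesgue_Rd d) \<alpha>" "integrable (lebesgue_Rd d) \<beta>"
    "x \<in> Rd d \<Longrightarrow> y \<in> Rd d \<Longrightarrow> \<bar>W x y\<bar> \<le> \<alpha> x + \<beta> y"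
  using assms by (simp_all add: dominated_def)

lemma pairing_mono:
  assumes "dominated d W \<alpha> \<beta>" "dominated d W' \<alpha>' \<beta>'" "integrable (lebesgue_Rd d) \<kappa>"
    and "\<And>x. x \<in> Rd d \<Longrightarrow> 0 \<le> \<kappa> x"
    and "\<And>x y. x \<in> Rd d \<Longrightarrow> y \<in> Rd d \<Longrightarrow> W x y \<le> W' x y"
  shows "pairing d W \<kappa> \<le> pairing d W' \<kappa>"
  unfolding pairing_def
  by (rule integral_mono[OF pairing_integrable[OF assms(1,3)] pairing_integrable[OF assms(2,3)]])
    (use assms(4,5) in \<open>auto simp: space_pair_Rd intro!: mult_right_mono\<close>)

lemma dominated_add:
  assumes "dominated d W \<alpha> \<beta>" "dominated d W' \<alpha>' \<beta>'"
  shows "dominated d (\<lambda>x y. W x y + W' x y) (\<lambda>x. \<alpha> x + \<alpha>' x) (\<lambda>x. \<beta> x + \<beta>' x)"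
proof -
  note [measurable] = dominatedD(1)[OF assms(1)] dominatedD(1)[OF assms(2)]
  have "\<bar>W x y + W' x y\<bar> \<le> (\<alpha> x + \<alpha>' x) + (\<beta> y + \<beta>' y)" if "x \<in> Rd d" "y \<in> Rd d" for x y
    using dominatedD(4)[OF assms(1) that] dominatedD(4)[OF assms(2) that] by linarith
  then show ?thesis
    using dominatedD(2,3)[OF assms(1)] dominatedD(2,3)[OF assms(2)] by (auto simp: dominated_def)
qed

lemma pairing_add_left:
  assumes "dominated d W \<alpha> \<beta>" "dominated d W' \<alpha>' \<beta>'" "integrable (lebesgue_Rd d) \<kappa>"
  shows "pairing d (\<lambda>x y. W x y + W' x y) \<kappa> = pairing d W \<kappa> + pairing d W' \<kappa>"
  unfolding pairing_def
  using Bochner_Integration.integral_add[OF pairing_integrable[OF assms(1,3)] pairing_integrable[OF assms(2,3)]]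
  by (simp add: split_def distrib_right)

lemma pairing_add_right:
  assumes "dominated d W \<alpha> \<beta>" "integrable (lebesgue_Rd d) \<kappa>" "integrable (lebesgue_Rd d) \<kappa>'"
  shows "pairing d W (\<lambda>\<xi>. \<kappa> \<xi> + \<kappa>' \<xi>) = pairing d W \<kappa> + pairing d W \<kappa>'"
  unfolding pairing_def
  using Bochner_Integration.integral_add[OF pairing_integrable[OF assms(1,2)] pairing_integrable[OF assms(1,3)]]
  by (simp add: split_def distrib_left)

lemma pairing_sum_right:
  assumes "dominated d W \<alpha> \<beta>" "\<And>i. i \<in> I \<Longrightarrow> integrable (lebesgue_Rd d) (\<kappa> i)"
  shows "pairing d W (\<lambda>\<xi>. \<Sum>i\<in>I. c i * \<kappa> i \<xi>) = (\<Sum>i\<in>I. c i * pairing d W (\<kappa> i))"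
proof -
  have "pairing d W (\<lambda>\<xi>. \<Sum>i\<in>I. c i * \<kappa> i \<xi>)
    = (\<integral>p. (\<Sum>i\<in>I. c i * (case p of (x, y) \<Rightarrow> W x y * \<kappa> i (vsub d x y))) \<partial>(lebesgue_Rd d \<Otimes>\<^sub>M lebesgue_Rd d))"
    unfolding pairing_def split_def by (simp add: sum_distrib_left mult.left_commute)
  also have "\<dots> = (\<Sum>i\<in>I. c i * pairing d W (\<kappa> i))"
    unfolding pairing_def using pairing_integrable[OF assms]
    by (subst Bochner_Integration.integral_sum) (auto intro!: integrable_mult_right)
  finally show ?thesis .
qed

lemma pairing_snd_only:
  assumes "integrable (lebesgue_Rd d) \<beta>" "integrable (lebesgue_Rd d) \<kappa>"
  shows "pairing d (\<lambda>x y. \<beta> y) \<kappa> = (\<integral>x. \<beta> x \<partial>lebesgue_Rd d) * (\<integral>x. \<kappa> x \<partial>lebesgue_Rd d)"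
  unfolding pairing_def by (rule kernel_integrable'(2)[OF assms])

lemma pairing_fst_only:
  assumes "integrable (lebesgue_Rd d) \<alpha>" "integrable (lebesgue_Rd d) \<kappa>"
  shows "pairing d (\<lambda>x y. \<alpha> x) \<kappa> = (\<integral>x. \<alpha> x \<partial>lebesgue_Rd d) * (\<integral>x. \<kappa> x \<partial>lebesgue_Rd d)"
  unfolding pairing_def by (rule kernel_integrable(2)[OF assms])

lemma pairing_swap:
  assumes "dominated d W \<alpha> \<beta>" "integrable (lebesgue_Rd d) \<kappa>"
  shows "pairing d (\<lambda>x y. W y x) (\<lambda>\<xi>. \<kappa> (vneg d \<xi>)) = pairing d W \<kappa>"
proof -
  have "vneg d (vsub d x y) = vsub d y x" for x y by (auto simp: vneg_def vsub_def)
  then show ?thesis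
    using lRR.integral_product_swap[OF borel_measurable_integrable[OF pairing_integrable[OF assms]]]
    by (simp add: pairing_def split_def)
qed

lemma pairing_shift_left:
  assumes W: "dominated d W \<alpha> \<beta>" and \<kappa>: "integrable (lebesgue_Rd d) \<kappa>"
  shows "pairing d W (\<lambda>\<xi>. \<kappa> (vsub d \<xi> h)) = pairing d (\<lambda>x y. W (vadd d x h) y) \<kappa>"
    and "dominated d (\<lambda>x y. W (vadd d x h) y) (\<lambda>x. \<alpha> (vadd d x h)) \<beta>"
proof -
  have *: "vsub d (vsub d (vadd d x h) y) h = vsub d x y" for x y by (auto simp: vsub_def vadd_def)
  note [measurable] = borel_measurable_integrable[OF \<kappa>] dominatedD(1)[OF W]
  have [measurable]: "(\<lambda>y. vadd d y h) \<in> lebesgue_Rd d \<rightarrow>\<^sub>M lebesgue_Rd d"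
    unfolding affine_forms(1) by (rule affine_measurable)
  have [measurable]: "(\<lambda>y. vsub d y h) \<in> lebesgue_Rd d \<rightarrow>\<^sub>M lebesgue_Rd d"
    unfolding affine_forms(2) by (rule affine_measurable)
  have "(\<lambda>(x, y). W (vadd d x h) y) \<in> borel_measurable (lebesgue_Rd d \<Otimes>\<^sub>M lebesgue_Rd d)" by measurable
  then show dom: "dominated d (\<lambda>x y. W (vadd d x h) y) (\<lambda>x. \<alpha> (vadd d x h)) \<beta>"
    using W integrable_vadd by (auto simp: dominated_def)
  have "pairing d W (\<lambda>\<xi>. \<kappa> (vsub d \<xi> h))
    = (\<integral>y. (\<integral>x. W x y * \<kappa> (vsub d (vsub d x y) h) \<partial>lebesgue_Rd d) \<partial>lebesgue_Rd d)"
    by (rule pairing_snd[OF W integrable_vsub_right[OF \<kappa>]])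
  also have "\<dots> = (\<integral>y. (\<integral>x. W (vadd d x h) y * \<kappa> (vsub d x y) \<partial>lebesgue_Rd d) \<partial>lebesgue_Rd d)"
  proof (rule Bochner_Integration.integral_cong[OF refl])
    fix y assume y: "y \<in> space (lebesgue_Rd d)"
    have "(\<lambda>x. W x y * \<kappa> (vsub d (vsub d x y) h)) \<in> borel_measurable (lebesgue_Rd d)"
      using y by measurable
    from integral_vadd[OF this, of h]
    show "(\<integral>x. W x y * \<kappa> (vsub d (vsub d x y) h) \<partial>lebesgue_Rd d)
       = (\<integral>x. W (vadd d x h) y * \<kappa> (vsub d x y) \<partial>lebesgue_Rd d)"
      by (simp add: *)
  qed
  also have "\<dots> = pairing d (\<lambda>x y. W (vadd d x h) y) \<kappa>"
    by (rule pairing_snd[OF dom \<kappa>, symmetric])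
  finally show "pairing d W (\<lambda>\<xi>. \<kappa> (vsub d \<xi> h)) = pairing d (\<lambda>x y. W (vadd d x h) y) \<kappa>" .
qed

text \<open>The common form of the three integrands |a - b|, |B a - B b| and the entropy flux.
  Together with J 0 0 = 0 the Lipschitz bound dominates J (v x) (w y) by L |v x| + L |w y|.\<close>

definition lip2 :: "real \<Rightarrow> (real \<Rightarrow> real \<Rightarrow> real) \<Rightarrow> bool" where
  "lip2 L J \<longleftrightarrow> 0 \<le> L \<and> J 0 0 = 0 \<and> (\<forall>a b a' b'. \<bar>J a b - J a' b'\<bar> \<le> L * (\<bar>a - a'\<bar> + \<bar>b - b'\<bar>))"

lemma lip2_measurable [measurable (raw)]:
  assumes J: "lip2 L J" and "f \<in> borel_measurable N" "g \<in> borel_measurable N"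
  shows "(\<lambda>x. J (f x) (g x)) \<in> borel_measurable N"
proof (rule borel_measurable_continuous_Pair[OF assms(2,3)])
  have "((\<lambda>p. J (fst p) (snd p)) \<longlongrightarrow> J (fst a) (snd a)) (at a)" for a :: "real \<times> real"
  proof -
    have "((\<lambda>p. L * (\<bar>fst p - fst a\<bar> + \<bar>snd p - snd a\<bar>)) \<longlongrightarrow> L * (\<bar>fst a - fst a\<bar> + \<bar>snd a - snd a\<bar>)) (at a)"
      by (intro tendsto_intros)
    then have "((\<lambda>p. L * (\<bar>fst p - fst a\<bar> + \<bar>snd p - snd a\<bar>)) \<longlongrightarrow> 0) (at a)" by simp
    then have "((\<lambda>p. J (fst p) (snd p) - J (fst a) (snd a)) \<longlongrightarrow> 0) (at a)"
      by (rule Lim_null_comparison[rotated]) (use J in \<open>auto simp: lip2_def\<close>)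
    then show ?thesis by (rule LIM_zero_cancel)
  qed
  then show "continuous_on UNIV (\<lambda>x. J (fst x) (snd x))"
    by (simp add: continuous_on_def)
qed

lemma lip2_abs_bound: "lip2 L J \<Longrightarrow> \<bar>J a b\<bar> \<le> L * \<bar>a\<bar> + L * \<bar>b\<bar>"
  unfolding lip2_def by (metis diff_zero distrib_left)

lemma dominated_lip2:
  assumes J: "lip2 L J" and v: "integrable (lebesgue_Rd d) v" and w: "integrable (lebesgue_Rd d) w"
  shows "dominated d (\<lambda>x y. J (v x) (w y)) (\<lambda>x. L * \<bar>v x\<bar>) (\<lambda>y. L * \<bar>w y\<bar>)"
proof -
  note [measurable] = borel_measurable_integrable[OF v] borel_measurable_integrable[OF w]
  have "(\<lambda>(x, y). J (v x) (w y)) \<in> borel_measurable (lebesgue_Rd d \<Otimes>\<^sub>M lebesgue_Rd d)"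
    unfolding split_def by (rule lip2_measurable[OF J]) measurable
  then show ?thesis using v w lip2_abs_bound[OF J] by (simp add: dominated_def)
qed

lemma lip2_dist: "lip2 1 (\<lambda>a b. \<bar>a - b\<bar>)"
  unfolding lip2_def by auto

lemma pairing_lip2_diff:
  assumes J: "lip2 L J" and v: "integrable (lebesgue_Rd d) v" and w: "integrable (lebesgue_Rd d) w"
    and v': "integrable (lebesgue_Rd d) v'" and w': "integrable (lebesgue_Rd d) w'"
    and \<kappa>: "integrable (lebesgue_Rd d) \<kappa>"
  shows "\<bar>pairing d (\<lambda>x y. J (v x) (w y)) \<kappa> - pairing d (\<lambda>x y. J (v' x) (w' y)) \<kappa>\<bar>
    \<le> L * (L1_norm d (\<lambda>x. v x - v' x) + L1_norm d (\<lambda>x. w x - w' x)) * (\<integral>x. \<bar>\<kappa> x\<bar> \<partial>lebesgue_Rd d)"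
proof -
  have "\<bar>pairing d (\<lambda>x y. J (v x) (w y)) \<kappa> - pairing d (\<lambda>x y. J (v' x) (w' y)) \<kappa>\<bar>
    \<le> ((\<integral>x. L * \<bar>v x - v' x\<bar> \<partial>lebesgue_Rd d) + (\<integral>x. L * \<bar>w x - w' x\<bar> \<partial>lebesgue_Rd d)) * (\<integral>x. \<bar>\<kappa> x\<bar> \<partial>lebesgue_Rd d)"
    by (rule pairing_diff_bound[OF dominated_lip2[OF J v w] dominated_lip2[OF J v' w'] \<kappa>])
      (use v w v' w' J in \<open>auto simp: lip2_def distrib_left[symmetric]\<close>)
  then show ?thesis by (simp add: L1_norm_def distrib_left)
qed

text \<open>The shift goes to the second function, so an increment of the kernel costs the L1
  modulus of w times the L1 norm of the kernel. Only w has to have controlled translates.\<close>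

lemma pairing_lip2_shift:
  assumes J: "lip2 L J" and v: "integrable (lebesgue_Rd d) v" and w: "integrable (lebesgue_Rd d) w"
    and \<kappa>: "integrable (lebesgue_Rd d) \<kappa>"
  shows "\<bar>pairing d (\<lambda>x y. J (v x) (w y)) (\<lambda>\<xi>. \<kappa> (vsub d \<xi> h)) - pairing d (\<lambda>x y. J (v x) (w y)) \<kappa>\<bar>
    \<le> L * L1_norm d (\<lambda>x. w (vsub d x h) - w x) * (\<integral>x. \<bar>\<kappa> x\<bar> \<partial>lebesgue_Rd d)"
  unfolding pairing_shift[OF dominated_lip2[OF J v w] \<kappa>]
  using pairing_lip2_diff[OF J v integrable_vsub_right[OF w] v w \<kappa>, of h] by (simp add: L1_norm_def)

lemma L1_norm_shift_eq:
  assumes w: "integrable (lebesgue_Rd d) w"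
  shows "L1_norm d (\<lambda>x. w (vsub d x h) - w x) = L1_norm d (\<lambda>x. w (vadd d x (vneg d h)) - w x)"
proof -
  have "vsub d x h = vadd d x (vneg d h)" for x by (auto simp: vsub_def vadd_def vneg_def)
  then show ?thesis by simp
qed

lemma vadd_vsub_cancel: "\<xi> \<in> Rd d \<Longrightarrow> vsub d (vadd d \<xi> y) y = \<xi>"
  by (auto simp: vsub_def vadd_def Rd_def PiE_iff extensional_def fun_eq_iff)

text \<open>In the variable \<xi> = x - y the pairing is, by Fubini, an average of the L1 norms of
  translation differences over the supporting cube, with total weight 1.\<close>

lemma mollify_bound:
  assumes g: "integrable (lebesgue_Rd d) g" and \<delta>: "0 < \<delta>"
    and b: "\<And>h. h \<in> Rd d \<Longrightarrow> (\<forall>i<d. \<bar>h i\<bar> \<le> \<delta>) \<Longrightarrow> L1_norm d (\<lambda>x. g (vadd d x h) - g x) \<le> e"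
  shows "pairing d (\<lambda>x y. \<bar>g x - g y\<bar>) (mollifier d \<delta>) \<le> e"
proof -
  note mi = mollifier_integrable[OF \<delta>, of d]
  note [measurable] = borel_measurable_integrable[OF g] borel_measurable_integrable[OF mi]
  define F where "F = (\<lambda>(\<xi>, y). \<bar>g (vadd d \<xi> y) - g y\<bar> * mollifier d \<delta> \<xi>)"
  have N: "(\<integral>y. norm (F (\<xi>, y)) \<partial>lebesgue_Rd d) = L1_norm d (\<lambda>x. g (vadd d x \<xi>) - g x) * mollifier d \<delta> \<xi>" for \<xi>
    using mollifier_nonneg[OF \<delta>] by (simp add: F_def L1_norm_def abs_mult vadd_def add.commute)
  have L1b: "L1_norm d (\<lambda>x. g (vadd d x \<xi>) - g x) \<le> 2 * L1_norm d g" for \<xi>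
  proof -
    have "L1_norm d (\<lambda>x. g (vadd d x \<xi>) - g x) \<le> (\<integral>x. \<bar>g (vadd d x \<xi>)\<bar> + \<bar>g x\<bar> \<partial>lebesgue_Rd d)"
      unfolding L1_norm_def using g integrable_vadd[OF g, of \<xi>]
      by (intro integral_mono integrable_abs Bochner_Integration.integrable_diff Bochner_Integration.integrable_add) auto
    also have "\<dots> = 2 * L1_norm d g"
      using g integrable_vadd[OF g, of \<xi>] integral_vadd[of "\<lambda>x. \<bar>g x\<bar>" d \<xi>]
      by (simp add: L1_norm_def)
    finally show ?thesis .
  qed
  have Fm [measurable]: "F \<in> borel_measurable (lebesgue_Rd d \<Otimes>\<^sub>M lebesgue_Rd d)"
    unfolding F_def by measurable
  have Fi: "integrable (lebesgue_Rd d \<Otimes>\<^sub>M lebesgue_Rd d) F"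
  proof (rule lRR.Fubini_integrable[OF Fm])
    show "integrable (lebesgue_Rd d) (\<lambda>\<xi>. \<integral>y. norm (F (\<xi>, y)) \<partial>lebesgue_Rd d)"
    proof (rule Bochner_Integration.integrable_bound)
      show "integrable (lebesgue_Rd d) (\<lambda>\<xi>. 2 * L1_norm d g * mollifier d \<delta> \<xi>)" using mi by simp
      show "(\<lambda>\<xi>. \<integral>y. norm (F (\<xi>, y)) \<partial>lebesgue_Rd d) \<in> borel_measurable (lebesgue_Rd d)" by measurable
      show "AE \<xi> in lebesgue_Rd d. norm (\<integral>y. norm (F (\<xi>, y)) \<partial>lebesgue_Rd d) \<le> norm (2 * L1_norm d g * mollifier d \<delta> \<xi>)"
        unfolding N using L1b mollifier_nonneg[OF \<delta>]
        by (auto simp: abs_mult L1_norm_def intro!: mult_right_mono)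
    qed
    show "AE \<xi> in lebesgue_Rd d. integrable (lebesgue_Rd d) (\<lambda>y. F (\<xi>, y))"
    proof (intro AE_I2)
      fix \<xi>
      have "vadd d \<xi> y = vadd d y \<xi>" for y by (auto simp: vadd_def add.commute)
      then show "integrable (lebesgue_Rd d) (\<lambda>y. F (\<xi>, y))"
        using g integrable_vadd[OF g, of \<xi>] by (auto simp: F_def intro!: integrable_mult_left integrable_abs)
    qed
  qed
  have "pairing d (\<lambda>x y. \<bar>g x - g y\<bar>) (mollifier d \<delta>)
    = (\<integral>y. (\<integral>x. \<bar>g x - g y\<bar> * mollifier d \<delta> (vsub d x y) \<partial>lebesgue_Rd d) \<partial>lebesgue_Rd d)"
    by (rule pairing_snd[OF dominated_lip2[OF lip2_dist g g] mi])
  also have "\<dots> = (\<integral>y. (\<integral>\<xi>. F (\<xi>, y) \<partial>lebesgue_Rd d) \<partial>lebesgue_Rd d)"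
  proof (rule Bochner_Integration.integral_cong[OF refl])
    fix y assume y: "y \<in> space (lebesgue_Rd d)"
    have "(\<lambda>x. \<bar>g x - g y\<bar> * mollifier d \<delta> (vsub d x y)) \<in> borel_measurable (lebesgue_Rd d)"
      using y by measurable
    from integral_vadd[OF this, of y]
    have "(\<integral>x. \<bar>g x - g y\<bar> * mollifier d \<delta> (vsub d x y) \<partial>lebesgue_Rd d)
      = (\<integral>\<xi>. \<bar>g (vadd d \<xi> y) - g y\<bar> * mollifier d \<delta> (vsub d (vadd d \<xi> y) y) \<partial>lebesgue_Rd d)" by simp
    also have "\<dots> = (\<integral>\<xi>. F (\<xi>, y) \<partial>lebesgue_Rd d)"
      by (rule Bochner_Integration.integral_cong[OF refl])
        (simp add: F_def vadd_vsub_cancel space_lebesgue_Rd)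
    finally show "(\<integral>x. \<bar>g x - g y\<bar> * mollifier d \<delta> (vsub d x y) \<partial>lebesgue_Rd d) = (\<integral>\<xi>. F (\<xi>, y) \<partial>lebesgue_Rd d)" .
  qed
  also have "\<dots> = (\<integral>\<xi>. (\<integral>y. F (\<xi>, y) \<partial>lebesgue_Rd d) \<partial>lebesgue_Rd d)"
    using lRR.Fubini_integral[where f = "\<lambda>x y. F (x, y)"] Fi by simp
  also have "\<dots> \<le> (\<integral>\<xi>. e * mollifier d \<delta> \<xi> \<partial>lebesgue_Rd d)"
  proof (rule integral_mono)
    show "integrable (lebesgue_Rd d) (\<lambda>\<xi>. \<integral>y. F (\<xi>, y) \<partial>lebesgue_Rd d)"
      using lRR.integrable_fst'[OF Fi] .
    show "integrable (lebesgue_Rd d) (\<lambda>\<xi>. e * mollifier d \<delta> \<xi>)" using mi by simp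
    fix \<xi> assume "\<xi> \<in> space (lebesgue_Rd d)"
    then have \<xi>: "\<xi> \<in> Rd d" by (simp add: space_lebesgue_Rd)
    have "(\<integral>y. F (\<xi>, y) \<partial>lebesgue_Rd d) = L1_norm d (\<lambda>x. g (vadd d x \<xi>) - g x) * mollifier d \<delta> \<xi>"
      by (simp add: F_def L1_norm_def vadd_def add.commute)
    also have "\<dots> \<le> e * mollifier d \<delta> \<xi>"
    proof (cases "\<forall>i<d. \<bar>\<xi> i\<bar> \<le> \<delta>")
      case True
      then show ?thesis using b[OF \<xi>] mollifier_nonneg[OF \<delta>] by (intro mult_right_mono) auto
    next
      case False
      then show ?thesis using mollifier_support[OF \<delta>] by (auto simp: not_le)
    qed
    finally show "(\<integral>y. F (\<xi>, y) \<partial>lebesgue_Rd d) \<le> e * mollifier d \<delta> \<xi>" .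
  qed
  also have "\<dots> = e" using mollifier_integral[OF \<delta>] by simp
  finally show ?thesis .
qed

lemma mollify_tendsto:
  assumes g: "integrable (lebesgue_Rd d) g" and e: "0 < e"
  obtains \<delta>0 where "0 < \<delta>0"
    "\<And>\<delta>. 0 < \<delta> \<Longrightarrow> \<delta> \<le> \<delta>0 \<Longrightarrow> pairing d (\<lambda>x y. \<bar>g x - g y\<bar>) (mollifier d \<delta>) \<le> e"
proof -
  obtain \<rho> where \<rho>: "\<rho> > 0" "\<And>h. (\<forall>i<d. \<bar>h i\<bar> \<le> \<rho>) \<Longrightarrow>
     (\<integral>x. \<bar>g (vadd d x h) - g x\<bar> \<partial>lebesgue_Rd d) \<le> e"
    using integrable_translation_continuous[OF g] e unfolding translation_continuous_def by blast
  show thesis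
    by (rule that[OF \<rho>(1)]) (auto intro!: mollify_bound[OF g] \<rho>(2)[folded L1_norm_def] intro: order_trans)
qed

section \<open>Convolutions as test fields, and translates of functions of bounded variation\<close>

definition conv :: "nat \<Rightarrow> (nat \<Rightarrow> real \<Rightarrow> real) \<Rightarrow> ((nat \<Rightarrow> real) \<Rightarrow> real) \<Rightarrow> (nat \<Rightarrow> real) \<Rightarrow> real" where
  "conv d g \<sigma> x = (\<integral>y. prodf d g (\<lambda>i. x i - y i) * \<sigma> y \<partial>lebesgue_Rd d)"

context
  fixes d :: nat and \<sigma> :: "(nat \<Rightarrow> real) \<Rightarrow> real"
  assumes \<sigma>: "integrable (lebesgue_Rd d) \<sigma>"
begin

lemma conv_integrand_integrable:
  assumes g: "Ccs d g"
  shows "integrable (lebesgue_Rd d) (\<lambda>y. prodf d g (\<lambda>i. x i - y i) * \<sigma> y)"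
proof -
  obtain C where C: "0 \<le> C" "\<And>x. \<bar>prodf d g x\<bar> \<le> C" using g by (rule prodf_bounded) blast
  have m: "(\<lambda>y. prodf d g (\<lambda>i. x i - y i)) \<in> borel_measurable (lebesgue_Rd d)"
  proof -
    have "(\<lambda>y. prodf d g (\<lambda>i\<in>{..<d}. x i + (-1) * y i)) \<in> borel_measurable (lebesgue_Rd d)"
      by (rule prodf_measurable[OF g affine_measurable])
    moreover have "prodf d g (\<lambda>i\<in>{..<d}. x i + (-1) * y i) = prodf d g (\<lambda>i. x i - y i)" for y
      by (rule prodf_cong) simp
    ultimately show ?thesis by simp
  qed
  show ?thesis
  proof (rule Bochner_Integration.integrable_bound)
    show "integrable (lebesgue_Rd d) (\<lambda>y. C * \<sigma> y)" using \<sigma> by simp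
    show "AE y in lebesgue_Rd d. norm (prodf d g (\<lambda>i. x i - y i) * \<sigma> y) \<le> norm (C * \<sigma> y)"
      using C by (auto simp: abs_mult intro!: mult_right_mono)
    show "(\<lambda>y. prodf d g (\<lambda>i. x i - y i) * \<sigma> y) \<in> borel_measurable (lebesgue_Rd d)"
      using m \<sigma> by (intro borel_measurable_times) auto
  qed
qed

lemma conv_DERIV:
  assumes g: "Ccs d g" and i: "i < d"
  shows "((\<lambda>s. conv d g \<sigma> (x(i := s))) has_real_derivative conv d (g(i := deriv (g i))) \<sigma> (x(i := t))) (at t)"
proof -
  obtain C where C: "0 \<le> C" "\<And>x. \<bar>prodf d (g(i := deriv (g i))) x\<bar> \<le> C"
    using Ccs_deriv[OF g] by (rule prodf_bounded) blast
  show ?thesis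
    unfolding conv_def
  proof (rule leibniz_rule_lebesgue[where b = "\<lambda>y. C * \<bar>\<sigma> y\<bar>"])
  show "integrable (lebesgue_Rd d) (\<lambda>y. prodf d g (\<lambda>j. (x(i := s)) j - y j) * \<sigma> y)" for s
    by (rule conv_integrand_integrable[OF g])
  show "(\<lambda>y. prodf d (g(i := deriv (g i))) (\<lambda>j. (x(i := t)) j - y j) * \<sigma> y) \<in> borel_measurable (lebesgue_Rd d)"
    by (rule borel_measurable_integrable[OF conv_integrand_integrable[OF Ccs_deriv[OF g]]])
  show "integrable (lebesgue_Rd d) (\<lambda>y. C * \<bar>\<sigma> y\<bar>)" using \<sigma> by simp
  show "\<bar>prodf d (g(i := deriv (g i))) (\<lambda>j. (x(i := s)) j - y j) * \<sigma> y\<bar> \<le> C * \<bar>\<sigma> y\<bar>" for s y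
    using C by (auto simp: abs_mult intro!: mult_right_mono)
  fix s y
  define z :: "nat \<Rightarrow> real" where "z j = (if j = i then 1 else 0)" for j
  have "\<And>j. j < d \<Longrightarrow> smooth1 (g j)" using g CcD by (auto simp: Ccs_def)
  from prodf_line_DERIV[of d g "\<lambda>j. (x(i := 0)) j - y j" z s, OF this]
  have "((\<lambda>s. prodf d g (\<lambda>j. (x(i := 0)) j - y j + s * z j)) has_real_derivative
     (\<Sum>k<d. z k * dprodf d g k (\<lambda>j. (x(i := 0)) j - y j + s * z j))) (at s)" by blast
  moreover have "(\<lambda>j. (x(i := 0)) j - y j + s * z j) = (\<lambda>j. (x(i := s)) j - y j)" for s
    by (auto simp: z_def)
  moreover have "(\<Sum>k<d. z k * dprodf d g k (\<lambda>j. (x(i := s)) j - y j)) = dprodf d g i (\<lambda>j. (x(i := s)) j - y j)"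
    using i by (simp add: z_def if_distrib[of "\<lambda>c. c * _"] cong: if_cong)
  ultimately have "((\<lambda>s. prodf d g (\<lambda>j. (x(i := s)) j - y j)) has_real_derivative
      dprodf d g i (\<lambda>j. (x(i := s)) j - y j)) (at s)" by simp
  then show "((\<lambda>s. prodf d g (\<lambda>j. (x(i := s)) j - y j) * \<sigma> y) has_real_derivative
      prodf d (g(i := deriv (g i))) (\<lambda>j. (x(i := s)) j - y j) * \<sigma> y) (at s)"
    unfolding dprodf_def by (rule DERIV_cmult_right)
  qed
qed

lemma partial_conv:
  assumes "Ccs d g" "i < d" shows "partial i (conv d g \<sigma>) = conv d (g(i := deriv (g i))) \<sigma>"
proof
  fix x show "partial i (conv d g \<sigma>) x = conv d (g(i := deriv (g i))) \<sigma> x"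
    unfolding partial_def using DERIV_imp_deriv[OF conv_DERIV[OF assms, of x "x i"]] by simp
qed

lemma conv_lipschitz:
  assumes g: "Ccs d g"
  obtains C where "\<And>x y. \<bar>conv d g \<sigma> x - conv d g \<sigma> y\<bar> \<le> C * (\<Sum>i<d. \<bar>x i - y i\<bar>)"
proof -
  obtain C where C: "0 \<le> C" "\<And>x y. \<bar>prodf d g x - prodf d g y\<bar> \<le> C * (\<Sum>i<d. \<bar>x i - y i\<bar>)"
    using g by (rule prodf_lipschitz) blast
  show thesis
  proof (rule that[of "C * (\<integral>y. \<bar>\<sigma> y\<bar> \<partial>lebesgue_Rd d)"])
    fix x x' :: "nat \<Rightarrow> real"
    let ?S = "\<Sum>i<d. \<bar>x i - x' i\<bar>"
    note i = conv_integrand_integrable[OF g]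
    have "\<bar>conv d g \<sigma> x - conv d g \<sigma> x'\<bar>
      = \<bar>\<integral>y. prodf d g (\<lambda>i. x i - y i) * \<sigma> y - prodf d g (\<lambda>i. x' i - y i) * \<sigma> y \<partial>lebesgue_Rd d\<bar>"
      unfolding conv_def by (simp add: i)
    also have "\<dots> \<le> (\<integral>y. \<bar>prodf d g (\<lambda>i. x i - y i) * \<sigma> y - prodf d g (\<lambda>i. x' i - y i) * \<sigma> y\<bar> \<partial>lebesgue_Rd d)"
      by (rule integral_abs_bound)
    also have "\<dots> \<le> (\<integral>y. (C * ?S) * \<bar>\<sigma> y\<bar> \<partial>lebesgue_Rd d)"
    proof (rule integral_mono)
      show "integrable (lebesgue_Rd d) (\<lambda>y. \<bar>prodf d g (\<lambda>i. x i - y i) * \<sigma> y - prodf d g (\<lambda>i. x' i - y i) * \<sigma> y\<bar>)"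
        by (intro integrable_abs Bochner_Integration.integrable_diff i)
      show "integrable (lebesgue_Rd d) (\<lambda>y. (C * ?S) * \<bar>\<sigma> y\<bar>)" using \<sigma> by simp
      fix y
      have "\<bar>prodf d g (\<lambda>i. x i - y i) - prodf d g (\<lambda>i. x' i - y i)\<bar> \<le> C * ?S"
        using C(2)[of "\<lambda>i. x i - y i" "\<lambda>i. x' i - y i"] by simp
      then show "\<bar>prodf d g (\<lambda>i. x i - y i) * \<sigma> y - prodf d g (\<lambda>i. x' i - y i) * \<sigma> y\<bar> \<le> (C * ?S) * \<bar>\<sigma> y\<bar>"
        unfolding left_diff_distrib[symmetric] abs_mult by (intro mult_right_mono) auto
    qed
    also have "\<dots> = (C * (\<integral>y. \<bar>\<sigma> y\<bar> \<partial>lebesgue_Rd d)) * ?S" by simp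
    finally show "\<bar>conv d g \<sigma> x - conv d g \<sigma> x'\<bar> \<le> (C * (\<integral>y. \<bar>\<sigma> y\<bar> \<partial>lebesgue_Rd d)) * ?S" .
  qed
qed

lemma foldr_partial_conv:
  assumes "Ccs d g" "set is \<subseteq> {..<d}"
  shows "\<exists>g'. Ccs d g' \<and> foldr partial is (conv d g \<sigma>) = conv d g' \<sigma>"
  using assms(2)
proof (induction "is")
  case (Cons i "is")
  then obtain g' where g': "Ccs d g'" "foldr partial is (conv d g \<sigma>) = conv d g' \<sigma>" by auto
  have "partial i (conv d g' \<sigma>) = conv d (g'(i := deriv (g' i))) \<sigma>"
    using Cons.prems g'(1) by (intro partial_conv) auto
  then show ?case using Ccs_deriv[OF g'(1), of i] g'(2) by auto
qed (use assms in auto)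

lemma test_fun_conv:
  assumes g: "Ccs d g" and supp: "\<And>y. y \<notin> cube d R \<Longrightarrow> \<sigma> y = 0"
  shows "test_fun d (conv d g \<sigma>)"
  unfolding test_fun_def smooth_def
proof (intro conjI allI impI ballI)
  fix "is" assume "set is \<subseteq> {..<d}"
  then obtain g' where g': "Ccs d g'" "foldr partial is (conv d g \<sigma>) = conv d g' \<sigma>"
    using foldr_partial_conv[OF g] by blast
  obtain C where "\<And>x y. \<bar>conv d g' \<sigma> x - conv d g' \<sigma> y\<bar> \<le> C * (\<Sum>i<d. \<bar>x i - y i\<bar>)"
    using g'(1) by (rule conv_lipschitz) blast
  then show "continuous_on (Rd d) (foldr partial is (conv d g \<sigma>))"
    unfolding g'(2) by (intro continuous_on_component_lipschitz)
  fix i x assume "i < d"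
  then show "(\<lambda>s. foldr partial is (conv d g \<sigma>) (x(i := s))) differentiable at (x i)"
    unfolding g'(2) using conv_DERIV[OF g'(1)] real_differentiable_def by blast
next
  obtain S where S: "0 < S" "\<And>x i. i < d \<Longrightarrow> S < \<bar>x i\<bar> \<Longrightarrow> prodf d g x = 0"
    using g by (rule prodf_support) blast
  show "compact (closure {x \<in> Rd d. conv d g \<sigma> x \<noteq> 0})"
  proof (rule compact_support_Rd[of d "R + S"])
    fix x i assume i: "i < d" and x: "R + S < \<bar>x i\<bar>"
    have "prodf d g (\<lambda>i. x i - y i) * \<sigma> y = 0" for y
    proof (cases "y \<in> cube d R")
      case True
      then have "y i \<in> {-R..R}" using i by (auto simp: cube_def PiE_iff)
      then have "S < \<bar>x i - y i\<bar>" using x by auto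
      then show ?thesis using S(2)[OF i, of "\<lambda>i. x i - y i"] by simp
    qed (simp add: supp)
    then have "(\<lambda>y. prodf d g (\<lambda>i. x i - y i) * \<sigma> y) = (\<lambda>_. 0)" by (rule ext)
    then show "conv d g \<sigma> x = 0" unfolding conv_def by (simp only:) simp
  qed
qed

end

lemma deriv_shift: "smooth1 g \<Longrightarrow> deriv (\<lambda>t. g (t - c)) = (\<lambda>t. deriv g (t - c))"
proof
  fix t assume g: "smooth1 g"
  have "((\<lambda>t. t - c) has_real_derivative 1) (at t)" by (auto intro!: derivative_eq_intros)
  from DERIV_chain2[OF smooth1_DERIV[OF g] this]
  show "deriv (\<lambda>t. g (t - c)) t = deriv g (t - c)" by (intro DERIV_imp_deriv) simp
qed

lemma dprodf_shift:
  assumes "i < d" "smooth1 (g i)"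
  shows "dprodf d (\<lambda>i t. g i (t - c i)) i \<xi> = dprodf d g i (\<lambda>i. \<xi> i - c i)"
  unfolding dprodf_def prodf_split[OF assms(1)] using assms(2)
  by (auto simp: deriv_shift intro!: prod.cong)

text \<open>The zero field is admissible, so the supremum is nonnegative; being also finite, it is
  not distorted by \<open>real_of_ereal\<close>. The zero test function is obtained as a convolution
  with the zero density.\<close>

lemma BV_total_variation:
  assumes "BV d u"
  shows "total_variation d u = ereal (real_of_ereal (total_variation d u))"
    and "0 \<le> real_of_ereal (total_variation d u)"
    and "\<And>\<psi>. (\<And>i. i < d \<Longrightarrow> test_fun d (\<lambda>x. \<psi> x i)) \<Longrightarrow> (\<And>x. x \<in> Rd d \<Longrightarrow> vnorm d (\<psi> x) \<le> 1) \<Longrightarrow>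
       (\<integral>x. u x * (\<Sum>i<d. partial i (\<lambda>y. \<psi> y i) x) \<partial>lebesgue_Rd d) \<le> real_of_ereal (total_variation d u)"
proof -
  have up: "ereal (\<integral>x. u x * (\<Sum>i<d. partial i (\<lambda>y. \<psi> y i) x) \<partial>lebesgue_Rd d) \<le> total_variation d u"
    if "\<And>i. i < d \<Longrightarrow> test_fun d (\<lambda>x. \<psi> x i)" "\<And>x. x \<in> Rd d \<Longrightarrow> vnorm d (\<psi> x) \<le> 1" for \<psi>
    unfolding total_variation_def by (rule SUP_upper) (use that in auto)
  have "test_fun d (\<lambda>x. 0)"
    using test_fun_conv[of d "\<lambda>_. 0" "\<lambda>_. scaled_bump 1" 0] mollifier_Ccs[of 1 d]
    by (simp add: conv_def[abs_def])
  moreover have "vnorm d (\<lambda>i. 0) \<le> 1" by (simp add: L2_set_def)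
  moreover have "partial i (\<lambda>y. 0) x = 0" for i x by (simp add: partial_def)
  ultimately have nn: "0 \<le> total_variation d u"
    using up[of "\<lambda>_ _. 0"] by (simp add: zero_ereal_def)
  have "total_variation d u < \<infinity>" using assms by (simp add: BV_def)
  then show e: "total_variation d u = ereal (real_of_ereal (total_variation d u))"
    using nn by (cases "total_variation d u") auto
  show "0 \<le> real_of_ereal (total_variation d u)" using nn by (simp add: real_of_ereal_pos)
  show "(\<integral>x. u x * (\<Sum>i<d. partial i (\<lambda>y. \<psi> y i) x) \<partial>lebesgue_Rd d) \<le> real_of_ereal (total_variation d u)"
    if "\<And>i. i < d \<Longrightarrow> test_fun d (\<lambda>x. \<psi> x i)" "\<And>x. x \<in> Rd d \<Longrightarrow> vnorm d (\<psi> x) \<le> 1" for \<psi>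
  proof -
    have "ereal (\<integral>x. u x * (\<Sum>i<d. partial i (\<lambda>y. \<psi> y i) x) \<partial>lebesgue_Rd d) \<le> total_variation d u"
      using that by (rule up)
    then show ?thesis by (subst (asm) e) simp
  qed
qed

lemma vnorm_scaled_le:
  assumes "0 < vnorm d h" "\<bar>a\<bar> \<le> 1"
  shows "vnorm d (\<lambda>i. - (h i / vnorm d h) * a) \<le> 1"
proof -
  have "vnorm d (\<lambda>i. - (h i / vnorm d h) * a) = sqrt (\<Sum>i<d. (a / vnorm d h)\<^sup>2 * (h i)\<^sup>2)"
    unfolding L2_set_def by (intro arg_cong[where f = sqrt] sum.cong refl) (simp add: power_mult_distrib power_divide)
  also have "\<dots> = \<bar>a / vnorm d h\<bar> * vnorm d h"
    unfolding sum_distrib_left[symmetric] real_sqrt_mult by (simp add: L2_set_def)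
  also have "\<dots> = \<bar>a\<bar>" using assms(1) by simp
  finally show ?thesis using assms(2) by simp
qed

text \<open>Links the two pictures: pairing u x \<sigma> y with a kernel is integrating u against
  the convolution of \<sigma>, so a derivative of the pairing becomes u tested with a
  divergence.\<close>

lemma pairing_conv:
  assumes u: "integrable (lebesgue_Rd d) u" and \<sigma>: "integrable (lebesgue_Rd d) \<sigma>" "\<And>y. \<bar>\<sigma> y\<bar> \<le> 1"
    and g: "Ccs d g"
  shows "dominated d (\<lambda>x y. u x * \<sigma> y) (\<lambda>x. \<bar>u x\<bar>) (\<lambda>_. 0)"
    and "pairing d (\<lambda>x y. u x * \<sigma> y) (prodf d g) = (\<integral>x. u x * conv d g \<sigma> x \<partial>lebesgue_Rd d)"
    and "integrable (lebesgue_Rd d) (\<lambda>x. u x * conv d g \<sigma> x)"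
proof -
  note [measurable] = borel_measurable_integrable[OF u] borel_measurable_integrable[OF \<sigma>(1)]
  show dom: "dominated d (\<lambda>x y. u x * \<sigma> y) (\<lambda>x. \<bar>u x\<bar>) (\<lambda>_. 0)"
    unfolding dominated_def using u \<sigma>(2) by (auto simp: abs_mult intro: mult_left_le)
  have c: "(\<integral>y. u x * \<sigma> y * prodf d g (vsub d x y) \<partial>lebesgue_Rd d) = u x * conv d g \<sigma> x" for x
  proof -
    have "prodf d g (vsub d x y) = prodf d g (\<lambda>i. x i - y i)" for y
      by (rule prodf_cong) (simp add: vsub_def)
    then have "u x * \<sigma> y * prodf d g (vsub d x y) = u x * (prodf d g (\<lambda>i. x i - y i) * \<sigma> y)" for y by simp
    then have "(\<integral>y. u x * \<sigma> y * prodf d g (vsub d x y) \<partial>lebesgue_Rd d)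
      = (\<integral>y. u x * (prodf d g (\<lambda>i. x i - y i) * \<sigma> y) \<partial>lebesgue_Rd d)"
      by (intro Bochner_Integration.integral_cong refl)
    then show ?thesis unfolding conv_def by simp
  qed
  show "pairing d (\<lambda>x y. u x * \<sigma> y) (prodf d g) = (\<integral>x. u x * conv d g \<sigma> x \<partial>lebesgue_Rd d)"
    unfolding pairing_fst[OF dom prodf_integrable[OF g]] c ..
  have "integrable (lebesgue_Rd d) (\<lambda>x. \<integral>y. (case (x, y) of (x, y) \<Rightarrow> u x * \<sigma> y * prodf d g (vsub d x y)) \<partial>lebesgue_Rd d)"
    by (rule lRR.integrable_fst'[OF pairing_integrable[OF dom prodf_integrable[OF g]]])
  then show "integrable (lebesgue_Rd d) (\<lambda>x. u x * conv d g \<sigma> x)" by (simp add: c)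
qed

lemma conv_cmult: "conv d g (\<lambda>y. c * \<sigma> y) x = c * conv d g \<sigma> x"
  unfolding conv_def by (simp add: mult.left_commute[of _ c])

(* The sign of u (x + h) - u x, cut off to a cube and mollified, times a unit vector along h is an
   admissible field in the definition of the total variation. *)

lemma BV_translation:
  assumes BV: "BV d u" and h: "h \<in> Rd d"
  shows "L1_norm d (\<lambda>x. u (vadd d x h) - u x) \<le> vnorm d h * real_of_ereal (total_variation d u)"
proof -
  define V where "V = real_of_ereal (total_variation d u)"
  note TV = BV_total_variation[OF BV, folded V_def]
  have u: "integrable (lebesgue_Rd d) u" using BV by (simp add: BV_def)
  define g where "g x = u (vadd d x h) - u x" for x
  have g: "integrable (lebesgue_Rd d) g" unfolding g_def using integrable_vadd[OF u] u by simp
  \<comment> \<open>The cube makes the sign function integrable. The last term is the price for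
    mollifying the sign; it disappears as \<delta> tends to 0 by \<open>mollify_tendsto\<close>,
    after which the cube exhausts the space.\<close>
  have main: "(\<integral>x. \<bar>g x\<bar> * indicator (cube d n) x \<partial>lebesgue_Rd d)
      \<le> vnorm d h * V + pairing d (\<lambda>x y. \<bar>g x - g y\<bar>) (mollifier d \<delta>)" if \<delta>: "0 < \<delta>" for \<delta> n
  proof -
    define \<sigma> where "\<sigma> y = sgn (g y) * indicator (cube d n) y" for y
    have \<sigma>b: "\<bar>\<sigma> y\<bar> \<le> 1" for y by (simp add: \<sigma>_def indicator_def sgn_if)
    have [measurable]: "g \<in> borel_measurable (lebesgue_Rd d)" using g by simp
    have \<sigma>m [measurable]: "\<sigma> \<in> borel_measurable (lebesgue_Rd d)" unfolding \<sigma>_def by measurable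
    have \<sigma>i: "integrable (lebesgue_Rd d) \<sigma>"
      by (rule Bochner_Integration.integrable_bound[OF cube_integrable[of d n]])
        (auto simp: \<sigma>_def indicator_def sgn_if)
    let ?W = "\<lambda>x y. u x * \<sigma> y"
    note mC = mollifier_Ccs[OF \<delta>, of d]
    note dom = pairing_conv(1)[OF u \<sigma>i \<sigma>b mC]
    \<comment> \<open>Transports the kernel along h. At s = 0 the pairing contains u x, at s = 1 it
      contains u (x + h), and the derivative in between is u tested with the divergence of a field
      parallel to h.\<close>
    define p where "p s = pairing d ?W (\<lambda>\<xi>. mollifier d \<delta> (\<lambda>i. \<xi> i + s * (- h i)))" for s
    define p' where "p' s = (\<Sum>i<d. - h i * pairing d ?W (\<lambda>\<xi>. dmollifier d \<delta> i (\<lambda>i. \<xi> i + s * (- h i))))" for s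
    have pD: "(p has_real_derivative p' s) (at s)" for s
      unfolding p_def[abs_def] p'_def by (rule pairing_prodf_DERIV[OF dom mC])
    have p'b: "p' s \<le> vnorm d h * V" for s
    proof (cases "vnorm d h = 0")
      case True
      then have "h i = 0" if "i < d" for i using that by (simp add: L2_set_eq_0_iff)
      then show ?thesis using True by (simp add: p'_def)
    next
      case False
      then have N: "0 < vnorm d h" using L2_set_nonneg[of h "{..<d}"] by linarith
      define gs where "gs = (\<lambda>i t. scaled_bump \<delta> (t - s * h i))"
      have gs: "Ccs d gs" unfolding gs_def by (rule Ccs_shift[OF mC])
      have pi: "pairing d ?W (\<lambda>\<xi>. dmollifier d \<delta> i (\<lambda>i. \<xi> i + s * (- h i)))
         = (\<integral>x. u x * partial i (conv d gs \<sigma>) x \<partial>lebesgue_Rd d)" if i: "i < d" for i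
      proof -
        have "(\<lambda>\<xi>. dmollifier d \<delta> i (\<lambda>i. \<xi> i + s * (- h i))) = prodf d (gs(i := deriv (gs i)))"
          using dprodf_shift[OF i, of "\<lambda>_. scaled_bump \<delta>" "\<lambda>i. s * h i"] CcD[OF scaled_bump_Cc[OF \<delta>]]
          unfolding dprodf_def gs_def by auto
        then show ?thesis
          using pairing_conv(2)[OF u \<sigma>i \<sigma>b Ccs_deriv[OF gs]] partial_conv[OF \<sigma>i gs i] by simp
      qed
      \<comment> \<open>The minus sign matches the direction in which p transports the kernel: the
        divergence of \<psi> tested with u gives p' s / |h|. Admissibility holds because an average
        of values in [-1,1] multiplies a unit vector.\<close>
      define \<psi> where "\<psi> x i = - (h i / vnorm d h) * conv d gs \<sigma> x" for x i
      have \<psi>c: "(\<lambda>x. \<psi> x i) = conv d gs (\<lambda>y. - (h i / vnorm d h) * \<sigma> y)" for i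
        unfolding \<psi>_def conv_cmult ..
      have pp: "partial i (\<lambda>x. \<psi> x i) x = - (h i / vnorm d h) * partial i (conv d gs \<sigma>) x" if "i < d" for i x
        unfolding \<psi>c using partial_conv[OF _ gs that] \<sigma>i by (simp only: partial_conv[OF \<sigma>i gs that] partial_conv[OF integrable_mult_right gs that] conv_cmult)
      have "(\<integral>x. u x * (\<Sum>i<d. partial i (\<lambda>y. \<psi> y i) x) \<partial>lebesgue_Rd d) \<le> V"
      proof (rule TV(3))
        show "test_fun d (\<lambda>x. \<psi> x i)" for i
          unfolding \<psi>c using gs
          by (intro test_fun_conv[where R = n] integrable_mult_right \<sigma>i) (auto simp: \<sigma>_def)
        fix x
        have "\<bar>conv d gs \<sigma> x\<bar> \<le> 1"
        proof -
          have gsn: "0 \<le> prodf d gs y" for y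
            unfolding prodf_def gs_def by (intro prod_nonneg) (simp add: scaled_bump_nonneg[OF \<delta>])
          have pe: "prodf d gs (\<lambda>i. x i - y i) = prodf d gs (vsub d x y)" for y
            by (rule prodf_cong) (simp add: vsub_def)
          have "\<bar>conv d gs \<sigma> x\<bar> \<le> (\<integral>y. \<bar>prodf d gs (\<lambda>i. x i - y i) * \<sigma> y\<bar> \<partial>lebesgue_Rd d)"
            unfolding conv_def by (rule integral_abs_bound)
          also have "\<dots> \<le> (\<integral>y. prodf d gs (vsub d x y) \<partial>lebesgue_Rd d)"
          proof (rule integral_mono)
            show "integrable (lebesgue_Rd d) (\<lambda>y. \<bar>prodf d gs (\<lambda>i. x i - y i) * \<sigma> y\<bar>)"
              by (rule integrable_abs[OF conv_integrand_integrable[OF \<sigma>i gs]])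
            show "integrable (lebesgue_Rd d) (\<lambda>y. prodf d gs (vsub d x y))"
              by (rule integrable_vsub_left[OF prodf_integrable[OF gs]])
            show "\<bar>prodf d gs (\<lambda>i. x i - y i) * \<sigma> y\<bar> \<le> prodf d gs (vsub d x y)" for y
              unfolding abs_mult pe using gsn \<sigma>b by (simp add: mult_left_le)
          qed
          also have "\<dots> = (\<integral>y. prodf d gs y \<partial>lebesgue_Rd d)"
            by (rule integral_vsub_left) (use prodf_integrable[OF gs] in auto)
          also have "\<dots> = (\<integral>\<xi>. mollifier d \<delta> (vsub d \<xi> (\<lambda>i. s * h i)) \<partial>lebesgue_Rd d)"
            by (intro Bochner_Integration.integral_cong refl) (auto simp: prodf_def gs_def vsub_def)
          also have "\<dots> = 1"
            using integral_vsub_right[of "mollifier d \<delta>" d] mollifier_integrable[OF \<delta>] mollifier_integral[OF \<delta>] by auto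
          finally show ?thesis .
        qed
        then show "vnorm d (\<psi> x) \<le> 1" unfolding \<psi>_def by (rule vnorm_scaled_le[OF N])
      qed
      also have "(\<integral>x. u x * (\<Sum>i<d. partial i (\<lambda>y. \<psi> y i) x) \<partial>lebesgue_Rd d)
        = (\<integral>x. (\<Sum>i<d. - (h i / vnorm d h) * (u x * partial i (conv d gs \<sigma>) x)) \<partial>lebesgue_Rd d)"
        by (intro Bochner_Integration.integral_cong refl) (simp add: pp sum_distrib_left mult.left_commute)
      also have "\<dots> = (\<Sum>i<d. - (h i / vnorm d h) * (\<integral>x. u x * partial i (conv d gs \<sigma>) x \<partial>lebesgue_Rd d))"
        using pairing_conv(3)[OF u \<sigma>i \<sigma>b Ccs_deriv[OF gs]] partial_conv[OF \<sigma>i gs]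
        by (subst Bochner_Integration.integral_sum) (auto intro!: integrable_mult_right)
      also have "\<dots> = p' s / vnorm d h"
        unfolding p'_def sum_divide_distrib
      proof (intro sum.cong refl)
        fix i assume "i \<in> {..<d}"
        then have i: "i < d" by simp
        show "- (h i / vnorm d h) * (\<integral>x. u x * partial i (conv d gs \<sigma>) x \<partial>lebesgue_Rd d)
          = - h i * pairing d ?W (\<lambda>\<xi>. dmollifier d \<delta> i (\<lambda>i. \<xi> i + s * (- h i))) / vnorm d h"
          unfolding pi[OF i] by simp
      qed
      finally show ?thesis using N by (simp add: field_simps)
    qed
    obtain c where c: "p 1 - p 0 = (1 - 0) * p' c" using MVT2[of 0 1 p p'] pD by auto
    have "p 1 = pairing d ?W (\<lambda>\<xi>. mollifier d \<delta> (vsub d \<xi> h))"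
      unfolding p_def by (intro arg_cong[where f = "pairing d ?W"] ext prodf_cong) (simp add: vsub_def)
    also have "\<dots> = pairing d (\<lambda>x y. u (vadd d x h) * \<sigma> y) (mollifier d \<delta>)"
      by (rule pairing_shift_left(1)[OF dom mollifier_integrable[OF \<delta>]])
    finally have p1: "p 1 = pairing d (\<lambda>x y. u (vadd d x h) * \<sigma> y) (mollifier d \<delta>)" .
    have p0: "p 0 = pairing d ?W (mollifier d \<delta>)" by (simp add: p_def)
    have "p 1 - p 0 = pairing d (\<lambda>x y. g x * \<sigma> y) (mollifier d \<delta>)"
      unfolding p1 p0 pairing_diff_left[OF pairing_shift_left(2)[OF dom mollifier_integrable[OF \<delta>]] dom mollifier_integrable[OF \<delta>]]
      by (simp add: g_def left_diff_distrib)
    then have 1: "pairing d (\<lambda>x y. g x * \<sigma> y) (mollifier d \<delta>) \<le> vnorm d h * V"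
      using c p'b[of c] by simp
    have gs_eq: "g y * \<sigma> y = \<bar>g y\<bar> * indicator (cube d n) y" for y
      by (simp add: \<sigma>_def sgn_if)
    have gsi: "integrable (lebesgue_Rd d) (\<lambda>y. g y * \<sigma> y)"
      unfolding gs_eq using integrable_mult_indicator[OF cube_sets[of d n] integrable_abs[OF g]]
      by (simp add: mult.commute)
    have "(\<integral>x. \<bar>g x\<bar> * indicator (cube d n) x \<partial>lebesgue_Rd d) = pairing d (\<lambda>x y. g y * \<sigma> y) (mollifier d \<delta>)"
      using pairing_snd_only[OF gsi mollifier_integrable[OF \<delta>]] mollifier_integral[OF \<delta>]
      by (simp add: gs_eq)
    also have "\<dots> \<le> pairing d (\<lambda>x y. g x * \<sigma> y + \<bar>g x - g y\<bar>) (mollifier d \<delta>)"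
    proof (rule pairing_mono)
      show "dominated d (\<lambda>x y. g y * \<sigma> y) (\<lambda>_. 0) (\<lambda>y. \<bar>g y * \<sigma> y\<bar>)"
        using gsi by (auto simp: dominated_def)
      show "dominated d (\<lambda>x y. g x * \<sigma> y + \<bar>g x - g y\<bar>) (\<lambda>x. \<bar>g x\<bar> + 1 * \<bar>g x\<bar>) (\<lambda>y. 0 + 1 * \<bar>g y\<bar>)"
        by (rule dominated_add[OF pairing_conv(1)[OF g \<sigma>i \<sigma>b mC] dominated_lip2[OF lip2_dist g g]])
      fix x y
      have "(g y - g x) * \<sigma> y \<le> \<bar>g x - g y\<bar>"
        using \<sigma>b[of y] abs_ge_self[of "(g y - g x) * \<sigma> y"] mult_left_le[of "\<bar>\<sigma> y\<bar>" "\<bar>g y - g x\<bar>"]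
        by (simp add: abs_mult abs_minus_commute)
      then show "g y * \<sigma> y \<le> g x * \<sigma> y + \<bar>g x - g y\<bar>" by (simp add: left_diff_distrib)
    qed (use mollifier_nonneg[OF \<delta>] mollifier_integrable[OF \<delta>] in auto)
    also have "\<dots> = pairing d (\<lambda>x y. g x * \<sigma> y) (mollifier d \<delta>) + pairing d (\<lambda>x y. \<bar>g x - g y\<bar>) (mollifier d \<delta>)"
      by (rule pairing_add_left[OF pairing_conv(1)[OF g \<sigma>i \<sigma>b mC] dominated_lip2[OF lip2_dist g g] mollifier_integrable[OF \<delta>]])
    finally show ?thesis using 1 by simp
  qed
  have "(\<integral>x. \<bar>g x\<bar> * indicator (cube d n) x \<partial>lebesgue_Rd d) \<le> vnorm d h * V" for n
  proof (rule field_le_epsilon)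
    fix e :: real assume "0 < e"
    then obtain \<delta> where "0 < \<delta>" "pairing d (\<lambda>x y. \<bar>g x - g y\<bar>) (mollifier d \<delta>) \<le> e"
      using mollify_tendsto[OF g] by (metis order_refl)
    then show "(\<integral>x. \<bar>g x\<bar> * indicator (cube d n) x \<partial>lebesgue_Rd d) \<le> vnorm d h * V + e"
      using main[of \<delta> n] by linarith
  qed
  moreover have "(\<lambda>n. \<integral>x. \<bar>g x\<bar> * indicator (cube d (real n)) x \<partial>lebesgue_Rd d) \<longlonglongrightarrow> (\<integral>x. \<bar>g x\<bar> \<partial>lebesgue_Rd d)"
  proof (rule integral_dominated_convergence[where w = "\<lambda>x. \<bar>g x\<bar>"])
    show "AE x in lebesgue_Rd d. (\<lambda>n. \<bar>g x\<bar> * indicator (cube d (real n)) x) \<longlonglongrightarrow> \<bar>g x\<bar>"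
    proof (intro AE_I2 tendsto_eventually)
      fix x assume "x \<in> space (lebesgue_Rd d)"
      then have "eventually (\<lambda>n. x \<in> cube d (real n)) sequentially"
        by (intro Rd_exhaust_cube) (simp add: space_lebesgue_Rd)
      then show "eventually (\<lambda>n. \<bar>g x\<bar> * indicator (cube d (real n)) x = \<bar>g x\<bar>) sequentially"
        by eventually_elim simp
    qed
  qed (use g in \<open>auto simp: indicator_def\<close>)
  ultimately have "(\<integral>x. \<bar>g x\<bar> \<partial>lebesgue_Rd d) \<le> vnorm d h * V"
    by (intro LIMSEQ_le_const2) blast+
  then show ?thesis by (simp add: L1_norm_def g_def V_def)
qed

lemma vnorm_le_sqrt:
  assumes "\<And>i. i < d \<Longrightarrow> \<bar>h i\<bar> \<le> \<delta>" "0 \<le> \<delta>" shows "vnorm d h \<le> sqrt (real d) * \<delta>"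
proof -
  have "(\<Sum>i<d. (h i)\<^sup>2) \<le> (\<Sum>i<d. \<delta>\<^sup>2)"
    using assms by (intro sum_mono) (simp add: abs_le_square_iff[symmetric])
  then have "vnorm d h \<le> sqrt (real d * \<delta>\<^sup>2)" unfolding L2_set_def by simp
  then show ?thesis using assms(2) by (simp add: real_sqrt_mult)
qed

text \<open>Cauchy-Schwarz; the source of the factor sqrt d in the estimate of the near
  jumps.\<close>

lemma sum_abs_le_vnorm: "(\<Sum>i<d. \<bar>z i\<bar>) \<le> sqrt (real d) * vnorm d z"
  using L2_set_mult_ineq[of "\<lambda>_. 1" z "{..<d}"] by (simp add: L2_set_def)

lemma mollify_bound_lipschitz:
  assumes w: "integrable (lebesgue_Rd d) w" and V: "0 \<le> V"
    and b: "\<And>h. h \<in> Rd d \<Longrightarrow> L1_norm d (\<lambda>x. w (vadd d x h) - w x) \<le> vnorm d h * V" and \<delta>: "0 < \<delta>"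
  shows "pairing d (\<lambda>x y. \<bar>w x - w y\<bar>) (mollifier d \<delta>) \<le> sqrt (real d) * \<delta> * V"
proof (rule mollify_bound[OF w \<delta>])
  fix h assume h: "h \<in> Rd d" "\<forall>i<d. \<bar>h i\<bar> \<le> \<delta>"
  have "vnorm d h * V \<le> sqrt (real d) * \<delta> * V"
    using h(2) \<delta> V by (intro mult_right_mono vnorm_le_sqrt) auto
  then show "L1_norm d (\<lambda>x. w (vadd d x h) - w x) \<le> sqrt (real d) * \<delta> * V"
    using b[OF h(1)] by linarith
qed

section \<open>The nonlocal operator on kernels\<close>

locale levy_space =
  fixes d :: nat and \<mu> :: "(nat \<Rightarrow> real) measure"
  assumes levy: "levy_measure d \<mu>"
begin

lemma space_levy: "space \<mu> = Rd d - {vzero d}"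
  using levy by (simp add: levy_measure_def)

lemma levy_ident [measurable]: "(\<lambda>z. z) \<in> \<mu> \<rightarrow>\<^sub>M lebesgue_Rd d"
proof -
  have "sets \<mu> = sets (restrict_space (lebesgue_Rd d) (Rd d - {vzero d}))"
    using levy by (simp add: levy_measure_def)
  then show ?thesis by (subst measurable_cong_sets[OF _ refl]) (auto intro: measurable_restrict_space1)
qed

lemma vnorm_levy_measurable [measurable]: "vnorm d \<in> borel_measurable \<mu>"
  using vnorm_measurable[OF levy_ident] by simp

lemma vnorm_pos: "z \<in> space \<mu> \<Longrightarrow> 0 < vnorm d z"
proof -
  assume z: "z \<in> space \<mu>"
  have "vnorm d z \<noteq> 0"
  proof
    assume "vnorm d z = 0"
    then have "z = vzero d" using z by (auto simp: L2_set_eq_0_iff space_levy vzero_def Rd_def PiE_iff extensional_def)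
    then show False using z by (simp add: space_levy)
  qed
  then show ?thesis using L2_set_nonneg[of z "{..<d}"] by linarith
qed

lemma min_integrable: "integrable \<mu> (\<lambda>z. min ((vnorm d z)\<^sup>2) 1)"
proof (rule integrableI_bounded)
  show "(\<integral>\<^sup>+ z. ennreal (norm (min ((vnorm d z)\<^sup>2) 1)) \<partial>\<mu>) < \<infinity>"
    using levy by (simp add: levy_measure_def)
qed measurable

lemma near_integrable: "integrable \<mu> (\<lambda>z. indicator {z. vnorm d z \<le> r} z * (vnorm d z)\<^sup>2)"
proof (rule Bochner_Integration.integrable_bound)
  show "integrable \<mu> (\<lambda>z. max (r\<^sup>2) 1 * min ((vnorm d z)\<^sup>2) 1)" using min_integrable by simp
  show "AE z in \<mu>. norm (indicator {z. vnorm d z \<le> r} z * (vnorm d z)\<^sup>2) \<le> norm (max (r\<^sup>2) 1 * min ((vnorm d z)\<^sup>2) 1)"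
  proof (intro AE_I2)
    fix z
    have "(vnorm d z)\<^sup>2 \<le> max (r\<^sup>2) 1 * min ((vnorm d z)\<^sup>2) 1" if "vnorm d z \<le> r"
    proof -
      have "(vnorm d z)\<^sup>2 \<le> r\<^sup>2" using that L2_set_nonneg[of z "{..<d}"] by (intro power_mono) auto
      moreover have "1 * (vnorm d z)\<^sup>2 \<le> max (r\<^sup>2) 1 * (vnorm d z)\<^sup>2" by (intro mult_right_mono) auto
      ultimately show ?thesis by (auto simp: min_def le_max_iff_disj)
    qed
    then show "norm (indicator {z. vnorm d z \<le> r} z * (vnorm d z)\<^sup>2) \<le> norm (max (r\<^sup>2) 1 * min ((vnorm d z)\<^sup>2) 1)"
      by (auto simp: indicator_def abs_mult)
  qed
qed measurable

lemma far_integrable: assumes "0 < r" shows "integrable \<mu> (\<lambda>z. indicator {z. r < vnorm d z} z :: real)"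
proof (rule Bochner_Integration.integrable_bound)
  show "integrable \<mu> (\<lambda>z. 1 / min (r\<^sup>2) 1 * min ((vnorm d z)\<^sup>2) 1)" using min_integrable by simp
  show "AE z in \<mu>. norm (indicator {z. r < vnorm d z} z :: real) \<le> norm (1 / min (r\<^sup>2) 1 * min ((vnorm d z)\<^sup>2) 1)"
  proof (intro AE_I2)
    fix z
    have "min (r\<^sup>2) 1 \<le> min ((vnorm d z)\<^sup>2) 1" if "r < vnorm d z"
      using that assms by (intro min.mono power_mono) auto
    moreover have "0 < min (r\<^sup>2) 1" using assms by simp
    ultimately have "1 \<le> 1 / min (r\<^sup>2) 1 * min ((vnorm d z)\<^sup>2) 1" if "r < vnorm d z"
      using that by (simp add: field_simps)
    then show "norm (indicator {z. r < vnorm d z} z :: real) \<le> norm (1 / min (r\<^sup>2) 1 * min ((vnorm d z)\<^sup>2) 1)"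
      by (auto simp: indicator_def)
  qed
qed measurable

text \<open>Since 0 is excluded, the sets |z| > 1/(n+1) exhaust the space, and each has finite mass.
  Sigma-finiteness is what every use of Fubini with \<mu> rests on.\<close>

lemma levy_sigma_finite: "sigma_finite_measure \<mu>"
proof
  define A where "A n = {z \<in> space \<mu>. 1 / real (Suc n) < vnorm d z}" for n
  have Am: "A n \<in> sets \<mu>" for n unfolding A_def by measurable
  have "emeasure \<mu> (A n) \<noteq> \<infinity>" for n
  proof -
    have "integrable \<mu> (indicator (A n) :: _ \<Rightarrow> real)"
    proof -
      have "integrable \<mu> (\<lambda>z. indicator {z. 1 / real (Suc n) < vnorm d z} z :: real)"
        by (rule far_integrable) simp
      then show ?thesis
        by (rule iffD1[OF Bochner_Integration.integrable_cong[OF refl], rotated])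
          (auto simp: A_def indicator_def)
    qed
    then show ?thesis using Am by (simp add: integrable_indicator_iff less_top[symmetric])
  qed
  moreover have "(\<Union>n. A n) = space \<mu>"
  proof -
    have "\<exists>n. 1 / real (Suc n) < vnorm d z" if "z \<in> space \<mu>" for z
      using reals_Archimedean[OF vnorm_pos[OF that]] by (auto simp: inverse_eq_divide)
    then show ?thesis by (auto simp: A_def)
  qed
  ultimately show "\<exists>A. countable A \<and> A \<subseteq> sets \<mu> \<and> \<Union>A = space \<mu> \<and> (\<forall>a\<in>A. emeasure \<mu> a \<noteq> \<infinity>)"
    using Am by (intro exI[of _ "range A"]) auto
qed

sublocale L: sigma_finite_measure \<mu> by (rule levy_sigma_finite)
sublocale RL: pair_sigma_finite "lebesgue_Rd d" \<mu> ..

lemma vneg_levy: "vneg d \<in> \<mu> \<rightarrow>\<^sub>M \<mu>"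
proof -
  have s: "sets \<mu> = sets (restrict_space (lebesgue_Rd d) (Rd d - {vzero d}))"
    using levy by (simp add: levy_measure_def)
  have "vneg d \<in> \<mu> \<rightarrow>\<^sub>M restrict_space (lebesgue_Rd d) (Rd d - {vzero d})"
  proof (rule measurable_restrict_space2)
    show "vneg d \<in> \<mu> \<rightarrow>\<^sub>M lebesgue_Rd d" using vneg_measurable[OF levy_ident] by simp
    have "vneg d z \<noteq> vzero d" if "z \<in> Rd d - {vzero d}" for z
    proof
      assume *: "vneg d z = vzero d"
      have "z i = 0" if "i < d" for i using fun_cong[OF *, of i] that by (simp add: vneg_def vzero_def)
      then have "z = vzero d" using that by (auto simp: vzero_def Rd_def PiE_iff extensional_def)
      then show False using that by simp
    qed
    then show "vneg d \<in> space \<mu> \<rightarrow> Rd d - {vzero d}" by (auto simp: space_levy)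
  qed
  then show ?thesis by (subst measurable_cong_sets[OF refl s])
qed

lemma integral_dual:
  fixes f :: "(nat \<Rightarrow> real) \<Rightarrow> real"
  assumes "f \<in> borel_measurable \<mu>"
  shows "(\<integral>z. f z \<partial>dual_measure d \<mu>) = (\<integral>z. f (vneg d z) \<partial>\<mu>)"
  unfolding dual_measure_def by (rule integral_distr[OF vneg_levy assms])

lemma vnorm_vneg [simp]: "vnorm d (vneg d z) = vnorm d z"
  unfolding L2_set_def by (simp add: vneg_def)

(* The kernels are functions of \<xi> = x - y; the jump enters with a minus sign because it has been moved
   from the solution to the kernel. In near_kernel the compensator acts on all jumps up to r, also when
   r > 1, and drift r makes up for the difference to the compensator on the unit ball. *)

definition near_kernel :: "(nat \<Rightarrow> real \<Rightarrow> real) \<Rightarrow> real \<Rightarrow> (nat \<Rightarrow> real) \<Rightarrow> (nat \<Rightarrow> real) \<Rightarrow> real" where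
  "near_kernel g r \<xi> z = indicator {z. vnorm d z \<le> r} z *
     (prodf d g (vsub d \<xi> z) - prodf d g \<xi> + (\<Sum>i<d. z i * dprodf d g i \<xi>))"

definition far_kernel :: "(nat \<Rightarrow> real \<Rightarrow> real) \<Rightarrow> real \<Rightarrow> (nat \<Rightarrow> real) \<Rightarrow> (nat \<Rightarrow> real) \<Rightarrow> real" where
  "far_kernel g r \<xi> z = indicator {z. r < vnorm d z} z * (prodf d g (vsub d \<xi> z) - prodf d g \<xi>)"

definition near_op :: "(nat \<Rightarrow> real \<Rightarrow> real) \<Rightarrow> real \<Rightarrow> (nat \<Rightarrow> real) \<Rightarrow> real" where
  "near_op g r \<xi> = (\<integral>z. near_kernel g r \<xi> z \<partial>\<mu>)"

definition far_op :: "(nat \<Rightarrow> real \<Rightarrow> real) \<Rightarrow> real \<Rightarrow> (nat \<Rightarrow> real) \<Rightarrow> real" where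
  "far_op g r \<xi> = (\<integral>z. far_kernel g r \<xi> z \<partial>\<mu>)"

definition drift :: "real \<Rightarrow> nat \<Rightarrow> real" where
  "drift r i = (\<integral>z. indicator {z. r < vnorm d z \<and> vnorm d z \<le> 1} z * z i \<partial>\<mu>)
     - (\<integral>z. indicator {z. 1 < vnorm d z \<and> vnorm d z \<le> r} z * z i \<partial>\<mu>)"

lemma near_kernel_measurable:
  assumes g: "Ccs d g"
  shows "(\<lambda>(\<xi>, z). near_kernel g r \<xi> z) \<in> borel_measurable (lebesgue_Rd d \<Otimes>\<^sub>M \<mu>)"
proof -
  note [measurable] = prodf_measurable[OF g] dprodf_measurable[OF g]
  show ?thesis unfolding near_kernel_def by measurable
qed

lemma far_kernel_measurable:
  assumes g: "Ccs d g"
  shows "(\<lambda>(\<xi>, z). far_kernel g r \<xi> z) \<in> borel_measurable (lebesgue_Rd d \<Otimes>\<^sub>M \<mu>)"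
proof -
  note [measurable] = prodf_measurable[OF g]
  show ?thesis unfolding far_kernel_def by measurable
qed

text \<open>The compensated increment is of second order in z because the gradient of the kernel is
  Lipschitz, and jumps up to r enlarge the support by at most r. The square of |z| is what \<mu>
  integrates near 0.\<close>

lemma near_kernel_bound:
  assumes g: "Ccs d g" and r: "0 < r"
  obtains C R where "0 \<le> C"
    "\<And>\<xi> z. \<xi> \<in> Rd d \<Longrightarrow> \<bar>near_kernel g r \<xi> z\<bar> \<le> C * indicator (cube d R) \<xi> * (indicator {z. vnorm d z \<le> r} z * (vnorm d z)\<^sup>2)"
proof -
  obtain R where R: "0 < R" "\<And>x i. i < d \<Longrightarrow> R < \<bar>x i\<bar> \<Longrightarrow> prodf d g x = 0"
    using g by (rule prodf_support) blast
  \<comment> \<open>The derivatives vanish outside the same box: for j different from i the function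
    is zero along the whole line in direction i, and for j = i it is zero near the point.\<close>
  have R': "dprodf d g i x = 0" if "j < d" "R < \<bar>x j\<bar>" "i < d" for i j x
  proof -
    have sm: "smooth1 (g i)" using g that CcD by (auto simp: Ccs_def)
    have "(\<lambda>s. prodf d g (x(i := s))) = (\<lambda>s. 0)" if "j \<noteq> i"
      using R(2)[OF \<open>j < d\<close>] \<open>R < \<bar>x j\<bar>\<close> that by auto
    moreover have "partial i (prodf d g) x = 0" if "j = i"
    proof -
      have "((\<lambda>_. 0) has_real_derivative 0) (at (x i))" by simp
      then have "((\<lambda>s. prodf d g (x(i := s))) has_real_derivative 0) (at (x i))"
        by (rule has_field_derivative_transform_within_open[where S = "{..<-R} \<union> {R<..}"])
          (use \<open>R < \<bar>x j\<bar>\<close> that R(2)[OF \<open>i < d\<close>] in auto)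
      then show ?thesis unfolding partial_def by (rule DERIV_imp_deriv)
    qed
    ultimately have "partial i (prodf d g) x = 0" by (cases "j = i") (auto simp: partial_def)
    then show ?thesis using partial_prodf[of i d g] that sm by simp
  qed
  have "\<exists>C. 0 \<le> C \<and> (\<forall>x y. \<bar>dprodf d g i x - dprodf d g i y\<bar> \<le> C * (\<Sum>i<d. \<bar>x i - y i\<bar>))" for i
  proof -
    obtain C where "0 \<le> C" "\<And>x y. \<bar>dprodf d g i x - dprodf d g i y\<bar> \<le> C * (\<Sum>i<d. \<bar>x i - y i\<bar>)"
      unfolding dprodf_def using Ccs_deriv[OF g] by (rule prodf_lipschitz) blast
    then show ?thesis by blast
  qed
  then have "\<forall>i. \<exists>C. 0 \<le> C \<and> (\<forall>x y. \<bar>dprodf d g i x - dprodf d g i y\<bar> \<le> C * (\<Sum>i<d. \<bar>x i - y i\<bar>))" by blast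
  from choice[OF this] obtain C where
    C: "\<And>i. 0 \<le> C i" "\<And>i x y. \<bar>dprodf d g i x - dprodf d g i y\<bar> \<le> C i * (\<Sum>i<d. \<bar>x i - y i\<bar>)" by blast
  define K where "K = (\<Sum>i<d. C i)"
  have K: "C i \<le> K" if "i < d" for i unfolding K_def using that C(1) by (intro member_le_sum) auto
  have K0: "0 \<le> K" unfolding K_def using C(1) by (intro sum_nonneg) auto
  have sm: "\<And>i. i < d \<Longrightarrow> smooth1 (g i)" using g CcD by (auto simp: Ccs_def)
  show thesis
  proof (rule that[of "K * real d" "R + r"])
    show "0 \<le> K * real d" using K0 by simp
    fix \<xi> z :: "nat \<Rightarrow> real" assume \<xi>: "\<xi> \<in> Rd d"
    show "\<bar>near_kernel g r \<xi> z\<bar> \<le> K * real d * indicator (cube d (R + r)) \<xi> * (indicator {z. vnorm d z \<le> r} z * (vnorm d z)\<^sup>2)"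
    proof (cases "vnorm d z \<le> r")
      case z: True
      have zi: "\<bar>z i\<bar> \<le> r" if "i < d" for i
        using member_le_L2_set[of "{..<d}" i "\<lambda>i. \<bar>z i\<bar>"] z that by (simp add: L2_set_def)
      show ?thesis
      proof (cases "\<xi> \<in> cube d (R + r)")
        case True
        define p where "p s = prodf d g (\<lambda>i. \<xi> i + s * (- z i))" for s
        define p' where "p' s = (\<Sum>i<d. - z i * dprodf d g i (\<lambda>i. \<xi> i + s * (- z i)))" for s
        obtain c where c: "0 < c" "c < 1" "p 1 - p 0 = (1 - 0) * p' c"
          using MVT2[of 0 1 p p'] prodf_line_DERIV[OF sm, where z = "\<lambda>i. - z i" and a = \<xi>]
          unfolding p_def p'_def by auto
        \<comment> \<open>The compensator equals - p' 0, so the kernel is p 1 - p 0 - p' 0, and the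
          mean value theorem replaces p 1 - p 0 by p' c.\<close>
        have "near_kernel g r \<xi> z = p' c - p' 0"
        proof -
          have "p 1 = prodf d g (vsub d \<xi> z)" unfolding p_def by (rule prodf_cong) (simp add: vsub_def)
          moreover have "p' 0 = - (\<Sum>i<d. z i * dprodf d g i \<xi>)" by (simp add: p'_def sum_negf)
          moreover have "p 0 = prodf d g \<xi>" by (simp add: p_def)
          ultimately show ?thesis using c(3) z by (simp add: near_kernel_def)
        qed
        also have "\<bar>p' c - p' 0\<bar> \<le> (\<Sum>i<d. \<bar>z i\<bar> * (K * (\<Sum>i<d. \<bar>z i\<bar>)))"
          unfolding p'_def sum_subtractf[symmetric] right_diff_distrib[symmetric]
        proof (rule order_trans[OF sum_abs], rule sum_mono)
          fix i assume i: "i \<in> {..<d}"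
          have "\<bar>dprodf d g i (\<lambda>i. \<xi> i + c * (- z i)) - dprodf d g i (\<lambda>i. \<xi> i + 0 * (- z i))\<bar>
             \<le> C i * (\<Sum>j<d. \<bar>(\<xi> j + c * (- z j)) - (\<xi> j + 0 * (- z j))\<bar>)" by (rule C(2))
          also have "\<dots> \<le> K * (\<Sum>j<d. \<bar>z j\<bar>)"
            using K i c K0 by (intro mult_mono sum_mono sum_nonneg) (auto simp: abs_mult mult_le_cancel_right1 intro!: mult_left_le_one_le)
          finally show "\<bar>- z i * (dprodf d g i (\<lambda>i. \<xi> i + c * (- z i)) - dprodf d g i (\<lambda>i. \<xi> i + 0 * (- z i)))\<bar>
            \<le> \<bar>z i\<bar> * (K * (\<Sum>i<d. \<bar>z i\<bar>))"
            unfolding abs_mult abs_minus_cancel by (intro mult_left_mono) auto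
        qed
        also have "\<dots> = K * ((\<Sum>i<d. \<bar>z i\<bar>) * (\<Sum>i<d. \<bar>z i\<bar>))"
          by (simp add: sum_distrib_right[symmetric])
        also have "\<dots> \<le> K * ((sqrt (real d) * vnorm d z) * (sqrt (real d) * vnorm d z))"
          using K0 sum_abs_le_vnorm[of z d] by (intro mult_left_mono mult_mono) (auto intro: sum_nonneg L2_set_nonneg)
        also have "\<dots> = K * real d * (vnorm d z)\<^sup>2"
          by (simp add: power2_eq_square mult_ac)
        finally show ?thesis using True z by simp
      next
        case False
        then obtain i where i: "i < d" "\<xi> i \<notin> {-(R+r)..R+r}"
          using \<xi> unfolding cube_def Rd_def PiE_iff by blast
        have b: "R + r < \<bar>\<xi> i\<bar>" using i(2) by auto
        have "R < \<bar>vsub d \<xi> z i\<bar>" using zi[OF i(1)] b i(1) by (simp add: vsub_def)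
        then have "prodf d g (vsub d \<xi> z) = 0" "prodf d g \<xi> = 0" "\<And>j. j < d \<Longrightarrow> dprodf d g j \<xi> = 0"
          using b r i(1) R(2)[OF i(1), of "vsub d \<xi> z"] R(2)[OF i(1), of \<xi>] R'[OF i(1), of \<xi>] by auto
        then have "near_kernel g r \<xi> z = 0" by (simp add: near_kernel_def)
        then show ?thesis using K0 by simp
      qed
    qed (simp add: near_kernel_def)
  qed
qed

lemma tensor_integrable:
  fixes a b :: "(nat \<Rightarrow> real) \<Rightarrow> real"
  assumes a: "integrable (lebesgue_Rd d) a" and b: "integrable \<mu> b"
  shows "integrable (lebesgue_Rd d \<Otimes>\<^sub>M \<mu>) (\<lambda>(x, z). a x * b z)"
proof -
  note [measurable] = borel_measurable_integrable[OF a] borel_measurable_integrable[OF b]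
  show ?thesis
    by (rule RL.Fubini_integrable) (use a b in \<open>auto simp: abs_mult\<close>)
qed

lemma near_kernel_integrable:
  assumes g: "Ccs d g" and r: "0 < r"
  shows "integrable (lebesgue_Rd d \<Otimes>\<^sub>M \<mu>) (\<lambda>(\<xi>, z). near_kernel g r \<xi> z)"
    and "\<And>\<xi>. \<xi> \<in> Rd d \<Longrightarrow> integrable \<mu> (near_kernel g r \<xi>)"
    and "\<exists>C. \<forall>\<xi>\<in>Rd d. \<bar>near_op g r \<xi>\<bar> \<le> C"
proof -
  obtain C R where C: "0 \<le> C"
    "\<And>\<xi> z. \<xi> \<in> Rd d \<Longrightarrow> \<bar>near_kernel g r \<xi> z\<bar> \<le> C * indicator (cube d R) \<xi> * (indicator {z. vnorm d z \<le> r} z * (vnorm d z)\<^sup>2)"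
    using g r by (rule near_kernel_bound) blast
  note [measurable] = near_kernel_measurable[OF g]
  show "integrable (lebesgue_Rd d \<Otimes>\<^sub>M \<mu>) (\<lambda>(\<xi>, z). near_kernel g r \<xi> z)"
  proof (rule Bochner_Integration.integrable_bound)
    show "integrable (lebesgue_Rd d \<Otimes>\<^sub>M \<mu>)
       (\<lambda>(\<xi>, z). (C * indicator (cube d R) \<xi>) * (indicator {z. vnorm d z \<le> r} z * (vnorm d z)\<^sup>2))"
      by (intro tensor_integrable near_integrable integrable_mult_right cube_integrable)
    show "AE p in lebesgue_Rd d \<Otimes>\<^sub>M \<mu>. norm (case p of (\<xi>, z) \<Rightarrow> near_kernel g r \<xi> z)
      \<le> norm (case p of (\<xi>, z) \<Rightarrow> (C * indicator (cube d R) \<xi>) * (indicator {z. vnorm d z \<le> r} z * (vnorm d z)\<^sup>2))"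
      using C by (intro AE_I2) (auto simp: space_pair_measure space_lebesgue_Rd abs_mult)
  qed measurable
  have bz: "\<bar>near_kernel g r \<xi> z\<bar> \<le> C * (indicator {z. vnorm d z \<le> r} z * (vnorm d z)\<^sup>2)" if "\<xi> \<in> Rd d" for \<xi> z
    by (rule order_trans[OF C(2)[OF that]]) (use C(1) in \<open>auto simp: indicator_def\<close>)
  show i: "integrable \<mu> (near_kernel g r \<xi>)" if \<xi>: "\<xi> \<in> Rd d" for \<xi>
  proof (rule Bochner_Integration.integrable_bound)
    show "integrable \<mu> (\<lambda>z. C * (indicator {z. vnorm d z \<le> r} z * (vnorm d z)\<^sup>2))"
      by (intro integrable_mult_right near_integrable)
    have "\<xi> \<in> space (lebesgue_Rd d)" using \<xi> by (simp add: space_lebesgue_Rd)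
    from measurable_compose[OF measurable_Pair1'[OF this] near_kernel_measurable[OF g]]
    show "near_kernel g r \<xi> \<in> borel_measurable \<mu>" by simp
    show "AE z in \<mu>. norm (near_kernel g r \<xi> z) \<le> norm (C * (indicator {z. vnorm d z \<le> r} z * (vnorm d z)\<^sup>2))"
      using bz[OF \<xi>] C(1) by (intro AE_I2) (simp add: abs_mult)
  qed
  have "\<bar>near_op g r \<xi>\<bar> \<le> (\<integral>z. C * (indicator {z. vnorm d z \<le> r} z * (vnorm d z)\<^sup>2) \<partial>\<mu>)" if \<xi>: "\<xi> \<in> Rd d" for \<xi>
    unfolding near_op_def
    by (rule order_trans[OF integral_abs_bound integral_mono[OF integrable_abs[OF i[OF \<xi>]]
       integrable_mult_right[OF near_integrable] bz[OF \<xi>]]])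
  then show "\<exists>C. \<forall>\<xi>\<in>Rd d. \<bar>near_op g r \<xi>\<bar> \<le> C" by blast
qed

lemma far_kernel_integrable:
  assumes g: "Ccs d g" and r: "0 < r"
  shows "integrable (lebesgue_Rd d \<Otimes>\<^sub>M \<mu>) (\<lambda>(\<xi>, z). far_kernel g r \<xi> z)"
    and "\<And>\<xi>. \<xi> \<in> Rd d \<Longrightarrow> integrable \<mu> (far_kernel g r \<xi>)"
    and "\<exists>C. \<forall>\<xi>\<in>Rd d. \<bar>far_op g r \<xi>\<bar> \<le> C"
proof -
  note [measurable] = far_kernel_measurable[OF g] prodf_measurable[OF g]
  have \<psi>: "integrable (lebesgue_Rd d) (prodf d g)" by (rule prodf_integrable[OF g])
  have fi: "integrable \<mu> (\<lambda>z. indicator {z. r < vnorm d z} z :: real)" by (rule far_integrable[OF r])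
  have 1: "integrable (lebesgue_Rd d \<Otimes>\<^sub>M \<mu>) (\<lambda>(\<xi>, z). prodf d g \<xi> * indicator {z. r < vnorm d z} z)"
    by (rule tensor_integrable[OF \<psi> fi])
  \<comment> \<open>Here \<xi> is integrated before z, since translation invariance removes z from
    the inner integral.\<close>
  have 2: "integrable (lebesgue_Rd d \<Otimes>\<^sub>M \<mu>) (\<lambda>(\<xi>, z). prodf d g (vsub d \<xi> z) * indicator {z. r < vnorm d z} z)"
  proof -
    interpret LR: pair_sigma_finite \<mu> "lebesgue_Rd d" ..
    have m: "(\<lambda>(z, \<xi>). prodf d g (vsub d \<xi> z) * indicator {z. r < vnorm d z} z :: real) \<in> borel_measurable (\<mu> \<Otimes>\<^sub>M lebesgue_Rd d)"
      by measurable
    have "integrable (\<mu> \<Otimes>\<^sub>M lebesgue_Rd d) (\<lambda>(z, \<xi>). prodf d g (vsub d \<xi> z) * indicator {z. r < vnorm d z} z)"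
    proof (rule LR.Fubini_integrable[OF m])
      have "(\<lambda>\<xi>. \<bar>prodf d g \<xi>\<bar>) \<in> borel_measurable (lebesgue_Rd d)" by measurable
      from integral_vsub_right[OF this]
      show "integrable \<mu> (\<lambda>z. \<integral>\<xi>. norm (case (z, \<xi>) of (z, \<xi>) \<Rightarrow> prodf d g (vsub d \<xi> z) * indicator {z. r < vnorm d z} z) \<partial>lebesgue_Rd d)"
        using fi by (simp add: abs_mult)
      show "AE z in \<mu>. integrable (lebesgue_Rd d) (\<lambda>\<xi>. case (z, \<xi>) of (z, \<xi>) \<Rightarrow> prodf d g (vsub d \<xi> z) * indicator {z. r < vnorm d z} z)"
        using integrable_vsub_right[OF \<psi>] by simp
    qed
    from LR.integrable_product_swap[OF this] show ?thesis by (simp add: split_def)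
  qed
  show "integrable (lebesgue_Rd d \<Otimes>\<^sub>M \<mu>) (\<lambda>(\<xi>, z). far_kernel g r \<xi> z)"
    using Bochner_Integration.integrable_diff[OF 2 1] by (simp add: far_kernel_def split_def algebra_simps)
  obtain C where C: "0 \<le> C" "\<And>x. \<bar>prodf d g x\<bar> \<le> C" using g by (rule prodf_bounded) blast
  have bz: "\<bar>far_kernel g r \<xi> z\<bar> \<le> 2 * C * indicator {z. r < vnorm d z} z" for \<xi> z
  proof -
    have "\<bar>prodf d g (vsub d \<xi> z) - prodf d g \<xi>\<bar> \<le> 2 * C"
      using C(2)[of "vsub d \<xi> z"] C(2)[of \<xi>] by linarith
    then show ?thesis by (auto simp: far_kernel_def indicator_def)
  qed
  show i: "integrable \<mu> (far_kernel g r \<xi>)" if \<xi>: "\<xi> \<in> Rd d" for \<xi>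
  proof (rule Bochner_Integration.integrable_bound)
    show "integrable \<mu> (\<lambda>z. 2 * C * indicator {z. r < vnorm d z} z)"
      by (intro integrable_mult_right fi)
    have "\<xi> \<in> space (lebesgue_Rd d)" using \<xi> by (simp add: space_lebesgue_Rd)
    from measurable_compose[OF measurable_Pair1'[OF this] far_kernel_measurable[OF g]]
    show "far_kernel g r \<xi> \<in> borel_measurable \<mu>" by simp
    show "AE z in \<mu>. norm (far_kernel g r \<xi> z) \<le> norm (2 * C * indicator {z. r < vnorm d z} z)"
      using bz C(1) by (intro AE_I2) (simp add: abs_mult)
  qed
  have "\<bar>far_op g r \<xi>\<bar> \<le> (\<integral>z. 2 * C * indicator {z. r < vnorm d z} z \<partial>\<mu>)" if \<xi>: "\<xi> \<in> Rd d" for \<xi>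
    unfolding far_op_def
    by (rule order_trans[OF integral_abs_bound integral_mono[OF integrable_abs[OF i[OF \<xi>]]
       integrable_mult_right[OF fi] bz]])
  then show "\<exists>C. \<forall>\<xi>\<in>Rd d. \<bar>far_op g r \<xi>\<bar> \<le> C" by blast
qed

lemma near_op_integrable: "Ccs d g \<Longrightarrow> 0 < r \<Longrightarrow> integrable (lebesgue_Rd d) (near_op g r)"
  unfolding near_op_def using RL.integrable_fst'[OF near_kernel_integrable(1)] by simp

lemma far_op_integrable: "Ccs d g \<Longrightarrow> 0 < r \<Longrightarrow> integrable (lebesgue_Rd d) (far_op g r)"
  unfolding far_op_def using RL.integrable_fst'[OF far_kernel_integrable(1)] by simp

text \<open>Fubini between (x, y) and the jump z, in the form in which it is used: the pairing is
  estimated for one jump at a time, and the estimate is integrated against \<mu>.\<close>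

lemma pairing_kernel_Fubini:
  assumes W: "dominated d W \<alpha> \<beta>"
    and k: "integrable (lebesgue_Rd d \<Otimes>\<^sub>M \<mu>) (\<lambda>(\<xi>, z). k \<xi> z)" "\<And>\<xi>. \<xi> \<in> Rd d \<Longrightarrow> integrable \<mu> (k \<xi>)"
    and b: "integrable \<mu> b" "\<And>z. z \<in> space \<mu> \<Longrightarrow> pairing d W (\<lambda>\<xi>. k \<xi> z) \<le> b z"
  shows "pairing d W (\<lambda>\<xi>. \<integral>z. k \<xi> z \<partial>\<mu>) \<le> (\<integral>z. b z \<partial>\<mu>)"
proof -
  interpret RRL: pair_sigma_finite "lebesgue_Rd d \<Otimes>\<^sub>M lebesgue_Rd d" \<mu>
    by (intro pair_sigma_finite.intro L.sigma_finite_measure_axioms lRR.sigma_finite_measure_axioms)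
  note [measurable] = dominatedD(1)[OF W] borel_measurable_integrable[OF k(1)]
  define H where "H = (\<lambda>(p, z). (case p of (x, y) \<Rightarrow> W x y * k (vsub d x y) z))"
  have Hm: "H \<in> borel_measurable ((lebesgue_Rd d \<Otimes>\<^sub>M lebesgue_Rd d) \<Otimes>\<^sub>M \<mu>)"
    unfolding H_def by measurable
  have ka: "integrable (lebesgue_Rd d) (\<lambda>\<xi>. \<integral>z. \<bar>k \<xi> z\<bar> \<partial>\<mu>)"
    using RL.integrable_fst'[OF integrable_abs[OF k(1)]] by simp
  have Hi: "integrable ((lebesgue_Rd d \<Otimes>\<^sub>M lebesgue_Rd d) \<Otimes>\<^sub>M \<mu>) H"
  proof (rule RRL.Fubini_integrable[OF Hm])
    have "integrable (lebesgue_Rd d \<Otimes>\<^sub>M lebesgue_Rd d) (\<lambda>p. \<bar>case p of (x, y) \<Rightarrow> W x y * (\<integral>z. \<bar>k (vsub d x y) z\<bar> \<partial>\<mu>)\<bar>)"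
      by (rule integrable_abs[OF pairing_integrable[OF W ka]])
    then show "integrable (lebesgue_Rd d \<Otimes>\<^sub>M lebesgue_Rd d) (\<lambda>p. \<integral>z. norm (H (p, z)) \<partial>\<mu>)"
      by (simp add: H_def split_def abs_mult)
    show "AE p in lebesgue_Rd d \<Otimes>\<^sub>M lebesgue_Rd d. integrable \<mu> (\<lambda>z. H (p, z))"
      using k(2) by (auto simp: H_def split_def)
  qed
  have "pairing d W (\<lambda>\<xi>. \<integral>z. k \<xi> z \<partial>\<mu>) = (\<integral>p. (\<integral>z. H (p, z) \<partial>\<mu>) \<partial>(lebesgue_Rd d \<Otimes>\<^sub>M lebesgue_Rd d))"
    unfolding pairing_def H_def split_def by simp
  also have "\<dots> = (\<integral>z. (\<integral>p. H (p, z) \<partial>(lebesgue_Rd d \<Otimes>\<^sub>M lebesgue_Rd d)) \<partial>\<mu>)"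
    using RRL.Fubini_integral[where f = "\<lambda>p z. H (p, z)"] Hi by simp
  also have "\<dots> = (\<integral>z. pairing d W (\<lambda>\<xi>. k \<xi> z) \<partial>\<mu>)"
    unfolding pairing_def H_def split_def by simp
  also have "\<dots> \<le> (\<integral>z. b z \<partial>\<mu>)"
  proof (rule integral_mono[OF _ b(1) b(2)])
    have "integrable \<mu> (\<lambda>z. \<integral>p. H (p, z) \<partial>(lebesgue_Rd d \<Otimes>\<^sub>M lebesgue_Rd d))"
      using RRL.integrable_snd[where f = "\<lambda>p z. H (p, z)"] Hi by simp
    then show "integrable \<mu> (\<lambda>z. pairing d W (\<lambda>\<xi>. k \<xi> z))"
      unfolding pairing_def H_def split_def by simp
  qed
  finally show ?thesis .
qed

end

text \<open>The jump of the sign at b is harmless because F a - F b vanishes there. If a and a' lie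
  on different sides of b, the two Lipschitz bounds add up along the way through b.\<close>

lemma entropy_flux_lipschitz_left:
  fixes F :: "real \<Rightarrow> real"
  assumes F: "\<And>s s'. \<bar>F s - F s'\<bar> \<le> L * \<bar>s - s'\<bar>"
  shows "\<bar>sgn (a - b) * (F a - F b) - sgn (a' - b) * (F a' - F b)\<bar> \<le> L * \<bar>a - a'\<bar>"
proof -
  have opp: "\<bar>F p - F b\<bar> + \<bar>F q - F b\<bar> \<le> L * \<bar>p - q\<bar>" if "p \<le> b" "b \<le> q" for p q
  proof -
    have "\<bar>F p - F b\<bar> + \<bar>F q - F b\<bar> \<le> L * \<bar>p - b\<bar> + L * \<bar>q - b\<bar>" using F by (intro add_mono)
    also have "\<dots> = L * \<bar>p - q\<bar>" using that by (simp add: abs_if algebra_simps)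
    finally show ?thesis .
  qed
  consider "b < a \<and> b < a'" | "a < b \<and> a' < b" | "a \<le> b \<and> b \<le> a'" | "a' \<le> b \<and> b \<le> a" by linarith
  then show ?thesis
  proof cases
    case 1 then show ?thesis using F[of a a'] by simp
  next
    case 2 then show ?thesis using F[of a a'] by (simp add: abs_minus_commute)
  next
    case 3
    then have "\<bar>sgn (a - b) * (F a - F b)\<bar> \<le> \<bar>F a - F b\<bar>" "\<bar>sgn (a' - b) * (F a' - F b)\<bar> \<le> \<bar>F a' - F b\<bar>"
      by (auto simp: abs_mult sgn_if)
    then show ?thesis using opp[of a a'] 3 by linarith
  next
    case 4
    then have "\<bar>sgn (a - b) * (F a - F b)\<bar> \<le> \<bar>F a - F b\<bar>" "\<bar>sgn (a' - b) * (F a' - F b)\<bar> \<le> \<bar>F a' - F b\<bar>"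
      by (auto simp: abs_mult sgn_if)
    moreover have "\<bar>F a' - F b\<bar> + \<bar>F a - F b\<bar> \<le> L * \<bar>a - a'\<bar>"
      using opp[of a' a] 4 by (simp add: abs_minus_commute)
    ultimately show ?thesis by linarith
  qed
qed

lemma lip2_entropy_flux:
  assumes "\<And>s s'. \<bar>f s i - f s' i\<bar> \<le> L * \<bar>s - s'\<bar>" "0 \<le> L"
  shows "lip2 L (\<lambda>a b. entropy_flux f a b i)"
  unfolding lip2_def
proof (intro conjI allI)
  fix a b a' b'
  have sym: "entropy_flux f a b i = entropy_flux f b a i" for a b
    by (simp add: entropy_flux_def sgn_if)
  have 1: "\<bar>entropy_flux f a b i - entropy_flux f a' b i\<bar> \<le> L * \<bar>a - a'\<bar>" for a b a'
    unfolding entropy_flux_def by (rule entropy_flux_lipschitz_left[OF assms(1)])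
  have "\<bar>entropy_flux f a' b i - entropy_flux f a' b' i\<bar> \<le> L * \<bar>b - b'\<bar>"
    using 1[of b a' b'] by (simp add: sym)
  then show "\<bar>entropy_flux f a b i - entropy_flux f a' b' i\<bar> \<le> L * (\<bar>a - a'\<bar> + \<bar>b - b'\<bar>)"
    using 1[of a b a'] by (simp add: distrib_left)
qed (use assms in \<open>auto simp: entropy_flux_def\<close>)

lemma lip2_abs_diff:
  fixes B :: "real \<Rightarrow> real"
  assumes "\<And>s s'. \<bar>B s - B s'\<bar> \<le> L * \<bar>s - s'\<bar>" "0 \<le> L"
  shows "lip2 L (\<lambda>a b. \<bar>B a - B b\<bar>)"
  unfolding lip2_def
proof (intro conjI allI)
  fix a b a' b'
  have "\<bar>\<bar>B a - B b\<bar> - \<bar>B a' - B b'\<bar>\<bar> \<le> \<bar>B a - B a'\<bar> + \<bar>B b - B b'\<bar>" by linarith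
  also have "\<dots> \<le> L * \<bar>a - a'\<bar> + L * \<bar>b - b'\<bar>" using assms(1) by (intro add_mono)
  finally show "\<bar>\<bar>B a - B b\<bar> - \<bar>B a' - B b'\<bar>\<bar> \<le> L * (\<bar>a - a'\<bar> + \<bar>b - b'\<bar>)" by (simp add: distrib_left)
qed (use assms in auto)

section \<open>Integrals over space-time\<close>

abbreviation time_interval :: "real \<Rightarrow> real measure" where
  "time_interval T \<equiv> restrict_space lborel {0<..<T}"

lemma finite_measure_time_interval: "finite_measure (time_interval T)"
proof (rule finite_measureI)
  have "emeasure lborel {0<..<T} < \<infinity>" by (rule emeasure_bounded_finite) simp
  then show "emeasure (time_interval T) (space (time_interval T)) \<noteq> \<infinity>"
    by (simp add: emeasure_restrict_space space_restrict_space)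
qed

interpretation TI: finite_measure "time_interval T" for T by (rule finite_measure_time_interval)

interpretation ST: pair_sigma_finite "lebesgue_Rd d" "time_interval T" for d T ..

lemma space_space_time: "space (space_time d T) = Rd d \<times> {0<..<T}"
  by (auto simp: space_time_def space_pair_measure space_lebesgue_Rd space_restrict_space)

lemma sigma_finite_space_time: "sigma_finite_measure (space_time d T)"
  unfolding space_time_def by (rule ST.sigma_finite_measure_axioms)

lemma fst_space_time [measurable]: "fst \<in> space_time d T \<rightarrow>\<^sub>M lebesgue_Rd d"
  unfolding space_time_def by measurable

lemma snd_space_time [measurable]: "snd \<in> borel_measurable (space_time d T)"
proof -
  have "(\<lambda>x. x) \<in> time_interval T \<rightarrow>\<^sub>M borel" by (rule measurable_restrict_space1) simp
  then show ?thesis unfolding space_time_def by (rule measurable_compose[OF measurable_snd])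
qed

lemma time_fun_integrable:
  assumes "\<theta> \<in> borel_measurable borel" "\<And>t. \<bar>\<theta> t\<bar> \<le> (c::real)"
  shows "integrable (time_interval T) \<theta>"
proof (rule TI.integrable_const_bound)
  show "\<theta> \<in> borel_measurable (time_interval T)" using assms(1) by (intro measurable_restrict_space1) simp
qed (use assms in auto)

lemma space_time_tensor_integrable:
  assumes a: "integrable (lebesgue_Rd d) a" and \<theta>: "\<theta> \<in> borel_measurable borel" "\<And>t. \<bar>\<theta> t\<bar> \<le> (c::real)"
  shows "integrable (space_time d T) (\<lambda>(x, t). \<theta> t * (a x :: real))"
proof -
  have [measurable]: "\<theta> \<in> borel_measurable (time_interval T)"
    using \<theta>(1) by (intro measurable_restrict_space1) simp
  note [measurable] = borel_measurable_integrable[OF a]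
  show ?thesis
    unfolding space_time_def
    by (rule ST.Fubini_integrable) (use a time_fun_integrable[OF \<theta>] in \<open>auto simp: abs_mult\<close>)
qed

lemma space_time_bounded_integrable:
  assumes F: "F \<in> borel_measurable (space_time d T)" and a: "integrable (lebesgue_Rd d) a"
    and b: "AE p in space_time d T. \<bar>F p\<bar> \<le> c * \<bar>a (fst p)\<bar>"
  shows "integrable (space_time d T) (F :: _ \<Rightarrow> real)"
proof (rule Bochner_Integration.integrable_bound[OF _ F])
  show "integrable (space_time d T) (\<lambda>p. c * \<bar>a (fst p)\<bar>)"
    using space_time_tensor_integrable[OF integrable_abs[OF a], of "\<lambda>_. c" "\<bar>c\<bar>"] by (simp add: split_def)
  show "AE p in space_time d T. norm (F p) \<le> norm (c * \<bar>a (fst p)\<bar>)"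
    using b by eventually_elim auto
qed

lemma space_time_integral_snd:
  fixes F :: "(nat \<Rightarrow> real) \<times> real \<Rightarrow> real"
  assumes "integrable (space_time d T) F"
  shows "(\<integral>p. F p \<partial>space_time d T) = (\<integral>t. (\<integral>x. F (x, t) \<partial>lebesgue_Rd d) \<partial>time_interval T)"
    and "integrable (time_interval T) (\<lambda>t. \<integral>x. F (x, t) \<partial>lebesgue_Rd d)"
proof -
  have F: "integrable (lebesgue_Rd d \<Otimes>\<^sub>M time_interval T) (case_prod (\<lambda>x t. F (x, t)))"
    using assms unfolding space_time_def by simp
  show "(\<integral>p. F p \<partial>space_time d T) = (\<integral>t. (\<integral>x. F (x, t) \<partial>lebesgue_Rd d) \<partial>time_interval T)"
    using ST.integral_snd[OF F] unfolding space_time_def by simp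
  show "integrable (time_interval T) (\<lambda>t. \<integral>x. F (x, t) \<partial>lebesgue_Rd d)"
    using ST.integrable_snd[OF F] .
qed

section \<open>The nonlocal terms of the entropy inequality as operators on the kernel\<close>

context levy_space
begin

lemma drift_integrable:
  assumes "0 < a" "i < d"
  shows "integrable \<mu> (\<lambda>z. indicator {z. a < vnorm d z \<and> vnorm d z \<le> b} z * z i)"
proof (rule Bochner_Integration.integrable_bound)
  show "integrable \<mu> (\<lambda>z. \<bar>b\<bar> * indicator {z. a < vnorm d z} z)"
    by (intro integrable_mult_right far_integrable assms)
  show "(\<lambda>z. indicator {z. a < vnorm d z \<and> vnorm d z \<le> b} z * z i) \<in> borel_measurable \<mu>"
    using assms(2) by measurable
  have "\<bar>z i\<bar> \<le> vnorm d z" for z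
    using member_le_L2_set[of "{..<d}" i "\<lambda>i. \<bar>z i\<bar>"] assms(2) by (simp add: L2_set_def)
  then have zi: "vnorm d z \<le> b \<Longrightarrow> \<bar>z i\<bar> \<le> \<bar>b\<bar>" for z using order_trans abs_ge_self by (metis order.trans)
  show "AE z in \<mu>. norm (indicator {z. a < vnorm d z \<and> vnorm d z \<le> b} z * z i) \<le> norm (\<bar>b\<bar> * indicator {z. a < vnorm d z} z)"
    using zi by (intro AE_I2) (auto simp: indicator_def)
qed

text \<open>The reflection in the dual measure cancels the minus sign in the definition of the
  drift.\<close>

lemma levy_drift_dual:
  assumes "i < d"
  shows "levy_drift d (dual_measure d \<mu>) r i = (\<integral>z. indicator {z. r < vnorm d z \<and> vnorm d z \<le> 1} z * z i \<partial>\<mu>)"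
proof -
  have "(\<lambda>z. indicator {z. r < vnorm d z} z *\<^sub>R (z i * indicator {z. vnorm d z \<le> 1} z)) \<in> borel_measurable \<mu>"
    using assms by measurable
  from integral_dual[OF this]
  have "levy_drift d (dual_measure d \<mu>) r i
    = - (\<integral>z. indicator {z. r < vnorm d z} (vneg d z) *\<^sub>R (vneg d z i * indicator {z. vnorm d z \<le> 1} (vneg d z)) \<partial>\<mu>)"
    by (simp add: levy_drift_def set_lebesgue_integral_def)
  also have "\<dots> = (\<integral>z. - (indicator {z. r < vnorm d z} (vneg d z) *\<^sub>R (vneg d z i * indicator {z. vnorm d z \<le> 1} (vneg d z))) \<partial>\<mu>)"
    by simp
  also have "\<dots> = (\<integral>z. indicator {z. r < vnorm d z \<and> vnorm d z \<le> 1} z * z i \<partial>\<mu>)"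
  proof (rule Bochner_Integration.integral_cong[OF refl])
    fix z
    have "vneg d z i = - z i" using assms by (simp add: vneg_def)
    then show "- (indicator {z. r < vnorm d z} (vneg d z) *\<^sub>R (vneg d z i * indicator {z. vnorm d z \<le> 1} (vneg d z)))
      = indicator {z. r < vnorm d z \<and> vnorm d z \<le> 1} z * z i"
      by (simp add: indicator_def)
  qed
  finally show ?thesis .
qed

text \<open>Reconciles the two compensators. The definition compensates jumps in the unit ball,
  \<open>near_kernel\<close> all jumps up to r; the difference is the mean of the jumps between 1
  and r, which together with \<open>levy_drift\<close> forms \<open>drift\<close>. The constant c
  will be the value \<theta> t of the time factor.\<close>

lemma levy_near_dual:
  assumes g: "Ccs d g" and r: "0 < r" and x: "x \<in> Rd d"
  shows "levy_near d (dual_measure d \<mu>) r (\<lambda>y. prodf d g y * c) x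
    + (\<Sum>i<d. levy_drift d (dual_measure d \<mu>) r i * (dprodf d g i x * c))
    = c * (near_op g r x + (\<Sum>i<d. drift r i * dprodf d g i x))"
proof -
  have sm: "\<And>i. i < d \<Longrightarrow> smooth1 (g i)" using g CcD by (auto simp: Ccs_def)
  have pc: "partial i (\<lambda>y. prodf d g y * c) x = dprodf d g i x * c" if i: "i < d" for i
  proof -
    have "((\<lambda>s. prodf d g (x(i := s))) has_real_derivative partial i (prodf d g) x) (at (x i))"
      unfolding partial_def using prodf_update_differentiable[of i d g x "x i"] i sm[OF i]
      by (simp add: DERIV_deriv_iff_real_differentiable)
    from DERIV_cmult_right[OF this, of c]
    show ?thesis unfolding partial_prodf[of i d g, OF i sm[OF i]] partial_def[of i "\<lambda>y. prodf d g y * c"]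
      by (rule DERIV_imp_deriv)
  qed
  define S where "S = (\<lambda>z. indicator {z. 0 < vnorm d z \<and> vnorm d z \<le> r} z *\<^sub>R
     (prodf d g (vadd d x z) * c - prodf d g x * c
       - (\<Sum>i<d. z i * (dprodf d g i x * c)) * indicator {z. vnorm d z \<le> 1} z))"
  have xs: "x \<in> space (lebesgue_Rd d)" using x by (simp add: space_lebesgue_Rd)
  have "(\<lambda>z. prodf d g (vadd d x z)) \<in> borel_measurable \<mu>"
    using xs by (intro prodf_measurable[OF g] vadd_measurable) auto
  then have S: "S \<in> borel_measurable \<mu>" unfolding S_def by measurable
  define e where "e i = (\<integral>z. indicator {z. 1 < vnorm d z \<and> vnorm d z \<le> r} z * z i \<partial>\<mu>)" for i
  have "levy_near d (dual_measure d \<mu>) r (\<lambda>y. prodf d g y * c) x = (\<integral>z. S z \<partial>dual_measure d \<mu>)"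
    unfolding levy_near_def set_lebesgue_integral_def S_def by (simp add: pc)
  also have "\<dots> = (\<integral>z. S (vneg d z) \<partial>\<mu>)" by (rule integral_dual[OF S])
  also have "\<dots> = (\<integral>z. c * near_kernel g r x z - (\<Sum>i<d. c * dprodf d g i x * (indicator {z. 1 < vnorm d z \<and> vnorm d z \<le> r} z * z i)) \<partial>\<mu>)"
  proof (rule Bochner_Integration.integral_cong[OF refl])
    fix z assume "z \<in> space \<mu>"
    then have z: "0 < vnorm d z" by (rule vnorm_pos)
    have va: "vadd d x (vneg d z) = vsub d x z" by (auto simp: vadd_def vneg_def vsub_def)
    have vs: "(\<Sum>i<d. vneg d z i * (dprodf d g i x * c)) = - c * (\<Sum>i<d. z i * dprodf d g i x)"
      unfolding sum_distrib_left by (intro sum.cong refl) (simp add: vneg_def)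
    have es: "(\<Sum>i<d. c * dprodf d g i x * (indicator {z. 1 < vnorm d z \<and> vnorm d z \<le> r} z * z i))
      = c * indicator {z. 1 < vnorm d z \<and> vnorm d z \<le> r} z * (\<Sum>i<d. z i * dprodf d g i x)"
      unfolding sum_distrib_left by (intro sum.cong refl) simp
    show "S (vneg d z) = c * near_kernel g r x z - (\<Sum>i<d. c * dprodf d g i x * (indicator {z. 1 < vnorm d z \<and> vnorm d z \<le> r} z * z i))"
      unfolding es S_def near_kernel_def va vs using z by (simp add: indicator_def algebra_simps)
  qed
  also have "\<dots> = c * near_op g r x - (\<Sum>i<d. c * dprodf d g i x * e i)"
  proof -
    have i: "integrable \<mu> (\<lambda>z. c * dprodf d g i x * (indicator {z. 1 < vnorm d z \<and> vnorm d z \<le> r} z * z i))" if "i < d" for i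
      by (intro integrable_mult_right drift_integrable that) simp
    have "integrable \<mu> (\<lambda>z. c * near_kernel g r x z)"
      by (intro integrable_mult_right near_kernel_integrable(2)[OF g r x])
    moreover have "integrable \<mu> (\<lambda>z. \<Sum>i<d. c * dprodf d g i x * (indicator {z. 1 < vnorm d z \<and> vnorm d z \<le> r} z * z i))"
      by (rule Bochner_Integration.integrable_sum) (use i in auto)
    moreover have "(\<integral>z. (\<Sum>i<d. c * dprodf d g i x * (indicator {z. 1 < vnorm d z \<and> vnorm d z \<le> r} z * z i)) \<partial>\<mu>)
       = (\<Sum>i<d. c * dprodf d g i x * e i)"
      using i by (subst Bochner_Integration.integral_sum) (auto simp: e_def)
    ultimately show ?thesis by (simp add: near_op_def)
  qed
  finally have 1: "levy_near d (dual_measure d \<mu>) r (\<lambda>y. prodf d g y * c) x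
     = c * near_op g r x - (\<Sum>i<d. c * dprodf d g i x * e i)" .
  have "(\<Sum>i<d. levy_drift d (dual_measure d \<mu>) r i * (dprodf d g i x * c)) - (\<Sum>i<d. c * dprodf d g i x * e i)
    = c * (\<Sum>i<d. drift r i * dprodf d g i x)"
    unfolding sum_subtractf[symmetric] sum_distrib_left
    by (intro sum.cong refl) (simp add: levy_drift_dual drift_def e_def algebra_simps)
  then show ?thesis unfolding 1 by (simp add: distrib_left)
qed

(* For monotone B, sgn (a - k) (B b - B a) \<le> |B b - B k| - |B a - B k|; then the jump is moved onto the
   test function by translation invariance. *)

lemma far_entropy:
  fixes v :: "(nat \<Rightarrow> real) \<Rightarrow> real"
  assumes g: "Ccs d g" "\<And>x. 0 \<le> prodf d g x" and r: "0 < r"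
    and v: "v \<in> borel_measurable (lebesgue_Rd d)"
    and B: "mono B" "\<And>s. \<bar>B s\<bar> \<le> C" "B \<in> borel_measurable borel"
  shows "(\<integral>x. sgn (v x - k) * levy_far d \<mu> r (\<lambda>y. B (v y)) x * prodf d g x \<partial>lebesgue_Rd d)
     \<le> (\<integral>x. \<bar>B (v x) - B k\<bar> * far_op g r x \<partial>lebesgue_Rd d)"
proof -
  note [measurable] = v B(3) prodf_measurable[OF g(1)] far_kernel_measurable[OF g(1)]
  define h where "h x = \<bar>B (v x) - B k\<bar>" for x
  have [measurable]: "h \<in> borel_measurable (lebesgue_Rd d)" unfolding h_def by measurable
  have h: "0 \<le> h x" "h x \<le> 2 * C" for x
    using B(2)[of "v x"] B(2)[of k] by (auto simp: h_def)
  have C: "0 \<le> C" using B(2)[of 0] by linarith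
  have \<psi>: "integrable (lebesgue_Rd d) (prodf d g)" by (rule prodf_integrable[OF g(1)])
  have fi: "integrable \<mu> (\<lambda>z. indicator {z. r < vnorm d z} z :: real)" by (rule far_integrable[OF r])
  define I where "I z = (indicator {z. r < vnorm d z} z :: real)" for z
  have [measurable]: "I \<in> borel_measurable \<mu>" unfolding I_def by measurable
  define G where "G = (\<lambda>(x, z). sgn (v x - k) * (I z * (B (v (vadd d x z)) - B (v x))) * prodf d g x)"
  define D where "D = (\<lambda>(x, z). I z * (h (vadd d x z) - h x) * prodf d g x)"
  have tens: "integrable (lebesgue_Rd d \<Otimes>\<^sub>M \<mu>) (\<lambda>(x, z). 2 * C * I z * prodf d g x)"
    using tensor_integrable[OF \<psi> integrable_mult_right[OF fi, of "2 * C"]] by (simp add: I_def mult.commute)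
  have Di: "integrable (lebesgue_Rd d \<Otimes>\<^sub>M \<mu>) D"
  proof (rule Bochner_Integration.integrable_bound[OF tens])
    show "D \<in> borel_measurable (lebesgue_Rd d \<Otimes>\<^sub>M \<mu>)" unfolding D_def by measurable
    have "\<bar>h y - h x\<bar> \<le> 2 * C" for x y using h[of x] h[of y] by linarith
    then show "AE p in lebesgue_Rd d \<Otimes>\<^sub>M \<mu>. norm (D p) \<le> norm (case p of (x, z) \<Rightarrow> 2 * C * I z * prodf d g x)"
      using C g(2) by (intro AE_I2) (auto simp: D_def I_def indicator_def abs_mult intro!: mult_right_mono split: prod.split)
  qed
  have Gi: "integrable (lebesgue_Rd d \<Otimes>\<^sub>M \<mu>) G"
  proof (rule Bochner_Integration.integrable_bound[OF tens])
    show "G \<in> borel_measurable (lebesgue_Rd d \<Otimes>\<^sub>M \<mu>)" unfolding G_def by measurable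
    have "\<bar>B (v y) - B (v x)\<bar> \<le> 2 * C" for x y
      using B(2)[of "v x"] B(2)[of "v y"] by linarith
    then show "AE p in lebesgue_Rd d \<Otimes>\<^sub>M \<mu>. norm (G p) \<le> norm (case p of (x, z) \<Rightarrow> 2 * C * I z * prodf d g x)"
      using C g(2) by (intro AE_I2) (auto simp: G_def I_def indicator_def abs_mult intro!: mult_right_mono split: prod.split)
  qed
  have GD: "G p \<le> D p" for p
  proof -
    obtain x z where p: "p = (x, z)" by (cases p)
    have 1: "sgn (v x - k) * (B (v y) - B (v x)) \<le> h y - h x" for y
    proof (cases "v x" k rule: linorder_cases)
      case less
      then have "B (v x) \<le> B k" using B(1) by (simp add: monoD)
      then show ?thesis using less by (simp add: h_def)
    next
      case equal then show ?thesis using h by (simp add: h_def)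
    next
      case greater
      then have "B k \<le> B (v x)" using B(1) by (simp add: monoD)
      then show ?thesis using greater by (simp add: h_def)
    qed
    show ?thesis
      using mult_right_mono[OF 1[of "vadd d x z"] g(2)[of x]]
      by (auto simp: p G_def D_def I_def indicator_def)
  qed
  have "(\<integral>x. sgn (v x - k) * levy_far d \<mu> r (\<lambda>y. B (v y)) x * prodf d g x \<partial>lebesgue_Rd d)
    = (\<integral>x. (\<integral>z. G (x, z) \<partial>\<mu>) \<partial>lebesgue_Rd d)"
    by (simp add: levy_far_def set_lebesgue_integral_def G_def I_def)
  also have "\<dots> = (\<integral>p. G p \<partial>(lebesgue_Rd d \<Otimes>\<^sub>M \<mu>))" by (rule RL.integral_fst'[OF Gi])
  also have "\<dots> \<le> (\<integral>p. D p \<partial>(lebesgue_Rd d \<Otimes>\<^sub>M \<mu>))" by (rule integral_mono[OF Gi Di GD])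
  also have "\<dots> = (\<integral>z. (\<integral>x. D (x, z) \<partial>lebesgue_Rd d) \<partial>\<mu>)"
    using RL.integral_snd[where f = "\<lambda>x z. D (x, z)"] Di by simp
  also have "\<dots> = (\<integral>z. (\<integral>x. h x * far_kernel g r x z \<partial>lebesgue_Rd d) \<partial>\<mu>)"
  proof (rule Bochner_Integration.integral_cong[OF refl])
    fix z assume "z \<in> space \<mu>"
    then have zR: "z \<in> space (lebesgue_Rd d)" by (simp add: space_levy space_lebesgue_Rd)
    have b: "integrable (lebesgue_Rd d) (\<lambda>x. H x * a x)"
      if "H \<in> borel_measurable (lebesgue_Rd d)" "\<And>x. \<bar>H x\<bar> \<le> 2 * C" "integrable (lebesgue_Rd d) a"
      for H a :: "(nat \<Rightarrow> real) \<Rightarrow> real"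
    proof (rule Bochner_Integration.integrable_bound[OF integrable_mult_right[OF that(3), of "2 * C"]])
      show "(\<lambda>x. H x * a x) \<in> borel_measurable (lebesgue_Rd d)" using that by (intro borel_measurable_times) auto
      show "AE x in lebesgue_Rd d. norm (H x * a x) \<le> norm (2 * C * a x)"
        using that(2) C by (auto simp: abs_mult intro!: mult_right_mono)
    qed
    have hz: "(\<lambda>x. h (vadd d x z)) \<in> borel_measurable (lebesgue_Rd d)" using zR by measurable
    have i1: "integrable (lebesgue_Rd d) (\<lambda>x. h (vadd d x z) * prodf d g x)" using h hz \<psi> by (intro b) auto
    have i2: "integrable (lebesgue_Rd d) (\<lambda>x. h x * prodf d g x)" using h \<psi> by (intro b) auto
    have i3: "integrable (lebesgue_Rd d) (\<lambda>x. h x * prodf d g (vsub d x z))"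
      using h integrable_vsub_right[OF \<psi>] by (intro b) auto
    have m: "(\<lambda>x. h x * prodf d g (vsub d x z)) \<in> borel_measurable (lebesgue_Rd d)" using i3 by auto
    have tr: "(\<integral>x. h (vadd d x z) * prodf d g x \<partial>lebesgue_Rd d) = (\<integral>x. h x * prodf d g (vsub d x z) \<partial>lebesgue_Rd d)"
    proof -
      have "(\<integral>x. h x * prodf d g (vsub d x z) \<partial>lebesgue_Rd d) = (\<integral>x. h (vadd d x z) * prodf d g (vsub d (vadd d x z) z) \<partial>lebesgue_Rd d)"
        using integral_vadd[OF m, of z] by simp
      also have "\<dots> = (\<integral>x. h (vadd d x z) * prodf d g x \<partial>lebesgue_Rd d)"
        by (rule Bochner_Integration.integral_cong[OF refl]) (simp add: vadd_vsub_cancel space_lebesgue_Rd)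
      finally show ?thesis by simp
    qed
    have "(\<integral>x. D (x, z) \<partial>lebesgue_Rd d) = (\<integral>x. I z * (h (vadd d x z) * prodf d g x - h x * prodf d g x) \<partial>lebesgue_Rd d)"
      by (simp add: D_def algebra_simps)
    also have "\<dots> = I z * ((\<integral>x. h x * prodf d g (vsub d x z) \<partial>lebesgue_Rd d) - (\<integral>x. h x * prodf d g x \<partial>lebesgue_Rd d))"
      using i1 i2 tr by simp
    also have "\<dots> = (\<integral>x. I z * (h x * prodf d g (vsub d x z) - h x * prodf d g x) \<partial>lebesgue_Rd d)"
      using i2 i3 by simp
    also have "\<dots> = (\<integral>x. h x * far_kernel g r x z \<partial>lebesgue_Rd d)"
      by (simp add: far_kernel_def I_def algebra_simps)
    finally show "(\<integral>x. D (x, z) \<partial>lebesgue_Rd d) = (\<integral>x. h x * far_kernel g r x z \<partial>lebesgue_Rd d)" .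
  qed
  also have "\<dots> = (\<integral>x. (\<integral>z. h x * far_kernel g r x z \<partial>\<mu>) \<partial>lebesgue_Rd d)"
  proof (rule RL.Fubini_integral)
    show "integrable (lebesgue_Rd d \<Otimes>\<^sub>M \<mu>) (\<lambda>(x, z). h x * far_kernel g r x z)"
    proof (rule Bochner_Integration.integrable_bound)
      show "integrable (lebesgue_Rd d \<Otimes>\<^sub>M \<mu>) (\<lambda>p. 2 * C * (case p of (x, z) \<Rightarrow> far_kernel g r x z))"
        by (intro integrable_mult_right far_kernel_integrable[OF g(1) r])
      show "AE p in lebesgue_Rd d \<Otimes>\<^sub>M \<mu>. norm (case p of (x, z) \<Rightarrow> h x * far_kernel g r x z)
         \<le> norm (2 * C * (case p of (x, z) \<Rightarrow> far_kernel g r x z))"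
        using h C by (intro AE_I2) (auto simp: abs_mult intro!: mult_right_mono)
    qed measurable
  qed
  also have "\<dots> = (\<integral>x. \<bar>B (v x) - B k\<bar> * far_op g r x \<partial>lebesgue_Rd d)"
    by (simp add: far_op_def h_def)
  finally show ?thesis .
qed

end

lemma continuous_bounded_interval:
  assumes "continuous_on {0..T} (p :: real \<Rightarrow> real)"
  obtains C where "0 \<le> C" "\<And>t. t \<in> {0..T} \<Longrightarrow> \<bar>p t\<bar> \<le> C"
proof -
  have "compact (p ` {0..T})" by (intro compact_continuous_image assms) auto
  then obtain C where "\<forall>y\<in>p ` {0..T}. norm y \<le> C"
    using compact_imp_bounded bounded_iff by metis
  then show thesis by (intro that[of "max C 0"]) (auto simp: le_max_iff_disj)
qed

section \<open>Differential inequalities in time\<close>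

(* The weak form of p' \<le> q with p 0 \<le> p0. *)

locale time_inequality =
  fixes T :: real and p q :: "real \<Rightarrow> real" and p0 :: real
  assumes T: "0 < T"
    and pc: "continuous_on {0..T} p" and qc: "continuous_on {0..T} q"
    and H: "\<And>\<theta>. Cc \<theta> \<Longrightarrow> (\<And>s. 0 \<le> \<theta> s) \<Longrightarrow>
      0 \<le> (\<integral>t. deriv \<theta> t * p t + \<theta> t * q t \<partial>time_interval T) - \<theta> T * p T + \<theta> 0 * p0"
begin

(* With the extension by 0 outside of (0, T), cutoffs that begin at a negative time see the initial
   term p0. *)

definition p_ext where "p_ext t = indicator {0<..<T} t * p t"
definition q_ext where "q_ext t = indicator {0<..<T} t * q t"

lemma ext_measurable [measurable]: "p_ext \<in> borel_measurable borel" "q_ext \<in> borel_measurable borel"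
proof -
  have s: "{0<..<T} \<subseteq> {0..T}" by auto
  show "p_ext \<in> borel_measurable borel"
    using borel_measurable_continuous_on_indicator[OF _ continuous_on_subset[OF pc s]]
    by (simp add: p_ext_def[abs_def])
  show "q_ext \<in> borel_measurable borel"
    using borel_measurable_continuous_on_indicator[OF _ continuous_on_subset[OF qc s]]
    by (simp add: q_ext_def[abs_def])
qed

lemma ext_bounded: obtains C where "0 \<le> C" "\<And>t. \<bar>p_ext t\<bar> \<le> C" "\<And>t. \<bar>q_ext t\<bar> \<le> C"
proof -
  obtain C1 where 1: "0 \<le> C1" "\<And>t. t \<in> {0..T} \<Longrightarrow> \<bar>p t\<bar> \<le> C1" using pc by (rule continuous_bounded_interval) blast
  obtain C2 where 2: "0 \<le> C2" "\<And>t. t \<in> {0..T} \<Longrightarrow> \<bar>q t\<bar> \<le> C2" using qc by (rule continuous_bounded_interval) blast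
  show thesis
    by (rule that[of "max C1 C2"]) (use 1 2 in \<open>auto simp: p_ext_def q_ext_def indicator_def le_max_iff_disj\<close>)
qed

lemma isCont_p_ext: assumes "a \<in> {0<..<T} \<or> a < 0" shows "isCont p_ext a"
  using assms
proof
  assume a: "a \<in> {0<..<T}"
  have "continuous_on {0<..<T} p" by (rule continuous_on_subset[OF pc]) auto
  then have "isCont p a" using a by (simp add: continuous_on_eq_continuous_at)
  moreover have "eventually (\<lambda>t. p t = p_ext t) (nhds a)"
  proof -
    have "eventually (\<lambda>s. s \<in> {0<..<T}) (nhds a)" using a by (intro eventually_nhds_in_open) auto
    then show ?thesis by eventually_elim (auto simp: p_ext_def)
  qed
  ultimately show ?thesis using isCont_cong by blast
next
  assume a: "a < 0"
  have "eventually (\<lambda>s. s \<in> {..<0}) (nhds a)" using a by (intro eventually_nhds_in_open) auto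
  then have "eventually (\<lambda>t. 0 = p_ext t) (nhds a)" by eventually_elim (auto simp: p_ext_def)
  then show ?thesis using isCont_cong[of "\<lambda>_. 0" p_ext a] by auto
qed

text \<open>The hypothesis \<open>H\<close> with \<theta> = \<open>cutoff a b n\<close> and n to
  infinity. The terminal term vanishes because b < T. If a < 0, the cutoff is 1 at time 0 for large
  n and \<open>p_ext\<close> vanishes at a, so the initial term enters instead of p a; if a > 0, the
  cutoff eventually vanishes at time 0.\<close>

lemma cutoff_inequality:
  assumes b: "0 < b" "b < T" and a: "a < b" "a \<noteq> 0"
  shows "0 \<le> p_ext a - p b + (\<integral>t. q_ext t * indicator {a<..<b} t \<partial>lborel) + (if a < 0 then p0 else 0)"
proof -
  obtain C where C: "0 \<le> C" "\<And>t. \<bar>p_ext t\<bar> \<le> C" "\<And>t. \<bar>q_ext t\<bar> \<le> C" by (rule ext_bounded) blast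
  have inf: "(\<lambda>n. 1 / real n) \<longlonglongrightarrow> 0"
    by (intro tendsto_divide_0[OF tendsto_const] filterlim_at_top_imp_at_infinity filterlim_real_sequentially)
  have small: "eventually (\<lambda>n. 1 / real n < e \<and> 1 \<le> n) sequentially" if "0 < e" for e
    using order_tendstoD(2)[OF inf that] eventually_ge_at_top[of "1::nat"] by eventually_elim simp
  \<comment> \<open>X collects the derivative of the cutoff paired with p, Y the cutoff paired with
    q.\<close>
  define X where "X n = (\<integral>t. p_ext t * (real n * bump (real n * (t - a))) \<partial>lborel) - (\<integral>t. p_ext t * (real n * bump (real n * (t - b))) \<partial>lborel)" for n
  define Y where "Y n = (\<integral>t. q_ext t * cutoff a b n t \<partial>lborel)" for n
  have Xl: "X \<longlonglongrightarrow> p_ext a - p_ext b"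
    unfolding X_def using a b by (intro tendsto_diff bump_mollify[where C = C] isCont_p_ext C) auto
  have cutm [measurable]: "cutoff a b n \<in> borel_measurable borel" for n
    using cutoff_smooth1 smooth1_measurable by blast
  have Yl: "Y \<longlonglongrightarrow> (\<integral>t. q_ext t * indicator {a<..<b} t \<partial>lborel)"
    unfolding Y_def
  proof (rule integral_dominated_convergence[where w = "\<lambda>t. C * indicator {0<..<T} t"])
    show "integrable lborel (\<lambda>t. C * indicator {0<..<T} t)"
      using T by (intro integrable_mult_right integrable_real_indicator) auto
    have "AE t in lborel. t \<noteq> a" "AE t in lborel. t \<noteq> b" by (rule AE_lborel_singleton)+
    then show "AE t in lborel. (\<lambda>n. q_ext t * cutoff a b n t) \<longlonglongrightarrow> q_ext t * indicator {a<..<b} t"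
    proof eventually_elim
      case (elim t)
      have "(\<lambda>n. cutoff a b n t) \<longlonglongrightarrow> indicator {a<..<b} t"
      proof (cases "a < t \<and> t < b")
        case True
        then have "eventually (\<lambda>n. 1 / real n < min (t - a) (b - t) \<and> 1 \<le> n) sequentially" by (intro small) auto
        then have "eventually (\<lambda>n. cutoff a b n t = indicator {a<..<b} t) sequentially"
          by eventually_elim (use True in \<open>auto intro!: cutoff_inside\<close>)
        then show ?thesis by (rule tendsto_eventually)
      next
        case False
        then have o: "t < a \<or> b < t" using elim by auto
        then have "eventually (\<lambda>n. 1 / real n < max (a - t) (t - b) \<and> 1 \<le> n) sequentially" by (intro small) auto
        then have "eventually (\<lambda>n. cutoff a b n t = indicator {a<..<b} t) sequentially"
        proof eventually_elim
          case (elim n)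
          then have "t \<le> a - 1 / real n \<or> b + 1 / real n \<le> t" by (auto simp: max_def split: if_splits)
          then show ?case using elim a False by (auto simp: cutoff_outside)
        qed
        then show ?thesis by (rule tendsto_eventually)
      qed
      then show ?case by (intro tendsto_mult tendsto_const)
    qed
    show "AE t in lborel. norm (q_ext t * cutoff a b n t) \<le> C * indicator {0<..<T} t" for n
    proof (intro AE_I2)
      fix t
      have "\<bar>q_ext t\<bar> \<le> C * indicator {0<..<T} t" using C(3)[of t] by (auto simp: q_ext_def indicator_def)
      moreover have "\<bar>cutoff a b n t\<bar> \<le> 1" using cutoff_bounds[of a b n t] a by auto
      ultimately have "\<bar>q_ext t\<bar> * \<bar>cutoff a b n t\<bar> \<le> (C * indicator {0<..<T} t) * 1"
        using C(1) by (intro mult_mono) auto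
      then show "norm (q_ext t * cutoff a b n t) \<le> C * indicator {0<..<T} t" by (simp add: abs_mult)
    qed
    show "(\<lambda>t. q_ext t * indicator {a<..<b} t) \<in> borel_measurable lborel"
      using ext_measurable(2) by (intro borel_measurable_times borel_measurable_indicator) auto
    show "(\<lambda>t. q_ext t * cutoff a b n t) \<in> borel_measurable lborel" for n
      using ext_measurable(2) cutm[of n] by (intro borel_measurable_times) auto
  qed
  have T0: "(\<lambda>n. cutoff a b n T) \<longlonglongrightarrow> 0"
  proof (rule tendsto_eventually)
    have "eventually (\<lambda>n. 1 / real n < T - b \<and> 1 \<le> n) sequentially" using b by (intro small) auto
    then show "eventually (\<lambda>n. cutoff a b n T = 0) sequentially"
      by eventually_elim (use a in \<open>auto intro!: cutoff_outside\<close>)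
  qed
  have Z0: "(\<lambda>n. cutoff a b n 0) \<longlonglongrightarrow> (if a < 0 then 1 else 0)"
  proof (rule tendsto_eventually)
    have "eventually (\<lambda>n. 1 / real n < min b \<bar>a\<bar> \<and> 1 \<le> n) sequentially" using a b by (intro small) auto
    then show "eventually (\<lambda>n. cutoff a b n 0 = (if a < 0 then 1 else 0)) sequentially"
      by eventually_elim (use a in \<open>auto intro!: cutoff_outside cutoff_inside\<close>)
  qed
  have ineq: "0 \<le> X n + Y n - cutoff a b n T * p T + cutoff a b n 0 * p0" if n: "1 \<le> n" for n
  proof -
    have Cc: "Cc (cutoff a b n)" using n a by (intro cutoff_Cc) auto
    have d: "deriv (cutoff a b n) s = n * bump (n * (s - a)) - n * bump (n * (s - b))" for s
      by (rule DERIV_imp_deriv[OF cutoff_DERIV])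
    have bi: "integrable lborel (\<lambda>t. p_ext t * (real n * bump (real n * (t - c))))" for c
    proof (rule Bochner_Integration.integrable_bound)
      show "integrable lborel (\<lambda>t. C * (n * bump (n * (t - c))))"
        using Cc_integrable[OF Cc_shift[OF Cc_scale[OF bump_props(1), of n n]], of c] n by simp
      show "AE t in lborel. norm (p_ext t * (n * bump (n * (t - c)))) \<le> norm (C * (n * bump (n * (t - c))))"
        using C bump_props(2) by (auto simp: abs_mult intro!: mult_right_mono)
    qed simp
    have qi: "integrable lborel (\<lambda>t. q_ext t * cutoff a b n t)"
    proof (rule Bochner_Integration.integrable_bound)
      show "integrable lborel (\<lambda>t. C * cutoff a b n t)" using Cc_integrable[OF Cc] by simp
      show "AE t in lborel. norm (q_ext t * cutoff a b n t) \<le> norm (C * cutoff a b n t)"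
        using C by (auto simp: abs_mult intro!: mult_right_mono)
    qed simp
    have "(\<integral>t. deriv (cutoff a b n) t * p t + cutoff a b n t * q t \<partial>time_interval T)
      = (\<integral>t. indicator {0<..<T} t *\<^sub>R (deriv (cutoff a b n) t * p t + cutoff a b n t * q t) \<partial>lborel)"
      by (rule integral_restrict_space) simp
    also have "\<dots> = (\<integral>t. (p_ext t * (real n * bump (real n * (t - a))) - p_ext t * (real n * bump (real n * (t - b)))) + q_ext t * cutoff a b n t \<partial>lborel)"
      by (intro Bochner_Integration.integral_cong refl) (simp add: d p_ext_def q_ext_def algebra_simps)
    also have "\<dots> = X n + Y n"
      unfolding X_def Y_def
      by (subst Bochner_Integration.integral_add[OF Bochner_Integration.integrable_diff[OF bi bi] qi],
          subst Bochner_Integration.integral_diff[OF bi bi]) simp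
    finally show ?thesis using H[OF Cc] cutoff_bounds(1)[of a b n] a by simp
  qed
  have "(\<lambda>n. X n + Y n - cutoff a b n T * p T + cutoff a b n 0 * p0) \<longlonglongrightarrow>
     (p_ext a - p_ext b) + (\<integral>t. q_ext t * indicator {a<..<b} t \<partial>lborel) - 0 * p T + (if a < 0 then 1 else 0) * p0"
    by (intro tendsto_intros Xl Yl T0 Z0)
  then have "0 \<le> (p_ext a - p_ext b) + (\<integral>t. q_ext t * indicator {a<..<b} t \<partial>lborel) - 0 * p T + (if a < 0 then 1 else 0) * p0"
    by (rule LIMSEQ_le_const) (use ineq in blast)
  moreover have "p_ext b = p b" using b by (simp add: p_ext_def)
  ultimately show ?thesis by (simp split: if_splits)
qed

lemma interior_bound:
  assumes "0 < a" "a < b" "b < T" and c: "\<And>t. t \<in> {a..b} \<Longrightarrow> q t \<le> c"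
  shows "p b - p a \<le> c * (b - a)"
proof -
  obtain C where C: "0 \<le> C" "\<And>t. \<bar>p_ext t\<bar> \<le> C" "\<And>t. \<bar>q_ext t\<bar> \<le> C" by (rule ext_bounded) blast
  have ii: "integrable lborel (\<lambda>t. k * indicator {a<..<b} t)" for k :: real
    using assms by (intro integrable_mult_right integrable_real_indicator) auto
  have "integrable lborel (\<lambda>t. q_ext t * indicator {a<..<b} t)"
    by (rule Bochner_Integration.integrable_bound[OF ii[of C]]) (use C in \<open>auto simp: indicator_def\<close>)
  then have "(\<integral>t. q_ext t * indicator {a<..<b} t \<partial>lborel) \<le> (\<integral>t. c * indicator {a<..<b} t \<partial>lborel)"
    using ii assms by (intro integral_mono) (auto simp: indicator_def q_ext_def)
  also have "\<dots> = c * (b - a)" using assms by simp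
  finally show ?thesis using cutoff_inequality[of b a] assms by (simp add: p_ext_def)
qed

lemma p_tendsto:
  assumes "X \<longlonglongrightarrow> t" "\<And>n. X n \<in> {0..T}" "t \<in> {0..T}"
  shows "(\<lambda>n. p (X n)) \<longlonglongrightarrow> p t"
  using continuous_on_tendsto_compose[OF pc assms(1,3)] assms(2) by simp

text \<open>The end points 0 and T are reached from the interior by continuity of p.\<close>

lemma increment_bound:
  assumes ab: "0 \<le> a" "a \<le> b" "b \<le> T" and c: "\<And>t. t \<in> {a..b} \<Longrightarrow> q t \<le> c"
  shows "p b - p a \<le> c * (b - a)"
proof (cases "a = b")
  case False
  then have ab': "a < b" using ab by simp
  \<comment> \<open>Adding 3 keeps 2 h n below b - a, so the shrunken interval is nondegenerate and
    lies inside (0,T).\<close>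
  define h where "h n = (b - a) / (real n + 3)" for n :: nat
  have h0: "h \<longlonglongrightarrow> 0"
    unfolding h_def by (intro tendsto_divide_0[OF tendsto_const] filterlim_at_top_imp_at_infinity
      filterlim_tendsto_add_at_top[OF tendsto_const, of _ _ 3, unfolded add.commute[of 3]] filterlim_real_sequentially)
  have h: "0 < h n" "2 * h n < b - a" for n
  proof -
    have "(b - a) * 2 < (b - a) * (real n + 3)" using ab' by (intro mult_strict_left_mono) auto
    then show "2 * h n < b - a" by (simp add: h_def field_simps)
    show "0 < h n" using ab' by (simp add: h_def add_nonneg_pos)
  qed
  have l1: "(\<lambda>n. a + h n) \<longlonglongrightarrow> a" using tendsto_add[OF tendsto_const h0, of a] by simp
  have l2: "(\<lambda>n. b - h n) \<longlonglongrightarrow> b" using tendsto_diff[OF tendsto_const h0, of b] by simp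
  have "(\<lambda>n. p (b - h n) - p (a + h n)) \<longlonglongrightarrow> p b - p a"
  proof (intro tendsto_diff p_tendsto l1 l2)
    show "b - h n \<in> {0..T}" "a + h n \<in> {0..T}" for n using h[of n] ab by auto
  qed (use ab in auto)
  moreover have "(\<lambda>n. c * ((b - h n) - (a + h n))) \<longlonglongrightarrow> c * (b - a)"
    by (intro tendsto_intros l1 l2)
  moreover have "p (b - h n) - p (a + h n) \<le> c * ((b - h n) - (a + h n))" for n
  proof (rule interior_bound)
    show "0 < a + h n" "a + h n < b - h n" "b - h n < T" using h[of n] ab by auto
    show "q t \<le> c" if "t \<in> {a + h n..b - h n}" for t using that h[of n] by (intro c) auto
  qed
  ultimately show ?thesis by (intro LIMSEQ_le) blast+
qed simp

text \<open>Use cutoffs that begin at time -1 and end at h: what remains is p0 and the integral of q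
  over (0,h), which vanishes with h.\<close>

lemma initial_bound: "p 0 \<le> p0"
proof -
  obtain C where C: "0 \<le> C" "\<And>t. \<bar>p_ext t\<bar> \<le> C" "\<And>t. \<bar>q_ext t\<bar> \<le> C" by (rule ext_bounded) blast
  define h where "h n = T / (real n + 3)" for n :: nat
  have h0: "h \<longlonglongrightarrow> 0"
    unfolding h_def by (intro tendsto_divide_0[OF tendsto_const] filterlim_at_top_imp_at_infinity
      filterlim_tendsto_add_at_top[OF tendsto_const, of _ _ 3, unfolded add.commute[of 3]] filterlim_real_sequentially)
  have h: "0 < h n" "h n < T" for n
  proof -
    have "T * 1 < T * (real n + 3)" using T by (intro mult_strict_left_mono) auto
    then show "h n < T" by (simp add: h_def field_simps)
    show "0 < h n" using T by (simp add: h_def add_nonneg_pos)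
  qed
  have "p (h n) \<le> p0 + C * h n" for n
  proof -
    have ii: "integrable lborel (\<lambda>t. C * indicator {0<..<h n} t)"
      using h[of n] by (intro integrable_mult_right integrable_real_indicator) auto
    have b: "q_ext t * indicator {-1<..<h n} t \<le> C * indicator {0<..<h n} t" "\<bar>q_ext t * indicator {-1<..<h n} t\<bar> \<le> C * indicator {0<..<h n} t" for t
      using C(3)[of t] h[of n] by (auto simp: indicator_def q_ext_def split: if_splits)
    have "integrable lborel (\<lambda>t. q_ext t * indicator {-1<..<h n} t)"
      by (rule Bochner_Integration.integrable_bound[OF ii]) (use b C(1) in \<open>auto simp: abs_mult\<close>)
    then have "(\<integral>t. q_ext t * indicator {-1<..<h n} t \<partial>lborel) \<le> (\<integral>t. C * indicator {0<..<h n} t \<partial>lborel)"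
      using ii b(1) by (intro integral_mono) auto
    also have "\<dots> = C * h n" using h[of n] by simp
    finally show ?thesis using cutoff_inequality[of "h n" "-1"] h[of n] by (simp add: p_ext_def)
  qed
  moreover have "(\<lambda>n. p (h n)) \<longlonglongrightarrow> p 0"
    by (rule p_tendsto[OF h0]) (use h T less_imp_le in auto)
  moreover have "(\<lambda>n. p0 + C * h n) \<longlonglongrightarrow> p0 + C * 0" by (intro tendsto_intros h0)
  ultimately have "p 0 \<le> p0 + C * 0" by (intro LIMSEQ_le) blast+
  then show ?thesis by simp
qed

end

section \<open>Continuity in time with values in L1\<close>

lemma C_L1_integrable: "C_L1 d T v \<Longrightarrow> t \<in> {0..T} \<Longrightarrow> integrable (lebesgue_Rd d) (\<lambda>x. v x t)"
  by (simp add: C_L1_def)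

lemma C_L1_continuous:
  assumes v: "C_L1 d T v"
    and h: "\<And>s t. s \<in> {0..T} \<Longrightarrow> t \<in> {0..T} \<Longrightarrow> \<bar>h s - h t\<bar> \<le> K * L1_norm d (\<lambda>x. v x s - v x t)"
  shows "continuous_on {0..T} (h :: real \<Rightarrow> real)"
  unfolding continuous_on_def
proof
  fix t assume t: "t \<in> {0..T}"
  have "((\<lambda>s. K * L1_norm d (\<lambda>x. v x s - v x t)) \<longlongrightarrow> K * 0) (at t within {0..T})"
    using v t by (intro tendsto_mult tendsto_const) (simp add: C_L1_def)
  then have "((\<lambda>s. h s - h t) \<longlongrightarrow> 0) (at t within {0..T})"
    by (intro Lim_null_comparison[of "\<lambda>s. h s - h t" "\<lambda>s. K * L1_norm d (\<lambda>x. v x s - v x t)"])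
      (use h t in \<open>auto simp: eventually_at_filter\<close>)
  then show "(h \<longlongrightarrow> h t) (at t within {0..T})" by (rule LIM_zero_cancel)
qed

lemma L1_norm_triangle:
  assumes "integrable (lebesgue_Rd d) a" "integrable (lebesgue_Rd d) b" "integrable (lebesgue_Rd d) c"
  shows "L1_norm d (\<lambda>x. a x - c x) \<le> L1_norm d (\<lambda>x. a x - b x) + L1_norm d (\<lambda>x. b x - c x)"
proof -
  have "L1_norm d (\<lambda>x. a x - c x) \<le> (\<integral>x. \<bar>a x - b x\<bar> + \<bar>b x - c x\<bar> \<partial>lebesgue_Rd d)"
    unfolding L1_norm_def using assms
    by (intro integral_mono integrable_abs Bochner_Integration.integrable_diff Bochner_Integration.integrable_add) auto
  also have "\<dots> = L1_norm d (\<lambda>x. a x - b x) + L1_norm d (\<lambda>x. b x - c x)"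
    unfolding L1_norm_def using assms by (intro Bochner_Integration.integral_add integrable_abs Bochner_Integration.integrable_diff)
  finally show ?thesis .
qed

lemma C_L1_norm_bounded:
  assumes v: "C_L1 d T v"
  obtains C where "0 \<le> C" "\<And>t. t \<in> {0..T} \<Longrightarrow> L1_norm d (\<lambda>x. v x t) \<le> C"
proof -
  have "continuous_on {0..T} (\<lambda>t. L1_norm d (\<lambda>x. v x t))"
  proof (rule C_L1_continuous[OF v, where K = 1])
    fix s t assume st: "s \<in> {0..T}" "t \<in> {0..T}"
    note i = C_L1_integrable[OF v st(1)] C_L1_integrable[OF v st(2)]
    have "L1_norm d (\<lambda>x. v x s - 0) \<le> L1_norm d (\<lambda>x. v x s - v x t) + L1_norm d (\<lambda>x. v x t - 0)"
      "L1_norm d (\<lambda>x. v x t - 0) \<le> L1_norm d (\<lambda>x. v x t - v x s) + L1_norm d (\<lambda>x. v x s - 0)"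
      by (rule L1_norm_triangle; use i in simp)+
    moreover have "L1_norm d (\<lambda>x. v x t - v x s) = L1_norm d (\<lambda>x. v x s - v x t)"
      by (simp add: L1_norm_def abs_minus_commute)
    ultimately show "\<bar>L1_norm d (\<lambda>x. v x s) - L1_norm d (\<lambda>x. v x t)\<bar> \<le> 1 * L1_norm d (\<lambda>x. v x s - v x t)"
      by simp
  qed
  then show thesis by (rule continuous_bounded_interval) (use that in \<open>auto simp: abs_le_iff\<close>)
qed

lemma prodf_time: "prodf (Suc d) (g(d := \<theta>)) (x(d := t)) = prodf d g x * \<theta> t"
proof -
  have "(\<Prod>i<d. (g(d := \<theta>)) i ((x(d := t)) i)) = (\<Prod>i<d. g i (x i))"
    by (intro prod.cong) auto
  then show ?thesis unfolding prodf_def by (simp add: lessThan_Suc mult.commute del: fun_upd_apply) simp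
qed

lemma dprodf_time: "i < d \<Longrightarrow> dprodf (Suc d) (g(d := \<theta>)) i (x(d := t)) = dprodf d g i x * \<theta> t"
proof -
  assume "i < d"
  then have "(g(d := \<theta>))(i := deriv ((g(d := \<theta>)) i)) = (g(i := deriv (g i)))(d := \<theta>)" by auto
  then show ?thesis unfolding dprodf_def by (simp only: prodf_time)
qed

lemma dprodf_time_last: "dprodf (Suc d) (g(d := \<theta>)) d (x(d := t)) = prodf d g x * deriv \<theta> t"
  unfolding dprodf_def by (simp add: prodf_time)

lemma Cc_measurable: "Cc \<theta> \<Longrightarrow> \<theta> \<in> borel_measurable borel"
  using CcD smooth1_measurable by blast

section \<open>The entropy inequality against a frozen function\<close>

text \<open>One setting for both equations: B will be \<epsilon> A for the perturbed equation and 0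
  for the conservation law.\<close>

locale entropy_setting = levy_space d \<mu> for d \<mu> +
  fixes f :: "real \<Rightarrow> nat \<Rightarrow> real" and B :: "real \<Rightarrow> real"
    and u0 :: "(nat \<Rightarrow> real) \<Rightarrow> real" and T :: real and v :: "(nat \<Rightarrow> real) \<Rightarrow> real \<Rightarrow> real"
    and Lf LB CB :: real
  assumes T: "0 < T" and sol: "entropy_solution d f B \<mu> u0 T v"
    and u0: "integrable (lebesgue_Rd d) u0"
    and f_lip: "\<And>i s s'. i < d \<Longrightarrow> \<bar>f s i - f s' i\<bar> \<le> Lf * \<bar>s - s'\<bar>" and Lf: "0 \<le> Lf"
    and B_lip: "\<And>s s'. \<bar>B s - B s'\<bar> \<le> LB * \<bar>s - s'\<bar>" and LB: "0 \<le> LB"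
    and B_mono: "mono B" and B_bound: "\<And>s. \<bar>B s\<bar> \<le> CB"
begin

lemma lip2_flux: "i < d \<Longrightarrow> lip2 Lf (\<lambda>a b. entropy_flux f a b i)"
  by (rule lip2_entropy_flux[OF f_lip Lf])

lemma lip2_B: "lip2 LB (\<lambda>a b. \<bar>B a - B b\<bar>)"
  by (rule lip2_abs_diff[OF B_lip LB])

lemma B_measurable: "B \<in> borel_measurable borel"
proof -
  have "((\<lambda>s. B s) \<longlongrightarrow> B a) (at a)" for a
  proof -
    have "((\<lambda>s. LB * \<bar>s - a\<bar>) \<longlongrightarrow> LB * \<bar>a - a\<bar>) (at a)" by (intro tendsto_intros)
    then have "((\<lambda>s. LB * \<bar>s - a\<bar>) \<longlongrightarrow> 0) (at a)" by simp
    then have "((\<lambda>s. B s - B a) \<longlongrightarrow> 0) (at a)"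
      by (rule Lim_null_comparison[rotated]) (use B_lip in auto)
    then show ?thesis by (rule LIM_zero_cancel)
  qed
  then have "continuous_on UNIV B" by (simp add: continuous_on_def)
  then show ?thesis by (rule borel_measurable_continuous_onI)
qed

lemma v_C_L1: "C_L1 d T v" using sol by (simp add: entropy_solution_def)

lemma v_integrable: "t \<in> {0..T} \<Longrightarrow> integrable (lebesgue_Rd d) (\<lambda>x. v x t)"
  using v_C_L1 by (rule C_L1_integrable)

lemma v_measurable: "(\<lambda>(x, t). v x t) \<in> borel_measurable (space_time d T)"
  using sol by (simp add: entropy_solution_def L_inf_def)

lemma v_bounded: obtains c where "0 \<le> c" "AE p in space_time d T. \<bar>v (fst p) (snd p)\<bar> \<le> c"
proof -
  obtain c where c: "AE p in space_time d T. \<bar>case p of (x, t) \<Rightarrow> v x t\<bar> \<le> c"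
    using sol by (auto simp: entropy_solution_def L_inf_def)
  show thesis
  proof (rule that[of "max c 0"])
    show "AE p in space_time d T. \<bar>v (fst p) (snd p)\<bar> \<le> max c 0"
      using c by eventually_elim (auto simp: split_def)
  qed auto
qed

lemma v_space_time_integrable: "integrable (space_time d T) (\<lambda>(x, t). v x t)"
proof (rule integrableI_bounded[OF v_measurable])
  obtain C where C: "0 \<le> C" "\<And>t. t \<in> {0..T} \<Longrightarrow> L1_norm d (\<lambda>x. v x t) \<le> C"
    using v_C_L1 by (rule C_L1_norm_bounded) blast
  have m: "(\<lambda>p. ennreal (norm (case p of (x, t) \<Rightarrow> v x t))) \<in> borel_measurable (lebesgue_Rd d \<Otimes>\<^sub>M time_interval T)"
    using v_measurable unfolding space_time_def by measurable
  have "(\<integral>\<^sup>+ p. ennreal (norm (case p of (x, t) \<Rightarrow> v x t)) \<partial>space_time d T)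
    = (\<integral>\<^sup>+ t. (\<integral>\<^sup>+ x. ennreal (norm (v x t)) \<partial>lebesgue_Rd d) \<partial>time_interval T)"
    unfolding space_time_def using ST.nn_integral_snd[OF m] by simp
  also have "\<dots> \<le> (\<integral>\<^sup>+ t. ennreal C \<partial>time_interval T)"
  proof (rule nn_integral_mono)
    fix t assume "t \<in> space (time_interval T)"
    then have t: "t \<in> {0..T}" by (auto simp: space_restrict_space)
    have "(\<integral>\<^sup>+ x. ennreal (norm (v x t)) \<partial>lebesgue_Rd d) = ennreal (L1_norm d (\<lambda>x. v x t))"
      unfolding L1_norm_def real_norm_def
      using v_integrable[OF t] by (intro nn_integral_eq_integral integrable_abs) auto
    also have "\<dots> \<le> ennreal C" using C(2)[OF t] by (rule ennreal_leI)
    finally show "(\<integral>\<^sup>+ x. ennreal (norm (v x t)) \<partial>lebesgue_Rd d) \<le> ennreal C" .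
  qed
  also have "\<dots> < \<infinity>"
    using TI.emeasure_finite[of T "{0<..<T}"]
    by (simp add: ennreal_mult_eq_top_iff space_restrict_space less_top[symmetric])
  finally show "(\<integral>\<^sup>+ p. ennreal (norm (case p of (x, t) \<Rightarrow> v x t)) \<partial>space_time d T) < \<infinity>" .
qed

lemma v_fst_snd_measurable: "(\<lambda>p. v (fst p) (snd p)) \<in> borel_measurable (space_time d T)"
  using v_measurable by (simp add: split_def)

lemma term_measurable:
  assumes J: "lip2 L J" and \<kappa>: "\<kappa> \<in> borel_measurable (lebesgue_Rd d)" and \<theta>: "\<theta> \<in> borel_measurable borel"
  shows "(\<lambda>(x, t). \<theta> t * (J (v x t) k * \<kappa> x)) \<in> borel_measurable (space_time d T)"
  unfolding split_def
  by (intro borel_measurable_times lip2_measurable[OF J] v_fst_snd_measurable borel_measurable_const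
      measurable_compose[OF fst_space_time \<kappa>] measurable_compose[OF snd_space_time \<theta>])

lemma term_integrable:
  assumes J: "lip2 L J" and \<kappa>: "integrable (lebesgue_Rd d) \<kappa>"
    and \<theta>: "\<theta> \<in> borel_measurable borel" "\<And>t. \<bar>\<theta> t\<bar> \<le> (c::real)"
  shows "integrable (space_time d T) (\<lambda>(x, t). \<theta> t * (J (v x t) k * \<kappa> x))"
proof -
  obtain b where b: "0 \<le> b" "AE p in space_time d T. \<bar>v (fst p) (snd p)\<bar> \<le> b" by (rule v_bounded)
  have L: "0 \<le> L" using J by (simp add: lip2_def)
  have c: "0 \<le> c" using \<theta>(2)[of 0] by linarith
  show ?thesis
  proof (rule space_time_bounded_integrable[OF term_measurable[OF J borel_measurable_integrable[OF \<kappa>] \<theta>(1)] \<kappa>])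
    show "AE p in space_time d T. \<bar>case p of (x, t) \<Rightarrow> \<theta> t * (J (v x t) k * \<kappa> x)\<bar> \<le> (c * (L * b + L * \<bar>k\<bar>)) * \<bar>\<kappa> (fst p)\<bar>"
      using b(2)
    proof eventually_elim
      case (elim p)
      have "\<bar>J (v (fst p) (snd p)) k\<bar> \<le> L * \<bar>v (fst p) (snd p)\<bar> + L * \<bar>k\<bar>" by (rule lip2_abs_bound[OF J])
      also have "\<dots> \<le> L * b + L * \<bar>k\<bar>" using elim L by (intro add_mono mult_left_mono) auto
      finally have "\<bar>\<theta> (snd p)\<bar> * \<bar>J (v (fst p) (snd p)) k\<bar> \<le> c * (L * b + L * \<bar>k\<bar>)"
        using \<theta>(2) c by (intro mult_mono) auto
      then have "\<bar>\<theta> (snd p)\<bar> * \<bar>J (v (fst p) (snd p)) k\<bar> * \<bar>\<kappa> (fst p)\<bar> \<le> (c * (L * b + L * \<bar>k\<bar>)) * \<bar>\<kappa> (fst p)\<bar>"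
        by (rule mult_right_mono) simp
      then show ?case by (simp add: split_def abs_mult mult.assoc)
    qed
  qed
qed

text \<open>Integrating over y the space-time terms with k = w y and the kernel centred at y gives
  time integrals of pairings. The form \<open>has_bochner_integral\<close> delivers integrability in
  y together with the value, so the terms of the entropy inequality can be added.\<close>

lemma term_pairing:
  assumes J: "lip2 L J" and \<kappa>: "integrable (lebesgue_Rd d) \<kappa>" "\<exists>C. \<forall>x\<in>Rd d. \<bar>\<kappa> x\<bar> \<le> C"
    and \<theta>: "\<theta> \<in> borel_measurable borel" "\<And>t. \<bar>\<theta> t\<bar> \<le> (c::real)"
    and w: "integrable (lebesgue_Rd d) w"
  shows "has_bochner_integral (lebesgue_Rd d)
      (\<lambda>y. \<integral>(x, t). \<theta> t * (J (v x t) (w y) * \<kappa> (vsub d x y)) \<partial>space_time d T)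
      (\<integral>t. \<theta> t * pairing d (\<lambda>x y. J (v x t) (w y)) \<kappa> \<partial>time_interval T)"
    and "integrable (time_interval T) (\<lambda>t. \<theta> t * pairing d (\<lambda>x y. J (v x t) (w y)) \<kappa>)"
proof -
  interpret S: pair_sigma_finite "space_time d T" "lebesgue_Rd d"
    by (intro pair_sigma_finite.intro sigma_finite_space_time sigma_finite_lebesgue_Rd)
  obtain C where C: "\<And>x. x \<in> Rd d \<Longrightarrow> \<bar>\<kappa> x\<bar> \<le> C" using \<kappa>(2) by blast
  have L: "0 \<le> L" using J by (simp add: lip2_def)
  have c: "0 \<le> c" using \<theta>(2)[of 0] by linarith
  note \<kappa>m = borel_measurable_integrable[OF \<kappa>(1)] and wm = borel_measurable_integrable[OF w]
  have vs: "(\<lambda>q. vsub d (fst (fst q)) (snd q)) \<in> space_time d T \<Otimes>\<^sub>M lebesgue_Rd d \<rightarrow>\<^sub>M lebesgue_Rd d"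
    by (intro vsub_measurable measurable_compose[OF measurable_fst fst_space_time] measurable_snd)
  define G where "G = (\<lambda>q. \<theta> (snd (fst q)) * (J (v (fst (fst q)) (snd (fst q))) (w (snd q)) * \<kappa> (vsub d (fst (fst q)) (snd q))))"
  have Gm: "G \<in> borel_measurable (space_time d T \<Otimes>\<^sub>M lebesgue_Rd d)"
    unfolding G_def
    by (intro borel_measurable_times lip2_measurable[OF J] measurable_compose[OF measurable_fst v_fst_snd_measurable]
        measurable_compose[OF measurable_snd wm] measurable_compose[OF vs \<kappa>m]
        measurable_compose[OF measurable_compose[OF measurable_fst snd_space_time] \<theta>(1)])
  have ka: "integrable (lebesgue_Rd d) (\<lambda>x. \<bar>\<kappa> x\<bar>)" using \<kappa>(1) by simp
  have i1: "integrable (space_time d T \<Otimes>\<^sub>M lebesgue_Rd d) (\<lambda>q. \<bar>v (fst (fst q)) (snd (fst q))\<bar> * \<bar>\<kappa> (vsub d (fst (fst q)) (snd q))\<bar>)"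
  proof (rule S.Fubini_integrable)
    show "(\<lambda>q. \<bar>v (fst (fst q)) (snd (fst q))\<bar> * \<bar>\<kappa> (vsub d (fst (fst q)) (snd q))\<bar>) \<in> borel_measurable (space_time d T \<Otimes>\<^sub>M lebesgue_Rd d)"
      by (intro borel_measurable_times borel_measurable_abs measurable_compose[OF measurable_fst v_fst_snd_measurable] measurable_compose[OF vs \<kappa>m])
    show "integrable (space_time d T) (\<lambda>p. \<integral>y. norm (\<bar>v (fst (fst (p, y))) (snd (fst (p, y)))\<bar> * \<bar>\<kappa> (vsub d (fst (fst (p, y))) (snd (p, y)))\<bar>) \<partial>lebesgue_Rd d)"
      using integrable_mult_left[OF integrable_abs[OF v_space_time_integrable], of "\<integral>x. \<bar>\<kappa> x\<bar> \<partial>lebesgue_Rd d"]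
        integral_vsub_left[OF borel_measurable_integrable[OF ka]] by (simp add: split_def)
    show "AE p in space_time d T. integrable (lebesgue_Rd d) (\<lambda>y. \<bar>v (fst (fst (p, y))) (snd (fst (p, y)))\<bar> * \<bar>\<kappa> (vsub d (fst (fst (p, y))) (snd (p, y)))\<bar>)"
      using integrable_vsub_left[OF ka] by simp
  qed
  \<comment> \<open>The bound on the kernel makes the integral over y converge for every space-time
    point, not just after averaging in x.\<close>
  have i2: "integrable (space_time d T \<Otimes>\<^sub>M lebesgue_Rd d) (\<lambda>q. \<bar>w (snd q)\<bar> * \<bar>\<kappa> (vsub d (fst (fst q)) (snd q))\<bar>)"
  proof (rule S.Fubini_integrable)
    have k: "integrable (lebesgue_Rd d \<Otimes>\<^sub>M lebesgue_Rd d) (\<lambda>(x, y). \<bar>w y\<bar> * \<bar>\<kappa> (vsub d x y)\<bar>)"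
      by (rule kernel_integrable'(1)[OF integrable_abs[OF w] ka])
    have H: "integrable (lebesgue_Rd d) (\<lambda>x. \<integral>y. \<bar>w y\<bar> * \<bar>\<kappa> (vsub d x y)\<bar> \<partial>lebesgue_Rd d)"
      using lRR.integrable_fst'[OF k] by simp
    show "(\<lambda>q. \<bar>w (snd q)\<bar> * \<bar>\<kappa> (vsub d (fst (fst q)) (snd q))\<bar>) \<in> borel_measurable (space_time d T \<Otimes>\<^sub>M lebesgue_Rd d)"
      by (intro borel_measurable_times borel_measurable_abs measurable_compose[OF measurable_snd wm] measurable_compose[OF vs \<kappa>m])
    show "integrable (space_time d T) (\<lambda>p. \<integral>y. norm (\<bar>w (snd (p, y))\<bar> * \<bar>\<kappa> (vsub d (fst (fst (p, y))) (snd (p, y)))\<bar>) \<partial>lebesgue_Rd d)"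
      using space_time_tensor_integrable[OF H, of "\<lambda>_. 1" 1 T] by (simp add: split_def)
    show "AE p in space_time d T. integrable (lebesgue_Rd d) (\<lambda>y. \<bar>w (snd (p, y))\<bar> * \<bar>\<kappa> (vsub d (fst (fst (p, y))) (snd (p, y)))\<bar>)"
    proof (intro AE_I2)
      fix p assume "p \<in> space (space_time d T)"
      then have p: "fst p \<in> space (lebesgue_Rd d)" by (auto simp: space_space_time space_lebesgue_Rd)
      show "integrable (lebesgue_Rd d) (\<lambda>y. \<bar>w (snd (p, y))\<bar> * \<bar>\<kappa> (vsub d (fst (fst (p, y))) (snd (p, y)))\<bar>)"
      proof (rule Bochner_Integration.integrable_bound[OF integrable_mult_right[OF w, of C]])
        have "(\<lambda>y. vsub d (fst p) y) \<in> lebesgue_Rd d \<rightarrow>\<^sub>M lebesgue_Rd d"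
          unfolding affine_forms(3)[of d "fst p"] by (rule affine_measurable)
        from measurable_compose[OF this \<kappa>m]
        show "(\<lambda>y. \<bar>w (snd (p, y))\<bar> * \<bar>\<kappa> (vsub d (fst (fst (p, y))) (snd (p, y)))\<bar>) \<in> borel_measurable (lebesgue_Rd d)"
          using wm by (intro borel_measurable_times borel_measurable_abs) simp_all
        have "\<bar>w y\<bar> * \<bar>\<kappa> (vsub d (fst p) y)\<bar> \<le> \<bar>w y\<bar> * \<bar>C\<bar>" for y
          using C[of "vsub d (fst p) y"] by (intro mult_left_mono) auto
        then show "AE y in lebesgue_Rd d. norm (\<bar>w (snd (p, y))\<bar> * \<bar>\<kappa> (vsub d (fst (fst (p, y))) (snd (p, y)))\<bar>) \<le> norm (C * w y)"
          by (simp add: abs_mult mult.commute)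
      qed
    qed
  qed
  have Gi: "integrable (space_time d T \<Otimes>\<^sub>M lebesgue_Rd d) G"
  proof (rule Bochner_Integration.integrable_bound[OF _ Gm])
    show "integrable (space_time d T \<Otimes>\<^sub>M lebesgue_Rd d) (\<lambda>q. c * L * (\<bar>v (fst (fst q)) (snd (fst q))\<bar> * \<bar>\<kappa> (vsub d (fst (fst q)) (snd q))\<bar> + \<bar>w (snd q)\<bar> * \<bar>\<kappa> (vsub d (fst (fst q)) (snd q))\<bar>))"
      by (intro integrable_mult_right Bochner_Integration.integrable_add i1 i2)
    show "AE q in space_time d T \<Otimes>\<^sub>M lebesgue_Rd d. norm (G q) \<le> norm (c * L * (\<bar>v (fst (fst q)) (snd (fst q))\<bar> * \<bar>\<kappa> (vsub d (fst (fst q)) (snd q))\<bar> + \<bar>w (snd q)\<bar> * \<bar>\<kappa> (vsub d (fst (fst q)) (snd q))\<bar>))"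
    proof (intro AE_I2)
      fix q
      let ?a = "v (fst (fst q)) (snd (fst q))" and ?b = "w (snd q)" and ?k = "\<kappa> (vsub d (fst (fst q)) (snd q))"
      have "\<bar>\<theta> (snd (fst q))\<bar> * \<bar>J ?a ?b\<bar> \<le> c * (L * \<bar>?a\<bar> + L * \<bar>?b\<bar>)"
        using \<theta>(2) c lip2_abs_bound[OF J] by (intro mult_mono) auto
      then have "\<bar>\<theta> (snd (fst q))\<bar> * \<bar>J ?a ?b\<bar> * \<bar>?k\<bar> \<le> c * (L * \<bar>?a\<bar> + L * \<bar>?b\<bar>) * \<bar>?k\<bar>"
        by (rule mult_right_mono) simp
      also have "\<dots> = c * L * (\<bar>?a\<bar> * \<bar>?k\<bar> + \<bar>?b\<bar> * \<bar>?k\<bar>)" by (simp add: algebra_simps)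
      finally show "norm (G q) \<le> norm (c * L * (\<bar>?a\<bar> * \<bar>?k\<bar> + \<bar>?b\<bar> * \<bar>?k\<bar>))"
        using c L by (simp add: G_def abs_mult mult.assoc)
    qed
  qed
  have Gi': "integrable (space_time d T \<Otimes>\<^sub>M lebesgue_Rd d) (case_prod (\<lambda>p y. G (p, y)))" using Gi by simp
  have inner: "(\<integral>x. (\<integral>y. G ((x, t), y) \<partial>lebesgue_Rd d) \<partial>lebesgue_Rd d)
      = \<theta> t * pairing d (\<lambda>x y. J (v x t) (w y)) \<kappa>" if t: "t \<in> space (time_interval T)" for t
  proof -
    have "t \<in> {0..T}" using t by (auto simp: space_restrict_space)
    from pairing_fst[OF dominated_lip2[OF J v_integrable[OF this] w] \<kappa>(1)]
    show ?thesis by (simp add: G_def)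
  qed
  have y: "integrable (lebesgue_Rd d) (\<lambda>y. \<integral>p. G (p, y) \<partial>space_time d T)"
    using S.integrable_snd[OF Gi'] .
  have p: "integrable (space_time d T) (\<lambda>p. \<integral>y. G (p, y) \<partial>lebesgue_Rd d)"
    using S.integrable_fst[OF Gi'] .
  have "(\<integral>y. (\<integral>p. G (p, y) \<partial>space_time d T) \<partial>lebesgue_Rd d)
     = (\<integral>p. (\<integral>y. G (p, y) \<partial>lebesgue_Rd d) \<partial>space_time d T)"
    using S.Fubini_integral[OF Gi'] .
  also have "\<dots> = (\<integral>t. (\<integral>x. (\<integral>y. G ((x, t), y) \<partial>lebesgue_Rd d) \<partial>lebesgue_Rd d) \<partial>time_interval T)"
    by (rule space_time_integral_snd(1)[OF p])
  also have "\<dots> = (\<integral>t. \<theta> t * pairing d (\<lambda>x y. J (v x t) (w y)) \<kappa> \<partial>time_interval T)"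
    by (rule Bochner_Integration.integral_cong[OF refl inner])
  finally show "has_bochner_integral (lebesgue_Rd d)
      (\<lambda>y. \<integral>(x, t). \<theta> t * (J (v x t) (w y) * \<kappa> (vsub d x y)) \<partial>space_time d T)
      (\<integral>t. \<theta> t * pairing d (\<lambda>x y. J (v x t) (w y)) \<kappa> \<partial>time_interval T)"
    using has_bochner_integral_integrable[OF y] by (simp add: G_def split_def)
  show "integrable (time_interval T) (\<lambda>t. \<theta> t * pairing d (\<lambda>x y. J (v x t) (w y)) \<kappa>)"
    using space_time_integral_snd(2)[OF p] inner by (subst (asm) Bochner_Integration.integrable_cong[OF refl]) auto
qed

text \<open>\<open>far_entropy\<close> integrated in time. Boundedness of B bounds
  \<open>levy_far\<close> by 2 CB times the mass of the jumps beyond r, which makes the term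
  integrable.\<close>

lemma far_term:
  assumes g: "Ccs d g" "\<And>x. 0 \<le> prodf d g x" and r: "0 < r" and \<theta>: "Cc \<theta>" "\<And>s. 0 \<le> \<theta> s"
  shows "integrable (space_time d T) (\<lambda>(x, t). \<theta> t * (sgn (v x t - k) * levy_far d \<mu> r (\<lambda>y. B (v y t)) x * prodf d g x))"
    and "(\<integral>(x, t). \<theta> t * (sgn (v x t - k) * levy_far d \<mu> r (\<lambda>y. B (v y t)) x * prodf d g x) \<partial>space_time d T)
       \<le> (\<integral>(x, t). \<theta> t * (\<bar>B (v x t) - B k\<bar> * far_op g r x) \<partial>space_time d T)"
proof -
  obtain c where c: "0 \<le> c" "\<And>t. \<bar>\<theta> t\<bar> \<le> c" using \<theta>(1) by (rule Cc_bounded) blast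
  define m :: real where "m = (\<integral>z. indicator {z. r < vnorm d z} z \<partial>\<mu>)"
  have fi: "integrable \<mu> (\<lambda>z. indicator {z. r < vnorm d z} z :: real)" by (rule far_integrable[OF r])
  have mp: "(\<lambda>q. (vadd d (fst (fst q)) (snd q), snd (fst q))) \<in> space_time d T \<Otimes>\<^sub>M \<mu> \<rightarrow>\<^sub>M space_time d T"
  proof -
    have 1: "(\<lambda>q. vadd d (fst (fst q)) (snd q)) \<in> space_time d T \<Otimes>\<^sub>M \<mu> \<rightarrow>\<^sub>M lebesgue_Rd d"
      by (intro vadd_measurable measurable_compose[OF measurable_fst fst_space_time] measurable_compose[OF measurable_snd levy_ident])
    have 2: "(\<lambda>q. snd (fst q)) \<in> space_time d T \<Otimes>\<^sub>M \<mu> \<rightarrow>\<^sub>M time_interval T"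
      unfolding space_time_def by measurable
    show ?thesis using measurable_Pair[OF 1 2] by (simp add: space_time_def)
  qed
  have Bv: "(\<lambda>p. B (v (fst p) (snd p))) \<in> borel_measurable (space_time d T)"
    by (rule measurable_compose[OF v_fst_snd_measurable B_measurable])
  have ind: "(\<lambda>q. indicator {z. r < vnorm d z} (snd q) :: real) \<in> borel_measurable (space_time d T \<Otimes>\<^sub>M \<mu>)"
    by (rule measurable_compose[OF measurable_snd borel_measurable_integrable[OF fi]])
  have "(\<lambda>q. indicator {z. r < vnorm d z} (snd q) *\<^sub>R (B (v (vadd d (fst (fst q)) (snd q)) (snd (fst q))) - B (v (fst (fst q)) (snd (fst q)))))
      \<in> borel_measurable (space_time d T \<Otimes>\<^sub>M \<mu>)"
    using measurable_compose[OF mp Bv] measurable_compose[OF measurable_fst Bv]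
    by (intro borel_measurable_scaleR borel_measurable_diff ind) simp_all
  then have farm: "(\<lambda>p. levy_far d \<mu> r (\<lambda>y. B (v y (snd p))) (fst p)) \<in> borel_measurable (space_time d T)"
    unfolding levy_far_def set_lebesgue_integral_def
    by (intro L.borel_measurable_lebesgue_integral) (simp add: split_def)
  have farb: "\<bar>levy_far d \<mu> r (\<lambda>y. B (v y t)) x\<bar> \<le> 2 * CB * m" for x t
  proof -
    have "\<bar>levy_far d \<mu> r (\<lambda>y. B (v y t)) x\<bar> \<le> (\<integral>z. \<bar>indicator {z. r < vnorm d z} z *\<^sub>R (B (v (vadd d x z) t) - B (v x t))\<bar> \<partial>\<mu>)"
      unfolding levy_far_def set_lebesgue_integral_def by (rule integral_abs_bound)
    also have "\<dots> \<le> (\<integral>z. 2 * CB * indicator {z. r < vnorm d z} z \<partial>\<mu>)"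
    proof (rule integral_mono')
      show "integrable \<mu> (\<lambda>z. 2 * CB * indicator {z. r < vnorm d z} z)" using fi by (rule integrable_mult_right)
      fix z
      have "\<bar>B (v (vadd d x z) t) - B (v x t)\<bar> \<le> 2 * CB"
        using B_bound[of "v (vadd d x z) t"] B_bound[of "v x t"] by linarith
      then show "\<bar>indicator {z. r < vnorm d z} z *\<^sub>R (B (v (vadd d x z) t) - B (v x t))\<bar> \<le> 2 * CB * indicator {z. r < vnorm d z} z"
        by (auto simp: indicator_def)
      show "0 \<le> 2 * CB * indicator {z. r < vnorm d z} z" using B_bound[of 0] by (simp add: indicator_def)
    qed
    also have "\<dots> = 2 * CB * m" by (simp add: m_def)
    finally show ?thesis .
  qed
  define F where "F = (\<lambda>(x, t). \<theta> t * (sgn (v x t - k) * levy_far d \<mu> r (\<lambda>y. B (v y t)) x * prodf d g x))"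
  have Fm: "F \<in> borel_measurable (space_time d T)"
  proof -
    have "(\<lambda>p. sgn (v (fst p) (snd p) - k)) \<in> borel_measurable (space_time d T)"
    proof (rule measurable_compose[OF v_fst_snd_measurable])
      show "(\<lambda>s. sgn (s - k)) \<in> borel_measurable borel" by measurable
    qed
    then show ?thesis
      unfolding F_def split_def
      by (intro borel_measurable_times farm prodf_measurable[OF g(1) fst_space_time]
          measurable_compose[OF snd_space_time Cc_measurable[OF \<theta>(1)]])
  qed
  have Fi: "integrable (space_time d T) F"
  proof (rule space_time_bounded_integrable[OF Fm prodf_integrable[OF g(1)]])
    have "\<bar>F p\<bar> \<le> c * (2 * CB * m) * \<bar>prodf d g (fst p)\<bar>" for p
    proof -
      have "\<bar>sgn (v (fst p) (snd p) - k)\<bar> * \<bar>levy_far d \<mu> r (\<lambda>y. B (v y (snd p))) (fst p)\<bar> \<le> 1 * (2 * CB * m)"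
        by (rule mult_mono[OF _ farb]) (auto simp: abs_sgn_eq)
      then have "\<bar>\<theta> (snd p)\<bar> * (\<bar>sgn (v (fst p) (snd p) - k)\<bar> * \<bar>levy_far d \<mu> r (\<lambda>y. B (v y (snd p))) (fst p)\<bar>) \<le> c * (1 * (2 * CB * m))"
        by (intro mult_mono[OF c(2)]) (use c in auto)
      then have "(\<bar>\<theta> (snd p)\<bar> * (\<bar>sgn (v (fst p) (snd p) - k)\<bar> * \<bar>levy_far d \<mu> r (\<lambda>y. B (v y (snd p))) (fst p)\<bar>)) * \<bar>prodf d g (fst p)\<bar>
         \<le> c * (1 * (2 * CB * m)) * \<bar>prodf d g (fst p)\<bar>" by (rule mult_right_mono) simp
      then show ?thesis by (simp add: F_def split_def abs_mult mult.assoc)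
    qed
    then show "AE p in space_time d T. \<bar>F p\<bar> \<le> c * (2 * CB * m) * \<bar>prodf d g (fst p)\<bar>" by simp
  qed
  then show "integrable (space_time d T) (\<lambda>(x, t). \<theta> t * (sgn (v x t - k) * levy_far d \<mu> r (\<lambda>y. B (v y t)) x * prodf d g x))"
    by (simp add: F_def)
  define F' where "F' = (\<lambda>(x, t). \<theta> t * (\<bar>B (v x t) - B k\<bar> * far_op g r x))"
  have F'i: "integrable (space_time d T) F'"
    unfolding F'_def by (rule term_integrable[OF lip2_B far_op_integrable[OF g(1) r] Cc_measurable[OF \<theta>(1)] c(2)])
  have "(\<integral>p. F p \<partial>space_time d T) \<le> (\<integral>p. F' p \<partial>space_time d T)"
    unfolding space_time_integral_snd(1)[OF Fi] space_time_integral_snd(1)[OF F'i]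
  proof (rule integral_mono[OF space_time_integral_snd(2)[OF Fi] space_time_integral_snd(2)[OF F'i]])
    fix t assume "t \<in> space (time_interval T)"
    then have "t \<in> {0..T}" by (auto simp: space_restrict_space)
    then have "(\<lambda>x. v x t) \<in> borel_measurable (lebesgue_Rd d)" using v_integrable by auto
    from far_entropy[OF g r this B_mono B_bound B_measurable, of k]
    have "\<theta> t * (\<integral>x. sgn (v x t - k) * levy_far d \<mu> r (\<lambda>y. B (v y t)) x * prodf d g x \<partial>lebesgue_Rd d)
      \<le> \<theta> t * (\<integral>x. \<bar>B (v x t) - B k\<bar> * far_op g r x \<partial>lebesgue_Rd d)" using \<theta>(2) by (intro mult_left_mono)
    then show "(\<integral>x. F (x, t) \<partial>lebesgue_Rd d) \<le> (\<integral>x. F' (x, t) \<partial>lebesgue_Rd d)"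
      by (simp add: F_def F'_def)
  qed
  then show "(\<integral>(x, t). \<theta> t * (sgn (v x t - k) * levy_far d \<mu> r (\<lambda>y. B (v y t)) x * prodf d g x) \<partial>space_time d T)
       \<le> (\<integral>(x, t). \<theta> t * (\<bar>B (v x t) - B k\<bar> * far_op g r x) \<partial>space_time d T)"
    by (simp add: F_def F'_def)
qed

definition space_time_term :: "(real \<Rightarrow> real) \<Rightarrow> (real \<Rightarrow> real \<Rightarrow> real) \<Rightarrow> ((nat \<Rightarrow> real) \<Rightarrow> real) \<Rightarrow> real \<Rightarrow> real" where
  "space_time_term \<theta> J \<kappa> k = (\<integral>(x, t). \<theta> t * (J (v x t) k * \<kappa> x) \<partial>space_time d T)"

text \<open>The test function is the product of a spatial kernel and \<theta>. The jumps up to r and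
  the drift are regrouped by \<open>levy_near_dual\<close>, and the far term is replaced by its
  upper bound, so that the solution enters only through Lipschitz integrands.\<close>

lemma entropy_inequality:
  assumes g: "Ccs d g" "\<And>x. 0 \<le> prodf d g x" and r: "0 < r" and \<theta>: "Cc \<theta>" "\<And>s. 0 \<le> \<theta> s"
  shows "0 \<le> space_time_term (deriv \<theta>) (\<lambda>a b. \<bar>a - b\<bar>) (prodf d g) k
    + (\<Sum>i<d. space_time_term \<theta> (\<lambda>a b. entropy_flux f a b i) (dprodf d g i) k)
    + space_time_term \<theta> (\<lambda>a b. \<bar>B a - B b\<bar>) (near_op g r) k
    + space_time_term \<theta> (\<lambda>a b. \<bar>B a - B b\<bar>) (far_op g r) k
    + (\<Sum>i<d. drift r i * space_time_term \<theta> (\<lambda>a b. \<bar>B a - B b\<bar>) (dprodf d g i) k)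
    - (\<integral>x. \<bar>v x T - k\<bar> * prodf d g x \<partial>lebesgue_Rd d) * \<theta> T
    + (\<integral>x. \<bar>u0 x - k\<bar> * prodf d g x \<partial>lebesgue_Rd d) * \<theta> 0"
proof -
  obtain c where c: "0 \<le> c" "\<And>t. \<bar>\<theta> t\<bar> \<le> c" using \<theta>(1) by (rule Cc_bounded) blast
  obtain c' where c': "0 \<le> c'" "\<And>t. \<bar>deriv \<theta> t\<bar> \<le> c'" using Cc_deriv[OF \<theta>(1)] by (rule Cc_bounded) blast
  note \<theta>m = Cc_measurable[OF \<theta>(1)] Cc_measurable[OF Cc_deriv[OF \<theta>(1)]]
  have pint: "integrable (lebesgue_Rd d) (dprodf d g i)" for i
    unfolding dprodf_def by (rule prodf_integrable[OF Ccs_deriv[OF g(1)]])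
  have sm: "\<And>i. i < Suc d \<Longrightarrow> smooth1 ((g(d := \<theta>)) i)"
    using g(1) \<theta>(1) CcD by (auto simp: Ccs_def less_Suc_eq)
  define \<phi> where "\<phi> = prodf (Suc d) (g(d := \<theta>))"
  have \<phi>e: "\<phi> (x(d := t)) = prodf d g x * \<theta> t" for x t unfolding \<phi>_def by (rule prodf_time)
  have \<phi>d: "partial d \<phi> (x(d := t)) = prodf d g x * deriv \<theta> t" for x t
    unfolding \<phi>_def partial_prodf[of d "Suc d" "g(d := \<theta>)", OF lessI sm[OF lessI]] by (rule dprodf_time_last)
  have \<phi>i: "partial i \<phi> (x(d := t)) = dprodf d g i x * \<theta> t" if "i < d" for i x t
    unfolding \<phi>_def using partial_prodf[of i "Suc d" "g(d := \<theta>)"] sm[of i] that dprodf_time[OF that] by simp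
  have Ccs: "Ccs (Suc d) (g(d := \<theta>))" using g(1) \<theta>(1) by (auto simp: Ccs_def less_Suc_eq)
  have \<phi>0: "0 \<le> \<phi> y" for y
  proof -
    have "\<phi> y = \<phi> (y(d := y d))" by simp
    also have "\<dots> = prodf d g y * \<theta> (y d)" by (rule \<phi>e)
    finally show ?thesis using g(2) \<theta>(2) by simp
  qed
  define a1 where "a1 = (\<lambda>(x, t). \<bar>v x t - k\<bar> * partial d \<phi> (x(d := t))
            + (\<Sum>i<d. (entropy_flux f (v x t) k i + levy_drift d (dual_measure d \<mu>) r i * \<bar>B (v x t) - B k\<bar>)
                     * partial i \<phi> (x(d := t))))"
  define a2 where "a2 = (\<lambda>(x, t). \<bar>B (v x t) - B k\<bar> * levy_near d (dual_measure d \<mu>) r (\<lambda>y. \<phi> (y(d := t))) x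
            + sgn (v x t - k) * levy_far d \<mu> r (\<lambda>y. B (v y t)) x * \<phi> (x(d := t)))"
  have ent: "0 \<le> (\<integral>p. a1 p \<partial>space_time d T) + (\<integral>p. a2 p \<partial>space_time d T)
      - (\<integral>x. \<bar>v x T - k\<bar> * \<phi> (x(d := T)) \<partial>lebesgue_Rd d) + (\<integral>x. \<bar>u0 x - k\<bar> * \<phi> (x(d := 0)) \<partial>lebesgue_Rd d)"
    using sol r test_fun_prodf[OF Ccs] \<phi>0 unfolding entropy_solution_def a1_def a2_def \<phi>_def by blast
  define F1 where "F1 = (\<lambda>(x, t). deriv \<theta> t * (\<bar>v x t - k\<bar> * prodf d g x))"
  define F2 where "F2 i = (\<lambda>(x, t). \<theta> t * (entropy_flux f (v x t) k i * dprodf d g i x))" for i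
  define F3 where "F3 i = (\<lambda>(x, t). \<theta> t * (\<bar>B (v x t) - B k\<bar> * dprodf d g i x))" for i
  define F4 where "F4 = (\<lambda>(x, t). \<theta> t * (\<bar>B (v x t) - B k\<bar> * near_op g r x))"
  define F5 where "F5 = (\<lambda>(x, t). \<theta> t * (sgn (v x t - k) * levy_far d \<mu> r (\<lambda>y. B (v y t)) x * prodf d g x))"
  have I1: "integrable (space_time d T) F1"
    unfolding F1_def by (rule term_integrable[OF lip2_dist prodf_integrable[OF g(1)] \<theta>m(2) c'(2)])
  have I2: "integrable (space_time d T) (F2 i)" if "i < d" for i
    unfolding F2_def by (rule term_integrable[OF lip2_flux[OF that] pint \<theta>m(1) c(2)])
  have I3: "integrable (space_time d T) (F3 i)" for i
    unfolding F3_def by (rule term_integrable[OF lip2_B pint \<theta>m(1) c(2)])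
  have I4: "integrable (space_time d T) F4"
    unfolding F4_def by (rule term_integrable[OF lip2_B near_op_integrable[OF g(1) r] \<theta>m(1) c(2)])
  have I5: "integrable (space_time d T) F5"
    unfolding F5_def by (rule far_term(1)[OF g r \<theta>])
  let ?ld = "\<lambda>i. levy_drift d (dual_measure d \<mu>) r i"
  have e1: "a1 p = F1 p + ((\<Sum>i<d. F2 i p) + (\<Sum>i<d. ?ld i * F3 i p))" for p
    by (cases p) (simp add: a1_def F1_def F2_def F3_def \<phi>d \<phi>i algebra_simps sum.distrib)
  \<comment> \<open>The sum over \<open>levy_drift\<close> subtracted here cancels the one added in
    \<open>e1\<close>.\<close>
  have e2: "a2 p = (F4 p + (\<Sum>i<d. drift r i * F3 i p) - (\<Sum>i<d. ?ld i * F3 i p)) + F5 p"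
    if p: "p \<in> space (space_time d T)" for p
  proof -
    obtain x t where p': "p = (x, t)" "x \<in> Rd d" using p by (cases p) (auto simp: space_space_time)
    have n: "levy_near d (dual_measure d \<mu>) r (\<lambda>y. \<phi> (y(d := t))) x
      = \<theta> t * (near_op g r x + (\<Sum>i<d. drift r i * dprodf d g i x)) - (\<Sum>i<d. ?ld i * (dprodf d g i x * \<theta> t))"
      using levy_near_dual[OF g(1) r p'(2), of "\<theta> t"] unfolding \<phi>e by simp
    show ?thesis
      unfolding a2_def p' prod.case n
      by (simp add: F3_def F4_def F5_def \<phi>e right_diff_distrib distrib_left sum_distrib_left mult_ac)
  qed
  have S2: "integrable (space_time d T) (\<lambda>p. \<Sum>i<d. F2 i p)" by (rule Bochner_Integration.integrable_sum) (use I2 in auto)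
  have S3: "integrable (space_time d T) (\<lambda>p. \<Sum>i<d. e i * F3 i p)" for e
    by (intro Bochner_Integration.integrable_sum integrable_mult_right I3)
  have i1: "(\<integral>p. a1 p \<partial>space_time d T) = (\<integral>p. F1 p \<partial>space_time d T) + ((\<integral>p. (\<Sum>i<d. F2 i p) \<partial>space_time d T) + (\<integral>p. (\<Sum>i<d. ?ld i * F3 i p) \<partial>space_time d T))"
    unfolding e1[abs_def] using I1 S2 S3 by simp
  have "(\<integral>p. a2 p \<partial>space_time d T) = (\<integral>p. (F4 p + (\<Sum>i<d. drift r i * F3 i p) - (\<Sum>i<d. ?ld i * F3 i p)) + F5 p \<partial>space_time d T)"
    by (rule Bochner_Integration.integral_cong[OF refl e2])
  also have "\<dots> = (\<integral>p. F4 p \<partial>space_time d T) + (\<integral>p. (\<Sum>i<d. drift r i * F3 i p) \<partial>space_time d T)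
      - (\<integral>p. (\<Sum>i<d. ?ld i * F3 i p) \<partial>space_time d T) + (\<integral>p. F5 p \<partial>space_time d T)"
    using I4 I5 S3 by simp
  finally have i2: "(\<integral>p. a2 p \<partial>space_time d T) = \<dots>" .
  have s2: "(\<integral>p. (\<Sum>i<d. F2 i p) \<partial>space_time d T) = (\<Sum>i<d. space_time_term \<theta> (\<lambda>a b. entropy_flux f a b i) (dprodf d g i) k)"
    unfolding space_time_term_def F2_def[symmetric] by (rule Bochner_Integration.integral_sum) (use I2 in auto)
  have s3: "(\<integral>p. (\<Sum>i<d. drift r i * F3 i p) \<partial>space_time d T) = (\<Sum>i<d. drift r i * space_time_term \<theta> (\<lambda>a b. \<bar>B a - B b\<bar>) (dprodf d g i) k)"
    unfolding space_time_term_def F3_def[symmetric]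
    by (subst Bochner_Integration.integral_sum) (use I3 in auto)
  have f5: "(\<integral>p. F5 p \<partial>space_time d T) \<le> space_time_term \<theta> (\<lambda>a b. \<bar>B a - B b\<bar>) (far_op g r) k"
    unfolding F5_def space_time_term_def by (rule far_term(2)[OF g r \<theta>])
  have "(\<integral>x. \<bar>v x T - k\<bar> * \<phi> (x(d := T)) \<partial>lebesgue_Rd d) = (\<integral>x. \<bar>v x T - k\<bar> * prodf d g x \<partial>lebesgue_Rd d) * \<theta> T"
    "(\<integral>x. \<bar>u0 x - k\<bar> * \<phi> (x(d := 0)) \<partial>lebesgue_Rd d) = (\<integral>x. \<bar>u0 x - k\<bar> * prodf d g x \<partial>lebesgue_Rd d) * \<theta> 0"
    unfolding \<phi>e by (simp_all add: mult.assoc[symmetric])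
  then show ?thesis
    using ent i1 i2 f5 unfolding s2 s3 by (simp add: space_time_term_def F1_def F4_def)
qed

section \<open>Pairing a solution with a frozen function\<close>

definition Phi :: "(nat \<Rightarrow> real \<Rightarrow> real) \<Rightarrow> ((nat \<Rightarrow> real) \<Rightarrow> real) \<Rightarrow> real \<Rightarrow> real" where
  "Phi g w t = pairing d (\<lambda>x y. \<bar>v x t - w y\<bar>) (prodf d g)"

definition Flux :: "(nat \<Rightarrow> real \<Rightarrow> real) \<Rightarrow> ((nat \<Rightarrow> real) \<Rightarrow> real) \<Rightarrow> real \<Rightarrow> real" where
  "Flux g w t = (\<Sum>i<d. pairing d (\<lambda>x y. entropy_flux f (v x t) (w y) i) (dprodf d g i))"

definition Diff :: "(nat \<Rightarrow> real \<Rightarrow> real) \<Rightarrow> real \<Rightarrow> ((nat \<Rightarrow> real) \<Rightarrow> real) \<Rightarrow> real \<Rightarrow> real" where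
  "Diff g r w t = pairing d (\<lambda>x y. \<bar>B (v x t) - B (w y)\<bar>) (near_op g r)
    + pairing d (\<lambda>x y. \<bar>B (v x t) - B (w y)\<bar>) (far_op g r)
    + (\<Sum>i<d. drift r i * pairing d (\<lambda>x y. \<bar>B (v x t) - B (w y)\<bar>) (dprodf d g i))"

lemma has_bochner_integral_pairing:
  assumes "dominated d W \<alpha> \<beta>" "integrable (lebesgue_Rd d) \<kappa>"
  shows "has_bochner_integral (lebesgue_Rd d) (\<lambda>y. \<integral>x. W x y * \<kappa> (vsub d x y) \<partial>lebesgue_Rd d) (pairing d W \<kappa>)"
  using has_bochner_integral_integrable[OF lRR.integrable_snd[OF pairing_integrable[OF assms]]]
  unfolding pairing_snd[OF assms] .

(* The entropy inequality is used with k = w y and the test function prodf d g (x - y) \<theta> t, and then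
   integrated over y. *)

lemma entropy_pairing:
  assumes g: "Ccs d g" "\<And>x. 0 \<le> prodf d g x" and r: "0 < r" and \<theta>: "Cc \<theta>" "\<And>s. 0 \<le> \<theta> s"
    and w: "integrable (lebesgue_Rd d) w"
  shows "0 \<le> (\<integral>t. deriv \<theta> t * Phi g w t + \<theta> t * (Flux g w t + Diff g r w t) \<partial>time_interval T)
     - \<theta> T * Phi g w T + \<theta> 0 * pairing d (\<lambda>x y. \<bar>u0 x - w y\<bar>) (prodf d g)"
proof -
  obtain c where c: "0 \<le> c" "\<And>t. \<bar>\<theta> t\<bar> \<le> c" using \<theta>(1) by (rule Cc_bounded) blast
  obtain c' where c': "0 \<le> c'" "\<And>t. \<bar>deriv \<theta> t\<bar> \<le> c'" using Cc_deriv[OF \<theta>(1)] by (rule Cc_bounded) blast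
  note \<theta>m = Cc_measurable[OF \<theta>(1)] Cc_measurable[OF Cc_deriv[OF \<theta>(1)]]
  have sm: "\<And>i. i < d \<Longrightarrow> smooth1 (g i)" using g CcD by (auto simp: Ccs_def)
  define gs where "gs y = (\<lambda>i s. g i (s - y i))" for y :: "nat \<Rightarrow> real"
  have gs: "Ccs d (gs y)" for y unfolding gs_def by (rule Ccs_shift[OF g(1)])
  have p: "prodf d (gs y) x = prodf d g (vsub d x y)" for x y
    unfolding prodf_def gs_def by (intro prod.cong) (auto simp: vsub_def)
  have pd: "dprodf d (gs y) i x = dprodf d g i (vsub d x y)" if "i < d" for x y i
    unfolding gs_def dprodf_shift[of i d g, OF that sm[OF that]] unfolding dprodf_def
    by (rule prodf_cong) (simp add: vsub_def)
  have vv: "vsub d (vsub d x z) y = vsub d (vsub d x y) z" for x y z by (auto simp: vsub_def)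
  \<comment> \<open>The operators commute with translations, so centring the kernel at y only shifts
    the argument.\<close>
  have nk: "near_op (gs y) r x = near_op g r (vsub d x y)" for x y
    unfolding near_op_def near_kernel_def by (simp add: p pd vv[of x _ y])
  have fk: "far_op (gs y) r x = far_op g r (vsub d x y)" for x y
    unfolding far_op_def far_kernel_def by (simp add: p vv[of x _ y])
  have pint: "integrable (lebesgue_Rd d) (dprodf d g i)" and pbd: "\<exists>C. \<forall>x\<in>Rd d. \<bar>dprodf d g i x\<bar> \<le> C" for i
  proof -
    show "integrable (lebesgue_Rd d) (dprodf d g i)"
      unfolding dprodf_def by (rule prodf_integrable[OF Ccs_deriv[OF g(1)]])
    show "\<exists>C. \<forall>x\<in>Rd d. \<bar>dprodf d g i x\<bar> \<le> C"
      unfolding dprodf_def using Ccs_deriv[OF g(1)] by (rule prodf_bounded) blast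
  qed
  have gbd: "\<exists>C. \<forall>x\<in>Rd d. \<bar>prodf d g x\<bar> \<le> C" using g(1) by (rule prodf_bounded) blast
  let ?D = "\<lambda>a b. \<bar>a - b\<bar>" and ?B = "\<lambda>a b. \<bar>B a - B b\<bar>"
  note t1 = term_pairing[OF lip2_dist prodf_integrable[OF g(1)] gbd \<theta>m(2) c'(2) w]
  note t2 = term_pairing[OF lip2_flux pint pbd \<theta>m(1) c(2) w]
  note t3 = term_pairing[OF lip2_B near_op_integrable[OF g(1) r] near_kernel_integrable(3)[OF g(1) r] \<theta>m(1) c(2) w]
  note t4 = term_pairing[OF lip2_B far_op_integrable[OF g(1) r] far_kernel_integrable(3)[OF g(1) r] \<theta>m(1) c(2) w]
  note t5 = term_pairing[OF lip2_B pint pbd \<theta>m(1) c(2) w]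
  have Tin: "T \<in> {0..T}" using T by simp
  note hT = has_bochner_integral_pairing[OF dominated_lip2[OF lip2_dist v_integrable[OF Tin] w] prodf_integrable[OF g(1)]]
  note h0 = has_bochner_integral_pairing[OF dominated_lip2[OF lip2_dist u0 w] prodf_integrable[OF g(1)]]
  define R where "R y = space_time_term (deriv \<theta>) ?D (prodf d (gs y)) (w y)
    + (\<Sum>i<d. space_time_term \<theta> (\<lambda>a b. entropy_flux f a b i) (dprodf d (gs y) i) (w y))
    + space_time_term \<theta> ?B (near_op (gs y) r) (w y)
    + space_time_term \<theta> ?B (far_op (gs y) r) (w y)
    + (\<Sum>i<d. drift r i * space_time_term \<theta> ?B (dprodf d (gs y) i) (w y))
    - (\<integral>x. \<bar>v x T - w y\<bar> * prodf d (gs y) x \<partial>lebesgue_Rd d) * \<theta> T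
    + (\<integral>x. \<bar>u0 x - w y\<bar> * prodf d (gs y) x \<partial>lebesgue_Rd d) * \<theta> 0" for y
  have R0: "0 \<le> R y" for y
    unfolding R_def by (rule entropy_inequality[OF gs _ r \<theta>]) (simp add: p g(2))
  define X where "X = (\<integral>t. deriv \<theta> t * Phi g w t \<partial>time_interval T)
    + (\<Sum>i<d. \<integral>t. \<theta> t * pairing d (\<lambda>x y. entropy_flux f (v x t) (w y) i) (dprodf d g i) \<partial>time_interval T)
    + (\<integral>t. \<theta> t * pairing d (\<lambda>x y. ?B (v x t) (w y)) (near_op g r) \<partial>time_interval T)
    + (\<integral>t. \<theta> t * pairing d (\<lambda>x y. ?B (v x t) (w y)) (far_op g r) \<partial>time_interval T)
    + (\<Sum>i<d. drift r i * (\<integral>t. \<theta> t * pairing d (\<lambda>x y. ?B (v x t) (w y)) (dprodf d g i) \<partial>time_interval T))"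
  have "has_bochner_integral (lebesgue_Rd d) R (X - Phi g w T * \<theta> T + pairing d (\<lambda>x y. \<bar>u0 x - w y\<bar>) (prodf d g) * \<theta> 0)"
    unfolding R_def X_def Phi_def space_time_term_def p nk fk
  proof (intro has_bochner_integral_add has_bochner_integral_diff has_bochner_integral_mult_left
      has_bochner_integral_sum t1(1) t3(1) t4(1) hT h0)
    fix i assume "i \<in> {..<d}"
    then have i: "i < d" by simp
    show "has_bochner_integral (lebesgue_Rd d)
      (\<lambda>y. \<integral>(x, t). \<theta> t * (entropy_flux f (v x t) (w y) i * dprodf d (gs y) i x) \<partial>space_time d T)
      (\<integral>t. \<theta> t * pairing d (\<lambda>x y. entropy_flux f (v x t) (w y) i) (dprodf d g i) \<partial>time_interval T)"
      unfolding pd[OF i] by (rule t2(1)[OF i])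
    show "has_bochner_integral (lebesgue_Rd d)
      (\<lambda>y. drift r i * (\<integral>(x, t). \<theta> t * (?B (v x t) (w y) * dprodf d (gs y) i x) \<partial>space_time d T))
      (drift r i * (\<integral>t. \<theta> t * pairing d (\<lambda>x y. ?B (v x t) (w y)) (dprodf d g i) \<partial>time_interval T))"
      unfolding pd[OF i] by (intro has_bochner_integral_mult_right t5(1))
  qed
  from has_bochner_integral_integral_eq[OF this]
  have "0 \<le> X - Phi g w T * \<theta> T + pairing d (\<lambda>x y. \<bar>u0 x - w y\<bar>) (prodf d g) * \<theta> 0"
    using Bochner_Integration.integral_nonneg[where f = R and M = "lebesgue_Rd d"] R0 by simp
  moreover have "X = (\<integral>t. deriv \<theta> t * Phi g w t + \<theta> t * (Flux g w t + Diff g r w t) \<partial>time_interval T)"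
  proof -
    have s2: "integrable (time_interval T) (\<lambda>t. \<Sum>i<d. \<theta> t * pairing d (\<lambda>x y. entropy_flux f (v x t) (w y) i) (dprodf d g i))"
      by (intro Bochner_Integration.integrable_sum t2(2)) auto
    have s5: "integrable (time_interval T) (\<lambda>t. \<Sum>i<d. drift r i * (\<theta> t * pairing d (\<lambda>x y. ?B (v x t) (w y)) (dprodf d g i)))"
      by (intro Bochner_Integration.integrable_sum integrable_mult_right t5(2))
    have "X = (\<integral>t. deriv \<theta> t * Phi g w t \<partial>time_interval T)
      + (\<integral>t. (\<Sum>i<d. \<theta> t * pairing d (\<lambda>x y. entropy_flux f (v x t) (w y) i) (dprodf d g i)) \<partial>time_interval T)
      + (\<integral>t. \<theta> t * pairing d (\<lambda>x y. ?B (v x t) (w y)) (near_op g r) \<partial>time_interval T)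
      + (\<integral>t. \<theta> t * pairing d (\<lambda>x y. ?B (v x t) (w y)) (far_op g r) \<partial>time_interval T)
      + (\<integral>t. (\<Sum>i<d. drift r i * (\<theta> t * pairing d (\<lambda>x y. ?B (v x t) (w y)) (dprodf d g i))) \<partial>time_interval T)"
    proof -
      have "(\<integral>t. (\<Sum>i<d. \<theta> t * pairing d (\<lambda>x y. entropy_flux f (v x t) (w y) i) (dprodf d g i)) \<partial>time_interval T)
        = (\<Sum>i<d. \<integral>t. \<theta> t * pairing d (\<lambda>x y. entropy_flux f (v x t) (w y) i) (dprodf d g i) \<partial>time_interval T)"
        by (rule Bochner_Integration.integral_sum) (use t2(2) in simp)
      moreover have "(\<integral>t. (\<Sum>i<d. drift r i * (\<theta> t * pairing d (\<lambda>x y. ?B (v x t) (w y)) (dprodf d g i))) \<partial>time_interval T)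
        = (\<Sum>i<d. \<integral>t. drift r i * (\<theta> t * pairing d (\<lambda>x y. ?B (v x t) (w y)) (dprodf d g i)) \<partial>time_interval T)"
        by (rule Bochner_Integration.integral_sum) (use t5(2) in simp)
      ultimately show ?thesis unfolding X_def by simp
    qed
    also have "\<dots> = (\<integral>t. deriv \<theta> t * Phi g w t
      + (\<Sum>i<d. \<theta> t * pairing d (\<lambda>x y. entropy_flux f (v x t) (w y) i) (dprodf d g i))
      + \<theta> t * pairing d (\<lambda>x y. ?B (v x t) (w y)) (near_op g r)
      + \<theta> t * pairing d (\<lambda>x y. ?B (v x t) (w y)) (far_op g r)
      + (\<Sum>i<d. drift r i * (\<theta> t * pairing d (\<lambda>x y. ?B (v x t) (w y)) (dprodf d g i))) \<partial>time_interval T)"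
      using t1(2)[folded Phi_def] s2 t3(2) t4(2) s5 by simp
    also have "\<dots> = (\<integral>t. deriv \<theta> t * Phi g w t + \<theta> t * (Flux g w t + Diff g r w t) \<partial>time_interval T)"
      by (intro Bochner_Integration.integral_cong refl)
        (simp add: Flux_def Diff_def distrib_left sum_distrib_left mult.left_commute)
    finally show ?thesis .
  qed
  ultimately show ?thesis by (simp add: mult.commute)
qed

lemma Phi_lipschitz:
  assumes g: "Ccs d g" and w: "integrable (lebesgue_Rd d) w" and st: "s \<in> {0..T}" "t \<in> {0..T}"
  shows "\<bar>Phi g w s - Phi g w t\<bar> \<le> (\<integral>x. \<bar>prodf d g x\<bar> \<partial>lebesgue_Rd d) * L1_norm d (\<lambda>x. v x s - v x t)"
  unfolding Phi_def
  using pairing_lip2_diff[OF lip2_dist v_integrable[OF st(1)] w v_integrable[OF st(2)] w prodf_integrable[OF g]]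
  by (simp add: L1_norm_def mult.commute)

text \<open>Provides the continuity in time that \<open>time_inequality\<close> asks of its
  right-hand side; the size of K is irrelevant for that.\<close>

lemma generator_lipschitz:
  assumes g: "Ccs d g" and r: "0 < r" and w: "integrable (lebesgue_Rd d) w"
  shows "\<exists>K. \<forall>s\<in>{0..T}. \<forall>t\<in>{0..T}. \<bar>(Flux g w s + Diff g r w s) - (Flux g w t + Diff g r w t)\<bar> \<le> K * L1_norm d (\<lambda>x. v x s - v x t)"
proof -
  have pint: "integrable (lebesgue_Rd d) (dprodf d g i)" for i
    unfolding dprodf_def by (rule prodf_integrable[OF Ccs_deriv[OF g]])
  let ?I = "\<lambda>\<kappa>. \<integral>x. \<bar>\<kappa> x\<bar> \<partial>lebesgue_Rd d"
  have lip: "\<bar>pairing d (\<lambda>x y. J (v x s) (w y)) \<kappa> - pairing d (\<lambda>x y. J (v x t) (w y)) \<kappa>\<bar>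
     \<le> (L * ?I \<kappa>) * L1_norm d (\<lambda>x. v x s - v x t)"
    if "lip2 L J" "integrable (lebesgue_Rd d) \<kappa>" "s \<in> {0..T}" "t \<in> {0..T}" for J L \<kappa> s t
    using pairing_lip2_diff[OF that(1) v_integrable[OF that(3)] w v_integrable[OF that(4)] w that(2)]
    by (simp add: L1_norm_def mult_ac)
  define K where "K = (\<Sum>i<d. Lf * ?I (dprodf d g i)) + LB * ?I (near_op g r) + LB * ?I (far_op g r)
     + (\<Sum>i<d. \<bar>drift r i\<bar> * (LB * ?I (dprodf d g i)))"
  show ?thesis
  proof (intro exI[of _ K] ballI)
    fix s t assume st: "s \<in> {0..T}" "t \<in> {0..T}"
    let ?N = "L1_norm d (\<lambda>x. v x s - v x t)"
    have 1: "\<bar>Flux g w s - Flux g w t\<bar> \<le> (\<Sum>i<d. (Lf * ?I (dprodf d g i)) * ?N)"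
      unfolding Flux_def sum_subtractf[symmetric]
      by (intro order_trans[OF sum_abs] sum_mono lip[OF lip2_flux pint st]) auto
    have 2: "\<bar>(\<Sum>i<d. drift r i * pairing d (\<lambda>x y. \<bar>B (v x s) - B (w y)\<bar>) (dprodf d g i))
       - (\<Sum>i<d. drift r i * pairing d (\<lambda>x y. \<bar>B (v x t) - B (w y)\<bar>) (dprodf d g i))\<bar>
       \<le> (\<Sum>i<d. \<bar>drift r i\<bar> * ((LB * ?I (dprodf d g i)) * ?N))"
      unfolding sum_subtractf[symmetric] right_diff_distrib[symmetric]
      by (intro order_trans[OF sum_abs] sum_mono) (auto simp only: abs_mult intro!: mult_left_mono lip[OF lip2_B pint st] abs_ge_zero)
    have "\<bar>(Flux g w s + Diff g r w s) - (Flux g w t + Diff g r w t)\<bar>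
      \<le> (\<Sum>i<d. (Lf * ?I (dprodf d g i)) * ?N) + (LB * ?I (near_op g r)) * ?N + (LB * ?I (far_op g r)) * ?N
       + (\<Sum>i<d. \<bar>drift r i\<bar> * ((LB * ?I (dprodf d g i)) * ?N))"
      using 1 2 lip[OF lip2_B near_op_integrable[OF g r] st] lip[OF lip2_B far_op_integrable[OF g r] st]
      unfolding Diff_def by linarith
    also have "\<dots> = K * ?N"
      by (simp add: K_def distrib_right sum_distrib_right mult.assoc)
    finally show "\<bar>(Flux g w s + Diff g r w s) - (Flux g w t + Diff g r w t)\<bar> \<le> K * ?N" .
  qed
qed

lemma one_sided:
  assumes g: "Ccs d g" "\<And>x. 0 \<le> prodf d g x" and r: "0 < r" and w: "integrable (lebesgue_Rd d) w"
  shows "0 \<le> a \<Longrightarrow> a \<le> b \<Longrightarrow> b \<le> T \<Longrightarrow> (\<And>t. t \<in> {a..b} \<Longrightarrow> Flux g w t + Diff g r w t \<le> c) \<Longrightarrow>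
      Phi g w b - Phi g w a \<le> c * (b - a)"
    and "Phi g w 0 \<le> pairing d (\<lambda>x y. \<bar>u0 x - w y\<bar>) (prodf d g)"
proof -
  obtain K where K: "\<And>s t. s \<in> {0..T} \<Longrightarrow> t \<in> {0..T} \<Longrightarrow>
      \<bar>(Flux g w s + Diff g r w s) - (Flux g w t + Diff g r w t)\<bar> \<le> K * L1_norm d (\<lambda>x. v x s - v x t)"
    using generator_lipschitz[OF g(1) r w] by blast
  interpret ti: time_inequality T "Phi g w" "\<lambda>t. Flux g w t + Diff g r w t" "pairing d (\<lambda>x y. \<bar>u0 x - w y\<bar>) (prodf d g)"
  proof
    show "0 < T" by (rule T)
    show "continuous_on {0..T} (Phi g w)" by (rule C_L1_continuous[OF v_C_L1 Phi_lipschitz[OF g(1) w]])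
    show "continuous_on {0..T} (\<lambda>t. Flux g w t + Diff g r w t)" by (rule C_L1_continuous[OF v_C_L1 K])
  qed (rule entropy_pairing[OF g r _ _ w])
  show "0 \<le> a \<Longrightarrow> a \<le> b \<Longrightarrow> b \<le> T \<Longrightarrow> (\<And>t. t \<in> {a..b} \<Longrightarrow> Flux g w t + Diff g r w t \<le> c) \<Longrightarrow>
      Phi g w b - Phi g w a \<le> c * (b - a)" by (rule ti.increment_bound)
  show "Phi g w 0 \<le> pairing d (\<lambda>x y. \<bar>u0 x - w y\<bar>) (prodf d g)" by (rule ti.initial_bound)
qed

end

section \<open>Doubling the space variables\<close>

text \<open>The set of times with D t at most D 0 is closed, and from its supremum one can still
  move to the right unless it is T. D need not be differentiable.\<close>

lemma right_nonincreasing: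
  fixes D :: "real \<Rightarrow> real"
  assumes c: "continuous_on {0..T} D" and T: "0 \<le> T"
    and loc: "\<And>s. 0 \<le> s \<Longrightarrow> s < T \<Longrightarrow> \<exists>h>0. \<forall>t. s \<le> t \<and> t \<le> s + h \<and> t \<le> T \<longrightarrow> D t \<le> D s"
  shows "D T \<le> D 0"
proof -
  define S where "S = {t \<in> {0..T}. D t \<le> D 0}"
  have "closed ({0..T} \<inter> D -` {..D 0})" by (rule continuous_closed_preimage[OF c]) auto
  moreover have "S = {0..T} \<inter> D -` {..D 0}" by (auto simp: S_def)
  ultimately have cl: "closed S" by simp
  have ne: "0 \<in> S" using T by (simp add: S_def)
  have bd: "bdd_above S" unfolding S_def by (rule bdd_aboveI[of _ T]) auto
  have m: "Sup S \<in> S" using closed_contains_Sup[OF _ bd cl] ne by blast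
  have "Sup S = T"
  proof (rule ccontr)
    assume "Sup S \<noteq> T"
    then have mT: "0 \<le> Sup S" "Sup S < T" using m by (auto simp: S_def)
    obtain h where h: "h > 0" "\<And>t. Sup S \<le> t \<and> t \<le> Sup S + h \<and> t \<le> T \<Longrightarrow> D t \<le> D (Sup S)"
      using loc[OF mT] by blast
    define t where "t = min (Sup S + h) T"
    have "D t \<le> D (Sup S)" using h mT by (intro h(2)) (auto simp: t_def)
    then have "t \<in> S" using m mT h(1) by (auto simp: S_def t_def)
    then have "t \<le> Sup S" by (rule cSup_upper[OF _ bd])
    then show False using h(1) mT by (auto simp: t_def)
  qed
  then show ?thesis using m by (simp add: S_def)
qed

section \<open>The functionals \<open>phi\<close> and \<open>qflux\<close> on pairs of
  functions\<close>

definition phi :: "nat \<Rightarrow> real \<Rightarrow> ((nat \<Rightarrow> real) \<Rightarrow> real) \<Rightarrow> ((nat \<Rightarrow> real) \<Rightarrow> real) \<Rightarrow> real" where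
  "phi d \<delta> \<alpha> \<beta> = pairing d (\<lambda>x y. \<bar>\<alpha> x - \<beta> y\<bar>) (mollifier d \<delta>)"

definition qflux :: "nat \<Rightarrow> real \<Rightarrow> (real \<Rightarrow> nat \<Rightarrow> real) \<Rightarrow> ((nat \<Rightarrow> real) \<Rightarrow> real) \<Rightarrow> ((nat \<Rightarrow> real) \<Rightarrow> real) \<Rightarrow> real" where
  "qflux d \<delta> f \<alpha> \<beta> = (\<Sum>i<d. pairing d (\<lambda>x y. entropy_flux f (\<alpha> x) (\<beta> y) i) (dmollifier d \<delta> i))"

lemma entropy_flux_sym: "entropy_flux f a b i = entropy_flux f b a i"
  by (simp add: entropy_flux_def sgn_if)

lemma pairing_uminus_right: "pairing d W (\<lambda>\<xi>. - \<kappa> \<xi>) = - pairing d W \<kappa>"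
  unfolding pairing_def by (simp add: split_def)

lemma pairing_zero: "pairing d W (\<lambda>_. 0) = 0"
  unfolding pairing_def by (simp add: split_def)

lemma vneg_vsub: "vneg d x = vsub d (\<lambda>_. 0) x"
  by (auto simp: vneg_def vsub_def)

lemma prodf_cong_restrict: "prodf d g (vsub d x (\<lambda>_. 0)) = prodf d g x"
  by (rule prodf_cong) (simp add: vsub_def)

lemma L1_norm_nonneg: "0 \<le> L1_norm d v"
  by (simp add: L1_norm_def)

lemma L1_norm_commute: "L1_norm d (\<lambda>x. a x - b x) = L1_norm d (\<lambda>x. b x - a x)"
  by (simp add: L1_norm_def abs_minus_commute)

context
  fixes d :: nat and \<delta> :: real
  assumes \<delta>: "0 < \<delta>"
begin

lemma phi_sym:
  assumes "integrable (lebesgue_Rd d) \<alpha>" "integrable (lebesgue_Rd d) \<beta>"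
  shows "phi d \<delta> \<alpha> \<beta> = phi d \<delta> \<beta> \<alpha>"
proof -
  have e: "mollifier d \<delta> (vneg d \<xi>) = mollifier d \<delta> \<xi>" for \<xi>
    using mollifier_swap[OF \<delta>, of d "\<lambda>_. 0" \<xi>] by (simp add: vneg_vsub prodf_cong_restrict)
  have "phi d \<delta> \<beta> \<alpha> = pairing d (\<lambda>x y. \<bar>\<alpha> y - \<beta> x\<bar>) (\<lambda>\<xi>. mollifier d \<delta> (vneg d \<xi>))"
    by (simp add: phi_def e abs_minus_commute)
  also have "\<dots> = phi d \<delta> \<alpha> \<beta>"
    unfolding phi_def by (rule pairing_swap[OF dominated_lip2[OF lip2_dist assms] mollifier_integrable[OF \<delta>]])
  finally show ?thesis by simp
qed

lemma phi_lipschitz: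
  assumes "integrable (lebesgue_Rd d) \<alpha>" "integrable (lebesgue_Rd d) \<beta>"
    "integrable (lebesgue_Rd d) \<alpha>'" "integrable (lebesgue_Rd d) \<beta>'"
  shows "\<bar>phi d \<delta> \<alpha> \<beta> - phi d \<delta> \<alpha>' \<beta>'\<bar> \<le> L1_norm d (\<lambda>x. \<alpha> x - \<alpha>' x) + L1_norm d (\<lambda>x. \<beta> x - \<beta>' x)"
  unfolding phi_def
  using pairing_lip2_diff[OF lip2_dist assms mollifier_integrable[OF \<delta>]]
    mollifier_integral[OF \<delta>] mollifier_nonneg[OF \<delta>] by simp

text \<open>The triangle inequality through \<beta> y, averaged over y with the mollifier, which has
  mass 1. The price is the mollification error of \<beta> alone, so only one of the two functions
  has to be regular.\<close>

lemma phi_lower: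
  assumes a: "integrable (lebesgue_Rd d) \<alpha>" and b: "integrable (lebesgue_Rd d) \<beta>"
  shows "L1_norm d (\<lambda>x. \<alpha> x - \<beta> x) \<le> phi d \<delta> \<alpha> \<beta> + phi d \<delta> \<beta> \<beta>"
proof -
  note mi = mollifier_integrable[OF \<delta>, of d]
  have i: "integrable (lebesgue_Rd d) (\<lambda>x. \<bar>\<alpha> x - \<beta> x\<bar>)" using a b by auto
  have "L1_norm d (\<lambda>x. \<alpha> x - \<beta> x) = pairing d (\<lambda>x y. \<bar>\<alpha> x - \<beta> x\<bar>) (mollifier d \<delta>)"
    using pairing_fst_only[OF i mi] mollifier_integral[OF \<delta>] by (simp add: L1_norm_def)
  also have "\<dots> \<le> pairing d (\<lambda>x y. \<bar>\<alpha> x - \<beta> y\<bar> + \<bar>\<beta> x - \<beta> y\<bar>) (mollifier d \<delta>)"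
  proof (rule pairing_mono)
    show "dominated d (\<lambda>x y. \<bar>\<alpha> x - \<beta> x\<bar>) (\<lambda>x. \<bar>\<alpha> x - \<beta> x\<bar>) (\<lambda>_. 0)"
      using i by (auto simp: dominated_def)
    show "dominated d (\<lambda>x y. \<bar>\<alpha> x - \<beta> y\<bar> + \<bar>\<beta> x - \<beta> y\<bar>) (\<lambda>x. 1 * \<bar>\<alpha> x\<bar> + 1 * \<bar>\<beta> x\<bar>) (\<lambda>y. 1 * \<bar>\<beta> y\<bar> + 1 * \<bar>\<beta> y\<bar>)"
      by (rule dominated_add[OF dominated_lip2[OF lip2_dist a b] dominated_lip2[OF lip2_dist b b]])
  qed (use mi mollifier_nonneg[OF \<delta>] in auto)
  also have "\<dots> = phi d \<delta> \<alpha> \<beta> + phi d \<delta> \<beta> \<beta>"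
    unfolding phi_def by (rule pairing_add_left[OF dominated_lip2[OF lip2_dist a b] dominated_lip2[OF lip2_dist b b] mi])
  finally show ?thesis .
qed

lemma phi_upper:
  assumes a: "integrable (lebesgue_Rd d) \<alpha>" and b: "integrable (lebesgue_Rd d) \<beta>"
  shows "phi d \<delta> \<alpha> \<beta> \<le> L1_norm d (\<lambda>x. \<alpha> x - \<beta> x) + phi d \<delta> \<beta> \<beta>"
  using phi_lipschitz[OF a b b b] by (simp add: L1_norm_def)

lemma dmollifier_vneg:
  assumes "i < d" shows "dmollifier d \<delta> i (vneg d \<xi>) = - dmollifier d \<delta> i \<xi>"
proof -
  have "dmollifier d \<delta> i (vsub d \<xi> (\<lambda>_. 0)) = dmollifier d \<delta> i \<xi>"
    unfolding dprodf_def by (rule prodf_cong_restrict)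
  then show ?thesis using dmollifier_swap[OF \<delta> assms, of "\<lambda>_. 0" \<xi>] by (simp add: vneg_vsub)
qed

context
  fixes f :: "real \<Rightarrow> nat \<Rightarrow> real" and Lf :: real
  assumes f: "\<And>i s s'. i < d \<Longrightarrow> \<bar>f s i - f s' i\<bar> \<le> Lf * \<bar>s - s'\<bar>" and Lf: "0 \<le> Lf"
begin

text \<open>Exchanging x and y leaves the entropy flux unchanged and reverses the sign of the odd
  kernel.\<close>

lemma qflux_sym:
  assumes "integrable (lebesgue_Rd d) \<alpha>" "integrable (lebesgue_Rd d) \<beta>"
  shows "qflux d \<delta> f \<beta> \<alpha> = - qflux d \<delta> f \<alpha> \<beta>"
  unfolding qflux_def sum_negf[symmetric]
proof (intro sum.cong refl)
  fix i assume "i \<in> {..<d}"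
  then have i: "i < d" by simp
  note J = lip2_entropy_flux[of f i Lf, OF f[OF i] Lf]
  have "pairing d (\<lambda>x y. entropy_flux f (\<alpha> y) (\<beta> x) i) (\<lambda>\<xi>. dmollifier d \<delta> i (vneg d \<xi>))
    = pairing d (\<lambda>x y. entropy_flux f (\<alpha> x) (\<beta> y) i) (dmollifier d \<delta> i)"
    by (rule pairing_swap[OF dominated_lip2[OF J assms] dmollifier_integrable[OF \<delta>]])
  then show "pairing d (\<lambda>x y. entropy_flux f (\<beta> x) (\<alpha> y) i) (dmollifier d \<delta> i)
     = - pairing d (\<lambda>x y. entropy_flux f (\<alpha> x) (\<beta> y) i) (dmollifier d \<delta> i)"
    unfolding dmollifier_vneg[OF i] pairing_uminus_right by (simp add: entropy_flux_sym[of f "\<beta> _"])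
qed

text \<open>K grows with d and with 1/\<delta>, but it only multiplies the errors made by freezing,
  which vanish with the length of the time step.\<close>

lemma qflux_lipschitz:
  "\<exists>K\<ge>0. \<forall>\<alpha> \<beta> \<alpha>' \<beta>'. integrable (lebesgue_Rd d) \<alpha> \<longrightarrow> integrable (lebesgue_Rd d) \<beta> \<longrightarrow>
    integrable (lebesgue_Rd d) \<alpha>' \<longrightarrow> integrable (lebesgue_Rd d) \<beta>' \<longrightarrow>
    \<bar>qflux d \<delta> f \<alpha> \<beta> - qflux d \<delta> f \<alpha>' \<beta>'\<bar> \<le> K * (L1_norm d (\<lambda>x. \<alpha> x - \<alpha>' x) + L1_norm d (\<lambda>x. \<beta> x - \<beta>' x))"
proof (intro exI[of _ "\<Sum>i<d. Lf * (\<integral>x. \<bar>dmollifier d \<delta> i x\<bar> \<partial>lebesgue_Rd d)"] conjI allI impI)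
  show "0 \<le> (\<Sum>i<d. Lf * (\<integral>x. \<bar>dmollifier d \<delta> i x\<bar> \<partial>lebesgue_Rd d))"
    using Lf by (intro sum_nonneg mult_nonneg_nonneg) auto
  fix \<alpha> \<beta> \<alpha>' \<beta>' :: "(nat \<Rightarrow> real) \<Rightarrow> real"
  assume i: "integrable (lebesgue_Rd d) \<alpha>" "integrable (lebesgue_Rd d) \<beta>"
    "integrable (lebesgue_Rd d) \<alpha>'" "integrable (lebesgue_Rd d) \<beta>'"
  have "\<bar>qflux d \<delta> f \<alpha> \<beta> - qflux d \<delta> f \<alpha>' \<beta>'\<bar>
    \<le> (\<Sum>i<d. Lf * (L1_norm d (\<lambda>x. \<alpha> x - \<alpha>' x) + L1_norm d (\<lambda>x. \<beta> x - \<beta>' x)) * (\<integral>x. \<bar>dmollifier d \<delta> i x\<bar> \<partial>lebesgue_Rd d))"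
    unfolding qflux_def sum_subtractf[symmetric]
    by (intro order_trans[OF sum_abs] sum_mono pairing_lip2_diff[OF lip2_entropy_flux[OF f Lf] i dmollifier_integrable[OF \<delta>]]) auto
  then show "\<bar>qflux d \<delta> f \<alpha> \<beta> - qflux d \<delta> f \<alpha>' \<beta>'\<bar>
    \<le> (\<Sum>i<d. Lf * (\<integral>x. \<bar>dmollifier d \<delta> i x\<bar> \<partial>lebesgue_Rd d)) * (L1_norm d (\<lambda>x. \<alpha> x - \<alpha>' x) + L1_norm d (\<lambda>x. \<beta> x - \<beta>' x))"
    unfolding sum_distrib_right by (simp only: mult.assoc mult.commute mult.left_commute)
qed

(* This replaces the doubling of the time variable. On a short interval from s to t, first a moves with
   b frozen at time t, then b moves with a frozen at time s. By symmetry of the entropy flux and oddness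
   of the gradient of the kernel the two flux contributions cancel up to a small multiple of t - s. *)

lemma doubling:
  assumes a: "C_L1 d T a" and b: "C_L1 d T b"
    and A: "\<And>s t \<tau> c. 0 \<le> s \<Longrightarrow> s \<le> t \<Longrightarrow> t \<le> T \<Longrightarrow> \<tau> \<in> {0..T} \<Longrightarrow>
       (\<And>\<rho>. \<rho> \<in> {s..t} \<Longrightarrow> qflux d \<delta> f (\<lambda>x. a x \<rho>) (\<lambda>x. b x \<tau>) \<le> c) \<Longrightarrow>
       phi d \<delta> (\<lambda>x. a x t) (\<lambda>x. b x \<tau>) - phi d \<delta> (\<lambda>x. a x s) (\<lambda>x. b x \<tau>) \<le> (c + E) * (t - s)"
    and B: "\<And>s t \<tau> c. 0 \<le> s \<Longrightarrow> s \<le> t \<Longrightarrow> t \<le> T \<Longrightarrow> \<tau> \<in> {0..T} \<Longrightarrow>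
       (\<And>\<rho>. \<rho> \<in> {s..t} \<Longrightarrow> qflux d \<delta> f (\<lambda>x. b x \<rho>) (\<lambda>x. a x \<tau>) \<le> c) \<Longrightarrow>
       phi d \<delta> (\<lambda>x. b x t) (\<lambda>x. a x \<tau>) - phi d \<delta> (\<lambda>x. b x s) (\<lambda>x. a x \<tau>) \<le> c * (t - s)"
    and t: "t \<in> {0..T}"
  shows "phi d \<delta> (\<lambda>x. a x t) (\<lambda>x. b x t) \<le> phi d \<delta> (\<lambda>x. a x 0) (\<lambda>x. b x 0) + E * t"
proof (rule field_le_epsilon)
  fix e0 :: real assume e0: "0 < e0"
  define e where "e = e0 / (t + 1)"
  have e: "0 < e" "e * t \<le> e0"
    using e0 t by (auto simp: e_def field_simps add_nonneg_pos)
  obtain K where K: "0 \<le> K" "\<And>\<alpha> \<beta> \<alpha>' \<beta>'. integrable (lebesgue_Rd d) \<alpha> \<Longrightarrow> integrable (lebesgue_Rd d) \<beta> \<Longrightarrow>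
    integrable (lebesgue_Rd d) \<alpha>' \<Longrightarrow> integrable (lebesgue_Rd d) \<beta>' \<Longrightarrow>
    \<bar>qflux d \<delta> f \<alpha> \<beta> - qflux d \<delta> f \<alpha>' \<beta>'\<bar> \<le> K * (L1_norm d (\<lambda>x. \<alpha> x - \<alpha>' x) + L1_norm d (\<lambda>x. \<beta> x - \<beta>' x))"
    using qflux_lipschitz by blast
  let ?N = "\<lambda>v s t. L1_norm d (\<lambda>x. v x s - v x t)"
  have ai: "integrable (lebesgue_Rd d) (\<lambda>x. a x s)" and bi: "integrable (lebesgue_Rd d) (\<lambda>x. b x s)" if "s \<in> {0..T}" for s
    using C_L1_integrable[OF a that] C_L1_integrable[OF b that] by auto
  define P where "P s = phi d \<delta> (\<lambda>x. a x s) (\<lambda>x. b x s)" for s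
  \<comment> \<open>The slope is increased by e to absorb the freezing errors; D is then shown to be
    nonincreasing to the right of every time before t.\<close>
  define D where "D s = P s - (E + e) * s" for s
  have lim: "((\<lambda>s. ?N a s t) \<longlongrightarrow> 0) (at t within {0..T})" "((\<lambda>s. ?N b s t) \<longlongrightarrow> 0) (at t within {0..T})"
    if "t \<in> {0..T}" for t using a b that by (auto simp: C_L1_def)
  have Pc: "continuous_on {0..T} P"
    unfolding continuous_on_def
  proof
    fix t assume t: "t \<in> {0..T}"
    have "((\<lambda>s. ?N a s t + ?N b s t) \<longlongrightarrow> 0 + 0) (at t within {0..T})" by (intro tendsto_add lim t)
    then have "((\<lambda>s. P s - P t) \<longlongrightarrow> 0) (at t within {0..T})"
      by (intro Lim_null_comparison[of "\<lambda>s. P s - P t" "\<lambda>s. ?N a s t + ?N b s t"])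
        (use t in \<open>auto simp: eventually_at_filter P_def intro!: always_eventually phi_lipschitz ai bi\<close>)
    then show "(P \<longlongrightarrow> P t) (at t within {0..T})" by (rule LIM_zero_cancel)
  qed
  have "D t \<le> D 0"
  proof (rule right_nonincreasing)
    show "continuous_on {0..t} D"
      unfolding D_def using t by (intro continuous_intros continuous_on_subset[OF Pc]) auto
    show "0 \<le> t" using t by simp
    fix s assume s: "0 \<le> s" "s < t"
    then have sT: "s \<in> {0..T}" using t by auto
    \<comment> \<open>The first half-step has errors K \<eta> from each of the two functions, the
      second half-step one more; their sum 3 K \<eta> has to stay below e. Using K + 1 avoids a
      division by zero.\<close>
    define \<eta> where "\<eta> = e / (4 * (K + 1))"
    have \<eta>: "0 < \<eta>" "K * (3 * \<eta>) \<le> e"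
    proof -
      show "0 < \<eta>" using e(1) K(1) by (simp add: \<eta>_def)
      then have "K * (3 * \<eta>) \<le> (K + 1) * (4 * \<eta>)" using K(1) by (intro mult_mono) auto
      also have "\<dots> = e"
      proof -
        have "K + 1 \<noteq> 0" using K(1) by simp
        then show ?thesis unfolding \<eta>_def by (simp add: field_simps del: add_divide_distrib)
      qed
      finally show "K * (3 * \<eta>) \<le> e" .
    qed
    have "eventually (\<lambda>\<rho>. ?N a \<rho> s < \<eta>) (at s within {0..T})" "eventually (\<lambda>\<rho>. ?N b \<rho> s < \<eta>) (at s within {0..T})"
      using order_tendstoD(2)[OF lim(1)[OF sT] \<eta>(1)] order_tendstoD(2)[OF lim(2)[OF sT] \<eta>(1)] by auto
    then have "eventually (\<lambda>\<rho>. ?N a \<rho> s < \<eta> \<and> ?N b \<rho> s < \<eta>) (at s within {0..T})" by eventually_elim simp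
    then obtain h where h: "h > 0" "\<And>\<rho>. \<rho> \<in> {0..T} \<Longrightarrow> \<rho> \<noteq> s \<Longrightarrow> dist \<rho> s < h \<Longrightarrow> ?N a \<rho> s < \<eta> \<and> ?N b \<rho> s < \<eta>"
      unfolding eventually_at by blast
    have near: "?N a \<rho> s \<le> \<eta>" "?N b \<rho> s \<le> \<eta>" if "s \<le> \<rho>" "\<rho> \<le> s + h / 2" "\<rho> \<le> T" for \<rho>
    proof -
      have "?N a \<rho> s \<le> \<eta> \<and> ?N b \<rho> s \<le> \<eta>"
      proof (cases "\<rho> = s")
        case True then show ?thesis using \<eta>(1) by (simp add: L1_norm_def)
      next
        case False
        then have "dist \<rho> s < h" using that h(1) by (auto simp: dist_real_def)
        then show ?thesis using h(2)[of \<rho>] False that s by auto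
      qed
      then show "?N a \<rho> s \<le> \<eta>" "?N b \<rho> s \<le> \<eta>" by auto
    qed
    show "\<exists>h>0. \<forall>t'. s \<le> t' \<and> t' \<le> s + h \<and> t' \<le> t \<longrightarrow> D t' \<le> D s"
    proof (intro exI[of _ "h / 2"] conjI allI impI)
      fix t' assume t': "s \<le> t' \<and> t' \<le> s + h / 2 \<and> t' \<le> t"
      have t'T: "t' \<in> {0..T}" using t' s t by auto
      define q where "q = qflux d \<delta> f (\<lambda>x. a x s) (\<lambda>x. b x s)"
      have 1: "phi d \<delta> (\<lambda>x. a x t') (\<lambda>x. b x t') - phi d \<delta> (\<lambda>x. a x s) (\<lambda>x. b x t') \<le> ((q + K * (2 * \<eta>)) + E) * (t' - s)"
      proof (rule A)
        fix \<rho> assume \<rho>: "\<rho> \<in> {s..t'}"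
        have \<rho>T: "\<rho> \<in> {0..T}" using \<rho> s t' t by auto
        have "\<bar>qflux d \<delta> f (\<lambda>x. a x \<rho>) (\<lambda>x. b x t') - q\<bar> \<le> K * (?N a \<rho> s + ?N b t' s)"
          unfolding q_def by (rule K(2)[OF ai[OF \<rho>T] bi[OF t'T] ai[OF sT] bi[OF sT]])
        also have "\<dots> \<le> K * (2 * \<eta>)"
          using near(1)[of \<rho>] near(2)[of t'] \<rho> t' t K(1) by (intro mult_left_mono) auto
        finally show "qflux d \<delta> f (\<lambda>x. a x \<rho>) (\<lambda>x. b x t') \<le> q + K * (2 * \<eta>)" by linarith
      qed (use s t' t t'T in auto)
      have 2: "phi d \<delta> (\<lambda>x. b x t') (\<lambda>x. a x s) - phi d \<delta> (\<lambda>x. b x s) (\<lambda>x. a x s) \<le> (- q + K * \<eta>) * (t' - s)"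
      proof (rule B)
        fix \<rho> assume \<rho>: "\<rho> \<in> {s..t'}"
        have \<rho>T: "\<rho> \<in> {0..T}" using \<rho> s t' t by auto
        have "\<bar>qflux d \<delta> f (\<lambda>x. a x s) (\<lambda>x. b x \<rho>) - q\<bar> \<le> K * (?N a s s + ?N b \<rho> s)"
          unfolding q_def by (rule K(2)[OF ai[OF sT] bi[OF \<rho>T] ai[OF sT] bi[OF sT]])
        also have "\<dots> \<le> K * \<eta>"
          using near(2)[of \<rho>] \<rho> t' t K(1) by (intro mult_left_mono) (auto simp: L1_norm_def)
        finally show "qflux d \<delta> f (\<lambda>x. b x \<rho>) (\<lambda>x. a x s) \<le> - q + K * \<eta>"
          using qflux_sym[OF ai[OF sT] bi[OF \<rho>T]] by linarith
      qed (use s t' t sT in auto)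
      have "P t' - P s \<le> ((q + K * (2 * \<eta>)) + E) * (t' - s) + (- q + K * \<eta>) * (t' - s)"
        using 1 2 phi_sym[OF ai[OF sT] bi[OF t'T]] phi_sym[OF ai[OF sT] bi[OF sT]] unfolding P_def by linarith
      also have "\<dots> = (E + K * (3 * \<eta>)) * (t' - s)" by (simp add: algebra_simps)
      also have "\<dots> \<le> (E + e) * (t' - s)" using \<eta>(2) t' by (intro mult_right_mono) auto
      finally show "D t' \<le> D s" by (simp add: D_def algebra_simps)
    qed (use h in auto)
  qed
  then show "phi d \<delta> (\<lambda>x. a x t) (\<lambda>x. b x t) \<le> phi d \<delta> (\<lambda>x. a x 0) (\<lambda>x. b x 0) + E * t + e0"
    using e(2) by (simp add: D_def P_def distrib_right)
qed

end

end

text \<open>Both sides are the pairing of W with the translated kernel.\<close>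

lemma pairing_shift_both:
  assumes "dominated d W \<alpha> \<beta>" "integrable (lebesgue_Rd d) \<kappa>"
  shows "pairing d (\<lambda>x y. W (vadd d x h) y) \<kappa> = pairing d (\<lambda>x y. W x (vsub d y h)) \<kappa>"
  using pairing_shift_left(1)[OF assms, of h] pairing_shift[OF assms, of h] by simp

lemma vadd_C_L1: assumes "C_L1 d T v" shows "C_L1 d T (\<lambda>x. v (vadd d x h))"
  unfolding C_L1_def
proof (intro ballI conjI)
  fix t assume t: "t \<in> {0..T}"
  show "integrable (lebesgue_Rd d) (\<lambda>x. v (vadd d x h) t)"
    by (rule integrable_vadd[OF C_L1_integrable[OF assms t]])
  have e: "L1_norm d (\<lambda>x. v (vadd d x h) s - v (vadd d x h) t) = L1_norm d (\<lambda>x. v x s - v x t)" if "s \<in> {0..T}" for s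
    unfolding L1_norm_def using C_L1_integrable[OF assms t] C_L1_integrable[OF assms that]
    by (intro integral_vadd) auto
  have "((\<lambda>s. L1_norm d (\<lambda>x. v x s - v x t)) \<longlongrightarrow> 0) (at t within {0..T})"
    using assms t by (simp add: C_L1_def)
  then show "((\<lambda>s. L1_norm d (\<lambda>x. v (vadd d x h) s - v (vadd d x h) t)) \<longlongrightarrow> 0) (at t within {0..T})"
    by (rule Lim_transform_eventually) (auto simp: eventually_at_filter e)
qed

section \<open>One-sided growth, initial values and the bound for \<open>Diff\<close>\<close>

context entropy_setting
begin

lemma one_sided_mollifier:
  assumes \<delta>: "0 < \<delta>" and r: "0 < r" and w: "integrable (lebesgue_Rd d) w"
    and st: "0 \<le> s" "s \<le> t" "t \<le> T"
    and q: "\<And>\<rho>. \<rho> \<in> {s..t} \<Longrightarrow> qflux d \<delta> f (\<lambda>x. v x \<rho>) w \<le> c"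
    and D: "\<And>\<rho>. \<rho> \<in> {0..T} \<Longrightarrow> Diff (\<lambda>_. scaled_bump \<delta>) r w \<rho> \<le> E"
  shows "phi d \<delta> (\<lambda>x. v x t) w - phi d \<delta> (\<lambda>x. v x s) w \<le> (c + E) * (t - s)"
proof -
  have "Flux (\<lambda>_. scaled_bump \<delta>) w \<rho> + Diff (\<lambda>_. scaled_bump \<delta>) r w \<rho> \<le> c + E" if "\<rho> \<in> {s..t}" for \<rho>
    using q[OF that] D[of \<rho>] that st unfolding Flux_def qflux_def by (intro add_mono) auto
  from one_sided(1)[OF mollifier_Ccs[OF \<delta>] mollifier_nonneg[OF \<delta>] r w st this]
  show ?thesis by (simp add: Phi_def phi_def)
qed

lemma initial_value: "L1_norm d (\<lambda>x. v x 0 - u0 x) = 0"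
proof -
  have v0: "integrable (lebesgue_Rd d) (\<lambda>x. v x 0)" using v_integrable T by simp
  have "L1_norm d (\<lambda>x. v x 0 - u0 x) \<le> 0 + e" if e: "0 < e" for e
  proof -
    obtain \<delta> where \<delta>: "0 < \<delta>" "phi d \<delta> u0 u0 \<le> e / 2"
    proof -
      have "0 < e / 2" using e by simp
      then obtain \<delta>0 where \<delta>0: "0 < \<delta>0"
        "\<And>\<delta>. 0 < \<delta> \<Longrightarrow> \<delta> \<le> \<delta>0 \<Longrightarrow> pairing d (\<lambda>x y. \<bar>u0 x - u0 y\<bar>) (mollifier d \<delta>) \<le> e / 2"
        by (rule mollify_tendsto[OF u0]) blast
      show thesis using that[of \<delta>0] \<delta>0 by (simp add: phi_def)
    qed
    have "phi d \<delta> (\<lambda>x. v x 0) u0 \<le> phi d \<delta> u0 u0"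
      using one_sided(2)[OF mollifier_Ccs[OF \<delta>(1)] mollifier_nonneg[OF \<delta>(1)] zero_less_one u0]
      by (simp add: Phi_def phi_def)
    then show ?thesis using phi_lower[OF \<delta>(1) v0 u0] \<delta>(2) by linarith
  qed
  then have "L1_norm d (\<lambda>x. v x 0 - u0 x) \<le> 0" by (rule field_le_epsilon)
  then show ?thesis using L1_norm_nonneg[of d "\<lambda>x. v x 0 - u0 x"] by linarith
qed

lemma phi_initial:
  assumes \<delta>: "0 < \<delta>" and w: "integrable (lebesgue_Rd d) w"
  shows "phi d \<delta> (\<lambda>x. v x 0) w = phi d \<delta> u0 w"
proof -
  have v0: "integrable (lebesgue_Rd d) (\<lambda>x. v x 0)" using v_integrable T by simp
  show ?thesis using phi_lipschitz[OF \<delta> v0 w u0 w] initial_value by (simp add: L1_norm_def)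
qed

lemma L1_shift_bound:
  assumes w: "integrable (lebesgue_Rd d) w" shows "L1_norm d (\<lambda>x. w (vsub d x h) - w x) \<le> 2 * L1_norm d w"
proof -
  have "L1_norm d (\<lambda>x. w (vsub d x h) - w x) \<le> L1_norm d (\<lambda>x. w (vsub d x h) - 0) + L1_norm d (\<lambda>x. 0 - w x)"
    by (rule L1_norm_triangle[OF integrable_vsub_right[OF w] _ w]) simp
  also have "L1_norm d (\<lambda>x. w (vsub d x h) - 0) = L1_norm d w"
    using integral_vsub_right[of "\<lambda>x. \<bar>w x\<bar>" d h] w by (simp add: L1_norm_def)
  finally show ?thesis by (simp add: L1_norm_def)
qed

(* The three parts of the operator are estimated by moving increments of the kernel onto w. Near jumps
   use the mean value theorem and one derivative of the mollifier, hence the factor sqrt d / \<delta>; jumps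
   beyond r' use only the L1 norm. *)

lemma Diff_bound:
  assumes w: "integrable (lebesgue_Rd d) w" and V: "0 \<le> V"
    and wV: "\<And>h. h \<in> Rd d \<Longrightarrow> L1_norm d (\<lambda>x. w (vadd d x h) - w x) \<le> vnorm d h * V"
    and wm: "L1_norm d w \<le> m" and \<delta>: "0 < \<delta>" and r: "0 < r" and t: "t \<in> {0..T}"
  shows "Diff (\<lambda>_. scaled_bump \<delta>) r w t \<le>
     LB * (V * sqrt (real d) * bump_variation / \<delta> * (\<integral>z. indicator {z. vnorm d z \<le> r} z * (vnorm d z)\<^sup>2 \<partial>\<mu>)
       + V * vnorm d (drift r)
       + V * (\<integral>z. indicator {z. r < vnorm d z \<and> vnorm d z \<le> r'} z * vnorm d z \<partial>\<mu>)
       + 2 * m * (\<integral>z. indicator {z. max r r' < vnorm d z} z \<partial>\<mu>))"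
proof -
  let ?g = "\<lambda>_::nat. scaled_bump \<delta>"
  let ?W = "\<lambda>x y. \<bar>B (v x t) - B (w y)\<bar>"
  note g = mollifier_Ccs[OF \<delta>, of d]
  note mi = mollifier_integrable[OF \<delta>, of d] and di = dmollifier_integrable[OF \<delta>, of d]
  note dom = dominated_lip2[OF lip2_B v_integrable[OF t] w]
  have wV': "L1_norm d (\<lambda>x. w (vsub d x h) - w x) \<le> vnorm d h * V" for h
    unfolding L1_norm_shift_eq[OF w] using wV[of "vneg d h"] by simp
  have C1: "0 \<le> bump_variation" by (simp add: bump_variation_def)
  have sh: "\<bar>pairing d ?W (\<lambda>\<xi>. \<kappa> (vsub d \<xi> h)) - pairing d ?W \<kappa>\<bar>
     \<le> LB * L1_norm d (\<lambda>x. w (vsub d x h) - w x) * (\<integral>x. \<bar>\<kappa> x\<bar> \<partial>lebesgue_Rd d)"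
    if "integrable (lebesgue_Rd d) \<kappa>" for \<kappa> h
    by (rule pairing_lip2_shift[OF lip2_B v_integrable[OF t] w that])
  have sm: "\<bar>pairing d ?W (\<lambda>\<xi>. mollifier d \<delta> (vsub d \<xi> h)) - pairing d ?W (mollifier d \<delta>)\<bar>
     \<le> LB * L1_norm d (\<lambda>x. w (vsub d x h) - w x)" for h
    using sh[OF mi, of h] mollifier_integral[OF \<delta>, of d] mollifier_nonneg[OF \<delta>] by simp
  have line: "prodf d G (\<lambda>i. \<xi> i + s * (- z i)) = prodf d G (vsub d \<xi> (\<lambda>i. s * z i))" for G \<xi> s z
    by (rule prodf_cong) (simp add: vsub_def)
  have vs: "vnorm d (\<lambda>i. s * z i) = \<bar>s\<bar> * vnorm d z" for s z
  proof -
    have "(\<Sum>i<d. (s * z i)\<^sup>2) = s\<^sup>2 * (\<Sum>i<d. (z i)\<^sup>2)" by (simp add: power_mult_distrib sum_distrib_left)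
    then show ?thesis by (simp add: L2_set_def real_sqrt_mult)
  qed
  have near: "pairing d ?W (near_op ?g r)
    \<le> (\<integral>z. LB * V * sqrt (real d) * bump_variation / \<delta> * (indicator {z. vnorm d z \<le> r} z * (vnorm d z)\<^sup>2) \<partial>\<mu>)"
    unfolding near_op_def[abs_def]
  proof (rule pairing_kernel_Fubini[OF dom near_kernel_integrable(1,2)[OF g r]])
    show "integrable \<mu> (\<lambda>z. LB * V * sqrt (real d) * bump_variation / \<delta> * (indicator {z. vnorm d z \<le> r} z * (vnorm d z)\<^sup>2))"
      by (intro integrable_mult_right near_integrable)
    fix z
    show "pairing d ?W (\<lambda>\<xi>. near_kernel ?g r \<xi> z) \<le> LB * V * sqrt (real d) * bump_variation / \<delta> * (indicator {z. vnorm d z \<le> r} z * (vnorm d z)\<^sup>2)"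
    proof (cases "vnorm d z \<le> r")
      case False
      then have "(\<lambda>\<xi>. near_kernel ?g r \<xi> z) = (\<lambda>_. 0)" by (simp add: near_kernel_def)
      then show ?thesis using False by (simp add: pairing_zero)
    next
      case True
      \<comment> \<open>Transport along the jump: the compensated increment of the kernel is p 1 - p
        0 - p' 0 and so becomes a difference of first derivatives of the pairing.\<close>
      define p where "p s = pairing d ?W (\<lambda>\<xi>. mollifier d \<delta> (\<lambda>i. \<xi> i + s * (- z i)))" for s
      define p' where "p' s = (\<Sum>i<d. - z i * pairing d ?W (\<lambda>\<xi>. dmollifier d \<delta> i (\<lambda>i. \<xi> i + s * (- z i))))" for s
      have pD: "(p has_real_derivative p' s) (at s)" for s
        unfolding p_def[abs_def] p'_def by (rule pairing_prodf_DERIV[OF dom g])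
      obtain c where c: "0 < c" "c < 1" "p 1 - p 0 = (1 - 0) * p' c" using MVT2[of 0 1 p p'] pD by auto
      have "pairing d ?W (\<lambda>\<xi>. near_kernel ?g r \<xi> z)
         = pairing d ?W (\<lambda>\<xi>. (mollifier d \<delta> (vsub d \<xi> z) + (- mollifier d \<delta> \<xi>)) + (\<Sum>i<d. z i * dmollifier d \<delta> i \<xi>))"
        using True by (simp add: near_kernel_def)
      also have "\<dots> = pairing d ?W (\<lambda>\<xi>. mollifier d \<delta> (vsub d \<xi> z)) + - pairing d ?W (mollifier d \<delta>)
         + (\<Sum>i<d. z i * pairing d ?W (dmollifier d \<delta> i))"
      proof -
        have i1: "integrable (lebesgue_Rd d) (\<lambda>\<xi>. mollifier d \<delta> (vsub d \<xi> z))" by (rule integrable_vsub_right[OF mi])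
        have i2: "integrable (lebesgue_Rd d) (\<lambda>\<xi>. - mollifier d \<delta> \<xi>)" using mi by simp
        have i3: "integrable (lebesgue_Rd d) (\<lambda>\<xi>. \<Sum>i<d. z i * dmollifier d \<delta> i \<xi>)"
          by (intro Bochner_Integration.integrable_sum integrable_mult_right di)
        show ?thesis
          unfolding pairing_add_right[OF dom Bochner_Integration.integrable_add[OF i1 i2] i3]
            pairing_add_right[OF dom i1 i2] pairing_uminus_right pairing_sum_right[OF dom di] ..
      qed
      also have "\<dots> = p 1 - p 0 - p' 0"
        by (simp add: p_def p'_def line[of _ _ 1, simplified] sum_negf)
      also have "\<dots> = p' c - p' 0" using c by simp
      also have "\<dots> \<le> (\<Sum>i<d. \<bar>z i\<bar> * (LB * (vnorm d z * V) * (bump_variation / \<delta>)))"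
        unfolding p'_def sum_subtractf[symmetric] right_diff_distrib[symmetric]
      proof (rule order_trans[OF abs_ge_self], rule order_trans[OF sum_abs], rule sum_mono)
        fix i assume "i \<in> {..<d}"
        then have i: "i < d" by simp
        have "\<bar>pairing d ?W (\<lambda>\<xi>. dmollifier d \<delta> i (\<lambda>i. \<xi> i + c * (- z i))) - pairing d ?W (\<lambda>\<xi>. dmollifier d \<delta> i (\<lambda>i. \<xi> i + 0 * (- z i)))\<bar>
          = \<bar>pairing d ?W (\<lambda>\<xi>. dmollifier d \<delta> i (vsub d \<xi> (\<lambda>i. c * z i))) - pairing d ?W (dmollifier d \<delta> i)\<bar>"
          unfolding dprodf_def line by (simp add: prodf_cong_restrict)
        \<comment> \<open>The one derivative left on the mollifier costs
          \<open>bump_variation / \<delta>\<close>; the remaining shift by c z falls on w.\<close>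
        also have "\<dots> \<le> LB * L1_norm d (\<lambda>x. w (vsub d x (\<lambda>i. c * z i)) - w x) * (bump_variation / \<delta>)"
          using sh[OF di, of i] dmollifier_abs_integral[OF \<delta> i] by simp
        also have "\<dots> \<le> LB * (vnorm d z * V) * (bump_variation / \<delta>)"
        proof (intro mult_right_mono mult_left_mono LB)
          have "L1_norm d (\<lambda>x. w (vsub d x (\<lambda>i. c * z i)) - w x) \<le> c * vnorm d z * V"
            using wV'[of "\<lambda>i. c * z i"] c by (simp add: vs)
          also have "\<dots> \<le> 1 * vnorm d z * V" using c V L2_set_nonneg[of z "{..<d}"] by (intro mult_right_mono) auto
          finally show "L1_norm d (\<lambda>x. w (vsub d x (\<lambda>i. c * z i)) - w x) \<le> vnorm d z * V" by simp
        qed (use C1 \<delta> in simp)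
        finally show "\<bar>- z i * (pairing d ?W (\<lambda>\<xi>. dmollifier d \<delta> i (\<lambda>i. \<xi> i + c * (- z i))) - pairing d ?W (\<lambda>\<xi>. dmollifier d \<delta> i (\<lambda>i. \<xi> i + 0 * (- z i))))\<bar>
          \<le> \<bar>z i\<bar> * (LB * (vnorm d z * V) * (bump_variation / \<delta>))"
          unfolding abs_mult abs_minus_cancel by (intro mult_left_mono) auto
      qed
      also have "\<dots> = (\<Sum>i<d. \<bar>z i\<bar>) * (LB * (vnorm d z * V) * (bump_variation / \<delta>))"
        by (rule sum_distrib_right[symmetric])
      also have "\<dots> \<le> (sqrt (real d) * vnorm d z) * (LB * (vnorm d z * V) * (bump_variation / \<delta>))"
        using LB V C1 \<delta> L2_set_nonneg[of z "{..<d}"] by (intro mult_right_mono sum_abs_le_vnorm mult_nonneg_nonneg) auto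
      also have "\<dots> = LB * V * sqrt (real d) * bump_variation / \<delta> * (indicator {z. vnorm d z \<le> r} z * (vnorm d z)\<^sup>2)"
        using True by (simp add: power2_eq_square mult_ac)
      finally show ?thesis .
    qed
  qed
  have fi: "integrable \<mu> (\<lambda>z. indicator {z. r < vnorm d z \<and> vnorm d z \<le> r'} z * vnorm d z)"
    "integrable \<mu> (\<lambda>z. indicator {z. max r r' < vnorm d z} z :: real)"
  proof -
    show "integrable \<mu> (\<lambda>z. indicator {z. r < vnorm d z \<and> vnorm d z \<le> r'} z * vnorm d z)"
    proof (rule Bochner_Integration.integrable_bound[OF integrable_mult_right[OF far_integrable[OF r], of r']])
      have "\<bar>vnorm d z\<bar> \<le> \<bar>r'\<bar>" if "vnorm d z \<le> r'" for z
        using that L2_set_nonneg[of z "{..<d}"] by linarith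
      then show "AE z in \<mu>. norm (indicator {z. r < vnorm d z \<and> vnorm d z \<le> r'} z * vnorm d z) \<le> norm (r' * indicator {z. r < vnorm d z} z)"
        by (intro AE_I2) (auto simp: indicator_def)
    qed measurable
    show "integrable \<mu> (\<lambda>z. indicator {z. max r r' < vnorm d z} z :: real)"
      using r by (intro far_integrable) auto
  qed
  have far: "pairing d ?W (far_op ?g r)
    \<le> (\<integral>z. LB * (V * (indicator {z. r < vnorm d z \<and> vnorm d z \<le> r'} z * vnorm d z) + 2 * m * indicator {z. max r r' < vnorm d z} z) \<partial>\<mu>)"
    unfolding far_op_def[abs_def]
  proof (rule pairing_kernel_Fubini[OF dom far_kernel_integrable(1,2)[OF g r]])
    show "integrable \<mu> (\<lambda>z. LB * (V * (indicator {z. r < vnorm d z \<and> vnorm d z \<le> r'} z * vnorm d z) + 2 * m * indicator {z. max r r' < vnorm d z} z))"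
      by (intro integrable_mult_right Bochner_Integration.integrable_add fi)
    fix z
    show "pairing d ?W (\<lambda>\<xi>. far_kernel ?g r \<xi> z)
      \<le> LB * (V * (indicator {z. r < vnorm d z \<and> vnorm d z \<le> r'} z * vnorm d z) + 2 * m * indicator {z. max r r' < vnorm d z} z)"
    proof (cases "r < vnorm d z")
      case False
      then have "(\<lambda>\<xi>. far_kernel ?g r \<xi> z) = (\<lambda>_. 0)" by (simp add: far_kernel_def)
      then show ?thesis using False by (simp add: pairing_zero)
    next
      case True
      have i1: "integrable (lebesgue_Rd d) (\<lambda>\<xi>. mollifier d \<delta> (vsub d \<xi> z))" by (rule integrable_vsub_right[OF mi])
      have i2: "integrable (lebesgue_Rd d) (\<lambda>\<xi>. - mollifier d \<delta> \<xi>)" using mi by simp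
      have "pairing d ?W (\<lambda>\<xi>. far_kernel ?g r \<xi> z) = pairing d ?W (\<lambda>\<xi>. mollifier d \<delta> (vsub d \<xi> z) + - mollifier d \<delta> \<xi>)"
        using True by (simp add: far_kernel_def)
      also have "\<dots> = pairing d ?W (\<lambda>\<xi>. mollifier d \<delta> (vsub d \<xi> z)) - pairing d ?W (mollifier d \<delta>)"
        unfolding pairing_add_right[OF dom i1 i2] pairing_uminus_right by simp
      also have "\<dots> \<le> LB * L1_norm d (\<lambda>x. w (vsub d x z) - w x)" using sm[of z] by linarith
      also have "\<dots> \<le> LB * (V * (indicator {z. r < vnorm d z \<and> vnorm d z \<le> r'} z * vnorm d z) + 2 * m * indicator {z. max r r' < vnorm d z} z)"
      \<comment> \<open>Up to r' the translation estimate is better than nothing for large |z| only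
        if |z| is integrable there; beyond r' twice the L1 norm is used.\<close>
      proof (rule mult_left_mono[OF _ LB], cases "vnorm d z \<le> r'")
        case le: True
        then show "L1_norm d (\<lambda>x. w (vsub d x z) - w x) \<le> V * (indicator {z. r < vnorm d z \<and> vnorm d z \<le> r'} z * vnorm d z) + 2 * m * indicator {z. max r r' < vnorm d z} z"
          using True wV'[of z] by (simp add: mult.commute)
      next
        case False
        then show "L1_norm d (\<lambda>x. w (vsub d x z) - w x) \<le> V * (indicator {z. r < vnorm d z \<and> vnorm d z \<le> r'} z * vnorm d z) + 2 * m * indicator {z. max r r' < vnorm d z} z"
          using True L1_shift_bound[OF w, of z] wm by simp
      qed
      finally show ?thesis .
    qed
  qed
  \<comment> \<open>The sum is the derivative at 0 of the pairing when the kernel is transported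
    along \<open>drift r\<close>. Bounding the difference quotients puts no derivative on the
    mollifier, hence no factor 1/\<delta>.\<close>
  have drift: "(\<Sum>i<d. drift r i * pairing d ?W (dmollifier d \<delta> i)) \<le> LB * (vnorm d (drift r) * V)"
  proof -
    define p where "p s = pairing d ?W (\<lambda>\<xi>. mollifier d \<delta> (\<lambda>i. \<xi> i + s * drift r i))" for s
    have pD: "(p has_real_derivative (\<Sum>i<d. drift r i * pairing d ?W (\<lambda>\<xi>. dmollifier d \<delta> i (\<lambda>i. \<xi> i + 0 * drift r i)))) (at 0)"
      unfolding p_def[abs_def] by (rule pairing_prodf_DERIV[OF dom g])
    then have lim: "((\<lambda>h. (p h - p 0) / h) \<longlongrightarrow> (\<Sum>i<d. drift r i * pairing d ?W (dmollifier d \<delta> i))) (at 0)"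
      by (simp add: DERIV_def)
    have b: "(p h - p 0) / h \<le> LB * (vnorm d (drift r) * V)" if "h \<noteq> 0" for h
    proof -
      have "p h = pairing d ?W (\<lambda>\<xi>. mollifier d \<delta> (vsub d \<xi> (\<lambda>i. (- h) * drift r i)))"
        unfolding p_def by (intro arg_cong[where f = "pairing d ?W"] ext prodf_cong) (simp add: vsub_def)
      moreover have "p 0 = pairing d ?W (mollifier d \<delta>)" by (simp add: p_def)
      ultimately have "\<bar>p h - p 0\<bar> \<le> LB * L1_norm d (\<lambda>x. w (vsub d x (\<lambda>i. (- h) * drift r i)) - w x)"
        using sm by simp
      also have "\<dots> \<le> LB * (\<bar>h\<bar> * vnorm d (drift r) * V)"
        using wV'[of "\<lambda>i. (- h) * drift r i"] LB vs[of "- h" "drift r"] by (intro mult_left_mono) simp_all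
      finally have "\<bar>p h - p 0\<bar> / \<bar>h\<bar> \<le> LB * (vnorm d (drift r) * V)" using that by (simp add: field_simps)
      then have "\<bar>(p h - p 0) / h\<bar> \<le> LB * (vnorm d (drift r) * V)" by simp
      then show ?thesis by linarith
    qed
    show ?thesis
      by (rule tendsto_upperbound[OF lim]) (auto simp: eventually_at_filter b)
  qed
  have "Diff ?g r w t \<le>
    (\<integral>z. LB * V * sqrt (real d) * bump_variation / \<delta> * (indicator {z. vnorm d z \<le> r} z * (vnorm d z)\<^sup>2) \<partial>\<mu>)
    + (\<integral>z. LB * (V * (indicator {z. r < vnorm d z \<and> vnorm d z \<le> r'} z * vnorm d z) + 2 * m * indicator {z. max r r' < vnorm d z} z) \<partial>\<mu>)
    + LB * (vnorm d (drift r) * V)"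
    unfolding Diff_def using near far drift by linarith
  also have "\<dots> = LB * (V * sqrt (real d) * bump_variation / \<delta> * (\<integral>z. indicator {z. vnorm d z \<le> r} z * (vnorm d z)\<^sup>2 \<partial>\<mu>)
       + V * vnorm d (drift r)
       + V * (\<integral>z. indicator {z. r < vnorm d z \<and> vnorm d z \<le> r'} z * vnorm d z \<partial>\<mu>)
       + 2 * m * (\<integral>z. indicator {z. max r r' < vnorm d z} z \<partial>\<mu>))"
    using fi by (simp add: algebra_simps)
  finally show ?thesis .
qed

end

lemma pairing_zero_left: "pairing d (\<lambda>_ _. 0) \<kappa> = 0"
  unfolding pairing_def by (simp add: split_def)

context levy_space
begin

text \<open>At most one of the two integrals in \<open>drift\<close> extends over a nonempty set,
  and its sign does not affect the norm.\<close>

lemma vnorm_drift: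
  "vnorm d (drift r) = vnorm d (\<lambda>i. LINT z:{z. min r 1 < vnorm d z \<and> vnorm d z \<le> max r 1}|\<mu>. z i)"
proof (cases "r \<le> 1")
  case True
  have "{z. 1 < vnorm d z \<and> vnorm d z \<le> r} = {}" using True by auto
  then show ?thesis using True by (simp add: drift_def set_lebesgue_integral_def L2_set_def)
next
  case False
  have "{z. r < vnorm d z \<and> vnorm d z \<le> 1} = {}" using False by auto
  then show ?thesis using False by (simp add: drift_def set_lebesgue_integral_def L2_set_def)
qed

lemma near_moment:
  "(LINT z:{z. 0 < vnorm d z \<and> vnorm d z \<le> r}|\<mu>. (vnorm d z)\<^sup>2)
    = (\<integral>z. indicator {z. vnorm d z \<le> r} z * (vnorm d z)\<^sup>2 \<partial>\<mu>)"
  unfolding set_lebesgue_integral_def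
  by (rule Bochner_Integration.integral_cong[OF refl]) (use vnorm_pos in \<open>auto simp: indicator_def\<close>)

lemma far_mass: "(\<integral>z. indicator {z. r < vnorm d z} z \<partial>\<mu>) = measure \<mu> {z \<in> space \<mu>. r < vnorm d z}"
proof -
  have "{z. r < vnorm d z} \<inter> space \<mu> = {z \<in> space \<mu>. r < vnorm d z}" by auto
  then show ?thesis by simp
qed

end

lemma phi_zero:
  assumes "0 < \<delta>" "integrable (lebesgue_Rd d) \<alpha>"
  shows "phi d \<delta> \<alpha> (\<lambda>_. 0) = L1_norm d \<alpha>"
  using pairing_fst_only[OF integrable_abs[OF assms(2)] mollifier_integrable[OF assms(1)]]
    mollifier_integral[OF assms(1)] by (simp add: phi_def L1_norm_def)

section \<open>Comparison of the two solutions\<close>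

text \<open>The conservation law as the case B = 0 of the same setting, so that the one-sided
  estimates and \<open>initial_value\<close> apply to u as well.\<close>

locale conservation_law = entropy_setting d \<mu> f "\<lambda>_. 0" u0 T u Lf 0 0
  for d \<mu> f u0 T u Lf +
  assumes BV: "BV d u0"
begin

definition TV where "TV = real_of_ereal (total_variation d u0)"

lemma TV_nonneg: "0 \<le> TV"
  unfolding TV_def by (rule BV_total_variation(2)[OF BV])

lemma phi_u0: "0 < \<delta> \<Longrightarrow> phi d \<delta> u0 u0 \<le> sqrt (real d) * \<delta> * TV"
  unfolding phi_def by (rule mollify_bound_lipschitz[OF u0 TV_nonneg BV_translation[OF BV, folded TV_def]])

lemma Diff_zero: "Diff g r w t = 0"
  by (simp add: Diff_def pairing_zero_left)

lemma conservation_one_sided: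
  assumes "0 < \<delta>" "integrable (lebesgue_Rd d) w" "0 \<le> s" "s \<le> t" "t \<le> T"
    "\<And>\<rho>. \<rho> \<in> {s..t} \<Longrightarrow> qflux d \<delta> f (\<lambda>x. u x \<rho>) w \<le> c"
  shows "phi d \<delta> (\<lambda>x. u x t) w - phi d \<delta> (\<lambda>x. u x s) w \<le> c * (t - s)"
  using one_sided_mollifier[OF assms(1) zero_less_one assms(2-6), of 0] by (simp add: Diff_zero)

lemma L1_bound:
  assumes t: "t \<in> {0..T}" shows "L1_norm d (\<lambda>x. u x t) \<le> L1_norm d u0"
proof -
  have z: "integrable (lebesgue_Rd d) (\<lambda>_. 0 :: real)" by simp
  have q: "qflux d 1 f (\<lambda>x. u x \<rho>) (\<lambda>_. 0) \<le> 0" if \<rho>: "\<rho> \<in> {0..t}" for \<rho>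
  proof -
    have vi: "integrable (lebesgue_Rd d) (\<lambda>x. u x \<rho>)" using \<rho> t by (intro v_integrable) auto
    have "pairing d (\<lambda>x y. entropy_flux f (u x \<rho>) 0 i) (dmollifier d 1 i) = 0" if i: "i < d" for i
    proof -
      have m: "(\<lambda>x. entropy_flux f (u x \<rho>) 0 i) \<in> borel_measurable (lebesgue_Rd d)"
        by (rule lip2_measurable[OF lip2_flux[OF i]]) (use vi in auto)
      have "integrable (lebesgue_Rd d) (\<lambda>x. entropy_flux f (u x \<rho>) 0 i)"
        by (rule Bochner_Integration.integrable_bound[OF integrable_mult_right[OF vi, of Lf] m])
          (use lip2_abs_bound[OF lip2_flux[OF i], of _ 0] Lf in \<open>simp add: abs_mult\<close>)
      from pairing_fst_only[OF this dmollifier_integrable[OF zero_less_one]]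
      show ?thesis using dmollifier_integral[OF zero_less_one i] by simp
    qed
    then show ?thesis by (simp add: qflux_def)
  qed
  have "phi d 1 (\<lambda>x. u x t) (\<lambda>_. 0) - phi d 1 (\<lambda>x. u x 0) (\<lambda>_. 0) \<le> 0 * (t - 0)"
    by (rule conservation_one_sided[OF zero_less_one z]) (use t q in auto)
  then show ?thesis
    using phi_initial[OF zero_less_one z] phi_zero[OF zero_less_one u0] phi_zero[OF zero_less_one v_integrable[OF t]] by simp
qed

lemma phi_translate:
  assumes "0 < \<delta>" "integrable (lebesgue_Rd d) \<alpha>" "integrable (lebesgue_Rd d) \<beta>"
  shows "phi d \<delta> (\<lambda>x. \<alpha> (vadd d x h)) \<beta> = phi d \<delta> \<alpha> (\<lambda>y. \<beta> (vsub d y h))"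
    and "qflux d \<delta> f (\<lambda>x. \<alpha> (vadd d x h)) \<beta> = qflux d \<delta> f \<alpha> (\<lambda>y. \<beta> (vsub d y h))"
proof -
  show "phi d \<delta> (\<lambda>x. \<alpha> (vadd d x h)) \<beta> = phi d \<delta> \<alpha> (\<lambda>y. \<beta> (vsub d y h))"
    unfolding phi_def
    by (rule pairing_shift_both[OF dominated_lip2[OF lip2_dist assms(2,3)] mollifier_integrable[OF assms(1)]])
  show "qflux d \<delta> f (\<lambda>x. \<alpha> (vadd d x h)) \<beta> = qflux d \<delta> f \<alpha> (\<lambda>y. \<beta> (vsub d y h))"
    unfolding qflux_def
    by (intro sum.cong refl pairing_shift_both[OF dominated_lip2[OF lip2_flux assms(2,3)] dmollifier_integrable[OF assms(1)]]) simp
qed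

text \<open>\<open>doubling\<close> for the translated u against u itself, with E = 0, followed by
  \<delta> to 0. The mollification error at time 0 is controlled by the variation of u0, but at time
  t only qualitatively, because the regularity of u at time t is what is being proved.\<close>

lemma translation_bound:
  assumes t: "t \<in> {0..T}" and h: "h \<in> Rd d"
  shows "L1_norm d (\<lambda>x. u (vadd d x h) t - u x t) \<le> vnorm d h * TV"
proof (rule field_le_epsilon)
  fix e :: real assume e: "0 < e"
  note ui = v_integrable[OF t] and uh = integrable_vadd[OF v_integrable[OF t], of h]
  have T0: "0 \<in> {0..T}" using T by simp
  note u0i = v_integrable[OF T0]
  \<comment> \<open>Chosen so that the mollification error of u0 is at most e/2; the summand 1
    covers zero variation.\<close>
  define \<rho> where "\<rho> = e / (2 * (sqrt (real d) * TV + 1))"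
  have nn: "0 \<le> sqrt (real d) * TV" using TV_nonneg by simp
  have \<rho>: "0 < \<rho>" using e nn by (simp add: \<rho>_def add_nonneg_pos)
  have "0 < e / 2" using e by simp
  then obtain \<delta>0 where \<delta>0: "0 < \<delta>0"
     "\<And>\<delta>. 0 < \<delta> \<Longrightarrow> \<delta> \<le> \<delta>0 \<Longrightarrow> pairing d (\<lambda>x y. \<bar>u x t - u y t\<bar>) (mollifier d \<delta>) \<le> e / 2"
    by (rule mollify_tendsto[OF ui]) blast
  define \<delta> where "\<delta> = min \<delta>0 \<rho>"
  have \<delta>: "0 < \<delta>" using \<delta>0(1) \<rho> by (simp add: \<delta>_def)
  have 1: "phi d \<delta> (\<lambda>x. u x t) (\<lambda>x. u x t) \<le> e / 2"
    unfolding phi_def using \<delta>0(2)[OF \<delta>] by (simp add: \<delta>_def)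
  have 2: "sqrt (real d) * \<delta> * TV \<le> e / 2"
  proof -
    have "sqrt (real d) * \<delta> * TV \<le> (sqrt (real d) * TV + 1) * \<rho>"
      using nn \<rho> mult_mono[of "sqrt (real d) * TV" "sqrt (real d) * TV + 1" \<delta> \<rho>] \<delta>
      by (simp add: \<delta>_def mult_ac)
    also have "\<dots> = e / 2"
    proof -
      have "sqrt (real d) * TV + 1 \<noteq> 0" using nn by linarith
      then show ?thesis unfolding \<rho>_def by (metis nonzero_mult_divide_mult_cancel_left mult.commute times_divide_eq_right)
    qed
    finally show ?thesis .
  qed
  have 3: "phi d \<delta> (\<lambda>x. u (vadd d x h) t) (\<lambda>x. u x t) \<le> phi d \<delta> (\<lambda>x. u (vadd d x h) 0) (\<lambda>x. u x 0) + 0 * t"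
  proof (rule doubling[OF \<delta> f_lip Lf vadd_C_L1[OF v_C_L1] v_C_L1 _ _ t])
    fix s t \<tau> c assume st: "0 \<le> s" "s \<le> t" "t \<le> T" and \<tau>: "\<tau> \<in> {0..T}"
    have si: "s \<in> {0..T}" and ti: "t \<in> {0..T}" using st by auto
    show "phi d \<delta> (\<lambda>x. u (vadd d x h) t) (\<lambda>x. u x \<tau>) - phi d \<delta> (\<lambda>x. u (vadd d x h) s) (\<lambda>x. u x \<tau>) \<le> (c + 0) * (t - s)"
      if q: "\<And>\<rho>. \<rho> \<in> {s..t} \<Longrightarrow> qflux d \<delta> f (\<lambda>x. u (vadd d x h) \<rho>) (\<lambda>x. u x \<tau>) \<le> c"
      unfolding phi_translate(1)[OF \<delta> v_integrable[OF ti] v_integrable[OF \<tau>]]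
        phi_translate(1)[OF \<delta> v_integrable[OF si] v_integrable[OF \<tau>]] add_0_right
    proof (rule conservation_one_sided[OF \<delta> integrable_vsub_right[OF v_integrable[OF \<tau>]] st])
      fix \<rho> assume \<rho>: "\<rho> \<in> {s..t}"
      then have "\<rho> \<in> {0..T}" using st by auto
      from phi_translate(2)[OF \<delta> v_integrable[OF this] v_integrable[OF \<tau>], of h] q[OF \<rho>]
      show "qflux d \<delta> f (\<lambda>x. u x \<rho>) (\<lambda>x. u (vsub d x h) \<tau>) \<le> c" by simp
    qed
    show "phi d \<delta> (\<lambda>x. u x t) (\<lambda>x. u (vadd d x h) \<tau>) - phi d \<delta> (\<lambda>x. u x s) (\<lambda>x. u (vadd d x h) \<tau>) \<le> c * (t - s)"
      if q: "\<And>\<rho>. \<rho> \<in> {s..t} \<Longrightarrow> qflux d \<delta> f (\<lambda>x. u x \<rho>) (\<lambda>x. u (vadd d x h) \<tau>) \<le> c"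
      by (rule conservation_one_sided[OF \<delta> integrable_vadd[OF v_integrable[OF \<tau>]] st q])
  qed
  have u0h: "integrable (lebesgue_Rd d) (\<lambda>x. u0 (vadd d x h))" by (rule integrable_vadd[OF u0])
  have u0hi: "L1_norm d (\<lambda>x. u (vadd d x h) 0 - u0 (vadd d x h)) = 0"
    using initial_value integral_vadd[of "\<lambda>x. \<bar>u x 0 - u0 x\<bar>" d h] u0i u0 by (simp add: L1_norm_def)
  have "\<bar>phi d \<delta> (\<lambda>x. u (vadd d x h) 0) (\<lambda>x. u x 0) - phi d \<delta> (\<lambda>x. u0 (vadd d x h)) u0\<bar>
     \<le> L1_norm d (\<lambda>x. u (vadd d x h) 0 - u0 (vadd d x h)) + L1_norm d (\<lambda>x. u x 0 - u0 x)"
    by (rule phi_lipschitz[OF \<delta> integrable_vadd[OF u0i] u0i u0h u0])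
  then have 4: "phi d \<delta> (\<lambda>x. u (vadd d x h) 0) (\<lambda>x. u x 0) \<le> phi d \<delta> (\<lambda>x. u0 (vadd d x h)) u0"
    using u0hi initial_value by linarith
  have 5: "phi d \<delta> (\<lambda>x. u0 (vadd d x h)) u0 \<le> vnorm d h * TV + sqrt (real d) * \<delta> * TV"
    using phi_upper[OF \<delta> u0h u0] BV_translation[OF BV h] phi_u0[OF \<delta>] by (simp add: TV_def)
  show "L1_norm d (\<lambda>x. u (vadd d x h) t - u x t) \<le> vnorm d h * TV + e"
    using phi_lower[OF \<delta> uh ui] 1 2 3 4 5 by simp
qed

end

locale comparison = conservation_law d \<mu> f u0 T u Lf + E: entropy_setting d \<mu> f B u0 T v Lf LB CB
  for d \<mu> f u0 T u Lf B v LB CB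
begin

text \<open>\<open>L1_bound\<close> and \<open>translation_bound\<close> are uniform in time, so one
  bound E for \<open>Diff\<close> serves all frozen times. The mollification error is paid twice, at
  time 0 and at time t.\<close>

lemma comparison_bound:
  assumes t: "t \<in> {0..T}" and \<delta>: "0 < \<delta>" and r: "0 < r" "r < r'"
  shows "L1_norm d (\<lambda>x. v x t - u x t) \<le> 2 * (sqrt (real d) * \<delta> * TV)
     + LB * (TV * sqrt (real d) * bump_variation / \<delta> * (\<integral>z. indicator {z. vnorm d z \<le> r} z * (vnorm d z)\<^sup>2 \<partial>\<mu>)
       + TV * vnorm d (drift r)
       + TV * (\<integral>z. indicator {z. r < vnorm d z \<and> vnorm d z \<le> r'} z * vnorm d z \<partial>\<mu>)
       + 2 * L1_norm d u0 * (\<integral>z. indicator {z. r' < vnorm d z} z \<partial>\<mu>)) * t"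
    (is "_ \<le> _ + ?E * t")
proof -
  have T0: "0 \<in> {0..T}" using T by simp
  have mx: "max r r' = r'" using r by simp
  have D: "E.Diff (\<lambda>_. scaled_bump \<delta>) r (\<lambda>x. u x \<tau>) \<rho> \<le> ?E" if "\<tau> \<in> {0..T}" "\<rho> \<in> {0..T}" for \<tau> \<rho>
    using E.Diff_bound[OF v_integrable[OF that(1)] TV_nonneg translation_bound[OF that(1)] L1_bound[OF that(1)] \<delta> r(1) that(2), of r']
    unfolding mx by simp
  have 1: "phi d \<delta> (\<lambda>x. v x t) (\<lambda>x. u x t) \<le> phi d \<delta> (\<lambda>x. v x 0) (\<lambda>x. u x 0) + ?E * t"
  proof (rule doubling[OF \<delta> f_lip Lf E.v_C_L1 v_C_L1 _ _ t])
    fix s t \<tau> c assume st: "0 \<le> s" "s \<le> t" "t \<le> T" and \<tau>: "\<tau> \<in> {0..T}"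
    show "phi d \<delta> (\<lambda>x. v x t) (\<lambda>x. u x \<tau>) - phi d \<delta> (\<lambda>x. v x s) (\<lambda>x. u x \<tau>) \<le> (c + ?E) * (t - s)"
      if "\<And>\<rho>. \<rho> \<in> {s..t} \<Longrightarrow> qflux d \<delta> f (\<lambda>x. v x \<rho>) (\<lambda>x. u x \<tau>) \<le> c"
      by (rule E.one_sided_mollifier[OF \<delta> r(1) v_integrable[OF \<tau>] st that D[OF \<tau>]])
    show "phi d \<delta> (\<lambda>x. u x t) (\<lambda>x. v x \<tau>) - phi d \<delta> (\<lambda>x. u x s) (\<lambda>x. v x \<tau>) \<le> c * (t - s)"
      if "\<And>\<rho>. \<rho> \<in> {s..t} \<Longrightarrow> qflux d \<delta> f (\<lambda>x. u x \<rho>) (\<lambda>x. v x \<tau>) \<le> c"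
      by (rule conservation_one_sided[OF \<delta> E.v_integrable[OF \<tau>] st that])
  qed
  \<comment> \<open>The two initial values are replaced by u0 one after the other; the symmetry of
    \<open>phi\<close> is used because \<open>phi_initial\<close> acts on the first
    argument.\<close>
  have "phi d \<delta> (\<lambda>x. v x 0) (\<lambda>x. u x 0) = phi d \<delta> u0 (\<lambda>x. u x 0)"
    by (rule E.phi_initial[OF \<delta> v_integrable[OF T0]])
  also have "\<dots> = phi d \<delta> (\<lambda>x. u x 0) u0" by (rule phi_sym[OF \<delta> u0 v_integrable[OF T0]])
  also have "\<dots> = phi d \<delta> u0 u0" by (rule phi_initial[OF \<delta> u0])
  finally have 2: "phi d \<delta> (\<lambda>x. v x 0) (\<lambda>x. u x 0) \<le> sqrt (real d) * \<delta> * TV" using phi_u0[OF \<delta>] by simp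
  have 3: "phi d \<delta> (\<lambda>x. u x t) (\<lambda>x. u x t) \<le> sqrt (real d) * \<delta> * TV"
    unfolding phi_def by (rule mollify_bound_lipschitz[OF v_integrable[OF t] TV_nonneg translation_bound[OF t] \<delta>])
  show ?thesis using phi_lower[OF \<delta> E.v_integrable[OF t] v_integrable[OF t]] 1 2 3 by linarith
qed

end

text \<open>The choice \<delta> = s makes both terms linear in s. If s = 0, this choice is not
  allowed, and \<delta> tends to 0 instead; P + 1 in the denominator covers P = 0.\<close>

lemma optimise_scale:
  fixes X P Q s c :: real
  assumes b: "\<And>\<delta>. 0 < \<delta> \<Longrightarrow> X \<le> P * \<delta> + Q * s\<^sup>2 / \<delta> + c" and nn: "0 \<le> s" "0 \<le> P" "0 \<le> Q"
  shows "X \<le> (P + Q) * s + c"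
proof (cases "s = 0")
  case False
  then have "0 < s" using nn by simp
  from b[OF this] show ?thesis using False by (simp add: power2_eq_square distrib_right)
next
  case True
  have "X \<le> c + e" if e: "0 < e" for e
  proof -
    have "0 < e / (P + 1)" using e nn by simp
    from b[OF this] have "X \<le> P * (e / (P + 1)) + c" using True by simp
    moreover have "P * (e / (P + 1)) \<le> e" using e nn by (simp add: field_simps)
    ultimately show ?thesis by linarith
  qed
  then have "X \<le> c" by (rule field_le_epsilon)
  then show ?thesis using True by simp
qed

definition (in levy_space) error_term :: "real \<Rightarrow> real \<Rightarrow> real \<Rightarrow> real \<Rightarrow> real" where
  "error_term T \<epsilon> r r' = sqrt (real d) * sqrt T * sqrt \<epsilon> *
      sqrt (LINT z:{z. 0 < vnorm d z \<and> vnorm d z \<le> r}|\<mu>. (vnorm d z)\<^sup>2)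
    + T * \<epsilon> *
      ((LINT z:{z. r < vnorm d z \<and> vnorm d z \<le> r'}|\<mu>. vnorm d z)
       + vnorm d (\<lambda>i. LINT z:{z. min r 1 < vnorm d z \<and> vnorm d z \<le> max r 1}|\<mu>. z i)
       + measure \<mu> {z \<in> space \<mu>. r' < vnorm d z})"

text \<open>The near term of \<open>comparison_bound\<close>, with t replaced by T, is a multiple of
  s^2 / \<delta> with s^2 = T \<epsilon> M, so \<open>optimise_scale\<close> applies. Variation and
  L1 norm of u0 are then both replaced by N, which dominates them.\<close>

lemma (in comparison) comparison_rate:
  assumes t: "t \<in> {0..T}" and r: "0 < r" "r < r'" and LB: "LB = \<epsilon> * L" "0 < \<epsilon>" "0 \<le> L"
    and N: "TV + L1_norm d u0 \<le> N"
  shows "L1_norm d (\<lambda>x. u x t - v x t) \<le> ((2 + L * bump_variation + 2 * L) * N + 1) * error_term T \<epsilon> r r'"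
proof -
  define M where "M = (\<integral>z. indicator {z. vnorm d z \<le> r} z * (vnorm d z)\<^sup>2 \<partial>\<mu>)"
  define I where "I = (\<integral>z. indicator {z. r < vnorm d z \<and> vnorm d z \<le> r'} z * vnorm d z \<partial>\<mu>)"
  define m :: real where "m = (\<integral>z. indicator {z. r' < vnorm d z} z \<partial>\<mu>)"
  define a where "a = vnorm d (drift r)"
  \<comment> \<open>The optimal mollification width; sqrt d is left out because both competing terms
    carry it.\<close>
  define s where "s = sqrt T * sqrt \<epsilon> * sqrt M"
  define n where "n = L1_norm d u0"
  define D where "D = a + I + m"
  have bv: "0 \<le> bump_variation" by (simp add: bump_variation_def)
  have nn: "0 \<le> M" "0 \<le> I" "0 \<le> m" "0 \<le> a" "0 \<le> n"
    unfolding M_def I_def m_def a_def n_def by (auto intro!: Bochner_Integration.integral_nonneg L1_norm_nonneg L2_set_nonneg)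
  have s: "0 \<le> s" "s\<^sup>2 = T * \<epsilon> * M" using T LB nn by (auto simp: s_def power_mult_distrib)
  have tT: "0 \<le> t" "t \<le> T" using t by auto
  let ?c = "T * (\<epsilon> * (L * (TV * a + TV * I + 2 * n * m)))"
  have bound: "L1_norm d (\<lambda>x. u x t - v x t)
     \<le> 2 * (sqrt (real d) * TV) * \<delta> + L * (TV * sqrt (real d) * bump_variation) * s\<^sup>2 / \<delta> + ?c" if \<delta>: "0 < \<delta>" for \<delta>
  proof -
    let ?e = "TV * sqrt (real d) * bump_variation / \<delta> * M + TV * a + TV * I + 2 * n * m"
    have "L1_norm d (\<lambda>x. u x t - v x t) \<le> 2 * (sqrt (real d) * \<delta> * TV) + LB * ?e * t"
      using comparison_bound[OF t \<delta> r] unfolding L1_norm_commute[of d "\<lambda>x. v x t"] M_def I_def m_def a_def n_def .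
    also have "LB * ?e * t \<le> LB * ?e * T"
      using nn bv TV_nonneg LB \<delta> tT by (intro mult_left_mono) auto
    also have "2 * (sqrt (real d) * \<delta> * TV) + LB * ?e * T
       = 2 * (sqrt (real d) * TV) * \<delta> + L * (TV * sqrt (real d) * bump_variation) * s\<^sup>2 / \<delta> + ?c"
      unfolding s(2) LB(1) by (simp add: algebra_simps)
    finally show ?thesis by simp
  qed
  let ?K = "(2 + L * bump_variation + 2 * L) * N + 1"
  have TN: "0 \<le> TV" "TV \<le> N" "n \<le> N" "0 \<le> N" using N nn TV_nonneg by (auto simp: n_def)
  have Ls: "0 \<le> L * bump_variation" using LB bv by simp
  have "L1_norm d (\<lambda>x. u x t - v x t)
     \<le> (2 * (sqrt (real d) * TV) + L * (TV * sqrt (real d) * bump_variation)) * s + ?c"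
    by (rule optimise_scale[OF bound]) (use s TN bv LB in auto)
  also have "\<dots> = (2 + L * bump_variation) * TV * (sqrt (real d) * s) + T * \<epsilon> * (L * (TV * a + TV * I + 2 * n * m))"
    by (simp add: algebra_simps)
  also have "\<dots> \<le> ?K * (sqrt (real d) * s) + T * \<epsilon> * (?K * D)"
  proof (intro add_mono mult_right_mono mult_left_mono)
    have "(2 + L * bump_variation) * TV \<le> (2 + L * bump_variation) * N" using TN Ls by (intro mult_left_mono) auto
    moreover have "0 \<le> 2 * L * N" using TN LB by simp
    ultimately show "(2 + L * bump_variation) * TV \<le> ?K" by (simp add: distrib_right)
    \<comment> \<open>The factor 2 N is needed for the largest jumps and is spent on all three terms
      to obtain a common constant.\<close>
    have "TV * a + TV * I + 2 * n * m \<le> 2 * N * a + 2 * N * I + 2 * N * m"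
      using TN nn by (intro add_mono mult_right_mono) auto
    then have "L * (TV * a + TV * I + 2 * n * m) \<le> L * (2 * N * D)"
      using LB by (intro mult_left_mono) (auto simp: D_def algebra_simps)
    also have "L * (2 * N * D) = (2 * L * N) * D" by simp
    also have "\<dots> \<le> ?K * D"
    proof (rule mult_right_mono)
      have "0 \<le> (2 + L * bump_variation) * N" using TN Ls by simp
      then show "2 * L * N \<le> ?K" by (simp add: distrib_right)
    qed (use nn in \<open>simp add: D_def\<close>)
    finally show "L * (TV * a + TV * I + 2 * n * m) \<le> ?K * D" .
  qed (use s T LB in auto)
  also have "\<dots> = ?K * (sqrt (real d) * s + T * \<epsilon> * D)" by (simp add: distrib_left)
  also have "sqrt (real d) * s + T * \<epsilon> * D = error_term T \<epsilon> r r'"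
    unfolding error_term_def near_moment far_mass[symmetric] vnorm_drift[symmetric] s_def D_def M_def I_def m_def a_def
    by (simp add: set_lebesgue_integral_def mult_ac add_ac)
  finally show ?thesis .
qed

text \<open>The sum of the component constants is a crude choice, but it never reaches the final
  bound because the flux terms cancel.\<close>

lemma flux_common_lipschitz:
  fixes d :: nat and f :: "real \<Rightarrow> nat \<Rightarrow> real"
  assumes "\<And>i. i < d \<Longrightarrow> \<exists>f'. W1_inf (\<lambda>s. f s i) f'"
  obtains L where "0 \<le> L" "\<And>i s s'. i < d \<Longrightarrow> \<bar>f s i - f s' i\<bar> \<le> L * \<bar>s - s'\<bar>"
proof -
  obtain f' where f': "\<And>i. i < d \<Longrightarrow> W1_inf (\<lambda>s. f s i) (f' i)" using assms by metis
  have n: "0 \<le> L_inf_norm lborel (f' i)" if "i < d" for i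
    using f'[OF that] by (intro L_inf_norm_AE) (auto simp: W1_inf_def)
  show thesis
  proof (rule that[of "\<Sum>i<d. L_inf_norm lborel (f' i)"])
    fix i s s' assume i: "i < d"
    have "\<bar>f s i - f s' i\<bar> \<le> L_inf_norm lborel (f' i) * \<bar>s - s'\<bar>" by (rule W1_inf_lipschitz[OF f'[OF i]])
    also have "\<dots> \<le> (\<Sum>i<d. L_inf_norm lborel (f' i)) * \<bar>s - s'\<bar>"
      using i n by (intro mult_right_mono member_le_sum) auto
    finally show "\<bar>f s i - f s' i\<bar> \<le> (\<Sum>i<d. L_inf_norm lborel (f' i)) * \<bar>s - s'\<bar>" .
  qed (use n in \<open>auto intro: sum_nonneg\<close>)
qed

theorem theorem3p9:
  shows "\<exists>C :: real \<Rightarrow> real \<Rightarrow> real.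
    \<forall>(d :: nat) (f :: real \<Rightarrow> nat \<Rightarrow> real) (A :: real \<Rightarrow> real) (A' :: real \<Rightarrow> real)
      (u\<^sub>0 :: (nat \<Rightarrow> real) \<Rightarrow> real) (\<mu> :: (nat \<Rightarrow> real) measure) (T :: real) (\<epsilon> :: real)
      (u :: (nat \<Rightarrow> real) \<Rightarrow> real \<Rightarrow> real) (u\<^sub>\<epsilon> :: (nat \<Rightarrow> real) \<Rightarrow> real \<Rightarrow> real).
    1 \<le> d \<longrightarrow>
    (\<forall>i<d. (\<exists>f'. W1_inf (\<lambda>s. f s i) f') \<and> f 0 i = 0) \<longrightarrow>
    W1_inf A A' \<and> mono A \<and> A 0 = 0 \<longrightarrow>
    L_inf (lebesgue_Rd d) u\<^sub>0 \<and> integrable (lebesgue_Rd d) u\<^sub>0 \<and> BV d u\<^sub>0 \<longrightarrow>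
    levy_measure d \<mu> \<longrightarrow>
    0 < T \<longrightarrow> 0 < \<epsilon> \<longrightarrow>
    entropy_solution d f (\<lambda>_. 0) \<mu> u\<^sub>0 T u \<longrightarrow>
    entropy_solution d f (\<lambda>s. \<epsilon> * A s) \<mu> u\<^sub>0 T u\<^sub>\<epsilon> \<longrightarrow>
    C_L1_norm d T (\<lambda>x t. u x t - u\<^sub>\<epsilon> x t)
      \<le> C (L1_BV_norm d u\<^sub>0) (L_inf_norm lborel A') *
        (INF (r, r')\<in>{(r, r'). 0 < r \<and> r < r'}.
          sqrt (real d) * sqrt T * sqrt \<epsilon> *
            sqrt (LINT z:{z. 0 < vnorm d z \<and> vnorm d z \<le> r}|\<mu>. (vnorm d z)\<^sup>2)
          + T * \<epsilon> *
            ((LINT z:{z. r < vnorm d z \<and> vnorm d z \<le> r'}|\<mu>. vnorm d z)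
             + vnorm d (\<lambda>i. LINT z:{z. min r 1 < vnorm d z \<and> vnorm d z \<le> max r 1}|\<mu>. z i)
             + measure \<mu> {z \<in> space \<mu>. r' < vnorm d z}))"
proof (rule exI[of _ "\<lambda>N L. (2 + L * bump_variation + 2 * L) * N + 1"], intro allI impI, elim conjE)
  fix d :: nat and f :: "real \<Rightarrow> nat \<Rightarrow> real" and A A' :: "real \<Rightarrow> real" and u\<^sub>0 :: "(nat \<Rightarrow> real) \<Rightarrow> real"
    and \<mu> :: "(nat \<Rightarrow> real) measure" and T \<epsilon> :: real and u u\<^sub>\<epsilon> :: "(nat \<Rightarrow> real) \<Rightarrow> real \<Rightarrow> real"
  assume f: "\<forall>i<d. (\<exists>f'. W1_inf (\<lambda>s. f s i) f') \<and> f 0 i = 0"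
    and A: "W1_inf A A'" "mono A"
    and u0: "integrable (lebesgue_Rd d) u\<^sub>0" "BV d u\<^sub>0"
    and levy: "levy_measure d \<mu>" and T: "0 < T" and \<epsilon>: "0 < \<epsilon>"
    and u: "entropy_solution d f (\<lambda>_. 0) \<mu> u\<^sub>0 T u"
    and v: "entropy_solution d f (\<lambda>s. \<epsilon> * A s) \<mu> u\<^sub>0 T u\<^sub>\<epsilon>"
  define N where "N = L1_BV_norm d u\<^sub>0"
  define L where "L = L_inf_norm lborel A'"
  define C where "C = (2 + L * bump_variation + 2 * L) * N + 1"
  obtain Lf where Lf: "0 \<le> Lf" "\<And>i s s'. i < d \<Longrightarrow> \<bar>f s i - f s' i\<bar> \<le> Lf * \<bar>s - s'\<bar>"
    using flux_common_lipschitz f by metis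
  obtain CA where CA: "0 \<le> CA" "\<And>s. \<bar>A s\<bar> \<le> CA" using A(1) by (rule W1_inf_bounded) blast
  have L: "0 \<le> L" unfolding L_def using A(1) by (intro L_inf_norm_AE) (auto simp: W1_inf_def)
  interpret comparison d \<mu> f u\<^sub>0 T u Lf "\<lambda>s. \<epsilon> * A s" u\<^sub>\<epsilon> "\<epsilon> * L" "\<epsilon> * CA"
  proof unfold_locales
    show "\<bar>\<epsilon> * A s - \<epsilon> * A s'\<bar> \<le> \<epsilon> * L * \<bar>s - s'\<bar>" for s s'
      using W1_inf_lipschitz[OF A(1), of s s'] \<epsilon> by (simp add: L_def abs_mult mult.assoc flip: right_diff_distrib)
    show "\<bar>\<epsilon> * A s\<bar> \<le> \<epsilon> * CA" for s using CA(2)[of s] \<epsilon> by (simp add: abs_mult)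
    show "mono (\<lambda>s. \<epsilon> * A s)" using A(2) \<epsilon> by (simp add: mono_def)
  qed (use levy T u v u0 Lf L \<epsilon> in \<open>auto simp: mono_def\<close>)
  have TN: "TV + L1_norm d u\<^sub>0 \<le> N" by (simp add: N_def L1_BV_norm_def TV_def)
  then have "0 \<le> N" using TV_nonneg L1_norm_nonneg[of d u\<^sub>0] by linarith
  then have C: "0 < C" using L by (auto simp: C_def bump_variation_def intro!: add_nonneg_pos mult_nonneg_nonneg add_nonneg_nonneg)
  \<comment> \<open>Dividing by C > 0 turns the bounds for the single pairs (r, r') into one lower
    bound for the infimum; the summand 1 in C ensures positivity also for N = 0.\<close>
  have "C_L1_norm d T (\<lambda>x t. u x t - u\<^sub>\<epsilon> x t) / C \<le> (INF (r, r')\<in>{(r, r'). 0 < r \<and> r < r'}. error_term T \<epsilon> r r')"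
  proof (rule cINF_greatest)
    have "(1, 2) \<in> {(r :: real, r'). 0 < r \<and> r < r'}" by simp
    then show "{(r :: real, r'). 0 < r \<and> r < r'} \<noteq> {}" by blast
    fix p :: "real \<times> real" assume p: "p \<in> {(r, r'). 0 < r \<and> r < r'}"
    obtain r r' where rr: "p = (r, r')" "0 < r" "r < r'" using p by auto
    have "C_L1_norm d T (\<lambda>x t. u x t - u\<^sub>\<epsilon> x t) \<le> C * error_term T \<epsilon> r r'"
      unfolding C_L1_norm_def
      by (rule cSUP_least) (use T in simp, unfold C_def, rule comparison_rate[OF _ rr(2,3) refl \<epsilon> L TN])
    then show "C_L1_norm d T (\<lambda>x t. u x t - u\<^sub>\<epsilon> x t) / C \<le> (case p of (r, r') \<Rightarrow> error_term T \<epsilon> r r')"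
      using C rr by (simp add: pos_divide_le_eq mult.commute)
  qed
  then have "C_L1_norm d T (\<lambda>x t. u x t - u\<^sub>\<epsilon> x t) \<le> C * (INF (r, r')\<in>{(r, r'). 0 < r \<and> r < r'}. error_term T \<epsilon> r r')"
    using C by (simp add: pos_divide_le_eq mult.commute)
  then show "C_L1_norm d T (\<lambda>x t. u x t - u\<^sub>\<epsilon> x t)
      \<le> ((2 + L_inf_norm lborel A' * bump_variation + 2 * L_inf_norm lborel A') * L1_BV_norm d u\<^sub>0 + 1) *
        (INF (r, r')\<in>{(r, r'). 0 < r \<and> r < r'}.
          sqrt (real d) * sqrt T * sqrt \<epsilon> *
            sqrt (LINT z:{z. 0 < vnorm d z \<and> vnorm d z \<le> r}|\<mu>. (vnorm d z)\<^sup>2)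
          + T * \<epsilon> *
            ((LINT z:{z. r < vnorm d z \<and> vnorm d z \<le> r'}|\<mu>. vnorm d z)
             + vnorm d (\<lambda>i. LINT z:{z. min r 1 < vnorm d z \<and> vnorm d z \<le> max r 1}|\<mu>. z i)
             + measure \<mu> {z \<in> space \<mu>. r' < vnorm d z}))"
    unfolding C_def N_def L_def error_term_def .
qed

end
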